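(* Let $s\in(1/2,1)$, $T>0$, $N\in\mathbb N_{\ge2}$, $\Delta t=T/N$ and $L>1$ be fixed, and let $\rho_0\in L^\infty(\Omega)$ with $\rho_0\ge0$ a.e. and $\frac1{|\Omega|}\int_\Omega\rho_0\,\mathrm dx=1$. Let $\rho^0=\rho^0(\Delta t)\in H^1(\Omega)$ be the unique solution of $\int_\Omega\rho^0\phi\,\mathrm dx+\Delta t\int_\Omega\nabla\rho^0\cdot\nabla\phi\,\mathrm dx=\int_\Omega\rho_0\phi\,\mathrm dx$ for all $\phi\in H^1(\Omega)$, and let $\rho^0_h$ and $(\rho^n_{h,\delta,L},c^n_{h,\delta,L})$, $n=1,\dots,N$, be the discrete initial datum and solutions of the fully discrete scheme described in the context. Then, as $h\to0_+$, $$\rho^0_h\to\rho^0_L:=\rho^0\quad\text{strongly in }L^2(\Omega).$$ Furthermore there exist a subsequence of $\{\rho^n_{h,\delta,L}\}_{\delta,h>0}$, a nonnegative function $\rho^n_L\in H^1(\Omega)$ and $c^n_L\in H^1_\diamond(\Omega):=H^1(\Omega)\cap L^2_\diamond(\Omega)$ such that, for each $n\in\{1,\dots,N\}$, as $\delta,h\to0_+$ along the subsequence: \begin{align*} &\nabla\rho^n_{h,\delta,L}\to\nabla\rho^n_L\ \text{ weakly in }L^2(\Omega;\mathbb R^d),\\ &\rho^n_{h,\delta,L}\to\rho^n_L\ \text{ strongly in }L^2(\Omega),\\ &\Theta^L_\delta(\rho^n_{h,\delta,L})\to\beta^L(\rho^n_L)I\ \text{ strongly in }L^2(\Omega;\mathbb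 R^{d\times d}),\\ &c^n_{h,\delta,L}\to c^n_L\ \text{ strongly in }L^2_\diamond(\Omega),\\ &\nabla c^n_{h,\delta,L}\to\nabla c^n_L\ \text{ weakly in }L^2(\Omega;\mathbb R^d). \end{align*} Moreover $\{\rho^n_L\}_{n=1,\dots,N}$ solves the semidiscrete problem: for $n=1,\dots,N$, $$\int_\Omega\frac{\rho^n_L-\rho^{n-1}_L}{\Delta t}\phi\,\mathrm dx=-\int_\Omega\nabla\rho^n_L\cdot\nabla\phi\,\mathrm dx+\int_\Omega\beta^L(\rho^n_L)A(x)\nabla c^n_L\cdot\nabla\phi\,\mathrm dx\quad\text{for all }\phi\in H^1(\Omega),$$ with $\rho^0_L=\rho^0$ and $-\mathcal L_{\mathrm N}^sc^n_L=(\beta^L(\rho^n_L))^\diamond$ in $\Omega$; $\rho^n_L\ge0$ a.e. on $\Omega$ for all $n=1,\dots,N$; and, given $\rho^0_L=\rho^0$ with $\frac1{|\Omega|}\int_\Omega\rho^0\,\mathrm dx=1$, one has $\frac1{|\Omega|}\int_\Omega\rho^n_L\,\mathrm dx=1$ for all $n=1,\dots,N$.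
   Context: Setting. $d\in\{2,3\}$ and $\Omega\subset\mathbb R^d$ is a bounded open connected polygonal ($d=2$) or Lipschitz polyhedral ($d=3$) domain. $A:\Omega\to\mathbb R^{d\times d}$ is symmetric with bounded measurable entries and, for constants $0<\Lambda_1\le\Lambda_2$, $\Lambda_1|\mathrm v|^2\le A(x)\mathrm v\cdot\mathrm v\le\Lambda_2|\mathrm v|^2$ for all $\mathrm v\in\mathbb R^d$ and a.e. $x\in\Omega$. $Q:\Omega\to\mathbb R$ is bounded, measurable and nonnegative. Operator. $\mathcal L_{\mathrm N}$ is the nonnegative self-adjoint operator on $L^2(\Omega)$ associated with the bilinear form $a_{\mathcal L_{\mathrm N}}(w,v)=\int_\Omega A(x)\nabla w\cdot\nabla v\,\mathrm dx+\int_\Omega Q(x)wv\,\mathrm dx$ on $H^1(\Omega)$; i.e. $\mathcal Lu=-\mathrm{div}(A\nabla u)+Qu$ with Neumann condition $A\nabla u\cdot n=0$ on $\partial\Omega$. If $Q$ is not a.e. zero, $\mathrm{Ker}(\mathcal L_{\mathrm N})=\{0\}$, and one sets $L^2_\diamond(\Omega)=L^2(\Omega)$, $v^\diamond=v$; if $Q=0$ a.e., $\mathrm{Ker}(\mathcal L_{\mathrm N})$ is the set of constants, and one sets $L^2_\diamond(\Omega)=\{v\in L^2(\Omega):\int_\Omega v\,\mathrm dx=0\}$, $v^\diamond=v-\frac1{|\Omega|}\int_\Omega v\,\mathrm dx$. Let $(\varphi_k)_{k\ge1}$ be an orthonormal basis of $L^2_\diamond(\Omega)$ of eigenfunctions of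 $\mathcal L_{\mathrm N}$ with eigenvalues $0<\lambda_1\le\lambda_2\le\cdots\to\infty$, and $u_k=\int_\Omega u\varphi_k\,\mathrm dx$. For $r\ge0$, $\mathcal H^r_\diamond(\Omega)=\{u\in L^2_\diamond(\Omega):\|u\|^2_{\mathcal H^r_\diamond(\Omega)}:=\sum_k\lambda_k^ru_k^2<\infty\}$, and $\mathcal H^{-r}_\diamond(\Omega)$ is its dual. $\mathcal L_{\mathrm N}^su=\sum_k\lambda_k^su_k\varphi_k$; for $f\in L^2_\diamond(\Omega)$ the equation $-\mathcal L_{\mathrm N}^sc=f$ has the unique solution $c=-\sum_k\lambda_k^{-s}f_k\varphi_k$. Standing elliptic regularity assumption: there is $\alpha\in(0,1]$ such that for every $r\in(0,\alpha]$ the solution operator $T_{\mathcal L_{\mathrm N}}:\mathcal H^{-1}_\diamond(\Omega)\to\mathcal H^1_\diamond(\Omega)$, given by $a_{\mathcal L_{\mathrm N}}(T_{\mathcal L_{\mathrm N}}F,v)=\langle F,v\rangle$ for all $v\in\mathcal H^1_\diamond(\Omega)$, is bounded from $\mathcal H^{-1+r}_\diamond(\Omega)$ to $\mathcal H^{1+r}_\diamond(\Omega)$. Cut-offs. For $0<\delta<1<L$: $\beta^L(\sigma)=\min\{\sigma,L\}$, $\beta^L_\delta(\sigma)=\max\{\delta,\min\{\sigma,L\}\}$. $G(\sigma)=\sigma(\log\sigma-1)+1$ for $\sigma>0$, $G(0)=1$, and $$G^L_\delta(\sigma)=\begin{cases}\frac{\sigma^2-\delta^2}{2\delta}+(\log\delta-1)\sigma+1,&\sigma\le\delta,\\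 G(\sigma),&\delta<\sigma<L,\\ \frac{\sigma^2-L^2}{2L}+(\log L-1)\sigma+1,&\sigma\ge L,\end{cases}$$ so that $\beta^L_\delta\,(G^L_\delta)''=1$. Finite elements. $\{\mathcal T_h\}_{h>0}$ is a quasi-uniform, shape-regular family of weakly acute triangulations of $\overline\Omega$ into closed simplices; $V_h$ is the space of continuous functions on $\overline\Omega$ that are affine on each $K\in\mathcal T_h$; $\pi_h:C(\overline\Omega)\to V_h$ is nodal interpolation at the vertices. For $\phi_h\in V_h$ and $K\in\mathcal T_h$ with vertices $P_0,\dots,P_d$, let $\widehat x\mapsto P_0+B_K\widehat x$ be the affine map from the reference simplex onto $K$; on the interior of $K$ let $\widetilde\Theta^L_\delta(\phi_h)$ be the diagonal matrix with entries $\widetilde\Theta^L_\delta(\phi_h)_{jj}=\frac{\phi_h(P_j)-\phi_h(P_0)}{(G^L_\delta)'(\phi_h(P_j))-(G^L_\delta)'(\phi_h(P_0))}$ if $\phi_h(P_j)\ne\phi_h(P_0)$ and $\beta^L_\delta(\phi_h(P_j))$ if $\phi_h(P_j)=\phi_h(P_0)$, $j=1,\dots,d$, and set $\Theta^L_\delta(\phi_h)=(B_K^{\mathrm T})^{-1}\widetilde\Theta^L_\delta(\phi_h)B_K^{\mathrm T}$. Discrete fractional operator. Let $(\psi^h_k)_k$ be an $L^2(\Omega)$-orthonormal basis of $V_h\cap L^2_\diamond(\Omega)$ with eigenvalues $\lambda^h_k>0$: $a_{\mathcal L_{\mathrm N}}(\psi^h_k,v_h)=\lambda^h_k(\psi^h_k,v_h)$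 for all $v_h\in V_h\cap L^2_\diamond(\Omega)$. $\mathcal L_{\mathrm N,h}^su_h=\sum_k(\lambda^h_k)^s(u_h,\psi^h_k)\psi^h_k$; the solution $c_h\in V_h\cap L^2_\diamond(\Omega)$ of $-\mathcal L_{\mathrm N,h}^sc_h=f$ with $f\in L^2_\diamond(\Omega)$ is $c_h=-\sum_k(\lambda^h_k)^{-s}(f,\psi^h_k)\psi^h_k$. Fully discrete scheme. $\rho^0_h\in V_h$ is the unique solution of $\int_\Omega\pi_h(\rho^0_h\phi_h)\,\mathrm dx+\Delta t\int_\Omega\nabla\rho^0_h\cdot\nabla\phi_h\,\mathrm dx=\int_\Omega\rho_0\phi_h\,\mathrm dx$ for all $\phi_h\in V_h$. Set $\rho^0_{h,\delta,L}=\rho^0_h$; for $n=1,\dots,N$, $\rho^n_{h,\delta,L}\in V_h$ satisfies $$\int_\Omega\pi_h\Big(\frac{\rho^n_{h,\delta,L}-\rho^{n-1}_{h,\delta,L}}{\Delta t}\phi_h\Big)\mathrm dx=-\int_\Omega\nabla\rho^n_{h,\delta,L}\cdot\nabla\phi_h\,\mathrm dx+\int_\Omega\Theta^L_\delta(\rho^n_{h,\delta,L})A(x)\nabla c^n_{h,\delta,L}\cdot\nabla\phi_h\,\mathrm dx\quad\text{for all }\phi_h\in V_h,$$ where $c^n_{h,\delta,L}\in V_h\cap L^2_\diamond(\Omega)$ satisfies $-\mathcal L_{\mathrm N,h}^sc^n_{h,\delta,L}=(\beta^L(\rho^n_{h,\delta,L}))^\diamond$. *)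

theory Defs
  imports "HOL-Analysis.Analysis"
begin

section \<open>Domains\<close>

text \<open>Near every boundary point the domain is, in suitable orthogonal coordinates with vertical
  direction \<open>e\<close>, the strict epigraph of a Lipschitz function of the horizontal coordinates
  \<open>y - (y \<bullet> e) e\<close>.\<close>

definition lipschitz_boundary :: "'a::euclidean_space set \<Rightarrow> bool" where
  "lipschitz_boundary \<Omega> \<longleftrightarrow>
     (\<forall>x\<in>frontier \<Omega>. \<exists>r>0. \<exists>e C (\<gamma> :: 'a \<Rightarrow> real). norm e = 1 \<and> C-lipschitz_on UNIV \<gamma> \<and>
        (\<forall>y\<in>ball x r. y \<in> \<Omega> \<longleftrightarrow> \<gamma> (y - (y \<bullet> e) *\<^sub>R e) < y \<bullet> e))"

text \<open>In the plane this is the class of bounded domains whose boundary consists of finitely many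
  disjoint simple closed polygons: such a boundary is automatically Lipschitz.\<close>

definition lipschitz_polyhedral_domain :: "'a::euclidean_space set \<Rightarrow> bool" where
  "lipschitz_polyhedral_domain \<Omega> \<longleftrightarrow>
     open \<Omega> \<and> connected \<Omega> \<and> bounded \<Omega> \<and> \<Omega> \<noteq> {} \<and> lipschitz_boundary \<Omega> \<and>
     (\<exists>\<P>. finite \<P> \<and> (\<forall>P\<in>\<P>. polytope P) \<and> closure \<Omega> = \<Union>\<P>)"


section \<open>Lebesgue and Sobolev spaces\<close>

text \<open>Elements of \<open>L\<^sup>2\<close> and \<open>H\<^sup>1\<close> are represented by functions on the whole space, of which only
  the values in \<open>\<Omega>\<close>, up to null sets, matter.\<close>

definition L2 :: "'a::euclidean_space set \<Rightarrow> ('a \<Rightarrow> 'b::euclidean_space) set" where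
  "L2 \<Omega> = {u \<in> borel_measurable (lebesgue_on \<Omega>).
             integrable (lebesgue_on \<Omega>) (\<lambda>x. (norm (u x))\<^sup>2)}"

definition L2_inner ::
  "'a::euclidean_space set \<Rightarrow> ('a \<Rightarrow> 'b::euclidean_space) \<Rightarrow> ('a \<Rightarrow> 'b) \<Rightarrow> real" where
  "L2_inner \<Omega> u v = (LINT x|lebesgue_on \<Omega>. u x \<bullet> v x)"

definition L2_norm :: "'a::euclidean_space set \<Rightarrow> ('a \<Rightarrow> 'b::euclidean_space) \<Rightarrow> real" where
  "L2_norm \<Omega> u = sqrt (L2_inner \<Omega> u u)"

definition L2_strong_lim ::
  "'a::euclidean_space set \<Rightarrow> ('i \<Rightarrow> 'a \<Rightarrow> 'b::euclidean_space) \<Rightarrow> ('a \<Rightarrow> 'b) \<Rightarrow> 'i filter \<Rightarrow> bool" where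
  "L2_strong_lim \<Omega> u v F \<longleftrightarrow> v \<in> L2 \<Omega> \<and> (\<forall>\<^sub>F j in F. u j \<in> L2 \<Omega>) \<and>
     ((\<lambda>j. L2_norm \<Omega> (\<lambda>x. u j x - v x)) \<longlongrightarrow> 0) F"

definition L2_weak_lim ::
  "'a::euclidean_space set \<Rightarrow> ('i \<Rightarrow> 'a \<Rightarrow> 'b::euclidean_space) \<Rightarrow> ('a \<Rightarrow> 'b) \<Rightarrow> 'i filter \<Rightarrow> bool" where
  "L2_weak_lim \<Omega> u v F \<longleftrightarrow> v \<in> L2 \<Omega> \<and> (\<forall>\<^sub>F j in F. u j \<in> L2 \<Omega>) \<and>
     (\<forall>w\<in>L2 \<Omega>. ((\<lambda>j. L2_inner \<Omega> (u j) w) \<longlongrightarrow> L2_inner \<Omega> v w) F)"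

definition Linfty :: "'a::euclidean_space set \<Rightarrow> ('a \<Rightarrow> 'b::euclidean_space) set" where
  "Linfty \<Omega> = {u \<in> borel_measurable (lebesgue_on \<Omega>). \<exists>C. AE x in lebesgue_on \<Omega>. norm (u x) \<le> C}"

definition mean_value :: "'a::euclidean_space set \<Rightarrow> ('a \<Rightarrow> real) \<Rightarrow> real" where
  "mean_value \<Omega> u = (LINT x|lebesgue_on \<Omega>. u x) / measure lebesgue \<Omega>"

primrec times_cont_diff :: "nat \<Rightarrow> (real ^ 'n \<Rightarrow> real) \<Rightarrow> bool" where
  "times_cont_diff 0 f \<longleftrightarrow> continuous_on UNIV f"
| "times_cont_diff (Suc k) f \<longleftrightarrow>
     (\<exists>D :: 'n \<Rightarrow> real ^ 'n \<Rightarrow> real.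
        (\<forall>x. (f has_derivative (\<lambda>y. \<Sum>i\<in>UNIV. D i x * y $ i)) (at x)) \<and>
        (\<forall>i. times_cont_diff k (D i)))"

definition test_functions :: "(real ^ 'n) set \<Rightarrow> (real ^ 'n \<Rightarrow> real) set" where
  "test_functions \<Omega> = {f. (\<forall>k. times_cont_diff k f) \<and>
     compact (closure {x. f x \<noteq> 0}) \<and> closure {x. f x \<noteq> 0} \<subseteq> \<Omega>}"

definition weak_gradient ::
  "(real ^ 'n) set \<Rightarrow> (real ^ 'n \<Rightarrow> real) \<Rightarrow> (real ^ 'n \<Rightarrow> real ^ 'n) \<Rightarrow> bool" where
  "weak_gradient \<Omega> u g \<longleftrightarrow> (\<forall>f\<in>test_functions \<Omega>. \<forall>i.
     (LINT x|lebesgue_on \<Omega>. u x * frechet_derivative f (at x) (axis i 1)) =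
     - (LINT x|lebesgue_on \<Omega>. g x $ i * f x))"

definition H1 :: "(real ^ 'n) set \<Rightarrow> (real ^ 'n \<Rightarrow> real) set" where
  "H1 \<Omega> = {u \<in> L2 \<Omega>. \<exists>g\<in>L2 \<Omega>. weak_gradient \<Omega> u g}"

definition grad :: "(real ^ 'n) set \<Rightarrow> (real ^ 'n \<Rightarrow> real) \<Rightarrow> real ^ 'n \<Rightarrow> real ^ 'n" where
  "grad \<Omega> u = (SOME g. g \<in> L2 \<Omega> \<and> weak_gradient \<Omega> u g)"


section \<open>The Neumann operator and its fractional powers\<close>

definition elliptic_coefficients ::
  "(real ^ 'n) set \<Rightarrow> real \<Rightarrow> real \<Rightarrow> (real ^ 'n \<Rightarrow> real ^ 'n ^ 'n) \<Rightarrow> (real ^ 'n \<Rightarrow> real) \<Rightarrow> bool" where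
  "elliptic_coefficients \<Omega> \<Lambda>1 \<Lambda>2 A Q \<longleftrightarrow>
     0 < \<Lambda>1 \<and> \<Lambda>1 \<le> \<Lambda>2 \<and> A \<in> Linfty \<Omega> \<and>
     (AE x in lebesgue_on \<Omega>. transpose (A x) = A x \<and>
        (\<forall>v. \<Lambda>1 * (norm v)\<^sup>2 \<le> (A x *v v) \<bullet> v \<and> (A x *v v) \<bullet> v \<le> \<Lambda>2 * (norm v)\<^sup>2)) \<and>
     Q \<in> Linfty \<Omega> \<and> (AE x in lebesgue_on \<Omega>. 0 \<le> Q x)"

definition energy_form ::
  "(real ^ 'n) set \<Rightarrow> (real ^ 'n \<Rightarrow> real ^ 'n ^ 'n) \<Rightarrow> (real ^ 'n \<Rightarrow> real) \<Rightarrow>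
    (real ^ 'n \<Rightarrow> real) \<Rightarrow> (real ^ 'n \<Rightarrow> real) \<Rightarrow> real" where
  "energy_form \<Omega> A Q w v =
     (LINT x|lebesgue_on \<Omega>. (A x *v grad \<Omega> w x) \<bullet> grad \<Omega> v x) +
     (LINT x|lebesgue_on \<Omega>. Q x * w x * v x)"

text \<open>The graph of the self-adjoint operator associated with the form on \<open>H\<^sup>1\<close>:
  \<open>u\<close> is in the domain and is mapped to \<open>f\<close>.\<close>

definition neumann_operator ::
  "(real ^ 'n) set \<Rightarrow> (real ^ 'n \<Rightarrow> real ^ 'n ^ 'n) \<Rightarrow> (real ^ 'n \<Rightarrow> real) \<Rightarrow>
    (real ^ 'n \<Rightarrow> real) \<Rightarrow> (real ^ 'n \<Rightarrow> real) \<Rightarrow> bool" where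
  "neumann_operator \<Omega> A Q u f \<longleftrightarrow> u \<in> H1 \<Omega> \<and> f \<in> L2 \<Omega> \<and>
     (\<forall>v\<in>H1 \<Omega>. energy_form \<Omega> A Q u v = L2_inner \<Omega> f v)"

definition L2_dia :: "(real ^ 'n) set \<Rightarrow> (real ^ 'n \<Rightarrow> real) \<Rightarrow> (real ^ 'n \<Rightarrow> real) set" where
  "L2_dia \<Omega> Q = (if (AE x in lebesgue_on \<Omega>. Q x = 0)
     then {v \<in> L2 \<Omega>. (LINT x|lebesgue_on \<Omega>. v x) = 0} else L2 \<Omega>)"

definition dia ::
  "(real ^ 'n) set \<Rightarrow> (real ^ 'n \<Rightarrow> real) \<Rightarrow> (real ^ 'n \<Rightarrow> real) \<Rightarrow> real ^ 'n \<Rightarrow> real" where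
  "dia \<Omega> Q v = (if (AE x in lebesgue_on \<Omega>. Q x = 0) then (\<lambda>x. v x - mean_value \<Omega> v) else v)"

text \<open>Eigenpairs are numbered from \<open>0\<close>.\<close>

definition neumann_eigenbasis ::
  "(real ^ 'n) set \<Rightarrow> (real ^ 'n \<Rightarrow> real ^ 'n ^ 'n) \<Rightarrow> (real ^ 'n \<Rightarrow> real) \<Rightarrow>
    (nat \<Rightarrow> real) \<Rightarrow> (nat \<Rightarrow> real ^ 'n \<Rightarrow> real) \<Rightarrow> bool" where
  "neumann_eigenbasis \<Omega> A Q lam phi \<longleftrightarrow>
     (\<forall>k. phi k \<in> L2_dia \<Omega> Q \<and> neumann_operator \<Omega> A Q (phi k) (\<lambda>x. lam k * phi k x)) \<and>
     (\<forall>k. 0 < lam k) \<and> mono lam \<and> filterlim lam at_top sequentially \<and>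
     (\<forall>k l. L2_inner \<Omega> (phi k) (phi l) = (if k = l then 1 else 0)) \<and>
     (\<forall>u\<in>L2_dia \<Omega> Q.
        L2_strong_lim \<Omega> (\<lambda>m x. \<Sum>k<m. L2_inner \<Omega> u (phi k) * phi k x) u sequentially)"

definition Hr_dia ::
  "(real ^ 'n) set \<Rightarrow> (real ^ 'n \<Rightarrow> real) \<Rightarrow> (nat \<Rightarrow> real) \<Rightarrow> (nat \<Rightarrow> real ^ 'n \<Rightarrow> real) \<Rightarrow>
    real \<Rightarrow> (real ^ 'n \<Rightarrow> real) set" where
  "Hr_dia \<Omega> Q lam phi r =
     {u \<in> L2_dia \<Omega> Q. summable (\<lambda>k. lam k powr r * (L2_inner \<Omega> u (phi k))\<^sup>2)}"

definition Hr_norm ::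
  "(real ^ 'n) set \<Rightarrow> (nat \<Rightarrow> real) \<Rightarrow> (nat \<Rightarrow> real ^ 'n \<Rightarrow> real) \<Rightarrow>
    real \<Rightarrow> (real ^ 'n \<Rightarrow> real) \<Rightarrow> real" where
  "Hr_norm \<Omega> lam phi r u = sqrt (\<Sum>k. lam k powr r * (L2_inner \<Omega> u (phi k))\<^sup>2)"

text \<open>\<open>\<H>\<close> with exponent \<open>-r\<close>, for \<open>r \<ge> 0\<close>: the bounded linear functionals on \<open>\<H>\<close> with
  exponent \<open>r\<close>, and their operator norm.\<close>

definition Hr_dual ::
  "(real ^ 'n) set \<Rightarrow> (real ^ 'n \<Rightarrow> real) \<Rightarrow> (nat \<Rightarrow> real) \<Rightarrow> (nat \<Rightarrow> real ^ 'n \<Rightarrow> real) \<Rightarrow>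
    real \<Rightarrow> ((real ^ 'n \<Rightarrow> real) \<Rightarrow> real) set" where
  "Hr_dual \<Omega> Q lam phi r = {F.
     (\<forall>u\<in>Hr_dia \<Omega> Q lam phi r. \<forall>v\<in>Hr_dia \<Omega> Q lam phi r. F (\<lambda>x. u x + v x) = F u + F v) \<and>
     (\<forall>a. \<forall>u\<in>Hr_dia \<Omega> Q lam phi r. F (\<lambda>x. a * u x) = a * F u) \<and>
     (\<exists>C. \<forall>u\<in>Hr_dia \<Omega> Q lam phi r. \<bar>F u\<bar> \<le> C * Hr_norm \<Omega> lam phi r u)}"

definition Hr_dual_norm ::
  "(real ^ 'n) set \<Rightarrow> (real ^ 'n \<Rightarrow> real) \<Rightarrow> (nat \<Rightarrow> real) \<Rightarrow> (nat \<Rightarrow> real ^ 'n \<Rightarrow> real) \<Rightarrow>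
    real \<Rightarrow> ((real ^ 'n \<Rightarrow> real) \<Rightarrow> real) \<Rightarrow> real" where
  "Hr_dual_norm \<Omega> Q lam phi r F =
     (SUP u\<in>{u \<in> Hr_dia \<Omega> Q lam phi r. Hr_norm \<Omega> lam phi r u \<le> 1}. \<bar>F u\<bar>)"

definition elliptic_regularity ::
  "(real ^ 'n) set \<Rightarrow> (real ^ 'n \<Rightarrow> real ^ 'n ^ 'n) \<Rightarrow> (real ^ 'n \<Rightarrow> real) \<Rightarrow>
    (nat \<Rightarrow> real) \<Rightarrow> (nat \<Rightarrow> real ^ 'n \<Rightarrow> real) \<Rightarrow> bool" where
  "elliptic_regularity \<Omega> A Q lam phi \<longleftrightarrow> (\<exists>\<alpha>. 0 < \<alpha> \<and> \<alpha> \<le> 1 \<and>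
     (\<forall>r. 0 < r \<and> r \<le> \<alpha> \<longrightarrow> (\<exists>C. \<forall>F\<in>Hr_dual \<Omega> Q lam phi (1 - r). \<forall>w\<in>Hr_dia \<Omega> Q lam phi 1.
        (\<forall>v\<in>Hr_dia \<Omega> Q lam phi 1. energy_form \<Omega> A Q w v = F v) \<longrightarrow>
        w \<in> Hr_dia \<Omega> Q lam phi (1 + r) \<and>
        Hr_norm \<Omega> lam phi (1 + r) w \<le> C * Hr_dual_norm \<Omega> Q lam phi (1 - r) F)))"

text \<open>The equation \<open>\<L>\<^sup>s u = g\<close> in \<open>L\<^sup>2\<close>, \<open>s > 0\<close>: the spectral series of \<open>\<L>\<^sup>s u\<close> converges to \<open>g\<close>.\<close>

definition fractional_power ::
  "(real ^ 'n) set \<Rightarrow> (real ^ 'n \<Rightarrow> real) \<Rightarrow> (nat \<Rightarrow> real) \<Rightarrow> (nat \<Rightarrow> real ^ 'n \<Rightarrow> real) \<Rightarrow>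
    real \<Rightarrow> (real ^ 'n \<Rightarrow> real) \<Rightarrow> (real ^ 'n \<Rightarrow> real) \<Rightarrow> bool" where
  "fractional_power \<Omega> Q lam phi s u g \<longleftrightarrow> u \<in> Hr_dia \<Omega> Q lam phi (2 * s) \<and>
     L2_strong_lim \<Omega> (\<lambda>m x. \<Sum>k<m. lam k powr s * L2_inner \<Omega> u (phi k) * phi k x) g sequentially"


section \<open>Cut-offs\<close>

definition \<beta>_upper :: "real \<Rightarrow> real \<Rightarrow> real" where
  "\<beta>_upper L \<sigma> = min \<sigma> L"

definition \<beta>_cut :: "real \<Rightarrow> real \<Rightarrow> real \<Rightarrow> real" where
  "\<beta>_cut \<delta> L \<sigma> = max \<delta> (min \<sigma> L)"

definition entropy :: "real \<Rightarrow> real" where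
  "entropy \<sigma> = (if \<sigma> = 0 then 1 else \<sigma> * (ln \<sigma> - 1) + 1)"

definition entropy_cut :: "real \<Rightarrow> real \<Rightarrow> real \<Rightarrow> real" where
  "entropy_cut \<delta> L \<sigma> =
     (if \<sigma> \<le> \<delta> then (\<sigma>\<^sup>2 - \<delta>\<^sup>2) / (2 * \<delta>) + (ln \<delta> - 1) * \<sigma> + 1
      else if \<sigma> < L then entropy \<sigma>
      else (\<sigma>\<^sup>2 - L\<^sup>2) / (2 * L) + (ln L - 1) * \<sigma> + 1)"


section \<open>Finite elements\<close>

text \<open>\<open>P K\<close> numbers the vertices of the simplex \<open>K\<close>: \<open>P K None\<close> is \<open>P\<^sub>0\<close> and \<open>P K (Some j)\<close> is
  \<open>P\<^sub>j\<close>, where \<open>j\<close> ranges over the coordinate indices.\<close>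

definition labelled_triangulation ::
  "(real ^ 'n) set \<Rightarrow> (real ^ 'n) set set \<Rightarrow> ((real ^ 'n) set \<Rightarrow> 'n option \<Rightarrow> real ^ 'n) \<Rightarrow> bool" where
  "labelled_triangulation \<Omega> \<T> P \<longleftrightarrow> triangulation \<T> \<and> \<Union>\<T> = closure \<Omega> \<and>
     (\<forall>K\<in>\<T>. inj (P K) \<and> \<not> affine_dependent (range (P K)) \<and> K = convex hull (range (P K)))"

definition vertices :: "(real ^ 'n) set set \<Rightarrow> (real ^ 'n) set" where
  "vertices \<T> = {p. \<exists>K\<in>\<T>. p extreme_point_of K}"

definition fe_space :: "(real ^ 'n) set \<Rightarrow> (real ^ 'n) set set \<Rightarrow> (real ^ 'n \<Rightarrow> real) set" where
  "fe_space \<Omega> \<T> = {v. continuous_on (closure \<Omega>) v \<and>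
     (\<forall>K\<in>\<T>. \<exists>a b. \<forall>x\<in>K. v x = a \<bullet> x + b)}"

text \<open>Determined uniquely on \<open>closure \<Omega>\<close>.\<close>

definition nodal_interpolant ::
  "(real ^ 'n) set \<Rightarrow> (real ^ 'n) set set \<Rightarrow> (real ^ 'n \<Rightarrow> real) \<Rightarrow> real ^ 'n \<Rightarrow> real" where
  "nodal_interpolant \<Omega> \<T> f = (SOME v. v \<in> fe_space \<Omega> \<T> \<and> (\<forall>p\<in>vertices \<T>. v p = f p))"

text \<open>Nonpositive off-diagonal entries of the stiffness matrix of the nodal basis. This is the weak
  form of the condition; it holds in particular if no angle between two faces of an element
  exceeds \<open>\<pi> / 2\<close>.\<close>

definition weakly_acute :: "(real ^ 'n) set \<Rightarrow> (real ^ 'n) set set \<Rightarrow> bool" where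
  "weakly_acute \<Omega> \<T> \<longleftrightarrow>
     (\<forall>p\<in>vertices \<T>. \<forall>q\<in>vertices \<T>. \<forall>f\<in>fe_space \<Omega> \<T>. \<forall>g\<in>fe_space \<Omega> \<T>. p \<noteq> q \<and>
        (\<forall>z\<in>vertices \<T>. f z = (if z = p then 1 else 0)) \<and>
        (\<forall>z\<in>vertices \<T>. g z = (if z = q then 1 else 0)) \<longrightarrow>
        L2_inner \<Omega> (grad \<Omega> f) (grad \<Omega> g) \<le> 0)"

text \<open>Meshes are indexed by their mesh size, which ranges over a set \<open>H\<close> of positive numbers
  accumulating at \<open>0\<close>; since \<open>\<Omega>\<close> is bounded, not every \<open>h > 0\<close> is a mesh size.\<close>

definition mesh_family ::
  "(real ^ 'n) set \<Rightarrow> real set \<Rightarrow> (real \<Rightarrow> (real ^ 'n) set set) \<Rightarrow>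
    (real \<Rightarrow> (real ^ 'n) set \<Rightarrow> 'n option \<Rightarrow> real ^ 'n) \<Rightarrow> bool" where
  "mesh_family \<Omega> H \<T> P \<longleftrightarrow> H \<subseteq> {0<..} \<and> 0 islimpt H \<and>
     (\<forall>h\<in>H. labelled_triangulation \<Omega> (\<T> h) (P h) \<and> h = Max (diameter ` \<T> h) \<and>
        weakly_acute \<Omega> (\<T> h)) \<and>
     \<comment> \<open>shape regularity: inscribed balls of comparable diameter\<close>
     (\<exists>\<kappa>>0. \<forall>h\<in>H. \<forall>K\<in>\<T> h. \<exists>x. cball x (\<kappa> * diameter K) \<subseteq> K) \<and>
     \<comment> \<open>quasi-uniformity\<close>
     (\<exists>\<kappa>>0. \<forall>h\<in>H. \<forall>K\<in>\<T> h. \<kappa> * h \<le> diameter K)"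

text \<open>The matrix \<open>B\<^sub>K\<close>, whose \<open>j\<close>-th column is \<open>P\<^sub>j - P\<^sub>0\<close>.\<close>

definition simplex_matrix :: "('n option \<Rightarrow> real ^ 'n) \<Rightarrow> real ^ 'n ^ 'n" where
  "simplex_matrix p = (\<chi> i j. (p (Some j) - p None) $ i)"

definition \<Theta>_ref ::
  "real \<Rightarrow> real \<Rightarrow> ('n option \<Rightarrow> real ^ 'n) \<Rightarrow> (real ^ 'n \<Rightarrow> real) \<Rightarrow> real ^ 'n ^ 'n" where
  "\<Theta>_ref \<delta> L p f = (\<chi> i j. if i \<noteq> j then 0
     else if f (p (Some j)) \<noteq> f (p None)
       then (f (p (Some j)) - f (p None)) /
            (deriv (entropy_cut \<delta> L) (f (p (Some j))) - deriv (entropy_cut \<delta> L) (f (p None)))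
     else \<beta>_cut \<delta> L (f (p (Some j))))"

definition \<Theta>_elem ::
  "real \<Rightarrow> real \<Rightarrow> ('n option \<Rightarrow> real ^ 'n) \<Rightarrow> (real ^ 'n \<Rightarrow> real) \<Rightarrow> real ^ 'n ^ 'n" where
  "\<Theta>_elem \<delta> L p f =
     matrix_inv (transpose (simplex_matrix p)) ** \<Theta>_ref \<delta> L p f ** transpose (simplex_matrix p)"

text \<open>The value \<open>0\<close> is only taken outside the interiors of the elements, hence on a null set.\<close>

definition \<Theta> ::
  "(real ^ 'n) set set \<Rightarrow> ((real ^ 'n) set \<Rightarrow> 'n option \<Rightarrow> real ^ 'n) \<Rightarrow> real \<Rightarrow> real \<Rightarrow>
    (real ^ 'n \<Rightarrow> real) \<Rightarrow> real ^ 'n \<Rightarrow> real ^ 'n ^ 'n" where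
  "\<Theta> \<T> P \<delta> L f x = (if \<exists>K\<in>\<T>. x \<in> interior K
     then \<Theta>_elem \<delta> L (P (THE K. K \<in> \<T> \<and> x \<in> interior K)) f else 0)"


section \<open>The discrete fractional operator and the fully discrete scheme\<close>

definition discrete_eigenbasis ::
  "(real ^ 'n) set \<Rightarrow> (real ^ 'n \<Rightarrow> real ^ 'n ^ 'n) \<Rightarrow> (real ^ 'n \<Rightarrow> real) \<Rightarrow> (real ^ 'n) set set \<Rightarrow>
    nat \<Rightarrow> (nat \<Rightarrow> real) \<Rightarrow> (nat \<Rightarrow> real ^ 'n \<Rightarrow> real) \<Rightarrow> bool" where
  "discrete_eigenbasis \<Omega> A Q \<T> m mu psi \<longleftrightarrow>
     (\<forall>k<m. psi k \<in> fe_space \<Omega> \<T> \<inter> L2_dia \<Omega> Q \<and> 0 < mu k \<and>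
        (\<forall>v\<in>fe_space \<Omega> \<T> \<inter> L2_dia \<Omega> Q.
           energy_form \<Omega> A Q (psi k) v = mu k * L2_inner \<Omega> (psi k) v)) \<and>
     (\<forall>k<m. \<forall>l<m. L2_inner \<Omega> (psi k) (psi l) = (if k = l then 1 else 0)) \<and>
     (\<forall>v\<in>fe_space \<Omega> \<T> \<inter> L2_dia \<Omega> Q. \<forall>x\<in>closure \<Omega>.
        v x = (\<Sum>k<m. L2_inner \<Omega> v (psi k) * psi k x))"

text \<open>\<open>c\<close> is the solution in \<open>V\<^sub>h \<inter> L\<^sup>2\<^sub>\<diamond>\<close> of \<open>- \<L>\<^sup>s c = f\<close> for the discrete operator. Here \<open>f\<close>
  need not belong to \<open>V\<^sub>h\<close>.\<close>

definition discrete_fractional_solution ::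
  "(real ^ 'n) set \<Rightarrow> (real ^ 'n \<Rightarrow> real) \<Rightarrow> (real ^ 'n) set set \<Rightarrow>
    nat \<Rightarrow> (nat \<Rightarrow> real) \<Rightarrow> (nat \<Rightarrow> real ^ 'n \<Rightarrow> real) \<Rightarrow> real \<Rightarrow>
    (real ^ 'n \<Rightarrow> real) \<Rightarrow> (real ^ 'n \<Rightarrow> real) \<Rightarrow> bool" where
  "discrete_fractional_solution \<Omega> Q \<T> m mu psi s f c \<longleftrightarrow>
     c \<in> fe_space \<Omega> \<T> \<inter> L2_dia \<Omega> Q \<and>
     (\<forall>x\<in>closure \<Omega>. c x = - (\<Sum>k<m. mu k powr (- s) * L2_inner \<Omega> f (psi k) * psi k x))"

definition smoothed_initial_datum ::
  "(real ^ 'n) set \<Rightarrow> real \<Rightarrow> (real ^ 'n \<Rightarrow> real) \<Rightarrow> (real ^ 'n \<Rightarrow> real) \<Rightarrow> bool" where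
  "smoothed_initial_datum \<Omega> dt rho0 r \<longleftrightarrow> r \<in> H1 \<Omega> \<and>
     (\<forall>f\<in>H1 \<Omega>. (LINT x|lebesgue_on \<Omega>. r x * f x)
        + dt * (LINT x|lebesgue_on \<Omega>. grad \<Omega> r x \<bullet> grad \<Omega> f x)
        = (LINT x|lebesgue_on \<Omega>. rho0 x * f x))"

definition discrete_initial_datum ::
  "(real ^ 'n) set \<Rightarrow> (real ^ 'n) set set \<Rightarrow> real \<Rightarrow> (real ^ 'n \<Rightarrow> real) \<Rightarrow>
    (real ^ 'n \<Rightarrow> real) \<Rightarrow> bool" where
  "discrete_initial_datum \<Omega> \<T> dt rho0 r \<longleftrightarrow> r \<in> fe_space \<Omega> \<T> \<and>
     (\<forall>f\<in>fe_space \<Omega> \<T>. (LINT x|lebesgue_on \<Omega>. nodal_interpolant \<Omega> \<T> (\<lambda>y. r y * f y) x)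
        + dt * (LINT x|lebesgue_on \<Omega>. grad \<Omega> r x \<bullet> grad \<Omega> f x)
        = (LINT x|lebesgue_on \<Omega>. rho0 x * f x))"

definition fully_discrete_solution ::
  "(real ^ 'n) set \<Rightarrow> (real ^ 'n \<Rightarrow> real ^ 'n ^ 'n) \<Rightarrow> (real ^ 'n \<Rightarrow> real) \<Rightarrow>
    (real ^ 'n) set set \<Rightarrow> ((real ^ 'n) set \<Rightarrow> 'n option \<Rightarrow> real ^ 'n) \<Rightarrow>
    nat \<Rightarrow> (nat \<Rightarrow> real) \<Rightarrow> (nat \<Rightarrow> real ^ 'n \<Rightarrow> real) \<Rightarrow>
    real \<Rightarrow> real \<Rightarrow> real \<Rightarrow> real \<Rightarrow> nat \<Rightarrow> (real ^ 'n \<Rightarrow> real) \<Rightarrow>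
    (nat \<Rightarrow> real ^ 'n \<Rightarrow> real) \<Rightarrow> (nat \<Rightarrow> real ^ 'n \<Rightarrow> real) \<Rightarrow> bool" where
  "fully_discrete_solution \<Omega> A Q \<T> P m mu psi s \<delta> L dt N rho0h rho c \<longleftrightarrow> rho 0 = rho0h \<and>
     (\<forall>n\<in>{1..N}.
        rho n \<in> fe_space \<Omega> \<T> \<and>
        (\<forall>f\<in>fe_space \<Omega> \<T>.
           (LINT x|lebesgue_on \<Omega>.
              nodal_interpolant \<Omega> \<T> (\<lambda>y. (rho n y - rho (n - 1) y) / dt * f y) x)
           = - (LINT x|lebesgue_on \<Omega>. grad \<Omega> (rho n) x \<bullet> grad \<Omega> f x)
             + (LINT x|lebesgue_on \<Omega>.
                  (\<Theta> \<T> P \<delta> L (rho n) x *v (A x *v grad \<Omega> (c n) x)) \<bullet> grad \<Omega> f x)) \<and>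
        discrete_fractional_solution \<Omega> Q \<T> m mu psi s
          (dia \<Omega> Q (\<lambda>x. \<beta>_upper L (rho n x))) (c n))"

end

theory Submission
 imports Defs "HOL-Real_Asymp.Real_Asymp" "HOL-Complex_Analysis.Great_Picard"
begin

text \<open>The limit passage is by compactness. By shape regularity alone, \<open>\<Theta>\<close> is bounded by a
 multiple of \<open>L / \<kappa>\<close> and differs from \<open>\<beta>_cut \<delta> L \<rho>\<close> times the identity by a multiple of \<open>h |grad \<rho>|\<close>.
 Testing a time step with its own solution therefore bounds the gradient of the density by the drift,
 and compactness of the embedding of \<open>H1\<close> follows from the discreteness of the spectrum.
 A limit of discrete densities is nonnegative: where it is negative, \<open>\<Theta>\<close> is eventually of size \<open>\<delta>\<close>,
 so the drift disappears there, and one tests with a smooth negative part. If the densities were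
 unbounded in \<open>L2\<close>, the same argument for the normalized densities would give a nonnegative limit, so that
 \<open>min \<rho> L\<close>, hence the drift, would be negligible compared with \<open>\<rho>\<close>; the energy estimate would then
 force the normalized densities to tend to \<open>0\<close>.
 The discrete potentials are identified through their coefficients in the continuous eigenbasis; these
 are controlled by the approximation of each single eigenfunction by finite elements, without any
 convergence of the discrete spectrum.\<close>

text \<open>The obstacle is the asymmetry of the cut-offs: \<open>\<beta>_upper\<close> is not cut
  from below, whereas the matrix \<open>\<Theta>\<close> follows \<open>\<beta>_cut\<close>, which
  is. Hence the drift is bounded only by the density itself, so that the energy estimate does not
  close for a time step of arbitrary size, and \<open>\<Theta>\<close> can tend to
  \<open>\<beta>_upper\<close> of the limit only where that limit is nonnegative. Nonnegativity is
  therefore proved before anything is known about the limits of mobility and potential: the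
  remaining terms of the equation determine the weak limit of the flux, which can be tested with any
  function in \<open>H1\<close>. For the same lemma to serve normalized densities, the predicate for
  a time step carries a factor between the density in the equation and the one in the mobility.
  Density of C1 functions rests on the Lipschitz boundary: mollifying with boxes moved into the
  domain takes the place of an extension operator. Weak convergence of gradients comes from
  expansions in the eigenbasis rather than from weak compactness of balls.\<close>

abbreviation "null X \<equiv> X \<longlonglongrightarrow> 0"

section \<open>Semi-inner products on spaces of functions\<close>

text \<open>Functions are not identified almost everywhere, so the forms are only semidefinite. One
  set of axioms serves both the L2 product and the energy form, which in addition vanishes on
  constants when \<open>Q\<close> is zero.\<close>

locale semi_inner =
 fixes S :: "('x \<Rightarrow> 'b::real_vector) set" and ip :: "('x \<Rightarrow> 'b) \<Rightarrow> ('x \<Rightarrow> 'b) \<Rightarrow> real"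
 assumes S_add [simp]: "u \<in> S \<Longrightarrow> v \<in> S \<Longrightarrow> (\<lambda>x. u x + v x) \<in> S"
  and S_scale [simp]: "u \<in> S \<Longrightarrow> (\<lambda>x. a *\<^sub>R u x) \<in> S"
  and S_zero [simp]: "(\<lambda>x. 0) \<in> S"
  and ip_add_left: "u \<in> S \<Longrightarrow> v \<in> S \<Longrightarrow> w \<in> S \<Longrightarrow> ip (\<lambda>x. u x + v x) w = ip u w + ip v w"
  and ip_scale_left: "u \<in> S \<Longrightarrow> w \<in> S \<Longrightarrow> ip (\<lambda>x. a *\<^sub>R u x) w = a * ip u w"
  and ip_sym: "u \<in> S \<Longrightarrow> v \<in> S \<Longrightarrow> ip u v = ip v u"
  and ip_nonneg: "u \<in> S \<Longrightarrow> 0 \<le> ip u u"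
begin

definition nrm :: "('x \<Rightarrow> 'b) \<Rightarrow> real" where "nrm u = sqrt (ip u u)"

lemma S_minus [simp]: "u \<in> S \<Longrightarrow> (\<lambda>x. - u x) \<in> S"
 using S_scale[of u "-1"] by simp

lemma S_diff [simp]: "u \<in> S \<Longrightarrow> v \<in> S \<Longrightarrow> (\<lambda>x. u x - v x) \<in> S"
 using S_add[of u "\<lambda>x. - v x"] by simp

lemma S_sum: "(\<And>k. k \<in> I \<Longrightarrow> f k \<in> S) \<Longrightarrow> (\<lambda>x. \<Sum>k\<in>I. f k x) \<in> S"
 by (induction I rule: infinite_finite_induct) auto

lemma ip_add_right: "u \<in> S \<Longrightarrow> v \<in> S \<Longrightarrow> w \<in> S \<Longrightarrow> ip w (\<lambda>x. u x + v x) = ip w u + ip w v"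
 using ip_add_left[of u v w] by (simp add: ip_sym)

lemma ip_scale_right: "u \<in> S \<Longrightarrow> w \<in> S \<Longrightarrow> ip w (\<lambda>x. a *\<^sub>R u x) = a * ip w u"
 using ip_scale_left[of u w a] by (simp add: ip_sym)

lemma ip_minus_left: "u \<in> S \<Longrightarrow> w \<in> S \<Longrightarrow> ip (\<lambda>x. - u x) w = - ip u w"
 using ip_scale_left[of u w "-1"] by simp

lemma ip_diff_left: "u \<in> S \<Longrightarrow> v \<in> S \<Longrightarrow> w \<in> S \<Longrightarrow> ip (\<lambda>x. u x - v x) w = ip u w - ip v w"
 using ip_add_left[of u "\<lambda>x. - v x" w] by (simp add: ip_minus_left)

lemma ip_diff_right: "u \<in> S \<Longrightarrow> v \<in> S \<Longrightarrow> w \<in> S \<Longrightarrow> ip w (\<lambda>x. u x - v x) = ip w u - ip w v"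
 using ip_diff_left[of u v w] by (simp add: ip_sym)

lemma ip_zero_left: "w \<in> S \<Longrightarrow> ip (\<lambda>x. 0) w = 0"
 using ip_scale_left[of w w 0] by simp

lemma ip_sum_left:
 "(\<And>k. k \<in> I \<Longrightarrow> f k \<in> S) \<Longrightarrow> w \<in> S \<Longrightarrow> ip (\<lambda>x. \<Sum>k\<in>I. f k x) w = (\<Sum>k\<in>I. ip (f k) w)"
proof (induction I rule: infinite_finite_induct)
 case (insert k I)
 then show ?case by (simp add: ip_add_left S_sum)
qed (simp_all add: ip_zero_left)

lemma nrm_nonneg: "u \<in> S \<Longrightarrow> 0 \<le> nrm u"
 by (simp add: nrm_def ip_nonneg)

lemma nrm_sq: "u \<in> S \<Longrightarrow> (nrm u)^2 = ip u u"
 by (simp add: nrm_def ip_nonneg)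

lemma ip_diff_self:
 assumes "u \<in> S" "v \<in> S"
 shows "ip (\<lambda>x. u x - v x) (\<lambda>x. u x - v x) = ip u u - 2 * ip u v + ip v v"
 using assms by (simp add: ip_diff_left ip_diff_right ip_sym)

lemma cauchy_schwarz:
 assumes u: "u \<in> S" and v: "v \<in> S"
 shows "\<bar>ip u v\<bar> \<le> nrm u * nrm v"
proof -
 have q: "0 \<le> ip u u - 2 * a * ip u v + a^2 * ip v v" for a
 proof -
  have "0 \<le> ip (\<lambda>x. u x - a *\<^sub>R v x) (\<lambda>x. u x - a *\<^sub>R v x)"
   using assms by (intro ip_nonneg) simp
  then show ?thesis
   using assms ip_diff_self[of u "\<lambda>x. a *\<^sub>R v x"]
   by (simp add: ip_scale_left ip_scale_right power2_eq_square)
 qed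
 have "(ip u v)^2 \<le> ip u u * ip v v"
 proof (cases "ip v v = 0")
  case True
  have "ip u v = 0"
  proof (rule ccontr)
   assume n: "ip u v \<noteq> 0"
   \<comment> \<open>With \<open>ip v v = 0\<close> the expression in \<open>q\<close> is linear in
     \<open>a\<close>; this choice of \<open>a\<close> makes it -1.\<close>
   show False
    using q[of "(ip u u + 1) / (2 * ip u v)"] n True ip_nonneg[OF u] by simp
  qed
  then show ?thesis using True by simp
 next
  case False
  then have p: "ip v v > 0" using ip_nonneg[OF v] by simp
  show ?thesis using q[of "ip u v / ip v v"] p
   by (simp add: field_simps power2_eq_square)
 qed
 then have "sqrt ((ip u v)^2) \<le> sqrt (ip u u * ip v v)" by (rule real_sqrt_le_mono)
 then show ?thesis by (simp add: nrm_def real_sqrt_mult)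
qed

lemma nrm_triangle:
 assumes "u \<in> S" "v \<in> S"
 shows "nrm (\<lambda>x. u x + v x) \<le> nrm u + nrm v"
proof (rule power2_le_imp_le)
 have "(nrm (\<lambda>x. u x + v x))^2 = ip u u + 2 * ip u v + ip v v"
  using assms by (simp add: nrm_sq ip_add_left ip_add_right ip_sym)
 also have "\<dots> \<le> (nrm u)^2 + 2 * (nrm u * nrm v) + (nrm v)^2"
  using cauchy_schwarz[of u v] assms by (simp add: nrm_sq)
 finally show "(nrm (\<lambda>x. u x + v x))^2 \<le> (nrm u + nrm v)^2"
  by (simp add: power2_sum)
qed (use assms in \<open>simp add: nrm_nonneg\<close>)

lemma nrm_scale: "u \<in> S \<Longrightarrow> nrm (\<lambda>x. a *\<^sub>R u x) = \<bar>a\<bar> * nrm u"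
 by (simp add: nrm_def ip_scale_left ip_scale_right real_sqrt_mult mult.assoc[symmetric])

lemma nrm_minus: "u \<in> S \<Longrightarrow> nrm (\<lambda>x. - u x) = nrm u"
 using nrm_scale[of u "-1"] by simp

lemma nrm_triangle_diff:
 assumes "u \<in> S" "v \<in> S"
 shows "nrm (\<lambda>x. u x - v x) \<le> nrm u + nrm v"
 using nrm_triangle[of u "\<lambda>x. - v x"] assms by (simp add: nrm_minus)

lemma nrm_diff_commute: "u \<in> S \<Longrightarrow> v \<in> S \<Longrightarrow> nrm (\<lambda>x. u x - v x) = nrm (\<lambda>x. v x - u x)"
 using nrm_minus[of "\<lambda>x. u x - v x"] by simp

lemma nrm_triangle3:
 assumes "u \<in> S" "v \<in> S" "w \<in> S"
 shows "nrm (\<lambda>x. u x - w x) \<le> nrm (\<lambda>x. u x - v x) + nrm (\<lambda>x. v x - w x)"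
 using nrm_triangle[of "\<lambda>x. u x - v x" "\<lambda>x. v x - w x"] assms by simp

lemma ip_orth_expansion:
 assumes I: "finite I" and e: "\<And>k. k \<in> I \<Longrightarrow> e k \<in> S"
  and orth: "\<And>k l. k \<in> I \<Longrightarrow> l \<in> I \<Longrightarrow> ip (e k) (e l) = (if k = l then lam k else 0)"
 shows "ip (\<lambda>x. \<Sum>k\<in>I. a k *\<^sub>R e k x) (\<lambda>x. \<Sum>k\<in>I. b k *\<^sub>R e k x) = (\<Sum>k\<in>I. lam k * a k * b k)"
proof -
 have m: "(\<lambda>x. \<Sum>k\<in>I. b k *\<^sub>R e k x) \<in> S"
  by (intro S_sum S_scale e)
 have c: "ip (e k) (\<lambda>x. \<Sum>k\<in>I. b k *\<^sub>R e k x) = lam k * b k" if "k \<in> I" for k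
 proof -
  have "ip (e k) (\<lambda>x. \<Sum>k\<in>I. b k *\<^sub>R e k x) = (\<Sum>l\<in>I. ip (\<lambda>x. b l *\<^sub>R e l x) (e k))"
   using that e m by (subst ip_sym) (auto intro!: ip_sum_left)
  also have "\<dots> = (\<Sum>l\<in>I. if l = k then lam k * b k else 0)"
   using that e orth by (intro sum.cong) (auto simp: ip_scale_left)
  finally show ?thesis using that I by simp
 qed
 have "ip (\<lambda>x. \<Sum>k\<in>I. a k *\<^sub>R e k x) (\<lambda>x. \<Sum>k\<in>I. b k *\<^sub>R e k x)
   = (\<Sum>k\<in>I. ip (\<lambda>x. a k *\<^sub>R e k x) (\<lambda>x. \<Sum>k\<in>I. b k *\<^sub>R e k x))"
  using e m by (intro ip_sum_left) auto
 also have "\<dots> = (\<Sum>k\<in>I. lam k * a k * b k)"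
  using e m by (intro sum.cong) (auto simp: ip_scale_left c)
 finally show ?thesis .
qed

lemma ip_orth_sub:
 assumes I: "finite I" and e: "\<And>k. k \<in> I \<Longrightarrow> e k \<in> S" and u: "u \<in> S"
  and orth: "\<And>k l. k \<in> I \<Longrightarrow> l \<in> I \<Longrightarrow> ip (e k) (e l) = (if k = l then lam k else 0)"
 shows "ip (\<lambda>x. u x - (\<Sum>k\<in>I. a k *\<^sub>R e k x)) (\<lambda>x. u x - (\<Sum>k\<in>I. a k *\<^sub>R e k x))
   = ip u u - 2 * (\<Sum>k\<in>I. a k * ip u (e k)) + (\<Sum>k\<in>I. lam k * (a k)^2)"
proof -
 have m: "(\<lambda>x. \<Sum>k\<in>I. a k *\<^sub>R e k x) \<in> S"
  by (intro S_sum S_scale e)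
 have "ip u (\<lambda>x. \<Sum>k\<in>I. a k *\<^sub>R e k x) = (\<Sum>k\<in>I. ip (\<lambda>x. a k *\<^sub>R e k x) u)"
  using e u m by (subst ip_sym) (auto intro!: ip_sum_left)
 also have "\<dots> = (\<Sum>k\<in>I. a k * ip u (e k))"
  using e u by (intro sum.cong) (auto simp: ip_scale_left ip_sym)
 finally show ?thesis
  using ip_diff_self[OF u m] ip_orth_expansion[OF I e orth, of a a]
  by (simp add: power2_eq_square mult.assoc)
qed

text \<open>The weights \<open>lam\<close> allow a family that is orthogonal but not normalized:
  eigenfunctions have weight 1 in the L2 product and their eigenvalue in the energy form. The
  inequality is nonnegativity of the form at the residual of the orthogonal projection, whose
  coefficients are \<open>?a\<close>.\<close>

lemma bessel:
 assumes I: "finite I" and e: "\<And>k. k \<in> I \<Longrightarrow> e k \<in> S" and u: "u \<in> S"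
  and orth: "\<And>k l. k \<in> I \<Longrightarrow> l \<in> I \<Longrightarrow> ip (e k) (e l) = (if k = l then lam k else 0)"
  and lam: "\<And>k. k \<in> I \<Longrightarrow> 0 < lam k"
 shows "(\<Sum>k\<in>I. (ip u (e k))^2 / lam k) \<le> ip u u"
proof -
 let ?a = "\<lambda>k. ip u (e k) / lam k"
 have "0 \<le> ip (\<lambda>x. u x - (\<Sum>k\<in>I. ?a k *\<^sub>R e k x)) (\<lambda>x. u x - (\<Sum>k\<in>I. ?a k *\<^sub>R e k x))"
  using u by (intro ip_nonneg S_diff S_sum S_scale e) auto
 also have "\<dots> = ip u u - 2 * (\<Sum>k\<in>I. ?a k * ip u (e k)) + (\<Sum>k\<in>I. lam k * (?a k)^2)"
  by (rule ip_orth_sub[OF I e u orth])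
 also have "(\<Sum>k\<in>I. lam k * (?a k)^2) = (\<Sum>k\<in>I. (ip u (e k))^2 / lam k)"
  by (intro sum.cong refl) (use lam in \<open>fastforce simp: field_simps power2_eq_square\<close>)
 also have "(\<Sum>k\<in>I. ?a k * ip u (e k)) = (\<Sum>k\<in>I. (ip u (e k))^2 / lam k)"
  by (simp add: power2_eq_square)
 finally show ?thesis by simp
qed

end

section \<open>The space of square integrable functions\<close>

lemma L2_measurable: "u \<in> L2 U \<Longrightarrow> u \<in> borel_measurable (lebesgue_on U)"
 by (simp add: L2_def)

lemma L2_integrable_sq: "u \<in> L2 U \<Longrightarrow> integrable (lebesgue_on U) (\<lambda>x. (norm (u x))^2)"
 by (simp add: L2_def)

lemma L2_dominated:
 fixes u :: "'a::euclidean_space \<Rightarrow> 'b::euclidean_space" and v :: "'a \<Rightarrow> 'c::euclidean_space"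
 assumes u: "u \<in> L2 U" and v: "v \<in> borel_measurable (lebesgue_on U)"
  and le: "AE x in lebesgue_on U. norm (v x) \<le> C * norm (u x)"
 shows "v \<in> L2 U"
proof -
 have "integrable (lebesgue_on U) (\<lambda>x. (norm (v x))^2)"
 proof (rule Bochner_Integration.integrable_bound)
  show "integrable (lebesgue_on U) (\<lambda>x. C^2 * (norm (u x))^2)"
   using u by (simp add: L2_def)
  show "AE x in lebesgue_on U. norm ((norm (v x))^2) \<le> norm (C^2 * (norm (u x))^2)"
   using le
  proof eventually_elim
   case (elim x)
   then have "(norm (v x))^2 \<le> (C * norm (u x))^2" by (intro power_mono) auto
   then show ?case by (simp add: power_mult_distrib)
  qed
 qed (use v in measurable)
 then show ?thesis using v by (simp add: L2_def)
qed

lemma L2_scaleR: "u \<in> L2 U \<Longrightarrow> (\<lambda>x. a *\<^sub>R u x) \<in> L2 U"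
 by (rule L2_dominated[of u _ _ "\<bar>a\<bar>"]) (auto dest: L2_measurable)

lemma L2_zero: "(\<lambda>x. 0) \<in> L2 U"
 by (simp add: L2_def)

lemma L2_add:
 fixes u v :: "'a::euclidean_space \<Rightarrow> 'b::euclidean_space"
 assumes "u \<in> L2 U" "v \<in> L2 U" shows "(\<lambda>x. u x + v x) \<in> L2 U"
proof -
 have m: "u \<in> borel_measurable (lebesgue_on U)" "v \<in> borel_measurable (lebesgue_on U)"
  using assms by (auto dest: L2_measurable)
 have "integrable (lebesgue_on U) (\<lambda>x. (norm (u x + v x))^2)"
 proof (rule Bochner_Integration.integrable_bound)
  show "integrable (lebesgue_on U) (\<lambda>x. 2 * (norm (u x))^2 + 2 * (norm (v x))^2)"
   using assms by (auto simp: L2_def)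
  have "(norm (u x + v x))^2 \<le> 2 * (norm (u x))^2 + 2 * (norm (v x))^2" for x
  proof -
   have "(norm (u x + v x))^2 \<le> (norm (u x) + norm (v x))^2"
    by (intro power_mono norm_triangle_ineq) auto
   also have "\<dots> \<le> 2 * (norm (u x))^2 + 2 * (norm (v x))^2"
    using sum_squares_bound[of "norm (u x)" "norm (v x)"] by (simp add: power2_sum)
   finally show ?thesis .
  qed
  then show "AE x in lebesgue_on U. norm ((norm (u x + v x))^2)
    \<le> norm (2 * (norm (u x))^2 + 2 * (norm (v x))^2)"
   by auto
 qed (use m in measurable)
 then show ?thesis using m by (simp add: L2_def)
qed

lemma L2_inner_integrable:
 fixes u v :: "'a::euclidean_space \<Rightarrow> 'b::euclidean_space"
 assumes "u \<in> L2 U" "v \<in> L2 U" shows "integrable (lebesgue_on U) (\<lambda>x. u x \<bullet> v x)"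
proof (rule Bochner_Integration.integrable_bound)
 show "integrable (lebesgue_on U) (\<lambda>x. (norm (u x))^2 + (norm (v x))^2)"
  using assms by (auto simp: L2_def)
 have "\<bar>u x \<bullet> v x\<bar> \<le> (norm (u x))^2 + (norm (v x))^2" for x
  using Cauchy_Schwarz_ineq2[of "u x" "v x"] sum_squares_bound[of "norm (u x)" "norm (v x)"]
   mult_nonneg_nonneg[of "norm (u x)" "norm (v x)"] by (simp del: mult_nonneg_nonneg)
 then show "AE x in lebesgue_on U. norm (u x \<bullet> v x) \<le> norm ((norm (u x))^2 + (norm (v x))^2)"
  by auto
 show "(\<lambda>x. u x \<bullet> v x) \<in> borel_measurable (lebesgue_on U)"
  using assms by (auto dest!: L2_measurable)
qed

global_interpretation L2: semi_inner "L2 U" "L2_inner U"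
 for U :: "'a::euclidean_space set"
proof
 fix u v w :: "'a \<Rightarrow> 'b::euclidean_space" and a :: real
 assume u: "u \<in> L2 U"
 show "(\<lambda>x. a *\<^sub>R u x) \<in> L2 U" by (rule L2_scaleR[OF u])
 show "0 \<le> L2_inner U u u" by (simp add: L2_inner_def)
 { assume w: "w \<in> L2 U"
  show "L2_inner U (\<lambda>x. a *\<^sub>R u x) w = a * L2_inner U u w" by (simp add: L2_inner_def) }
 assume v: "v \<in> L2 U"
 show "(\<lambda>x. u x + v x) \<in> L2 U" by (rule L2_add[OF u v])
 show "L2_inner U u v = L2_inner U v u" by (simp add: L2_inner_def inner_commute)
 assume w: "w \<in> L2 U"
 show "L2_inner U (\<lambda>x. u x + v x) w = L2_inner U u w + L2_inner U v w"
  using L2_inner_integrable[OF u w] L2_inner_integrable[OF v w]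
  by (simp add: L2_inner_def inner_add_left)
qed (rule L2_zero)

lemma L2_nrm: "L2.nrm U = L2_norm U"
 by (simp add: fun_eq_iff L2.nrm_def L2_norm_def)

lemmas L2_cauchy_schwarz = L2.cauchy_schwarz[unfolded L2_nrm]
lemmas L2_norm_sq = L2.nrm_sq[unfolded L2_nrm]
lemmas L2_triangle = L2.nrm_triangle[unfolded L2_nrm]
lemmas L2_triangle3 = L2.nrm_triangle3[unfolded L2_nrm]
lemmas L2_norm_scaleR = L2.nrm_scale[unfolded L2_nrm]
lemmas L2_norm_commute = L2.nrm_diff_commute[unfolded L2_nrm]

lemma L2_scale: "u \<in> L2 U \<Longrightarrow> (\<lambda>x. a * u x) \<in> L2 U" for u :: "'a::euclidean_space \<Rightarrow> real"
 using L2_scaleR[of u U a] by simp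

lemma L2_norm_scale: "u \<in> L2 U \<Longrightarrow> L2_norm U (\<lambda>x. a * u x) = \<bar>a\<bar> * L2_norm U u"
 for u :: "'a::euclidean_space \<Rightarrow> real"
 using L2_norm_scaleR[of u U a] by simp

lemma L2_inner_scale_left: "u \<in> L2 U \<Longrightarrow> w \<in> L2 U \<Longrightarrow> L2_inner U (\<lambda>x. a * u x) w = a * L2_inner U u w"
 for u :: "'a::euclidean_space \<Rightarrow> real"
 using L2.ip_scale_left[of u U w a] by simp

lemma L2_inner_scale_right: "u \<in> L2 U \<Longrightarrow> w \<in> L2 U \<Longrightarrow> L2_inner U w (\<lambda>x. a * u x) = a * L2_inner U w u"
 for u :: "'a::euclidean_space \<Rightarrow> real"
 using L2.ip_scale_right[of u U w a] by simp

lemma L2_norm_eq: "L2_norm U u = sqrt (LINT x|lebesgue_on U. (norm (u x))^2)"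
 by (simp add: L2_norm_def L2_inner_def power2_norm_eq_inner)

lemma L2_norm_sq_eq: "(L2_norm U u)^2 = (LINT x|lebesgue_on U. (norm (u x))^2)"
 by (simp add: L2_norm_eq)

lemma L2_norm_ge_0: "0 \<le> L2_norm U u"
 by (simp add: L2_norm_eq)

lemma L2_norm_mono:
 fixes u :: "'a::euclidean_space \<Rightarrow> 'b::euclidean_space" and v :: "'a \<Rightarrow> 'c::euclidean_space"
 assumes u: "u \<in> L2 U" and v: "v \<in> borel_measurable (lebesgue_on U)" and C: "0 \<le> C"
  and le: "AE x in lebesgue_on U. norm (v x) \<le> C * norm (u x)"
 shows "L2_norm U v \<le> C * L2_norm U u"
proof -
 have vL: "v \<in> L2 U" using L2_dominated[OF u v le] .
 have "(LINT x|lebesgue_on U. (norm (v x))^2) \<le> (LINT x|lebesgue_on U. C^2 * (norm (u x))^2)"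
 proof (rule integral_mono_AE)
  show "AE x in lebesgue_on U. (norm (v x))^2 \<le> C^2 * (norm (u x))^2"
   using le
  proof eventually_elim
   case (elim x)
   then have "(norm (v x))^2 \<le> (C * norm (u x))^2" by (intro power_mono) auto
   then show ?case by (simp add: power_mult_distrib)
  qed
 qed (use u vL in \<open>auto simp: L2_def\<close>)
 then have "(L2_norm U v)^2 \<le> (C * L2_norm U u)^2"
  by (simp add: L2_norm_sq_eq power_mult_distrib)
 then show ?thesis by (rule power2_le_imp_le) (simp add: L2_norm_ge_0 C)
qed

lemma L2_norm_cong_AE:
 assumes "u \<in> borel_measurable (lebesgue_on U)" "v \<in> borel_measurable (lebesgue_on U)"
  and "AE x in lebesgue_on U. u x = v x"
 shows "L2_norm U u = L2_norm U v"
 unfolding L2_norm_eq using assms by (auto intro!: arg_cong[where f=sqrt] integral_cong_AE)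

lemma L2_cong_AE:
 assumes "u \<in> L2 U" "v \<in> borel_measurable (lebesgue_on U)" "AE x in lebesgue_on U. u x = v x"
 shows "v \<in> L2 U"
 using assms by (intro L2_dominated[OF assms(1,2), of 1]) auto

lemma L2_inner_cong_AE:
 assumes "u \<in> borel_measurable (lebesgue_on U)" "v \<in> borel_measurable (lebesgue_on U)"
  "w \<in> borel_measurable (lebesgue_on U)"
  and "AE x in lebesgue_on U. u x = v x"
 shows "L2_inner U u w = L2_inner U v w"
 unfolding L2_inner_def using assms by (auto intro!: integral_cong_AE)

lemma L2_norm_eq_0_iff:
 assumes "u \<in> L2 U"
 shows "L2_norm U u = 0 \<longleftrightarrow> (AE x in lebesgue_on U. u x = 0)"
 using integral_nonneg_eq_0_iff_AE[OF L2_integrable_sq[OF assms]]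
 by (simp add: L2_norm_eq)

lemma L2_bounded:
 fixes u :: "'a::euclidean_space \<Rightarrow> 'b::euclidean_space"
 assumes fin: "U \<in> lmeasurable" and u: "u \<in> borel_measurable (lebesgue_on U)"
  and le: "AE x in lebesgue_on U. norm (u x) \<le> C" and C: "0 \<le> C"
 shows "u \<in> L2 U" "L2_norm U u \<le> C * sqrt (measure lebesgue U)"
proof -
 interpret finite_measure "lebesgue_on U" by (rule finite_measure_lebesgue_on[OF fin])
 have 1: "(\<lambda>x. 1::real) \<in> L2 U" by (simp add: L2_def)
 show "u \<in> L2 U" using le by (intro L2_dominated[OF 1 u, of C]) auto
 have "L2_norm U u \<le> C * L2_norm U (\<lambda>x. 1::real)"
  using le C by (intro L2_norm_mono[OF 1 u]) auto
 then show "L2_norm U u \<le> C * sqrt (measure lebesgue U)"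
  using fin by (simp add: L2_norm_eq measure_restrict_space fmeasurableD)
qed

lemma L2_const: "U \<in> lmeasurable \<Longrightarrow> (\<lambda>x. c) \<in> L2 U"
 by (rule L2_bounded(1)[of _ _ "norm c"]) auto

lemma L2_integrable:
 fixes u :: "'a::euclidean_space \<Rightarrow> 'b::euclidean_space"
 assumes "U \<in> lmeasurable" "u \<in> L2 U" shows "integrable (lebesgue_on U) u"
proof (rule Bochner_Integration.integrable_bound)
 interpret finite_measure "lebesgue_on U" by (rule finite_measure_lebesgue_on[OF assms(1)])
 show "integrable (lebesgue_on U) (\<lambda>x. 1 + (norm (u x))^2)"
  using L2_integrable_sq[OF assms(2)] by simp
 have "norm (u x) \<le> 1 + (norm (u x))^2" for x
  using sum_squares_bound[of 1 "norm (u x)"] norm_ge_zero[of "u x"] by (simp del: norm_ge_zero)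
 then show "AE x in lebesgue_on U. norm (u x) \<le> norm (1 + (norm (u x))^2)" by auto
qed (use assms in \<open>auto dest: L2_measurable\<close>)

lemma integral_norm_le_L2:
 fixes u :: "'a::euclidean_space \<Rightarrow> 'b::euclidean_space"
 assumes fin: "U \<in> lmeasurable" and u: "u \<in> L2 U"
 shows "(LINT x|lebesgue_on U. norm (u x)) \<le> sqrt (measure lebesgue U) * L2_norm U u"
proof -
 have 1: "(\<lambda>x. 1::real) \<in> L2 U" using fin by (rule L2_const)
 have n: "(\<lambda>x. norm (u x)) \<in> L2 U"
  using u by (intro L2_dominated[OF u, of _ 1]) (auto dest: L2_measurable)
 have "L2_inner U (\<lambda>x. 1) (\<lambda>x. norm (u x)) \<le> L2_norm U (\<lambda>x. 1::real) * L2_norm U (\<lambda>x. norm (u x))"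
  using L2_cauchy_schwarz[OF 1 n] by linarith
 moreover have "L2_norm U (\<lambda>x. 1::real) \<le> sqrt (measure lebesgue U)"
  using L2_bounded(2)[OF fin, of "\<lambda>x. 1::real" 1] by simp
 moreover have "L2_norm U (\<lambda>x. norm (u x)) = L2_norm U u" by (simp add: L2_norm_eq)
 ultimately show ?thesis
  using mult_right_mono[OF _ L2_norm_ge_0[of U u]] by (fastforce simp: L2_inner_def)
qed

section \<open>Almost everywhere subsequences, dominated convergence and completeness of L2\<close>

lemma L2_AE_subseq:
 fixes u :: "nat \<Rightarrow> 'a::euclidean_space \<Rightarrow> 'b::euclidean_space"
 assumes u: "\<And>j. u j \<in> L2 U" and v: "v \<in> L2 U"
  and lim: "null (\<lambda>j. L2_norm U (\<lambda>x. u j x - v x))"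
 obtains r :: "nat \<Rightarrow> nat" where "strict_mono r"
  "AE x in lebesgue_on U. (\<lambda>j. u (r j) x) \<longlonglongrightarrow> v x"
proof -
 have "null (\<lambda>j. (L2_norm U (\<lambda>x. u j x - v x))^2)" using tendsto_power[OF lim, of 2] by simp
 then have "\<exists>r::nat\<Rightarrow>nat. strict_mono r \<and>
   (AE x in lebesgue_on U. null (\<lambda>j. (norm (u (r j) x - v x))^2))"
  using u v by (intro tendsto_L1_AE_subseq) (auto simp: L2_norm_sq_eq intro!: L2_integrable_sq)
 then obtain r :: "nat \<Rightarrow> nat" where r: "strict_mono r"
  "AE x in lebesgue_on U. null (\<lambda>j. (norm (u (r j) x - v x))^2)" by blast
 have "AE x in lebesgue_on U. (\<lambda>j. u (r j) x) \<longlonglongrightarrow> v x"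
  using r(2)
 proof eventually_elim
  case (elim x)
  have "null (\<lambda>j. norm (u (r j) x - v x))"
   using tendsto_real_sqrt[OF elim] by simp
  then show ?case by (simp add: LIM_zero_iff tendsto_norm_zero_iff)
 qed
 with r(1) that show thesis by blast
qed

lemma L2_dominated_convergence:
 fixes u :: "nat \<Rightarrow> 'a::euclidean_space \<Rightarrow> 'b::euclidean_space" and w :: "'a \<Rightarrow> 'c::euclidean_space"
 assumes u: "\<And>j. u j \<in> borel_measurable (lebesgue_on U)" and w: "w \<in> L2 U"
  and lim: "AE x in lebesgue_on U. null (\<lambda>j. u j x)"
  and le: "\<And>j. AE x in lebesgue_on U. norm (u j x) \<le> C * norm (w x)"
 shows "null (\<lambda>j. L2_norm U (u j))"
proof -
 have "(\<lambda>j. LINT x|lebesgue_on U. (norm (u j x))^2) \<longlonglongrightarrow> (LINT x|lebesgue_on U. 0::real)"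
 proof (rule integral_dominated_convergence)
  show "integrable (lebesgue_on U) (\<lambda>x. C^2 * (norm (w x))^2)" using w by (simp add: L2_def)
  show "AE x in lebesgue_on U. norm ((norm (u j x))^2) \<le> C^2 * (norm (w x))^2" for j
   using le[of j]
  proof eventually_elim
   case (elim x)
   then have "(norm (u j x))^2 \<le> (C * norm (w x))^2" by (intro power_mono) auto
   then show ?case by (simp add: power_mult_distrib)
  qed
  show "AE x in lebesgue_on U. null (\<lambda>j. (norm (u j x))^2)"
   using lim
  proof eventually_elim
   case (elim x)
   then show ?case using tendsto_power[OF tendsto_norm[OF elim], of 2] by simp
  qed
  show "(\<lambda>x. (norm (u j x))^2) \<in> borel_measurable (lebesgue_on U)" for j
   using u[of j] by measurable
 qed auto
 then show ?thesis using tendsto_real_sqrt by (fastforce simp: L2_norm_eq)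
qed

text \<open>On a set of finite measure an L2 Cauchy sequence is Cauchy in L1 and so has a
  subsequence that converges almost everywhere. Fatou's lemma along this subsequence turns the
  Cauchy bound into a bound on the distance to the pointwise limit, for the whole sequence.\<close>

lemma L2_complete:
 fixes u :: "nat \<Rightarrow> 'a::euclidean_space \<Rightarrow> 'b::euclidean_space"
 assumes fin: "U \<in> lmeasurable" and u: "\<And>j. u j \<in> L2 U"
  and cau: "\<And>e. e > 0 \<Longrightarrow> \<exists>N. \<forall>i\<ge>N. \<forall>j\<ge>N. L2_norm U (\<lambda>x. u i x - u j x) < e"
 obtains v where "v \<in> L2 U" "null (\<lambda>j. L2_norm U (\<lambda>x. u j x - v x))"
proof -
 let ?M = "lebesgue_on U"
 let ?m = "sqrt (measure lebesgue U) + 1"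
 have m: "?m > 0" by (simp add: add_nonneg_pos)
 have ui: "integrable ?M (u n)" for n using L2_integrable[OF fin u] .
 have c1: "\<exists>N. \<forall>i\<ge>N. \<forall>j\<ge>N. LINT x|?M. norm (u i x - u j x) < e" if e: "e > 0" for e
 proof -
  obtain N where N: "\<forall>i\<ge>N. \<forall>j\<ge>N. L2_norm U (\<lambda>x. u i x - u j x) < e / ?m"
   using cau[OF divide_pos_pos[OF e m]] by blast
  have "LINT x|?M. norm (u i x - u j x) < e" if "i \<ge> N" "j \<ge> N" for i j
  proof -
   have "LINT x|?M. norm (u i x - u j x) \<le> sqrt (measure lebesgue U) * L2_norm U (\<lambda>x. u i x - u j x)"
    using u by (intro integral_norm_le_L2 fin) simp
   also have "\<dots> \<le> ?m * L2_norm U (\<lambda>x. u i x - u j x)"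
    by (intro mult_right_mono) (auto simp: L2_norm_ge_0)
   also have "\<dots> < e" using N that m by (simp add: field_simps)
   finally show ?thesis .
  qed
  then show ?thesis by blast
 qed
 obtain r where r: "strict_mono r" "AE x in ?M. Cauchy (\<lambda>i. u (r i) x)"
  by (rule cauchy_L1_AE_cauchy_subseq[OF ui c1]) assumption
 define v where "v x = lim (\<lambda>i. u (r i) x)" for x
 have um: "u j \<in> borel_measurable ?M" for j using u by (rule L2_measurable)
 have vm: "v \<in> borel_measurable ?M"
  unfolding v_def by (rule borel_measurable_lim_metric) (rule um)
 have conv: "AE x in ?M. (\<lambda>i. u (r i) x) \<longlonglongrightarrow> v x"
  using r(2) unfolding v_def by eventually_elim (simp add: Cauchy_convergent convergent_LIMSEQ_iff[symmetric])
 have est: "u n - v \<in> L2 U \<and> L2_norm U (\<lambda>x. u n x - v x) \<le> e"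
  if e: "e > 0" and N: "\<forall>i\<ge>N. \<forall>j\<ge>N. L2_norm U (\<lambda>x. u i x - u j x) < e" and n: "n \<ge> N" for e N n
 proof -
  have dm: "(\<lambda>x. u n x - v x) \<in> borel_measurable ?M" using um vm by measurable
  have "(\<integral>\<^sup>+x. ennreal ((norm (u n x - v x))^2) \<partial>?M)
    = (\<integral>\<^sup>+x. liminf (\<lambda>i. ennreal ((norm (u n x - u (r i) x))^2)) \<partial>?M)"
  proof (rule nn_integral_cong_AE, use conv in eventually_elim)
   case (elim x)
   have "(\<lambda>i. ennreal ((norm (u n x - u (r i) x))^2)) \<longlonglongrightarrow> ennreal ((norm (u n x - v x))^2)"
    by (intro tendsto_ennrealI tendsto_intros elim)
   then show ?case using lim_imp_Liminf by (metis sequentially_bot)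
  qed
  also have "\<dots> \<le> liminf (\<lambda>i. \<integral>\<^sup>+x. ennreal ((norm (u n x - u (r i) x))^2) \<partial>?M)"
   using um by (intro nn_integral_liminf) measurable
  also have "\<dots> \<le> ennreal (e^2)"
  proof (rule Liminf_le)
   show "\<forall>\<^sub>F i in sequentially. (\<integral>\<^sup>+x. ennreal ((norm (u n x - u (r i) x))^2) \<partial>?M) \<le> ennreal (e^2)"
    using eventually_ge_at_top[of N]
   proof eventually_elim
    case (elim i)
    then have ri: "r i \<ge> N" using seq_suble[OF r(1), of i] by simp
    have "(\<integral>\<^sup>+x. ennreal ((norm (u n x - u (r i) x))^2) \<partial>?M)
      = ennreal ((L2_norm U (\<lambda>x. u n x - u (r i) x))^2)"
     unfolding L2_norm_sq_eq using u
     by (intro nn_integral_eq_integral L2_integrable_sq) auto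
    also have "\<dots> \<le> ennreal (e^2)"
     using N n ri by (intro ennreal_leI power_mono) (auto simp: L2_norm_ge_0 less_imp_le)
    finally show ?case .
   qed
  qed simp
  finally have fin2: "(\<integral>\<^sup>+x. ennreal ((norm (u n x - v x))^2) \<partial>?M) \<le> ennreal (e^2)" .
  then have int: "integrable ?M (\<lambda>x. (norm (u n x - v x))^2)"
   using dm by (intro integrableI_bounded) (auto simp: le_less_trans)
  have "ennreal (LINT x|?M. (norm (u n x - v x))^2) \<le> ennreal (e^2)"
   using fin2 nn_integral_eq_integral[OF int] by simp
  then have "(L2_norm U (\<lambda>x. u n x - v x))^2 \<le> e^2"
   using e by (simp add: L2_norm_sq_eq ennreal_le_iff)
  then have "L2_norm U (\<lambda>x. u n x - v x) \<le> e" using e power2_le_imp_le by fastforce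
  moreover have "u n - v \<in> L2 U" using int dm by (simp add: L2_def fun_diff_def)
  ultimately show ?thesis by simp
 qed
 have vL: "v \<in> L2 U"
 proof -
  obtain N where "\<forall>i\<ge>N. \<forall>j\<ge>N. L2_norm U (\<lambda>x. u i x - u j x) < 1" using cau[of 1] by auto
  then have "u N - v \<in> L2 U" using est[of 1 N N] by simp
  then have "(\<lambda>x. u N x - (u N - v) x) \<in> L2 U" using u by (intro L2.S_diff)
  then show ?thesis by simp
 qed
 moreover have "null (\<lambda>j. L2_norm U (\<lambda>x. u j x - v x))"
 proof (rule LIMSEQ_I)
  fix e :: real assume e: "0 < e"
  obtain N where N: "\<forall>i\<ge>N. \<forall>j\<ge>N. L2_norm U (\<lambda>x. u i x - u j x) < e / 2" using cau[of "e/2"] e by auto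
  have "norm (L2_norm U (\<lambda>x. u n x - v x) - 0) < e" if "n \<ge> N" for n
   using est[of "e/2" N n] N that e L2_norm_ge_0[of U "\<lambda>x. u n x - v x"] by auto
  then show "\<exists>no. \<forall>n\<ge>no. norm (L2_norm U (\<lambda>x. u n x - v x) - 0) < e" by blast
 qed
 ultimately show thesis using that by blast
qed

section \<open>Test functions\<close>

text \<open>The polynomials make the family closed under differentiation.\<close>

definition flat_exp :: "real poly \<Rightarrow> real \<Rightarrow> real" where
 "flat_exp p t = (if t > 0 then poly p (1 / t) * exp (- (1 / t)) else 0)"

lemma poly_times_exp_tendsto_0: "((\<lambda>s. poly p s * exp (- s)) \<longlongrightarrow> (0::real)) at_top"
proof -
 have "((\<lambda>s. \<Sum>i\<le>degree p. coeff p i * (s ^ i / exp s)) \<longlongrightarrow> (\<Sum>i\<le>degree p. coeff p i * 0)) at_top"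
  by (intro tendsto_sum tendsto_mult tendsto_const tendsto_power_div_exp_0)
 then show ?thesis
  by (simp add: poly_altdef sum_distrib_right exp_minus divide_inverse mult.assoc)
qed

text \<open>Differentiating p(1/t) exp(-1/t) gives (p - p')(1/t) exp(-1/t) / t^2, and the factor
  1/t^2 is absorbed into the polynomial as the monomial of degree two. At 0 the right-hand quotient
  tends to 0 because the exponential beats every polynomial in 1/t.\<close>

lemma flat_exp_has_derivative:
 "(flat_exp p has_real_derivative flat_exp ([:0, 0, 1:] * (p - pderiv p)) t) (at t)"
proof (cases t "0::real" rule: linorder_cases)
 case greater
 have "((\<lambda>t. poly p (1 / t) * exp (- (1 / t))) has_real_derivative
   flat_exp ([:0, 0, 1:] * (p - pderiv p)) t) (at t)"
  using greater
  by (auto intro!: derivative_eq_intros DERIV_chain'[OF _ poly_DERIV]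
    simp: flat_exp_def field_simps power2_eq_square)
 then show ?thesis
  by (rule has_field_derivative_transform_within_open[of _ _ _ "{0<..}"])
   (use greater in \<open>auto simp: flat_exp_def\<close>)
next
 case less
 have "((\<lambda>t. 0) has_real_derivative flat_exp ([:0, 0, 1:] * (p - pderiv p)) t) (at t)"
  using less by (simp add: flat_exp_def)
 then show ?thesis
  by (rule has_field_derivative_transform_within_open[of _ _ _ "{..<0}"])
   (use less in \<open>auto simp: flat_exp_def\<close>)
next
 case equal
 have "((\<lambda>h. flat_exp p h / h) \<longlongrightarrow> 0) (at_right 0)"
 proof (rule Lim_transform_eventually)
  have "filterlim (\<lambda>h::real. 1 / h) at_top (at_right 0)"
   using filterlim_inverse_at_top_right by (simp add: inverse_eq_divide)
  from filterlim_compose[OF poly_times_exp_tendsto_0[of "[:0, 1:] * p"] this]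
  show "((\<lambda>h. poly ([:0, 1:] * p) (1 / h) * exp (- (1 / h))) \<longlongrightarrow> 0) (at_right 0)" .
  show "\<forall>\<^sub>F h in at_right 0. poly ([:0, 1:] * p) (1 / h) * exp (- (1 / h)) = flat_exp p h / h"
   using eventually_at_right_less[of "0::real"]
   by eventually_elim (simp add: flat_exp_def)
 qed
 moreover have "((\<lambda>h. flat_exp p h / h) \<longlongrightarrow> 0) (at_left 0)"
 proof (rule Lim_transform_eventually[OF tendsto_const])
  show "\<forall>\<^sub>F h in at_left 0. 0 = flat_exp p h / h"
   by (auto simp: eventually_at_left_field flat_exp_def intro: exI[of _ "-1"])
 qed
 ultimately have "((\<lambda>h. flat_exp p h / h) \<longlongrightarrow> 0) (at 0)"
  by (rule filterlim_split_at[rotated])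
 then have "(flat_exp p has_real_derivative 0) (at 0)"
  by (simp add: has_field_derivative_iff flat_exp_def[of p 0])
 then show ?thesis using equal by (simp add: flat_exp_def)
qed

lemma flat_exp_continuous: "continuous_on A (flat_exp p)"
 by (intro continuous_at_imp_continuous_on ballI DERIV_isCont) (rule flat_exp_has_derivative)

lemma tcd_Suc_imp: "times_cont_diff (Suc k) f \<Longrightarrow> times_cont_diff k f"
proof (induction k arbitrary: f)
 case 0
 then obtain D where D: "\<forall>x. (f has_derivative (\<lambda>y. \<Sum>i\<in>UNIV. D i x * y $ i)) (at x)" by auto
 show ?case
  by (auto intro!: continuous_at_imp_continuous_on has_derivative_continuous D[rule_format])
next
 case (Suc k)
 from Suc.prems obtain D where
  D: "\<forall>x. (f has_derivative (\<lambda>y. \<Sum>i\<in>UNIV. D i x * y $ i)) (at x)" "\<forall>i. times_cont_diff (Suc k) (D i)"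
  by (subst (asm) times_cont_diff.simps(2)) blast
 then show ?case using Suc.IH by (subst times_cont_diff.simps(2)) blast
qed

lemma tcd_const: "times_cont_diff k (\<lambda>x. c)"
 by (induction k arbitrary: c) (auto intro!: exI[of _ "\<lambda>i x. 0"])

lemma tcd_add: "times_cont_diff k f \<Longrightarrow> times_cont_diff k g \<Longrightarrow> times_cont_diff k (\<lambda>x. f x + g x)"
proof (induction k arbitrary: f g)
 case (Suc k)
 obtain D E where
  D: "\<forall>x. (f has_derivative (\<lambda>y. \<Sum>i\<in>UNIV. D i x * y $ i)) (at x)" "\<forall>i. times_cont_diff k (D i)"
  and E: "\<forall>x. (g has_derivative (\<lambda>y. \<Sum>i\<in>UNIV. E i x * y $ i)) (at x)" "\<forall>i. times_cont_diff k (E i)"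
  using Suc.prems by auto
 have "((\<lambda>x. f x + g x) has_derivative (\<lambda>y. \<Sum>i\<in>UNIV. (D i x + E i x) * y $ i)) (at x)" for x
  using has_derivative_add[OF D(1)[rule_format] E(1)[rule_format]]
  by (simp add: distrib_right sum.distrib)
 then show ?case using Suc.IH D(2) E(2)
  by (auto intro!: exI[of _ "\<lambda>i x. D i x + E i x"])
qed (auto intro: continuous_intros)

lemma tcd_mult: "times_cont_diff k f \<Longrightarrow> times_cont_diff k g \<Longrightarrow> times_cont_diff k (\<lambda>x. f x * g x)"
proof (induction k arbitrary: f g)
 case (Suc k)
 obtain D E where
  D: "\<forall>x. (f has_derivative (\<lambda>y. \<Sum>i\<in>UNIV. D i x * y $ i)) (at x)" "\<forall>i. times_cont_diff k (D i)"
  and E: "\<forall>x. (g has_derivative (\<lambda>y. \<Sum>i\<in>UNIV. E i x * y $ i)) (at x)" "\<forall>i. times_cont_diff k (E i)"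
  using Suc.prems by auto
 have "((\<lambda>x. f x * g x) has_derivative (\<lambda>y. \<Sum>i\<in>UNIV. (f x * E i x + D i x * g x) * y $ i)) (at x)" for x
 proof -
  have "(\<lambda>y. \<Sum>i\<in>UNIV. (f x * E i x + D i x * g x) * y $ i)
    = (\<lambda>y. f x * (\<Sum>i\<in>UNIV. E i x * y $ i) + (\<Sum>i\<in>UNIV. D i x * y $ i) * g x)"
   by (simp add: fun_eq_iff sum_distrib_left sum_distrib_right sum.distrib[symmetric] algebra_simps)
  then show ?thesis
   using has_derivative_mult[OF D(1)[rule_format, of x] E(1)[rule_format, of x]] by simp
 qed
 moreover have "times_cont_diff k (\<lambda>x. f x * E i x + D i x * g x)" for i
  using tcd_Suc_imp[OF Suc.prems(1)] tcd_Suc_imp[OF Suc.prems(2)] D(2) E(2)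
  by (intro tcd_add Suc.IH) simp_all
 ultimately show ?case
  by (auto intro!: exI[of _ "\<lambda>i x. f x * E i x + D i x * g x"])
qed (auto intro: continuous_intros)

lemma tcd_prod: "(\<And>i. i \<in> I \<Longrightarrow> times_cont_diff k (f i)) \<Longrightarrow> times_cont_diff k (\<lambda>x. \<Prod>i\<in>I. f i x)"
 by (induction I rule: infinite_finite_induct) (auto intro: tcd_const tcd_mult)

lemma tcd_flat_exp: "times_cont_diff k (\<lambda>x::real^'n. flat_exp p (c * x $ j + d))"
proof (induction k arbitrary: p)
 case 0
 show ?case by (auto intro!: continuous_on_compose2[OF flat_exp_continuous] continuous_intros)
next
 case (Suc k)
 let ?q = "[:0, 0, 1:] * (p - pderiv p)"
 let ?D = "\<lambda>i (x::real^'n). (if i = j then c else 0) * flat_exp ?q (c * x $ j + d)"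
 have "((\<lambda>x. flat_exp p (c * x $ j + d)) has_derivative (\<lambda>y. \<Sum>i\<in>UNIV. ?D i x * y $ i)) (at x)" for x
 proof -
  have "((\<lambda>x. c * x $ j + d) has_derivative (\<lambda>y. c * y $ j)) (at x)"
   by (auto intro!: derivative_eq_intros bounded_linear.has_derivative[OF bounded_linear_vec_nth])
  from has_derivative_compose[OF this flat_exp_has_derivative[unfolded has_field_derivative_def]]
  have "((\<lambda>x. flat_exp p (c * x $ j + d)) has_derivative
    (\<lambda>y. flat_exp ?q (c * x $ j + d) * (c * y $ j))) (at x)" .
  moreover have "(\<lambda>y. \<Sum>i\<in>UNIV. ?D i x * y $ i) = (\<lambda>y. flat_exp ?q (c * x $ j + d) * (c * y $ j))"
  proof
   fix y :: "real^'n"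
   have "(\<Sum>i\<in>UNIV. ?D i x * y $ i)
     = (\<Sum>i\<in>UNIV. if i = j then flat_exp ?q (c * x $ j + d) * (c * y $ j) else 0)"
    by (intro sum.cong) auto
   then show "(\<Sum>i\<in>UNIV. ?D i x * y $ i) = flat_exp ?q (c * x $ j + d) * (c * y $ j)"
    by simp
  qed
  ultimately show ?thesis by simp
 qed
 moreover have "times_cont_diff k (?D i)" for i
  by (intro tcd_mult tcd_const Suc.IH)
 ultimately show ?case unfolding times_cont_diff.simps(2) by (intro exI[of _ ?D] conjI allI)
qed

text \<open>Smooth, nonnegative, and positive exactly on the open box. As a product over the
  coordinates it needs only one-dimensional factors, each an instance of
  \<open>tcd_flat_exp\<close>.\<close>

definition box_bump :: "real^'n \<Rightarrow> real^'n \<Rightarrow> real^'n \<Rightarrow> real" where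
 "box_bump a b x = (\<Prod>i\<in>UNIV. flat_exp 1 (x $ i - a $ i) * flat_exp 1 (b $ i - x $ i))"

lemma tcd_box_bump: "times_cont_diff k (box_bump a b)"
proof -
 have "times_cont_diff k (\<lambda>x. \<Prod>i\<in>UNIV. flat_exp 1 (1 * x $ i + - a $ i) * flat_exp 1 (- 1 * x $ i + b $ i))"
  by (intro tcd_prod tcd_mult tcd_flat_exp)
 then show ?thesis by (simp add: box_bump_def[abs_def])
qed

lemma box_bump_nonneg: "0 \<le> box_bump a b x"
 by (auto simp: box_bump_def flat_exp_def intro!: prod_nonneg)

lemma box_bump_pos: "0 < box_bump a b x \<longleftrightarrow> x \<in> box a b"
proof
 assume "0 < box_bump a b x"
 then have "box_bump a b x \<noteq> 0" by simp
 then show "x \<in> box a b"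
  unfolding box_bump_def mem_box_cart by (auto simp: flat_exp_def split: if_splits)
next
 assume "x \<in> box a b"
 then show "0 < box_bump a b x"
  unfolding box_bump_def mem_box_cart by (auto simp: flat_exp_def intro!: prod_pos)
qed

lemma box_bump_zero: "x \<notin> box a b \<Longrightarrow> box_bump a b x = 0"
 using box_bump_pos[of a b x] box_bump_nonneg[of a b x] by simp

lemma box_bump_shift: "box_bump a b (y - x) = box_bump (a + x) (b + x) y"
 by (simp add: box_bump_def algebra_simps)

lemma box_bump_test:
 assumes "cbox a b \<subseteq> U" shows "box_bump a b \<in> test_functions U"
proof -
 have "{x. box_bump a b x \<noteq> 0} \<subseteq> cbox a b"
  using box_bump_zero[of _ a b] box_subset_cbox by blast
 then have "closure {x. box_bump a b x \<noteq> 0} \<subseteq> cbox a b"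
  by (rule closure_minimal) (rule closed_cbox)
 then show ?thesis
  using assms tcd_box_bump
  by (auto simp: test_functions_def compact_eq_bounded_closed intro: bounded_subset[OF bounded_cbox])
qed

lemma tcd_frechet:
 assumes "times_cont_diff (Suc k) f"
 shows "(f has_derivative (\<lambda>h. \<Sum>i\<in>UNIV. frechet_derivative f (at x) (axis i 1) * h $ i)) (at x)"
  and "times_cont_diff k (\<lambda>x. frechet_derivative f (at x) (axis i 1))"
proof -
 obtain D where D: "\<And>x. (f has_derivative (\<lambda>y. \<Sum>i\<in>UNIV. D i x * y $ i)) (at x)" "\<And>i. times_cont_diff k (D i)"
  using assms by auto
 have "frechet_derivative f (at x) (axis i 1) = D i x" for x i
 proof -
  have "frechet_derivative f (at x) (axis i 1) = (\<Sum>l\<in>UNIV. D l x * axis i 1 $ l)"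
   by (subst frechet_derivative_at[OF D(1), symmetric]) simp
  also have "\<dots> = (\<Sum>l\<in>UNIV. if l = i then D i x else 0)"
   by (intro sum.cong) (auto simp: axis_def)
  finally show ?thesis by simp
 qed
 then show "(f has_derivative (\<lambda>h. \<Sum>i\<in>UNIV. frechet_derivative f (at x) (axis i 1) * h $ i)) (at x)"
  and "times_cont_diff k (\<lambda>x. frechet_derivative f (at x) (axis i 1))" using D by auto
qed

definition pder :: "(real^'n \<Rightarrow> real) \<Rightarrow> 'n \<Rightarrow> real^'n \<Rightarrow> real" where
 "pder f i x = frechet_derivative f (at x) (axis i 1)"

lemma test_has_derivative:
 "f \<in> test_functions U \<Longrightarrow> (f has_derivative (\<lambda>h. \<Sum>i\<in>UNIV. pder f i x * h $ i)) (at x)"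
 using tcd_frechet(1)[of 0 f] by (auto simp: test_functions_def pder_def)

lemma test_pder_continuous: "f \<in> test_functions U \<Longrightarrow> continuous_on A (pder f i)"
 using tcd_frechet(2)[of 0 f i]
 by (auto simp: test_functions_def pder_def[abs_def] intro: continuous_on_subset)

lemma test_continuous: "f \<in> test_functions U \<Longrightarrow> continuous_on A f"
 by (rule continuous_on_subset[of UNIV]) (auto simp: test_functions_def dest: spec[of _ 0])

lemma test_compact_support: "f \<in> test_functions U \<Longrightarrow> compact (closure {x. f x \<noteq> 0})"
 by (simp add: test_functions_def)

lemma test_zero: "f \<in> test_functions U \<Longrightarrow> x \<notin> closure {x. f x \<noteq> 0} \<Longrightarrow> f x = 0"
 using closure_subset[of "{x. f x \<noteq> 0}"] by blast

lemma test_pder_zero: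
 assumes f: "f \<in> test_functions U" and x: "x \<notin> closure {x. f x \<noteq> 0}"
 shows "pder f i x = 0"
proof -
 define C where "C = closure {x. f x \<noteq> 0}"
 have C: "open (- C)" "x \<in> - C"
  using x by (simp_all add: C_def open_Compl)
 have "(f has_derivative (\<lambda>h. 0)) (at x)"
 proof (rule has_derivative_transform_within_open)
  show "((\<lambda>x. 0) has_derivative (\<lambda>h. 0)) (at x)" by (rule has_derivative_const)
  show "open (- C)" by (rule C(1))
  show "x \<in> - C" by (rule C(2))
  show "0 = f y" if "y \<in> - C" for y using that test_zero[OF f, of y] unfolding C_def by simp
 qed
 then have "frechet_derivative f (at x) = (\<lambda>h. 0)" using frechet_derivative_at by metis
 then show ?thesis by (simp add: pder_def)
qed

lemma compact_support_uniformly_continuous: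
 fixes g :: "'a::euclidean_space \<Rightarrow> real"
 assumes g: "continuous_on UNIV g" and C: "compact C" and z: "\<And>x. x \<notin> C \<Longrightarrow> g x = 0"
 shows "uniformly_continuous_on UNIV g"
 unfolding uniformly_continuous_on_def
proof (intro allI impI)
 fix e :: real assume e: "e > 0"
 obtain R where R: "C \<subseteq> ball 0 R" "R > 0"
  using compact_imp_bounded[OF C] bounded_subset_ballD by blast
 have "uniformly_continuous_on (cball 0 (R + 1)) g"
  using g by (intro compact_uniformly_continuous continuous_on_subset[OF g]) auto
 then obtain d where d: "d > 0" and
  dd: "\<And>x x'. x \<in> cball 0 (R+1) \<Longrightarrow> x' \<in> cball 0 (R+1) \<Longrightarrow> dist x' x < d \<Longrightarrow> dist (g x') (g x) < e"
  unfolding uniformly_continuous_on_def using e by metis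
 \<comment> \<open>Limiting the distance to 1 leaves two cases: both points lie in the larger ball,
   or neither lies in the support.\<close>
 have "dist (g x') (g x) < e" if "dist x' x < min d 1" for x x'
 proof (cases "x \<in> cball 0 (R+1) \<and> x' \<in> cball 0 (R+1)")
  case True
  then show ?thesis using dd that by auto
 next
  case False
  have "norm x \<le> norm x' + dist x' x" "norm x' \<le> norm x + dist x' x"
   using norm_triangle_sub[of x x'] norm_triangle_sub[of x' x] by (auto simp: dist_norm norm_minus_commute)
  then have "x \<notin> C" "x' \<notin> C" using False that R(1) by (auto simp: subset_iff)
  then show ?thesis using z e by simp
 qed
 then show "\<exists>d>0. \<forall>x\<in>UNIV. \<forall>x'\<in>UNIV. dist x' x < d \<longrightarrow> dist (g x') (g x) < e"
  using d by (intro exI[of _ "min d 1"]) auto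
qed

lemma test_pder_uniformly_continuous:
 assumes "f \<in> test_functions U" shows "uniformly_continuous_on UNIV (pder f i)"
 by (rule compact_support_uniformly_continuous[OF test_pder_continuous[OF assms]
    test_compact_support[OF assms] test_pder_zero[OF assms]])

lemma compact_support_bounded:
 fixes g :: "'a::euclidean_space \<Rightarrow> real"
 assumes g: "continuous_on UNIV g" and C: "compact C" and z: "\<And>x. x \<notin> C \<Longrightarrow> g x = 0"
 obtains B where "\<And>x. \<bar>g x\<bar> \<le> B" "0 \<le> B"
proof -
 have "bounded (g ` C)"
  using g C by (intro compact_imp_bounded compact_continuous_image continuous_on_subset[OF g]) auto
 then obtain B where B: "\<And>x. x \<in> C \<Longrightarrow> \<bar>g x\<bar> \<le> B" by (auto simp: bounded_iff)
 have "\<bar>g x\<bar> \<le> \<bar>B\<bar>" for x using B[of x] z[of x] by (cases "x \<in> C") auto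
 then show thesis using that[of "\<bar>B\<bar>"] by auto
qed

lemma test_bounded:
 assumes f: "f \<in> test_functions U"
 obtains B where "\<And>x. \<bar>f x\<bar> \<le> B" "\<And>x i. \<bar>pder f i x\<bar> \<le> B" "0 \<le> B"
proof -
 note C = test_compact_support[OF f]
 obtain B0 where B0: "\<And>x. \<bar>f x\<bar> \<le> B0" "0 \<le> B0"
  using compact_support_bounded[OF test_continuous[OF f] C test_zero[OF f]] by metis
 have "\<exists>B\<ge>0. \<forall>x. \<bar>pder f i x\<bar> \<le> B" for i
  using compact_support_bounded[OF test_pder_continuous[OF f] C test_pder_zero[OF f]] by metis
 then obtain B where B: "\<And>i. B i \<ge> 0" "\<And>i x. \<bar>pder f i x\<bar> \<le> B i" by metis
 have "B i \<le> (\<Sum>i\<in>UNIV. B i)" for i using B(1) by (intro member_le_sum) auto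
 then have "\<And>x i. \<bar>pder f i x\<bar> \<le> B0 + (\<Sum>i\<in>UNIV. B i)" using B(2) B0(2) by (meson add_increasing order_trans)
 moreover have "0 \<le> (\<Sum>i\<in>UNIV. B i)" using B(1) by (intro sum_nonneg) auto
 ultimately show thesis using that[of "B0 + (\<Sum>i\<in>UNIV. B i)"] B0 by (auto intro: add_increasing2)
qed

lemma test_L2:
 assumes fin: "U \<in> lmeasurable" and f: "f \<in> test_functions U"
 shows "f \<in> L2 U" "pder f i \<in> L2 U"
proof -
 obtain B where B: "\<And>x. \<bar>f x\<bar> \<le> B" "\<And>x i. \<bar>pder f i x\<bar> \<le> B" "0 \<le> B"
  using test_bounded[OF f] by metis
 have S: "U \<in> sets lebesgue" using fin by (rule fmeasurableD)
 show "f \<in> L2 U"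
  using B by (intro L2_bounded(1)[OF fin, of _ B] continuous_imp_measurable_on_sets_lebesgue test_continuous[OF f] S) auto
 show "pder f i \<in> L2 U"
  using B by (intro L2_bounded(1)[OF fin, of _ B] continuous_imp_measurable_on_sets_lebesgue test_pder_continuous[OF f] S) auto
qed

text \<open>A first-order Taylor expansion with remainder uniform in \<open>x\<close>, from uniform
  continuity of the partial derivatives. It serves to differentiate under the convolution integral
  and to pass to the limit in difference quotients of test functions.\<close>

lemma test_uniform_linearization:
 fixes f :: "real^'n \<Rightarrow> real"
 assumes f: "f \<in> test_functions U" and e: "e > 0"
 obtains d where "d > 0"
  "\<And>x h. norm h < d \<Longrightarrow> \<bar>f (x + h) - f x - (\<Sum>i\<in>UNIV. pder f i x * h $ i)\<bar> \<le> e * norm h"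
proof -
 let ?n = "real CARD('n)"
 have n: "?n > 0" by simp
 have "\<exists>d>0. \<forall>x x'. dist x' x < d \<longrightarrow> dist (pder f i x') (pder f i x) < e / ?n" for i
  using test_pder_uniformly_continuous[OF f, of i,
    unfolded uniformly_continuous_on_def, rule_format, OF divide_pos_pos[OF e n]] by auto
 then obtain D where D: "\<And>i. D i > 0"
  "\<And>i x x'. dist x' x < D i \<Longrightarrow> dist (pder f i x') (pder f i x) < e / ?n" by metis
 define d where "d = Min (range D)"
 have dle: "d \<le> D i" for i unfolding d_def by (intro Min_le) auto
 have d: "d > 0" unfolding d_def using D(1) by (subst Min_gr_iff) auto
 have "\<bar>f (x + h) - f x - (\<Sum>i\<in>UNIV. pder f i x * h $ i)\<bar> \<le> e * norm h" if h: "norm h < d" for x h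
 proof -
  let ?g = "\<lambda>t. f (x + t *\<^sub>R h)"
  have der: "(?g has_real_derivative (\<Sum>i\<in>UNIV. pder f i (x + t *\<^sub>R h) * h $ i)) (at t)" for t
  proof -
   have "((\<lambda>t. x + t *\<^sub>R h) has_derivative (\<lambda>s. s *\<^sub>R h)) (at t)"
    by (auto intro!: derivative_eq_intros)
   from has_derivative_compose[OF this test_has_derivative[OF f]]
   have "(?g has_derivative (\<lambda>s. \<Sum>i\<in>UNIV. pder f i (x + t *\<^sub>R h) * (s *\<^sub>R h) $ i)) (at t)" .
   moreover have "(\<lambda>s. \<Sum>i\<in>UNIV. pder f i (x + t *\<^sub>R h) * (s *\<^sub>R h) $ i)
     = (*) (\<Sum>i\<in>UNIV. pder f i (x + t *\<^sub>R h) * h $ i)"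
    by (simp add: fun_eq_iff sum_distrib_left algebra_simps)
   ultimately show ?thesis by (simp add: has_field_derivative_def)
  qed
  obtain t where t: "0 < t" "t < 1" "?g 1 - ?g 0 = (1 - 0) * (\<Sum>i\<in>UNIV. pder f i (x + t *\<^sub>R h) * h $ i)"
   using MVT2[of 0 1 ?g "\<lambda>t. \<Sum>i\<in>UNIV. pder f i (x + t *\<^sub>R h) * h $ i"] der by auto
  have "f (x + h) - f x - (\<Sum>i\<in>UNIV. pder f i x * h $ i)
    = (\<Sum>i\<in>UNIV. (pder f i (x + t *\<^sub>R h) - pder f i x) * h $ i)"
   using t by (simp add: left_diff_distrib sum_subtractf)
  also have "\<bar>\<dots>\<bar> \<le> (\<Sum>i\<in>(UNIV::'n set). e / ?n * norm h)"
  proof (rule order_trans[OF sum_abs], rule sum_mono)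
   fix i
   have "norm (t *\<^sub>R h) \<le> 1 * norm h" using t by (simp add: mult_left_le_one_le)
   then have "dist (x + t *\<^sub>R h) x < D i" using h dle[of i] by (simp add: dist_norm)
   then have "\<bar>pder f i (x + t *\<^sub>R h) - pder f i x\<bar> \<le> e / ?n"
    using D(2)[of "x + t *\<^sub>R h" x i] by (simp add: dist_real_def)
   then show "\<bar>(pder f i (x + t *\<^sub>R h) - pder f i x) * h $ i\<bar> \<le> e / ?n * norm h"
    unfolding abs_mult using e by (intro mult_mono component_le_norm_cart) auto
  qed
  also have "\<dots> = e * norm h" by simp
  finally show ?thesis .
 qed
 with d that show thesis by blast
qed

section \<open>Mollification\<close>

lemma nn_integral_lborel_shift:
 fixes f :: "'a::euclidean_space \<Rightarrow> ennreal"
 assumes [measurable]: "f \<in> borel_measurable borel"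
 shows "(\<integral>\<^sup>+x. f (y - x) \<partial>lborel) = (\<integral>\<^sup>+x. f x \<partial>lborel)"
  and "(\<integral>\<^sup>+y. f (y - x) \<partial>lborel) = (\<integral>\<^sup>+x. f x \<partial>lborel)"
proof -
 have "lborel = density (distr lborel borel (\<lambda>x. y + (-1) *\<^sub>R x)) (\<lambda>_. ennreal (\<bar>-1\<bar>^DIM('a)))"
  by (rule lborel_affine) simp
 from arg_cong[OF this, of "\<lambda>M. integral\<^sup>N M f"]
 show "(\<integral>\<^sup>+x. f (y - x) \<partial>lborel) = (\<integral>\<^sup>+x. f x \<partial>lborel)"
  by (simp add: nn_integral_density nn_integral_distr)
 have "lborel = density (distr lborel borel (\<lambda>z. - x + 1 *\<^sub>R z)) (\<lambda>_. ennreal (\<bar>1\<bar>^DIM('a)))"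
  by (rule lborel_affine) simp
 from arg_cong[OF this, of "\<lambda>M. integral\<^sup>N M f"]
 show "(\<integral>\<^sup>+y. f (y - x) \<partial>lborel) = (\<integral>\<^sup>+x. f x \<partial>lborel)"
  by (simp add: nn_integral_density nn_integral_distr)
qed

lemma LIMSEQ_0_less: "X \<longlonglongrightarrow> 0 \<Longrightarrow> 0 < e \<Longrightarrow> \<exists>n. X n < (e::real)"
 using order_tendstoD(2)[of X 0 sequentially e] eventually_happens'[OF sequentially_bot] by blast

lemma small_box:
 fixes p :: "'a::euclidean_space"
 assumes "s > 0" obtains a b where "p \<in> box a b" "cbox a b \<subseteq> ball p s"
proof -
 obtain a b where ab: "p \<in> box a b" "box a b \<subseteq> ball p (s/2)"
  using rational_boxes[of "s/2" p] assms by auto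
 have "cbox a b = closure (box a b)" using ab(1) by (subst closure_box) auto
 also have "\<dots> \<subseteq> cball p (s/2)" using ab(2) by (intro closure_minimal order_trans[OF _ ball_subset_cball]) auto
 also have "\<dots> \<subseteq> ball p s" using assms by auto
 finally show thesis using ab(1) that by blast
qed

lemma test_scale: "f \<in> test_functions U \<Longrightarrow> (\<lambda>x. c * f x) \<in> test_functions U"
proof -
 assume f: "f \<in> test_functions U"
 have "closure {x. c * f x \<noteq> 0} \<subseteq> closure {x. f x \<noteq> 0}" by (intro closure_mono) auto
 then show ?thesis
  using f by (auto simp: test_functions_def intro!: tcd_mult tcd_const
    intro: compact_closure[THEN iffD2] bounded_subset[of "{x. f x \<noteq> 0}"])
qed

text \<open>The supporting box need not contain 0: close to the boundary a box away from the origin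
  is used, so that averages see only points of the domain.\<close>

definition mollifier :: "real^'n \<Rightarrow> real^'n \<Rightarrow> real^'n \<Rightarrow> real" where
 "mollifier a b z = inverse (LINT z|lborel. box_bump a b z) * box_bump a b z"

lemma mollifier_test: "mollifier a b \<in> test_functions UNIV"
 unfolding mollifier_def[abs_def] by (intro test_scale box_bump_test) simp

lemma mollifier_nonneg: "0 \<le> mollifier a b z"
 by (simp add: mollifier_def box_bump_nonneg integral_nonneg)

lemma mollifier_zero: "z \<notin> box a b \<Longrightarrow> mollifier a b z = 0"
 by (simp add: mollifier_def box_bump_zero)

lemma mollifier_continuous: "continuous_on A (mollifier a b)"
 by (rule test_continuous[OF mollifier_test])

lemma mollifier_measurable [measurable]: "mollifier a b \<in> borel_measurable borel"
 by (rule borel_measurable_continuous_onI[OF mollifier_continuous])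

lemma mollifier_integral:
 assumes "box a b \<noteq> {}" shows "(\<integral>\<^sup>+z. mollifier a b z \<partial>lborel) = 1"
proof -
 have c: "continuous_on UNIV (box_bump a b)" by (rule test_continuous[OF box_bump_test[of _ _ UNIV]]) simp
 have m: "box_bump a b \<in> borel_measurable borel" by (rule borel_measurable_continuous_onI[OF c])
 obtain B where B: "\<And>x. \<bar>box_bump a b x\<bar> \<le> B" "0 \<le> B"
  using test_bounded[OF box_bump_test[of a b UNIV]] by (metis subset_UNIV)
 have i: "integrable lborel (box_bump a b)"
 proof (rule integrableI_bounded_set[of "cbox a b" _ _ B])
  show "AE x in lborel. x \<in> cbox a b \<longrightarrow> norm (box_bump a b x) \<le> B" using B by auto
  show "AE x in lborel. x \<notin> cbox a b \<longrightarrow> box_bump a b x = 0"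
   using box_bump_zero box_subset_cbox by (metis (mono_tags, lifting) AE_I2 subset_iff)
  show "emeasure lborel (cbox a b) < \<infinity>" by (simp add: emeasure_lborel_cbox_eq)
 qed (use m in auto)
 have p: "(LINT z|lborel. box_bump a b z) > 0"
 proof (rule ccontr)
  assume "\<not> ?thesis"
  moreover have "0 \<le> (LINT z|lborel. box_bump a b z)"
   by (intro Bochner_Integration.integral_nonneg box_bump_nonneg)
  ultimately have "(LINT z|lborel. box_bump a b z) = 0" by linarith
  then have "AE z in lborel. box_bump a b z = 0"
   using integral_nonneg_eq_0_iff_AE[OF i] box_bump_nonneg[of a b] by auto
  then have "AE z in lborel. z \<notin> box a b" by (rule eventually_mono) (metis box_bump_pos less_irrefl)
  then have "box a b \<in> null_sets lborel" by (subst AE_iff_null_sets) auto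
  then have "negligible (box a b)"
   by (simp add: negligible_iff_null_sets null_sets_completionI)
  then show False using open_not_negligible[OF open_box assms] by simp
 qed
 have "(\<integral>\<^sup>+z. mollifier a b z \<partial>lborel) = ennreal (LINT z|lborel. mollifier a b z)"
  using i unfolding mollifier_def by (intro nn_integral_eq_integral) (auto simp: box_bump_nonneg integral_nonneg)
 also have "(LINT z|lborel. mollifier a b z) = 1" using p by (simp add: mollifier_def)
 finally show ?thesis by simp
qed

text \<open>The kernel is evaluated at \<open>y - x\<close>, so the value at \<open>x\<close>
  averages \<open>u\<close> over \<open>x\<close> plus the box. Restricting the integral to
  \<open>U\<close> amounts to extending \<open>u\<close> by zero.\<close>

definition mollify :: "(real^'n) set \<Rightarrow> real^'n \<Rightarrow> real^'n \<Rightarrow> (real^'n \<Rightarrow> real) \<Rightarrow> real^'n \<Rightarrow> real" where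
 "mollify U a b u x = (LINT y|lebesgue_on U. mollifier a b (y - x) * u y)"

locale bounded_open =
 fixes U :: "(real^'n) set"
 assumes open_dom: "open U" and bounded_dom: "bounded U"
begin

abbreviation "MU \<equiv> lebesgue_on U"
abbreviation "bm \<equiv> borel_measurable MU"
abbreviation "nm \<equiv> L2_norm U"
abbreviation "inn \<equiv> L2_inner U"
abbreviation "tends u v \<equiv> null (\<lambda>j. nm (\<lambda>x. u j x - v x))"

lemma dom_lmeasurable: "U \<in> lmeasurable"
 using open_dom bounded_dom by (rule lmeasurable_open[rotated])

lemma compl_nonempty: "- U \<noteq> {}"
proof
 assume "- U = {}"
 then have "U = UNIV" by blast
 then show False using bounded_dom not_bounded_UNIV by metis
qed

lemma dom_sets: "U \<in> sets lebesgue"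
 using dom_lmeasurable by (rule fmeasurableD)

lemma continuous_measurable: "continuous_on U f \<Longrightarrow> f \<in> bm"
 for f :: "real^'n \<Rightarrow> 'b::euclidean_space"
 by (rule continuous_imp_measurable_on_sets_lebesgue[OF _ dom_sets])

lemma mollifier_shift_L2: "(\<lambda>y. mollifier a b (y - x)) \<in> L2 U" "(\<lambda>y. sqrt (mollifier a b (y - x))) \<in> L2 U"
proof -
 obtain B where B: "\<And>x. \<bar>mollifier a b x\<bar> \<le> B" "0 \<le> B"
  using test_bounded[OF mollifier_test[of a b]] by metis
 have c: "continuous_on U (\<lambda>y. mollifier a b (y - x))"
  by (intro continuous_on_compose2[OF mollifier_continuous[of UNIV]] continuous_intros) auto
 show "(\<lambda>y. mollifier a b (y - x)) \<in> L2 U"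
  using B by (intro L2_bounded(1)[OF dom_lmeasurable, of _ B] continuous_measurable c) auto
 show "(\<lambda>y. sqrt (mollifier a b (y - x))) \<in> L2 U"
  using B mollifier_nonneg[of a b]
  by (intro L2_bounded(1)[OF dom_lmeasurable, of _ "sqrt B"] continuous_measurable continuous_on_real_sqrt c)
   (auto simp: real_sqrt_le_mono abs_le_iff)
qed

lemma mollify_integrable: "u \<in> L2 U \<Longrightarrow> integrable MU (\<lambda>y. mollifier a b (y - x) * u y)"
 using L2_inner_integrable[OF mollifier_shift_L2(1)] by fastforce

lemma mollify_diff:
 "u \<in> L2 U \<Longrightarrow> v \<in> L2 U \<Longrightarrow> mollify U a b (\<lambda>x. u x - v x) x = mollify U a b u x - mollify U a b v x"
 by (simp add: mollify_def right_diff_distrib mollify_integrable)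

text \<open>Young's inequality for a kernel of mass at most 1; part of the mass may fall outside
  \<open>U\<close>. The kernel is split into two square roots for the Cauchy-Schwarz inequality,
  which gives the pointwise bound \<open>jensen\<close>, and Tonelli's theorem integrates out the
  other variable.\<close>

lemma mollify_norm_le:
 assumes ab: "box a b \<noteq> {}" and u: "u \<in> L2 U"
 shows "mollify U a b u \<in> L2 U" "nm (mollify U a b u) \<le> nm u"
proof -
 let ?M = "MU"
 interpret finite_measure ?M by (rule finite_measure_lebesgue_on[OF dom_lmeasurable])
 interpret pair_sigma_finite ?M ?M by standard
 have um [measurable]: "u \<in> borel_measurable ?M" using u by (rule L2_measurable)
 have id [measurable]: "(\<lambda>x. x) \<in> borel_measurable ?M" using id_borel_measurable_lebesgue_on[of U] by (simp add: id_def)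
 have km [measurable]: "(\<lambda>(x, y). mollifier a b (y - x)) \<in> borel_measurable (?M \<Otimes>\<^sub>M ?M)" by measurable
 have mm: "mollify U a b u \<in> borel_measurable ?M"
  unfolding mollify_def[abs_def] by measurable
 have k1: "(\<integral>\<^sup>+y. mollifier a b (y - x) \<partial>?M) \<le> 1" "(\<integral>\<^sup>+y. mollifier a b (x - y) \<partial>?M) \<le> 1" for x
 proof -
  have "(\<integral>\<^sup>+y. mollifier a b (y - x) \<partial>?M) \<le> (\<integral>\<^sup>+y. mollifier a b (y - x) \<partial>lebesgue)"
   using dom_sets by (auto simp: nn_integral_restrict_space intro!: nn_integral_mono split: split_indicator)
  also have "\<dots> = 1"
   using nn_integral_lborel_shift(2)[of "\<lambda>z. ennreal (mollifier a b z)" x] mollifier_integral[OF ab]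
   by (simp add: nn_integral_completion)
  finally show "(\<integral>\<^sup>+y. mollifier a b (y - x) \<partial>?M) \<le> 1" .
  have "(\<integral>\<^sup>+y. mollifier a b (x - y) \<partial>?M) \<le> (\<integral>\<^sup>+y. mollifier a b (x - y) \<partial>lebesgue)"
   using dom_sets by (auto simp: nn_integral_restrict_space intro!: nn_integral_mono split: split_indicator)
  also have "\<dots> = 1"
   using nn_integral_lborel_shift(1)[of "\<lambda>z. ennreal (mollifier a b z)" x] mollifier_integral[OF ab]
   by (simp add: nn_integral_completion)
  finally show "(\<integral>\<^sup>+y. mollifier a b (x - y) \<partial>?M) \<le> 1" .
 qed
 have jensen: "ennreal ((mollify U a b u x)^2) \<le> (\<integral>\<^sup>+y. mollifier a b (y - x) * (u y)^2 \<partial>?M)" for x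
 proof -
  let ?s = "\<lambda>y. sqrt (mollifier a b (y - x))"
  obtain B where B: "\<And>x. \<bar>mollifier a b x\<bar> \<le> B" "0 \<le> B"
   using test_bounded[OF mollifier_test[of a b]] by metis
  have s: "?s \<in> L2 U" by (rule mollifier_shift_L2)
  have su: "(\<lambda>y. ?s y * u y) \<in> L2 U"
  proof (rule L2_dominated[OF u, of _ "sqrt B"])
   show "(\<lambda>y. ?s y * u y) \<in> borel_measurable ?M" by measurable
   show "AE y in ?M. norm (?s y * u y) \<le> sqrt B * norm (u y)"
    using B mollifier_nonneg[of a b]
    by (intro AE_I2) (auto simp: abs_mult abs_le_iff intro!: mult_right_mono real_sqrt_le_mono)
  qed
  have e1: "inn ?s (\<lambda>y. ?s y * u y) = mollify U a b u x"
   by (simp add: L2_inner_def mollify_def mult.assoc[symmetric] mollifier_nonneg)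
  have "ennreal ((nm ?s)^2) \<le> 1"
  proof -
   have "ennreal ((nm ?s)^2) = (\<integral>\<^sup>+y. mollifier a b (y - x) \<partial>?M)"
    using nn_integral_eq_integral[OF L2_integrable_sq[OF s]] by (simp add: L2_norm_sq_eq mollifier_nonneg)
   then show ?thesis using k1(1)[of x] by simp
  qed
  then have n1: "(nm ?s)^2 \<le> 1" by (simp add: ennreal_le_1)
  have n2: "ennreal ((nm (\<lambda>y. ?s y * u y))^2) = (\<integral>\<^sup>+y. mollifier a b (y - x) * (u y)^2 \<partial>?M)"
   using nn_integral_eq_integral[OF L2_integrable_sq[OF su]]
   by (simp add: L2_norm_sq_eq mollifier_nonneg power_mult_distrib)
  have "\<bar>mollify U a b u x\<bar>^2 \<le> (nm ?s * nm (\<lambda>y. ?s y * u y))^2"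
   using L2_cauchy_schwarz[OF s su] e1 by (intro power_mono) auto
  also have "\<dots> \<le> 1 * (nm (\<lambda>y. ?s y * u y))^2"
   unfolding power_mult_distrib using n1 by (intro mult_right_mono) auto
  finally have "(mollify U a b u x)^2 \<le> (nm (\<lambda>y. ?s y * u y))^2" by simp
  from ennreal_leI[OF this] show ?thesis by (simp only: n2)
 qed
 have "(\<integral>\<^sup>+x. ennreal ((mollify U a b u x)^2) \<partial>?M)
   \<le> (\<integral>\<^sup>+x. (\<integral>\<^sup>+y. mollifier a b (y - x) * (u y)^2 \<partial>?M) \<partial>?M)"
  by (intro nn_integral_mono jensen)
 also have "\<dots> = (\<integral>\<^sup>+y. (\<integral>\<^sup>+x. mollifier a b (y - x) * (u y)^2 \<partial>?M) \<partial>?M)"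
  by (rule Fubini') measurable
 also have "\<dots> = (\<integral>\<^sup>+y. (\<integral>\<^sup>+x. mollifier a b (y - x) \<partial>?M) * ennreal ((u y)^2) \<partial>?M)"
 proof (rule nn_integral_cong)
  fix y assume y: "y \<in> space ?M"
  have "(\<lambda>x. ennreal (mollifier a b (y - x))) \<in> borel_measurable ?M" by measurable
  then show "(\<integral>\<^sup>+x. mollifier a b (y - x) * (u y)^2 \<partial>?M) = (\<integral>\<^sup>+x. mollifier a b (y - x) \<partial>?M) * ennreal ((u y)^2)"
   by (simp add: ennreal_mult mollifier_nonneg nn_integral_multc)
 qed
 also have "\<dots> \<le> (\<integral>\<^sup>+y. 1 * ennreal ((u y)^2) \<partial>?M)"
  by (intro nn_integral_mono mult_right_mono k1) auto
 also have "\<dots> = ennreal ((nm u)^2)"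
  using nn_integral_eq_integral[OF L2_integrable_sq[OF u]] by (simp add: L2_norm_sq_eq)
 finally have le: "(\<integral>\<^sup>+x. ennreal ((mollify U a b u x)^2) \<partial>?M) \<le> ennreal ((nm u)^2)" .
 have int: "integrable ?M (\<lambda>x. (mollify U a b u x)^2)"
  using mm le by (intro integrableI_bounded) (auto simp: le_less_trans)
 then show "mollify U a b u \<in> L2 U" using mm by (simp add: L2_def)
 have "ennreal ((nm (mollify U a b u))^2) \<le> ennreal ((nm u)^2)"
  using le nn_integral_eq_integral[OF int] by (simp add: L2_norm_sq_eq)
 then have "(nm (mollify U a b u))^2 \<le> (nm u)^2"
  by (subst (asm) ennreal_le_iff) auto
 then show "nm (mollify U a b u) \<le> nm u"
  by (rule power2_le_imp_le) (rule L2_norm_ge_0)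
qed

text \<open>Truncation to a bounded function comes first, then an almost everywhere approximation by
  continuous functions. The approximants are clipped again to keep a common bound for dominated
  convergence, and multiplied by a cut-off of the distance to the complement so that they vanish
  outside \<open>U\<close>.\<close>

lemma L2_approx_continuous:
 assumes u: "u \<in> L2 U" and e: "e > 0"
 obtains g where "continuous_on UNIV g" "\<And>x. x \<notin> U \<Longrightarrow> g x = (0::real)" "nm (\<lambda>x. u x - g x) < e"
proof -
 let ?M = "MU"
 define clip where "clip m t = max (- m) (min m t)" for m t :: real
 have um [measurable]: "u \<in> borel_measurable ?M" using u by (rule L2_measurable)
 have "null (\<lambda>m. nm (\<lambda>x. clip (real m) (u x) - u x))"
 proof (rule L2_dominated_convergence[OF _ u, of _ 1])
  show "(\<lambda>x. clip (real m) (u x) - u x) \<in> borel_measurable ?M" for m unfolding clip_def by measurable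
  show "AE x in ?M. norm (clip (real m) (u x) - u x) \<le> 1 * norm (u x)" for m
   by (auto simp: clip_def)
  have "null (\<lambda>m. clip (real m) t - t)" for t
  proof (rule tendsto_eventually)
   obtain M where "\<bar>t\<bar> \<le> real M" using real_arch_simple by blast
   then show "\<forall>\<^sub>F m in sequentially. clip (real m) t - t = 0"
    by (intro eventually_sequentiallyI[of M]) (auto simp: clip_def)
  qed
  then show "AE x in ?M. null (\<lambda>m. clip (real m) (u x) - u x)" by simp
 qed
 then obtain m where m: "nm (\<lambda>x. clip (real m) (u x) - u x) < e / 2"
  using LIMSEQ_0_less[of _ "e/2"] e by (meson half_gt_zero)
 let ?v = "\<lambda>x. clip (real m) (u x)"
 have vm: "?v \<in> borel_measurable ?M" unfolding clip_def by measurable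
 have vL: "?v \<in> L2 U"
  by (rule L2_dominated[OF u vm, of 1]) (auto simp: clip_def)
 obtain N g where N: "negligible N" and g: "\<And>n. continuous_on UNIV (g n)"
  and lim: "\<And>x. x \<notin> N \<Longrightarrow> (\<lambda>n. g n x) \<longlonglongrightarrow> (if x \<in> U then ?v x else 0)"
  using vm measurable_on_iff_borel_measurable[OF dom_sets, of ?v] unfolding measurable_on_def by blast
 note ne = compl_nonempty
 define h where "h n x = min 1 (real n * infdist x (- U)) * clip (real m) (g n x)" for n x
 have hc: "continuous_on UNIV (h n)" for n
  unfolding h_def clip_def by (intro continuous_intros g)
 have h0: "h n x = 0" if "x \<notin> U" for n x using that by (simp add: h_def)
 have hm: "h n \<in> borel_measurable ?M" for n
  by (rule continuous_measurable[OF continuous_on_subset[OF hc]]) simp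
 have ae: "AE x in ?M. x \<notin> N"
 proof -
  have "AE x in lebesgue. x \<notin> N" using N by (simp add: AE_not_in negligible_iff_null_sets)
  then have "AE x in lebesgue. x \<in> U \<longrightarrow> x \<notin> N" by eventually_elim simp
  then show ?thesis using dom_sets by (simp add: AE_restrict_space_iff)
 qed
 have lim0: "tends h ?v"
 proof (rule L2_dominated_convergence[OF _ L2_const[OF dom_lmeasurable, of "1::real"], of _ "2 * real m"])
  show "(\<lambda>x. h n x - ?v x) \<in> borel_measurable ?M" for n using hm[of n] vm by measurable
  have "\<bar>h n x - ?v x\<bar> \<le> 2 * real m" for n x
  proof -
   have c: "\<bar>clip (real m) t\<bar> \<le> real m" for t by (auto simp: clip_def)
   have "\<bar>h n x\<bar> \<le> 1 * real m"
    unfolding h_def abs_mult using infdist_nonneg[of x "- U"] by (intro mult_mono c) auto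
   then show ?thesis using c[of "u x"] by linarith
  qed
  then show "AE x in ?M. norm (h n x - ?v x) \<le> 2 * real m * norm (1::real)" for n by simp
  show "AE x in ?M. null (\<lambda>n. h n x - ?v x)"
   using ae AE_space
  proof eventually_elim
   case (elim x)
   have x: "x \<in> U" using elim by simp
   have d: "infdist x (- U) > 0"
    using x ne open_dom in_closed_iff_infdist_zero[of "- U" x] infdist_nonneg[of x "- U"] by (auto simp: closed_Compl)
   have "(\<lambda>n. g n x) \<longlonglongrightarrow> ?v x" using lim[OF elim(1)] x by simp
   then have "(\<lambda>n. clip (real m) (g n x)) \<longlonglongrightarrow> clip (real m) (?v x)"
    unfolding clip_def by (intro tendsto_max tendsto_min tendsto_const)
   moreover have "(\<lambda>n. min 1 (real n * infdist x (- U))) \<longlonglongrightarrow> 1"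
   proof (rule tendsto_eventually)
    obtain n where "1 / infdist x (- U) \<le> real n" using real_arch_simple by blast
    then have "1 \<le> real k * infdist x (- U)" if "k \<ge> n" for k
     using d that by (auto simp: field_simps intro: order_trans)
    then show "\<forall>\<^sub>F n in sequentially. min 1 (real n * infdist x (- U)) = 1"
     by (intro eventually_sequentiallyI[of n]) (auto simp: min_def)
   qed
   ultimately have "(\<lambda>n. h n x) \<longlonglongrightarrow> 1 * clip (real m) (?v x)"
    unfolding h_def by (intro tendsto_mult)
   moreover have "clip (real m) (?v x) = ?v x" by (auto simp: clip_def)
   ultimately show ?case by (simp add: LIM_zero)
  qed
 qed
 then obtain n where n: "nm (\<lambda>x. h n x - ?v x) < e / 2"
  using LIMSEQ_0_less[of _ "e/2"] e by (meson half_gt_zero)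
 have hL: "h n \<in> L2 U"
 proof -
  have "\<bar>h n x\<bar> \<le> real m" for x
  proof -
   have "\<bar>h n x\<bar> \<le> 1 * real m"
    unfolding h_def abs_mult using infdist_nonneg[of x "- U"]
    by (intro mult_mono) (auto simp: clip_def)
   then show ?thesis by simp
  qed
  then show ?thesis by (intro L2_bounded(1)[OF dom_lmeasurable hm, of _ "real m"]) auto
 qed
 have "nm (\<lambda>x. u x - h n x) < e"
  using L2_triangle3[OF u vL hL] m n L2_norm_commute[OF u vL] L2_norm_commute[OF vL hL] by linarith
 with hc h0 that show thesis by blast
qed

text \<open>Approximation by a uniformly continuous \<open>g\<close>, with
  \<open>mollify_norm_le\<close> carrying the error of that approximation. The size \<open>d\<close>
  restricts only how far the box reaches from the origin, which admits boxes off centre.\<close>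

lemma mollify_approx:
 assumes u: "u \<in> L2 U" and e: "e > 0"
 obtains d where "d > 0"
  "\<And>a b. box a b \<noteq> {} \<Longrightarrow> cbox a b \<subseteq> ball 0 d \<Longrightarrow> nm (\<lambda>x. mollify U a b u x - u x) < e"
proof -
 let ?M = "MU"
 obtain g where g: "continuous_on UNIV g" "\<And>x. x \<notin> U \<Longrightarrow> g x = (0::real)" and
  ug: "nm (\<lambda>x. u x - g x) < e / 3"
  using L2_approx_continuous[OF u, of "e/3"] e by auto
 have C: "compact (closure U)" using bounded_dom by simp
 have g0: "g x = 0" if "x \<notin> closure U" for x using g(2) that closure_subset by blast
 obtain B where B: "\<And>x. \<bar>g x\<bar> \<le> B" "0 \<le> B" using compact_support_bounded[OF g(1) C g0] by metis
 have gm: "g \<in> borel_measurable ?M" by (rule continuous_measurable[OF continuous_on_subset[OF g(1)]]) simp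
 have gL: "g \<in> L2 U" using B by (intro L2_bounded(1)[OF dom_lmeasurable gm, of B]) auto
 define m where "m = sqrt (measure lebesgue U) + 1"
 have m: "m > 0" by (simp add: m_def add_nonneg_pos)
 have "e / (3 * m) > 0" using e m by simp
 then obtain d where d: "d > 0" and dd: "\<And>x x'. dist x' x < d \<Longrightarrow> dist (g x') (g x) < e / (3 * m)"
  using compact_support_uniformly_continuous[OF g(1) C g0] unfolding uniformly_continuous_on_def by (metis UNIV_I)
 have "nm (\<lambda>x. mollify U a b u x - u x) < e"
  if ab: "box a b \<noteq> {}" and sub: "cbox a b \<subseteq> ball 0 d" for a b
 proof -
  have pw: "\<bar>mollify U a b g x - g x\<bar> \<le> e / (3 * m)" for x
  proof -
   have int1: "(\<integral>\<^sup>+y. ennreal (mollifier a b (y - x)) \<partial>lebesgue) = 1"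
    using nn_integral_lborel_shift(2)[of "\<lambda>z. ennreal (mollifier a b z)" x] mollifier_integral[OF ab]
    by (simp add: nn_integral_completion)
   have km: "(\<lambda>y. mollifier a b (y - x)) \<in> borel_measurable lebesgue"
    by (intro measurable_completion) measurable
   have gmm: "g \<in> borel_measurable lebesgue"
    by (intro measurable_completion) (simp add: borel_measurable_continuous_onI[OF g(1)])
   have i1: "integrable lebesgue (\<lambda>y. mollifier a b (y - x))"
    using int1 km by (intro integrableI_nonneg) (auto simp: mollifier_nonneg)
   have v1: "(LINT y|lebesgue. mollifier a b (y - x)) = 1"
    using int1 nn_integral_eq_integral[OF i1] by (simp add: mollifier_nonneg integral_nonneg ennreal_eq_1)
   have i2: "integrable lebesgue (\<lambda>y. mollifier a b (y - x) * g y)"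
   proof (rule Bochner_Integration.integrable_bound)
    show "integrable lebesgue (\<lambda>y. B * mollifier a b (y - x))" using i1 by simp
    show "(\<lambda>y. mollifier a b (y - x) * g y) \<in> borel_measurable lebesgue" using km gmm by measurable
    have "\<bar>g y\<bar> * \<bar>mollifier a b (y - x)\<bar> \<le> \<bar>B\<bar> * \<bar>mollifier a b (y - x)\<bar>" for y
     using B(1)[of y] by (intro mult_right_mono) auto
    then show "AE y in lebesgue. norm (mollifier a b (y - x) * g y) \<le> norm (B * mollifier a b (y - x))"
     by (intro AE_I2) (simp add: abs_mult mult.commute)
   qed
   \<comment> \<open>Since \<open>g\<close> vanishes outside \<open>U\<close>, the integral runs
     over the whole space, where the kernel has mass exactly 1; the estimate therefore holds up to
     the boundary.\<close>
   have "mollify U a b g x = (LINT y|lebesgue. mollifier a b (y - x) * g y)"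
    unfolding mollify_def using dom_sets g(2)
    by (subst integral_restrict_space) (auto intro!: Bochner_Integration.integral_cong simp: indicator_def)
   also have "\<dots> - g x = (LINT y|lebesgue. mollifier a b (y - x) * (g y - g x))"
    using i1 i2 v1 by (simp add: right_diff_distrib)
   also have "\<bar>\<dots>\<bar> \<le> (LINT y|lebesgue. mollifier a b (y - x) * (e / (3 * m)))"
   proof -
    have "\<bar>mollifier a b (y - x) * (g y - g x)\<bar> \<le> mollifier a b (y - x) * (e / (3 * m))" for y
    proof (cases "y - x \<in> box a b")
     case True
     then have "norm (y - x) < d" using sub box_subset_cbox by (metis mem_ball_0 subset_iff)
     then have "\<bar>g y - g x\<bar> \<le> e / (3 * m)" using dd[of y x] by (simp add: dist_norm dist_real_def less_imp_le)
     then show ?thesis by (simp add: abs_mult mollifier_nonneg mult_left_mono del: times_divide_eq_right)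
    qed (simp add: mollifier_zero)
    then have "(LINT y|lebesgue. \<bar>mollifier a b (y - x) * (g y - g x)\<bar>) \<le> (LINT y|lebesgue. mollifier a b (y - x) * (e / (3 * m)))"
     using i1 i2 by (intro integral_mono) (auto simp: right_diff_distrib)
    then show ?thesis by (rule order_trans[OF integral_abs_bound])
   qed
   also have "\<dots> = e / (3 * m)" using v1 by simp
   finally show ?thesis .
  qed
  have mg: "mollify U a b g \<in> L2 U" and mu: "mollify U a b u \<in> L2 U"
   using mollify_norm_le(1)[OF ab] gL u by auto
  have gbound: "nm (\<lambda>x. mollify U a b g x - g x) \<le> e / (3 * m) * sqrt (measure lebesgue U)"
   using pw e m L2_measurable[OF L2.S_diff[OF mg gL]]
   by (intro L2_bounded(2)[OF dom_lmeasurable]) auto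
  also have "\<dots> \<le> e / (3 * m) * m" using e m by (intro mult_left_mono) (auto simp: m_def)
  also have "\<dots> = e / 3" using m by simp
  finally have 2: "nm (\<lambda>x. mollify U a b g x - g x) \<le> e / 3" .
  have "nm (\<lambda>x. mollify U a b u x - mollify U a b g x) \<le> nm (\<lambda>x. u x - g x)"
  proof -
   have "mollify U a b (\<lambda>x. u x - g x) = (\<lambda>x. mollify U a b u x - mollify U a b g x)"
    by (intro ext mollify_diff u gL)
   then show ?thesis using mollify_norm_le(2)[OF ab L2.S_diff[OF u gL]] by simp
  qed
  then have 1: "nm (\<lambda>x. mollify U a b u x - mollify U a b g x) < e / 3" using ug by simp
  have "nm (\<lambda>x. mollify U a b u x - u x)
    \<le> nm (\<lambda>x. mollify U a b u x - mollify U a b g x) + nm (\<lambda>x. mollify U a b g x - g x) + nm (\<lambda>x. g x - u x)"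
   using L2_triangle3[OF mu mg u] L2_triangle3[OF mg gL u] by linarith
  then show ?thesis using 1 2 ug L2_norm_commute[OF u gL] by linarith
 qed
 with d that show thesis by blast
qed

lemma mollifier_shift_test:
 assumes "\<And>z. z \<in> cbox a b \<Longrightarrow> x + z \<in> U"
 shows "(\<lambda>y. mollifier a b (y - x)) \<in> test_functions U"
  and "pder (\<lambda>y. mollifier a b (y - x)) i y = pder (mollifier a b) i (y - x)"
proof -
 have "cbox (a + x) (b + x) \<subseteq> U"
 proof
  fix y assume "y \<in> cbox (a + x) (b + x)"
  then have "y - x \<in> cbox a b" by (auto simp: mem_box_cart algebra_simps)
  from assms[OF this] show "y \<in> U" by simp
 qed
 then show "(\<lambda>y. mollifier a b (y - x)) \<in> test_functions U"
  unfolding mollifier_def box_bump_shift by (intro test_scale box_bump_test)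
 have "((\<lambda>y. y - x) has_derivative (\<lambda>h. h)) (at y)" by (auto intro!: derivative_eq_intros)
 from has_derivative_compose[OF this test_has_derivative[OF mollifier_test]]
 have "((\<lambda>y. mollifier a b (y - x)) has_derivative (\<lambda>h. \<Sum>i\<in>UNIV. pder (mollifier a b) i (y - x) * h $ i)) (at y)" .
 from fun_cong[OF frechet_derivative_at[OF this], of "axis i 1"]
 have "pder (\<lambda>y. mollifier a b (y - x)) i y = (\<Sum>l\<in>UNIV. pder (mollifier a b) l (y - x) * axis i 1 $ l)"
  by (simp add: pder_def)
 also have "\<dots> = (\<Sum>l\<in>UNIV. if l = i then pder (mollifier a b) i (y - x) else 0)"
  by (intro sum.cong) (auto simp: axis_def)
 finally show "pder (\<lambda>y. mollifier a b (y - x)) i y = pder (mollifier a b) i (y - x)" by simp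
qed

text \<open>At points farther than \<open>e\<close> from the complement, a mollification with a box
  inside the ball of radius \<open>e\<close> is an integral against a test function, hence 0.
  Shrinking the box gives \<open>g = 0\<close> there, and countably many \<open>e\<close> exhaust
  \<open>U\<close>.\<close>

lemma fundamental_lemma:
 assumes g: "g \<in> L2 U" and orth: "\<And>f. f \<in> test_functions U \<Longrightarrow> (LINT x|MU. g x * f x) = 0"
 shows "AE x in MU. g x = 0"
proof -
 let ?M = "MU"
 note ne = compl_nonempty
 have gm [measurable]: "g \<in> borel_measurable ?M" using g by (rule L2_measurable)
 have loc: "AE x in ?M. infdist x (- U) > e \<longrightarrow> g x = 0" if e: "e > 0" for e
 proof -
  define G where "G x = (if infdist x (- U) > e then g x else 0)" for x
  have "continuous_on U (\<lambda>x. infdist x (- U))" by (intro continuous_intros)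
  then have [measurable]: "(\<lambda>x. infdist x (- U)) \<in> borel_measurable ?M" by (rule continuous_measurable)
  have Gm: "G \<in> borel_measurable ?M" unfolding G_def by measurable
  have GL: "G \<in> L2 U" by (rule L2_dominated[OF g Gm, of 1]) (auto simp: G_def)
  have small: "nm G < d" if d: "d > 0" for d
  proof -
   obtain t where t: "t > 0" and tt: "\<And>a b. box a b \<noteq> {} \<Longrightarrow> cbox a b \<subseteq> ball 0 t \<Longrightarrow>
     nm (\<lambda>x. mollify U a b g x - g x) < d"
    using mollify_approx[OF g d] by metis
   define s where "s = min t e"
   have "0 < s" using t e by (simp add: s_def)
   then obtain a b where ab: "(0::real^'n) \<in> box a b" "cbox a b \<subseteq> ball 0 s"
    using small_box by metis
   have sub: "cbox a b \<subseteq> ball 0 t" "cbox a b \<subseteq> ball 0 e" using ab(2) by (auto simp: s_def)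
   have z: "mollify U a b g x = 0" if "infdist x (- U) > e" for x
   proof -
    have "x + z \<in> U" if "z \<in> cbox a b" for z
    proof (rule ccontr)
     assume "x + z \<notin> U"
     then have "infdist x (- U) \<le> dist x (x + z)" by (intro infdist_le) auto
     also have "\<dots> < e" using sub(2) that by (auto simp: dist_norm)
     finally show False using \<open>infdist x (- U) > e\<close> by simp
    qed
    from orth[OF mollifier_shift_test(1)[OF this]] show ?thesis by (simp add: mollify_def mult.commute)
   qed
   have "nm G \<le> 1 * nm (\<lambda>x. mollify U a b g x - g x)"
    using ab(1) mollify_norm_le(1)[OF _ g] z
    by (intro L2_norm_mono Gm L2.S_diff g AE_I2) (auto simp: G_def)
   also have "\<dots> < d" using tt[OF _ sub(1)] ab(1) by auto
   finally show ?thesis .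
  qed
  have "nm G = 0" using small[of "nm G"] L2_norm_ge_0[of U G] by force
  then have "AE x in ?M. G x = 0" using L2_norm_eq_0_iff[OF GL] by simp
  then show ?thesis by eventually_elim (auto simp: G_def)
 qed
 have "AE x in ?M. \<forall>n::nat. infdist x (- U) > 1 / real (Suc n) \<longrightarrow> g x = 0"
  by (subst AE_all_countable) (auto intro!: loc)
 then show ?thesis
  using AE_space
 proof eventually_elim
  case (elim x)
  have "infdist x (- U) > 0"
   using elim(2) ne open_dom in_closed_iff_infdist_zero[of "- U" x] infdist_nonneg[of x "- U"] by (auto simp: closed_Compl)
  then obtain n where "1 / real (Suc n) < infdist x (- U)" using nat_approx_posE by blast
  then show ?case using elim(1) by blast
 qed
qed

end

section \<open>Weak gradients\<close>

lemma integral_lebesgue_shift: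
 fixes F :: "'a::euclidean_space \<Rightarrow> real"
 assumes F: "F \<in> borel_measurable lebesgue"
 shows "(\<lambda>x. F (x + c)) \<in> borel_measurable lebesgue"
  and "(LINT x|lebesgue. F (x + c)) = (LINT x|lebesgue. F x)"
proof -
 let ?T = "\<lambda>x::'a. c + (\<Sum>j\<in>Basis. (1 * (x \<bullet> j)) *\<^sub>R j)"
 have T: "?T = (\<lambda>x. x + c)" by (simp add: euclidean_representation add.commute)
 have m: "?T \<in> lebesgue \<rightarrow>\<^sub>M lebesgue"
  by (rule lebesgue_affine_measurable[where c="\<lambda>_. 1"]) auto
 have "lebesgue = density (distr lebesgue lebesgue ?T) (\<lambda>_. ennreal (\<Prod>j\<in>(Basis::'a set). \<bar>1\<bar>))"
  by (rule lebesgue_affine_euclidean[where c="\<lambda>_. 1"]) auto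
 then have d: "lebesgue = distr lebesgue lebesgue (\<lambda>x. x + c)" unfolding T by (simp add: density_1)
 show "(\<lambda>x. F (x + c)) \<in> borel_measurable lebesgue"
  using measurable_compose[OF m[unfolded T] F] .
 have "(LINT x|lebesgue. F x) = (LINT x|distr lebesgue lebesgue (\<lambda>x. x + c). F x)"
  using arg_cong[OF d, of "\<lambda>M. integral\<^sup>L M F"] .
 also have "\<dots> = (LINT x|lebesgue. F (x + c))"
  using m[unfolded T] F by (rule integral_distr)
 finally show "(LINT x|lebesgue. F (x + c)) = (LINT x|lebesgue. F x)" by simp
qed

context bounded_open
begin

lemma weak_gradient_iff:
 "weak_gradient U u g \<longleftrightarrow> (\<forall>f\<in>test_functions U. \<forall>i.
   (LINT x|MU. u x * pder f i x) = - (LINT x|MU. g x $ i * f x))"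
 by (simp add: weak_gradient_def pder_def)

lemma L2_component: "g \<in> L2 U \<Longrightarrow> (\<lambda>x. g x $ i) \<in> L2 U" for g :: "real^'n \<Rightarrow> real^'m"
proof -
 assume g: "g \<in> L2 U"
 have "(\<lambda>x. g x \<bullet> axis i 1) \<in> bm"
  using L2_measurable[OF g] by measurable
 then show ?thesis
  by (intro L2_dominated[OF g, of _ 1]) (auto simp: inner_axis component_le_norm_cart)
qed

lemma L2_prod_integrable: "u \<in> L2 U \<Longrightarrow> v \<in> L2 U \<Longrightarrow> integrable MU (\<lambda>x. u x * v x)"
 for u v :: "real^'n \<Rightarrow> real"
 using L2_inner_integrable[of u U v] by simp

lemmas test_L2' = test_L2[OF dom_lmeasurable]

lemma weak_gradient_unique:
 assumes "g \<in> L2 U" "h \<in> L2 U" "weak_gradient U u g" "weak_gradient U u h"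
 shows "AE x in MU. g x = h x"
proof -
 have "AE x in MU. g x $ i - h x $ i = 0" for i
 proof (rule fundamental_lemma)
  show "(\<lambda>x. g x $ i - h x $ i) \<in> L2 U" using assms by (intro L2.S_diff L2_component)
  fix f assume f: "f \<in> test_functions U"
  have "(LINT x|MU. (g x $ i - h x $ i) * f x)
    = (LINT x|MU. g x $ i * f x) - (LINT x|MU. h x $ i * f x)"
   using L2_prod_integrable[OF L2_component[OF assms(1)] test_L2'(1)[OF f]]
    L2_prod_integrable[OF L2_component[OF assms(2)] test_L2'(1)[OF f]]
   by (simp add: left_diff_distrib)
  also have "\<dots> = 0"
   using assms(3)[unfolded weak_gradient_iff, rule_format, OF f, of i]
    assms(4)[unfolded weak_gradient_iff, rule_format, OF f, of i] by simp
  finally show "(LINT x|MU. (g x $ i - h x $ i) * f x) = 0" .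
 qed
 then have "AE x in MU. \<forall>i. g x $ i - h x $ i = 0" by (intro AE_all_countable[THEN iffD2]) auto
 then show ?thesis by eventually_elim (simp add: vec_eq_iff)
qed

lemma grad_props:
 assumes "u \<in> H1 U"
 shows grad_L2: "grad U u \<in> L2 U" and grad_weak: "weak_gradient U u (grad U u)"
proof -
 have "\<exists>g. g \<in> L2 U \<and> weak_gradient U u g" using assms by (auto simp: H1_def)
 from someI_ex[OF this] show "grad U u \<in> L2 U" "weak_gradient U u (grad U u)"
  by (auto simp: grad_def)
qed

lemma H1_L2: "u \<in> H1 U \<Longrightarrow> u \<in> L2 U"
 by (simp add: H1_def)

lemma weak_gradient_grad:
 assumes "u \<in> L2 U" "g \<in> L2 U" "weak_gradient U u g"
 shows "u \<in> H1 U" "AE x in MU. grad U u x = g x"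
proof -
 show H: "u \<in> H1 U" using assms by (auto simp: H1_def)
 show "AE x in MU. grad U u x = g x"
  by (rule weak_gradient_unique[OF grad_L2[OF H] assms(2) grad_weak[OF H] assms(3)])
qed

lemma weak_gradient_cong:
 assumes "u \<in> bm" "v \<in> bm"
  "AE x in MU. u x = v x"
 shows "weak_gradient U u = weak_gradient U v"
proof -
 have "(LINT x|MU. u x * pder f i x) = (LINT x|MU. v x * pder f i x)"
  if "f \<in> test_functions U" for f i
  using assms L2_measurable[OF test_L2'(2)[OF that]]
  by (intro integral_cong_AE) (auto intro!: borel_measurable_times)
 then show ?thesis by (auto simp: fun_eq_iff weak_gradient_iff)
qed

lemma H1_cong_AE:
 assumes "u \<in> H1 U" "v \<in> bm" "AE x in MU. u x = v x"
 shows "v \<in> H1 U" "grad U v = grad U u"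
proof -
 have w: "weak_gradient U u = weak_gradient U v"
  using assms H1_L2 L2_measurable by (intro weak_gradient_cong) auto
 show "v \<in> H1 U"
  using assms(1) L2_cong_AE[OF H1_L2[OF assms(1)] assms(2,3)] w by (simp add: H1_def)
 show "grad U v = grad U u" by (simp add: grad_def w)
qed

lemma grad_lin:
 assumes u: "u \<in> H1 U" and v: "v \<in> H1 U"
 shows "(\<lambda>x. a * u x + b * v x) \<in> H1 U"
  and "AE x in MU. grad U (\<lambda>x. a * u x + b * v x) x = a *\<^sub>R grad U u x + b *\<^sub>R grad U v x"
proof -
 have 1: "(\<lambda>x. a * u x + b * v x) \<in> L2 U" using u v by (intro L2_add L2_scale H1_L2)
 have 2: "(\<lambda>x. a *\<^sub>R grad U u x + b *\<^sub>R grad U v x) \<in> L2 U"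
  using u v by (intro L2_add L2_scaleR grad_L2)
 have 3: "weak_gradient U (\<lambda>x. a * u x + b * v x) (\<lambda>x. a *\<^sub>R grad U u x + b *\<^sub>R grad U v x)"
  unfolding weak_gradient_iff
 proof (intro ballI allI)
  fix f i assume f: "f \<in> test_functions U"
  have "(LINT x|MU. (a * u x + b * v x) * pder f i x)
   = a * (LINT x|MU. u x * pder f i x) + b * (LINT x|MU. v x * pder f i x)"
   using L2_prod_integrable[OF H1_L2[OF u] test_L2'(2)[OF f]] L2_prod_integrable[OF H1_L2[OF v] test_L2'(2)[OF f]]
   by (simp add: distrib_right mult.assoc)
  also have "\<dots> = - (a * (LINT x|MU. grad U u x $ i * f x) + b * (LINT x|MU. grad U v x $ i * f x))"
   using grad_weak[OF u] grad_weak[OF v] f by (simp add: weak_gradient_iff)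
  also have "a * (LINT x|MU. grad U u x $ i * f x) + b * (LINT x|MU. grad U v x $ i * f x)
   = (LINT x|MU. (a *\<^sub>R grad U u x + b *\<^sub>R grad U v x) $ i * f x)"
   using L2_prod_integrable[OF L2_component[OF grad_L2[OF u]] test_L2'(1)[OF f]]
    L2_prod_integrable[OF L2_component[OF grad_L2[OF v]] test_L2'(1)[OF f]]
   by (simp add: distrib_right mult.assoc)
  finally show "(LINT x|MU. (a * u x + b * v x) * pder f i x)
   = - (LINT x|MU. (a *\<^sub>R grad U u x + b *\<^sub>R grad U v x) $ i * f x)" .
 qed
 show "(\<lambda>x. a * u x + b * v x) \<in> H1 U"
  and "AE x in MU. grad U (\<lambda>x. a * u x + b * v x) x = a *\<^sub>R grad U u x + b *\<^sub>R grad U v x"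
  using weak_gradient_grad[OF 1 2 3] .
qed

lemma H1_add: "u \<in> H1 U \<Longrightarrow> v \<in> H1 U \<Longrightarrow> (\<lambda>x. u x + v x) \<in> H1 U"
 using grad_lin(1)[of u v 1 1] by simp

lemma H1_diff: "u \<in> H1 U \<Longrightarrow> v \<in> H1 U \<Longrightarrow> (\<lambda>x. u x - v x) \<in> H1 U"
 using grad_lin(1)[of u v 1 "-1"] by simp

lemma H1_scale: "u \<in> H1 U \<Longrightarrow> (\<lambda>x. a * u x) \<in> H1 U"
 using grad_lin(1)[of u u a 0] by simp

lemma grad_add: "u \<in> H1 U \<Longrightarrow> v \<in> H1 U \<Longrightarrow>
  AE x in MU. grad U (\<lambda>x. u x + v x) x = grad U u x + grad U v x"
 using grad_lin(2)[of u v 1 1] by simp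

lemma grad_diff: "u \<in> H1 U \<Longrightarrow> v \<in> H1 U \<Longrightarrow>
  AE x in MU. grad U (\<lambda>x. u x - v x) x = grad U u x - grad U v x"
 using grad_lin(2)[of u v 1 "-1"] by simp

lemma grad_scale: "u \<in> H1 U \<Longrightarrow> AE x in MU. grad U (\<lambda>x. a * u x) x = a *\<^sub>R grad U u x"
 using grad_lin(2)[of u u a 0] by simp

lemma L2_norm_grad_diff:
 assumes "u \<in> H1 U" "v \<in> H1 U"
 shows "nm (grad U (\<lambda>x. u x - v x)) = nm (\<lambda>x. grad U u x - grad U v x)"
 using assms grad_L2[OF H1_diff] L2.S_diff[OF grad_L2 grad_L2]
 by (intro L2_norm_cong_AE grad_diff) (auto intro: L2_measurable)

lemma L2_norm_component_le:
 fixes g :: "real^'n \<Rightarrow> real^'m"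
 shows "g \<in> L2 U \<Longrightarrow> nm (\<lambda>x. g x $ i) \<le> nm g"
 using L2_norm_mono[of g U "\<lambda>x. g x $ i" 1] L2_measurable[OF L2_component[of g i]]
 by (auto simp: component_le_norm_cart)

lemma L2_inner_tendsto:
 fixes u :: "'i \<Rightarrow> real^'n \<Rightarrow> 'b::euclidean_space"
 assumes u: "\<And>j. u j \<in> L2 U" and v: "v \<in> L2 U" and w: "w \<in> L2 U"
  and lim: "((\<lambda>j. nm (\<lambda>x. u j x - v x)) \<longlongrightarrow> 0) F"
 shows "((\<lambda>j. inn (u j) w) \<longlongrightarrow> inn v w) F"
proof -
 have "((\<lambda>j. inn (u j) w - inn v w) \<longlongrightarrow> 0) F"
 proof (rule Lim_null_comparison)
  show "\<forall>\<^sub>F j in F. norm (inn (u j) w - inn v w) \<le> nm (\<lambda>x. u j x - v x) * nm w"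
   using L2_cauchy_schwarz[OF L2.S_diff[OF u v] w] L2.ip_diff_left[OF u v w] by (intro always_eventually) simp
  show "((\<lambda>j. nm (\<lambda>x. u j x - v x) * nm w) \<longlongrightarrow> 0) F"
   using tendsto_mult_left_zero[OF lim] .
 qed
 then show ?thesis by (simp add: LIM_zero_iff)
qed

lemma weak_gradient_closed:
 fixes u :: "nat \<Rightarrow> real^'n \<Rightarrow> real"
 assumes u: "\<And>j. u j \<in> L2 U" and g: "\<And>j. g j \<in> L2 U" and w: "\<And>j. weak_gradient U (u j) (g j)"
  and v: "v \<in> L2 U" and h: "h \<in> L2 U"
  and lim: "tends u v" "tends g h"
 shows "weak_gradient U v h"
 unfolding weak_gradient_iff
proof (intro ballI allI)
 fix f i assume f: "f \<in> test_functions U"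
 have 1: "(\<lambda>j. inn (u j) (pder f i)) \<longlonglongrightarrow> inn v (pder f i)"
  by (rule L2_inner_tendsto[OF u v test_L2'(2)[OF f] lim(1)])
 have "null (\<lambda>j. nm (\<lambda>x. g j x $ i - h x $ i))"
 proof (rule Lim_null_comparison[OF _ lim(2)], intro always_eventually allI)
  fix j
  show "norm (nm (\<lambda>x. g j x $ i - h x $ i)) \<le> nm (\<lambda>x. g j x - h x)"
   using L2_norm_component_le[OF L2.S_diff[OF g[of j] h], of i] by (simp add: L2_norm_ge_0)
 qed
 then have 2: "(\<lambda>j. inn (\<lambda>x. g j x $ i) f) \<longlonglongrightarrow> inn (\<lambda>x. h x $ i) f"
  by (intro L2_inner_tendsto L2_component g h test_L2'(1) f)
 have "inn (u j) (pder f i) = - inn (\<lambda>x. g j x $ i) f" for j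
  using w[of j] f by (simp add: weak_gradient_iff L2_inner_def)
 then have "inn v (pder f i) = - inn (\<lambda>x. h x $ i) f"
  using 1 tendsto_minus[OF 2] LIMSEQ_unique by (simp add: fun_eq_iff)
 then show "(LINT x|MU. v x * pder f i x) = - (LINT x|MU. h x $ i * f x)"
  by (simp add: L2_inner_def)
qed

text \<open>Difference quotients can be moved from \<open>v\<close> to the test function by translation.\<close>

lemma weak_gradient_lipschitz:
 assumes v: "v \<in> L2 U" and M: "0 \<le> M"
  and lip: "\<And>x y. closed_segment x y \<subseteq> U \<Longrightarrow> \<bar>v x - v y\<bar> \<le> M * dist x y"
  and der: "AE x in MU. \<forall>i. ((\<lambda>t. v (x + t *\<^sub>R axis i 1)) has_real_derivative g x $ i) (at 0)"
  and g: "g \<in> L2 U"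
 shows "weak_gradient U v g"
 unfolding weak_gradient_iff
proof (intro ballI allI)
 fix f and i :: 'n assume f: "f \<in> test_functions U"
 let ?M = "MU"
 define e :: "real^'n" where "e = axis i 1"
 have e1: "norm e = 1" by (simp add: e_def)
 define C where "C = closure {x. f x \<noteq> 0}"
 have C: "compact C" "C \<subseteq> U" using f by (auto simp: C_def test_functions_def)
 have fC: "f x \<noteq> 0 \<Longrightarrow> x \<in> C" for x using test_zero[OF f, of x] unfolding C_def by blast
 obtain d where d: "d > 0" "\<And>x y. x \<in> C \<Longrightarrow> y \<in> - U \<Longrightarrow> d \<le> dist x y"
 proof -
  have "C \<inter> - U = {}" using C(2) by blast
  from separate_compact_closed[OF C(1) closed_Compl[OF open_dom] this] show ?thesis using that by blast
 qed
 have inO: "x + s *\<^sub>R e \<in> U" if "x \<in> C" "\<bar>s\<bar> < d" for x s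
  using d(2)[OF that(1), of "x + s *\<^sub>R e"] that(2) e1 by (auto simp: dist_norm)
 \<comment> \<open>Every shift is shorter than the distance \<open>d\<close> from the support of
   \<open>f\<close> to the complement, so shifted support points stay in \<open>U\<close>.\<close>
 define t where "t k = d / (2 + real k)" for k
 have tpos: "t k > 0" "t k < d" for k using d(1) by (auto simp: t_def field_simps add_pos_nonneg)
 have tlim: "t \<longlonglongrightarrow> 0" unfolding t_def[abs_def] by real_asymp
 define V where "V x = indicator U x * v x" for x
 have Vm: "V \<in> borel_measurable lebesgue"
  using L2_measurable[OF v] dom_sets by (simp add: V_def[abs_def] borel_measurable_restrict_space_iff)
 have fm: "f \<in> borel_measurable lebesgue"
  by (intro measurable_completion) (simp add: borel_measurable_continuous_onI[OF test_continuous[OF f]])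
 have trans: "(LINT x|?M. v x * f (x + t k *\<^sub>R e)) = (LINT x|?M. v (x - t k *\<^sub>R e) * f x)" for k
 proof -
  have "(LINT x|?M. v x * f (x + t k *\<^sub>R e)) = (LINT x|lebesgue. V x * f (x + t k *\<^sub>R e))"
   using dom_sets by (simp add: integral_restrict_space V_def mult.assoc)
  also have "\<dots> = (LINT x|lebesgue. V ((x + t k *\<^sub>R e) - t k *\<^sub>R e) * f (x + t k *\<^sub>R e))" by simp
  also have "\<dots> = (LINT x|lebesgue. V (x - t k *\<^sub>R e) * f x)"
   using integral_lebesgue_shift(1)[OF Vm, of "- (t k *\<^sub>R e)"] fm
   by (intro integral_lebesgue_shift(2)[of "\<lambda>x. V (x - t k *\<^sub>R e) * f x"]) simp
  also have "\<dots> = (LINT x|lebesgue. indicator U x * (v (x - t k *\<^sub>R e) * f x))"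
  proof (intro Bochner_Integration.integral_cong refl)
   fix x show "V (x - t k *\<^sub>R e) * f x = indicator U x * (v (x - t k *\<^sub>R e) * f x)"
    using inO[OF fC, of x "- t k"] C(2) fC[of x] tpos[of k] by (cases "f x = 0") (auto simp: V_def)
  qed
  also have "\<dots> = (LINT x|?M. v (x - t k *\<^sub>R e) * f x)"
   using dom_sets by (simp add: integral_restrict_space)
  finally show ?thesis .
 qed
 have vm [measurable]: "v \<in> borel_measurable ?M" using v by (rule L2_measurable)
 have fmO [measurable]: "f \<in> borel_measurable ?M" using test_L2'(1)[OF f] by (rule L2_measurable)
 have shm: "(\<lambda>x. v (x - t k *\<^sub>R e) * f x) \<in> borel_measurable ?M" for k
 proof -
  have "(\<lambda>x. V (x - t k *\<^sub>R e) * f x) \<in> borel_measurable lebesgue"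
   using integral_lebesgue_shift(1)[OF Vm, of "- (t k *\<^sub>R e)"] fm by simp
  then have "(\<lambda>x. V (x - t k *\<^sub>R e) * f x) \<in> borel_measurable ?M" by (rule measurable_restrict_space1)
  moreover have "V (x - t k *\<^sub>R e) * f x = v (x - t k *\<^sub>R e) * f x" for x
   using inO[OF fC, of x "- t k"] fC[of x] tpos[of k] by (cases "f x = 0") (auto simp: V_def)
  ultimately show ?thesis by simp
 qed
 define D where "D k x = (v (x - t k *\<^sub>R e) - v x) / t k * f x" for k x
 \<comment> \<open>\<open>lip\<close> is assumed only for segments inside \<open>U\<close>; the
   segment between a support point and its translate is one.\<close>
 have Dbound: "\<bar>D k x\<bar> \<le> M * \<bar>f x\<bar>" for k x
 proof (cases "f x = 0")
  case False
  have "closed_segment (x - t k *\<^sub>R e) x \<subseteq> U"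
  proof
   fix y assume "y \<in> closed_segment (x - t k *\<^sub>R e) x"
   then obtain u where u: "0 \<le> u" "u \<le> 1" "y = (1 - u) *\<^sub>R (x - t k *\<^sub>R e) + u *\<^sub>R x"
    by (auto simp: in_segment)
   have "y = x + (- (1 - u) * t k) *\<^sub>R e" using u(3) by (simp add: algebra_simps)
   moreover have "\<bar>- (1 - u) * t k\<bar> < d"
   proof -
    have "(1 - u) * t k \<le> 1 * t k" using u tpos[of k] by (intro mult_right_mono) auto
    moreover have "\<bar>- (1 - u) * t k\<bar> = (1 - u) * t k" using u tpos[of k] by (simp add: abs_mult)
    ultimately show ?thesis using tpos[of k] by linarith
   qed
   ultimately show "y \<in> U" using inO[OF fC[OF False]] by metis
  qed
  from lip[OF this] have "\<bar>v (x - t k *\<^sub>R e) - v x\<bar> \<le> M * t k"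
   using tpos[of k] by (simp add: dist_norm e1)
  then have "\<bar>v (x - t k *\<^sub>R e) - v x\<bar> / t k \<le> M" using tpos[of k] by (simp add: field_simps)
  then show ?thesis using tpos[of k] unfolding D_def abs_mult abs_divide by (intro mult_right_mono) auto
 qed (simp add: D_def)
 have Dm: "D k \<in> borel_measurable ?M" for k
 proof -
  have "(\<lambda>x. (v (x - t k *\<^sub>R e) * f x - v x * f x) / t k) \<in> borel_measurable ?M"
   using shm[of k] by measurable
  then show ?thesis by (simp add: D_def[abs_def] left_diff_distrib)
 qed
 have fi: "integrable ?M f" by (rule L2_integrable[OF dom_lmeasurable test_L2'(1)[OF f]])
 have gi: "(\<lambda>x. g x $ i) \<in> L2 U" by (rule L2_component[OF g])
 have L1: "(\<lambda>k. LINT x|?M. D k x) \<longlonglongrightarrow> (LINT x|?M. - (g x $ i) * f x)"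
 proof (rule integral_dominated_convergence[where w="\<lambda>x. M * \<bar>f x\<bar>"])
  show "(\<lambda>x. - (g x $ i) * f x) \<in> borel_measurable ?M"
   using L2_measurable[OF gi] by measurable
  show "integrable ?M (\<lambda>x. M * \<bar>f x\<bar>)" using fi by simp
  show "AE x in ?M. (\<lambda>k. D k x) \<longlonglongrightarrow> - (g x $ i) * f x"
   using der
  proof eventually_elim
   case (elim x)
   then have "((\<lambda>t. v (x + t *\<^sub>R e)) has_real_derivative g x $ i) (at 0)" by (simp add: e_def)
   then have "((\<lambda>s. (v (x + s *\<^sub>R e) - v x) / s) \<longlongrightarrow> g x $ i) (at 0)"
    by (simp add: has_field_derivative_iff)
   moreover have "filterlim (\<lambda>k. - t k) (at 0) sequentially"
   proof -
    have "- t k \<noteq> 0" for k using tpos(1)[of k] by linarith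
    moreover have "null (\<lambda>k. - t k)" using tendsto_minus[OF tlim] by simp
    ultimately show ?thesis by (simp add: filterlim_at)
   qed
   ultimately have "(\<lambda>k. (v (x + (- t k) *\<^sub>R e) - v x) / (- t k)) \<longlonglongrightarrow> g x $ i"
    by (rule filterlim_compose)
   from tendsto_mult[OF tendsto_minus[OF this] tendsto_const[of "f x"]]
   show ?case by (simp add: D_def)
  qed
 qed (use Dm Dbound in auto)
 define E where "E k x = (f (x + t k *\<^sub>R e) - f x) / t k" for k x
 have vi: "integrable ?M v" by (rule L2_integrable[OF dom_lmeasurable v])
 obtain B where B: "\<And>x. \<bar>f x\<bar> \<le> B" "\<And>x i. \<bar>pder f i x\<bar> \<le> B" "0 \<le> B"
  using test_bounded[OF f] by metis
 have fsm: "(\<lambda>x. f (x + t k *\<^sub>R e)) \<in> borel_measurable ?M" for k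
  by (intro continuous_measurable continuous_on_compose2[OF test_continuous[OF f, of UNIV]] continuous_intros) auto
 have vfi: "integrable ?M (\<lambda>x. v x * f (x + t k *\<^sub>R e))" "integrable ?M (\<lambda>x. v x * f x)" for k
 proof -
  have "(\<lambda>x. f (x + t k *\<^sub>R e)) \<in> L2 U" using B(1,3) by (intro L2_bounded(1)[OF dom_lmeasurable fsm, of _ B]) auto
  then show "integrable ?M (\<lambda>x. v x * f (x + t k *\<^sub>R e))" by (rule L2_prod_integrable[OF v])
  show "integrable ?M (\<lambda>x. v x * f x)" by (rule L2_prod_integrable[OF v test_L2'(1)[OF f]])
 qed
 have DE: "(LINT x|?M. D k x) = (LINT x|?M. v x * E k x)" for k
 proof -
  have vsi: "integrable ?M (\<lambda>x. v (x - t k *\<^sub>R e) * f x)"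
  proof -
   have i: "integrable ?M (\<lambda>x. t k * D k x + v x * f x)"
    using vfi(2) fi Dm[of k] Dbound[of k]
    by (intro Bochner_Integration.integrable_add integrable_mult_right
      Bochner_Integration.integrable_bound[of ?M "\<lambda>x. M * \<bar>f x\<bar>" "D k"]) (auto simp: M)
   then show ?thesis using tpos(1)[of k] by (simp add: D_def field_simps)
  qed
  have "(LINT x|?M. D k x) = ((LINT x|?M. v (x - t k *\<^sub>R e) * f x) - (LINT x|?M. v x * f x)) / t k"
   using vsi vfi(2) by (simp add: D_def diff_divide_distrib left_diff_distrib)
  also have "\<dots> = (LINT x|?M. v x * E k x)"
   using vfi(1)[of k] vfi(2) by (simp add: trans[symmetric] E_def diff_divide_distrib right_diff_distrib)
  finally show ?thesis .
 qed
 \<comment> \<open>The difference quotients \<open>E k\<close> of \<open>f\<close> converge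
   uniformly, so integrability of \<open>v\<close> suffices.\<close>
 have "null (\<lambda>k. (LINT x|?M. v x * E k x) - (LINT x|?M. v x * pder f i x))"
 proof (rule LIMSEQ_I)
  fix r :: real assume r: "0 < r"
  define m where "m = (LINT x|?M. \<bar>v x\<bar>) + 1"
  have m: "m > 0" by (simp add: m_def add_nonneg_pos)
  obtain \<tau> where \<tau>: "\<tau> > 0" "\<And>x h. norm h < \<tau> \<Longrightarrow> \<bar>f (x + h) - f x - (\<Sum>i\<in>UNIV. pder f i x * h $ i)\<bar> \<le> r / (2 * m) * norm h"
   using test_uniform_linearization[OF f, of "r / (2 * m)"] r m by auto
  obtain N where N: "\<And>k. k \<ge> N \<Longrightarrow> t k < \<tau>"
   using order_tendstoD(2)[OF tlim \<tau>(1)] by (auto simp: eventually_sequentially)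
  have "norm ((LINT x|?M. v x * E k x) - (LINT x|?M. v x * pder f i x) - 0) < r" if "k \<ge> N" for k
  proof -
   have pw: "\<bar>E k x - pder f i x\<bar> \<le> r / (2 * m)" for x
   proof -
    have "(\<Sum>l\<in>UNIV. pder f l x * (t k *\<^sub>R e) $ l) = (\<Sum>l\<in>UNIV. if l = i then pder f i x * t k else 0)"
     by (intro sum.cong) (auto simp: e_def axis_def)
    then have "\<bar>f (x + t k *\<^sub>R e) - f x - pder f i x * t k\<bar> \<le> r / (2 * m) * t k"
     using \<tau>(2)[of "t k *\<^sub>R e" x] N[OF that] tpos[of k] e1 by simp
    moreover have "E k x - pder f i x = (f (x + t k *\<^sub>R e) - f x - pder f i x * t k) / t k"
     using tpos[of k] by (simp add: E_def field_simps)
    ultimately show ?thesis using tpos[of k] by (simp add: abs_divide pos_divide_le_eq)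
   qed
   have vE: "integrable ?M (\<lambda>x. v x * E k x)" using vfi by (simp add: E_def right_diff_distrib diff_divide_distrib)
   have vp: "integrable ?M (\<lambda>x. v x * pder f i x)" by (rule L2_prod_integrable[OF v test_L2'(2)[OF f]])
   have "(LINT x|?M. v x * E k x) - (LINT x|?M. v x * pder f i x) = (LINT x|?M. v x * (E k x - pder f i x))"
    using vE vp by (simp add: right_diff_distrib)
   also have "\<bar>\<dots>\<bar> \<le> (LINT x|?M. \<bar>v x * (E k x - pder f i x)\<bar>)" by (rule integral_abs_bound)
   also have "\<dots> \<le> (LINT x|?M. \<bar>v x\<bar> * (r / (2 * m)))"
   proof (rule integral_mono)
    show "integrable ?M (\<lambda>x. \<bar>v x * (E k x - pder f i x)\<bar>)"
     using vE vp by (simp add: right_diff_distrib)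
    show "integrable ?M (\<lambda>x. \<bar>v x\<bar> * (r / (2 * m)))" using vi by simp
    show "\<bar>v x * (E k x - pder f i x)\<bar> \<le> \<bar>v x\<bar> * (r / (2 * m))" for x
     unfolding abs_mult using pw by (intro mult_left_mono) auto
   qed
   also have "\<dots> \<le> m * (r / (2 * m))"
   proof -
    have "(LINT x|?M. \<bar>v x\<bar> * (r / (2 * m))) = (LINT x|?M. \<bar>v x\<bar>) * (r / (2 * m))" using vi by simp
    also have "\<dots> \<le> m * (r / (2 * m))" using r m by (intro mult_right_mono) (simp_all add: m_def)
    finally show ?thesis .
   qed
   also have "\<dots> < r" using r m by (simp add: field_simps)
   finally show ?thesis by simp
  qed
  then show "\<exists>no. \<forall>n\<ge>no. norm ((LINT x|?M. v x * E n x) - (LINT x|?M. v x * pder f i x) - 0) < r" by blast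
 qed
 then have L2: "(\<lambda>k. LINT x|?M. v x * E k x) \<longlonglongrightarrow> (LINT x|?M. v x * pder f i x)"
  by (simp add: LIM_zero_iff)
 have "(LINT x|?M. v x * pder f i x) = (LINT x|?M. - (g x $ i) * f x)"
  using LIMSEQ_unique[OF L2 L1[unfolded DE]] .
 then show "(LINT x|?M. v x * pder f i x) = - (LINT x|?M. g x $ i * f x)" by simp
qed

text \<open>Differentiability is required in the whole space at every point of the closure, so that
  such functions can be differentiated along edges of elements that lie on the boundary. The
  gradient \<open>G\<close> is carried along because \<open>grad\<close> is determined only almost
  everywhere.\<close>

definition C1_closure :: "(real^'n \<Rightarrow> real) \<Rightarrow> (real^'n \<Rightarrow> real^'n) \<Rightarrow> bool" where
 "C1_closure v G \<longleftrightarrow> continuous_on (closure U) G \<and>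
   (\<forall>x\<in>closure U. (v has_derivative (\<lambda>h. G x \<bullet> h)) (at x))"

lemma compact_dom: "compact (closure U)"
 using bounded_dom by simp

lemma C1_closure_continuous: "C1_closure v G \<Longrightarrow> continuous_on (closure U) v"
 by (auto simp: C1_closure_def intro!: continuous_at_imp_continuous_on has_derivative_continuous)

lemma continuous_L2:
 fixes f :: "real^'n \<Rightarrow> 'b::euclidean_space"
 assumes "continuous_on (closure U) f"
 shows "f \<in> L2 U"
proof -
 have "bounded (f ` closure U)"
  using assms compact_dom by (intro compact_imp_bounded compact_continuous_image)
 then obtain B where B: "\<And>x. x \<in> closure U \<Longrightarrow> norm (f x) \<le> B" by (auto simp: bounded_iff)
 have "norm (f x) \<le> \<bar>B\<bar>" if "x \<in> U" for x using B[of x] that closure_subset by force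
 then show ?thesis
  using continuous_on_subset[OF assms closure_subset]
  by (intro L2_bounded(1)[OF dom_lmeasurable, of _ "\<bar>B\<bar>"] continuous_measurable) auto
qed

lemma segment_mvt:
 fixes v :: "real^'n \<Rightarrow> real"
 assumes "\<And>x. x \<in> closed_segment a b \<Longrightarrow> (v has_derivative (\<lambda>h. G x \<bullet> h)) (at x)"
 obtains x where "x \<in> closed_segment a b" "v b - v a = G x \<bullet> (b - a)"
proof -
 let ?p = "\<lambda>t. a + t *\<^sub>R (b - a)"
 have seg: "?p t \<in> closed_segment a b" if "0 \<le> t" "t \<le> 1" for t
  using that by (auto simp: in_segment algebra_simps intro!: exI[of _ t])
 have "((\<lambda>t. v (?p t)) has_real_derivative (G (?p t) \<bullet> (b - a))) (at t)" if "0 \<le> t" "t \<le> 1" for t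
 proof -
  have "(?p has_derivative (\<lambda>s. s *\<^sub>R (b - a))) (at t)" by (auto intro!: derivative_eq_intros)
  from has_derivative_compose[OF this assms[OF seg[OF that]]]
  have "((\<lambda>t. v (?p t)) has_derivative (\<lambda>s. G (?p t) \<bullet> (s *\<^sub>R (b - a)))) (at t)" .
  then show ?thesis by (simp add: has_field_derivative_def mult.commute[of _ "G (?p t) \<bullet> (b - a)"])
 qed
 from MVT2[OF _ this, of 0 1] obtain t where "0 < t" "t < 1" "v b - v a = G (?p t) \<bullet> (b - a)" by auto
 then show thesis using that[of "?p t"] seg[of t] by auto
qed

lemma C1_closure_H1:
 assumes "C1_closure v G"
 shows "v \<in> H1 U" "AE x in MU. grad U v x = G x"
proof -
 have der: "\<And>x. x \<in> closure U \<Longrightarrow> (v has_derivative (\<lambda>h. G x \<bullet> h)) (at x)" and Gc: "continuous_on (closure U) G"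
  using assms by (auto simp: C1_closure_def)
 have vL: "v \<in> L2 U" and GL: "G \<in> L2 U" using continuous_L2 C1_closure_continuous[OF assms] Gc by auto
 have "bounded (G ` closure U)"
  using Gc compact_dom by (intro compact_imp_bounded compact_continuous_image)
 then obtain B0 where B0: "\<And>x. x \<in> closure U \<Longrightarrow> norm (G x) \<le> B0" by (auto simp: bounded_iff)
 define B where "B = \<bar>B0\<bar>"
 have B: "\<And>x. x \<in> closure U \<Longrightarrow> norm (G x) \<le> B" "0 \<le> B" using B0 by (force simp: B_def)+
 have "weak_gradient U v G"
 proof (rule weak_gradient_lipschitz[OF vL B(2) _ _ GL])
  fix x y assume s: "closed_segment x y \<subseteq> U"
  then have s': "\<And>z. z \<in> closed_segment x y \<Longrightarrow> z \<in> closure U" using closure_subset by blast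
  obtain z where z: "z \<in> closed_segment x y" "v y - v x = G z \<bullet> (y - x)"
   using segment_mvt[of x y v G] der s' by metis
  have "\<bar>v x - v y\<bar> = \<bar>G z \<bullet> (y - x)\<bar>" using z(2) by simp
  also have "\<dots> \<le> norm (G z) * norm (y - x)" by (rule Cauchy_Schwarz_ineq2)
  also have "\<dots> \<le> B * dist x y" using B(1)[OF s'[OF z(1)]] by (simp add: dist_norm norm_minus_commute mult_right_mono)
  finally show "\<bar>v x - v y\<bar> \<le> B * dist x y" .
 next
  have "((\<lambda>t. v (x + t *\<^sub>R axis i 1)) has_real_derivative G x $ i) (at 0)" if x: "x \<in> U" for x i
  proof -
   have p: "((\<lambda>t. x + t *\<^sub>R axis i 1) has_derivative (\<lambda>s. s *\<^sub>R axis i 1)) (at 0)" by (auto intro!: derivative_eq_intros)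
   have "x \<in> closure U" using x closure_subset by blast
   then have "(v has_derivative (\<lambda>h. G x \<bullet> h)) (at (x + 0 *\<^sub>R axis i 1))" using der by simp
   from has_derivative_compose[OF p this]
   have "((\<lambda>t. v (x + t *\<^sub>R axis i 1)) has_derivative (\<lambda>s. G x \<bullet> (s *\<^sub>R axis i 1))) (at 0)" .
   then show ?thesis by (simp add: has_field_derivative_def inner_axis mult.commute[of _ "G x $ i"])
  qed
  then show "AE x in MU. \<forall>i. ((\<lambda>t. v (x + t *\<^sub>R axis i 1)) has_real_derivative G x $ i) (at 0)"
   by (intro AE_I2) auto
 qed
 from weak_gradient_grad[OF vL GL this]
 show "v \<in> H1 U" "AE x in MU. grad U v x = G x" .
qed

lemma const_H1: "(\<lambda>x. c) \<in> H1 U" "AE x in MU. grad U (\<lambda>x. c) x = 0"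
proof -
 have "C1_closure (\<lambda>x. c) (\<lambda>x. 0)" by (simp add: C1_closure_def)
 from C1_closure_H1[OF this] show "(\<lambda>x. c) \<in> H1 U" "AE x in MU. grad U (\<lambda>x. c) x = 0" .
qed

end

section \<open>Density of continuously differentiable functions\<close>

lemma L2_norm_le_sum:
 fixes f :: "'a::euclidean_space \<Rightarrow> 'b::euclidean_space" and g :: "'k \<Rightarrow> 'a \<Rightarrow> 'c::euclidean_space"
 assumes I: "finite I" and f: "f \<in> borel_measurable (lebesgue_on U)" and g: "\<And>k. k \<in> I \<Longrightarrow> g k \<in> L2 U"
  and le: "AE x in lebesgue_on U. norm (f x) \<le> (\<Sum>k\<in>I. norm (g k x))"
 shows "L2_norm U f \<le> (\<Sum>k\<in>I. L2_norm U (g k))"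
proof -
 have n: "(\<lambda>x. norm (g k x)) \<in> L2 U" if "k \<in> I" for k
  by (rule L2_dominated[OF g[OF that], of _ 1]) (use L2_measurable[OF g[OF that]] in auto)
 have "(\<lambda>x. \<Sum>k\<in>I. norm (g k x)) \<in> L2 U \<and> L2_norm U (\<lambda>x. \<Sum>k\<in>I. norm (g k x)) \<le> (\<Sum>k\<in>I. L2_norm U (g k))"
  using I n
 proof (induction I rule: finite_induct)
  case (insert k I)
  have "L2_norm U (\<lambda>x. norm (g k x)) = L2_norm U (g k)" by (simp add: L2_norm_eq)
  then show ?case
   using insert L2_triangle[of "\<lambda>x. norm (g k x)" U "\<lambda>x. \<Sum>k\<in>I. norm (g k x)"] by (auto simp: L2_add)
 qed (simp add: L2_norm_eq)
 moreover from this have "L2_norm U f \<le> 1 * L2_norm U (\<lambda>x. \<Sum>k\<in>I. norm (g k x))"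
  by (intro L2_norm_mono f) (use le in \<open>auto simp: sum_nonneg\<close>)
 ultimately show ?thesis by linarith
qed

lemma max0_square_derivative: "((\<lambda>t::real. (max 0 t)^2) has_real_derivative 2 * max 0 t) (at t)"
proof (cases t "0::real" rule: linorder_cases)
 case greater
 have "((\<lambda>t. t^2) has_real_derivative 2 * max 0 t) (at t)"
  using greater by (auto intro!: derivative_eq_intros)
 then show ?thesis
  by (rule has_field_derivative_transform_within_open[of _ _ _ "{0<..}"]) (use greater in auto)
next
 case less
 have "((\<lambda>t. 0) has_real_derivative 2 * max 0 t) (at t)"
  using less by simp
 then show ?thesis
  by (rule has_field_derivative_transform_within_open[of _ _ _ "{..<0}"]) (use less in auto)
next
 case equal
 have "((\<lambda>h::real. (max 0 h)^2 / h) \<longlongrightarrow> 0) (at 0)"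
 proof (rule Lim_null_comparison)
  show "\<forall>\<^sub>F h::real in at 0. norm ((max 0 h)^2 / h) \<le> \<bar>h\<bar>"
   by (intro always_eventually) (auto simp: max_def power2_eq_square)
  show "((\<lambda>h::real. \<bar>h\<bar>) \<longlongrightarrow> 0) (at 0)" by (intro tendsto_eq_intros) auto
 qed
 then show ?thesis using equal by (simp add: has_field_derivative_iff)
qed

lemma sum_option_case:
 fixes F :: "'b \<Rightarrow> real"
 shows "(\<Sum>j\<in>(UNIV::'n::finite option set). F (case j of None \<Rightarrow> a | Some i \<Rightarrow> b i)) = (\<Sum>i\<in>UNIV. F (b i)) + F a"
 by (subst UNIV_option_conv) (simp add: sum.reindex)

lemma sum_Times_pair:
 fixes F :: "'b \<Rightarrow> real"
 shows "(\<Sum>pj\<in>D \<times> E. F (k pj)) = (\<Sum>p\<in>D. \<Sum>j\<in>E. F (k (p, j)))"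
 by (simp add: sum.cartesian_product)

context bounded_open
begin

text \<open>The minus sign comes from differentiating the kernel at \<open>y - x\<close> with
  respect to \<open>x\<close>.\<close>

definition mollify_grad :: "real^'n \<Rightarrow> real^'n \<Rightarrow> (real^'n \<Rightarrow> real) \<Rightarrow> real^'n \<Rightarrow> real^'n" where
 "mollify_grad a b u x = (\<chi> i. - (LINT y|MU. pder (mollifier a b) i (y - x) * u y))"

lemma pder_shift_integrable:
 assumes u: "u \<in> L2 U"
 shows "integrable MU (\<lambda>y. pder (mollifier a b) i (y - x) * u y)"
proof -
 obtain B where B: "\<And>x i. \<bar>pder (mollifier a b) i x\<bar> \<le> B" "0 \<le> B"
  using test_bounded[OF mollifier_test[of a b]] by metis
 have c: "continuous_on U (\<lambda>y. pder (mollifier a b) i (y - x))"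
  by (intro continuous_on_compose2[OF test_pder_continuous[OF mollifier_test, of UNIV]] continuous_intros) auto
 have "(\<lambda>y. pder (mollifier a b) i (y - x)) \<in> L2 U"
  using B by (intro L2_bounded(1)[OF dom_lmeasurable, of _ B] continuous_measurable c) auto
 then show ?thesis using u by (rule L2_prod_integrable)
qed

lemma integral_kernel_le:
 fixes u k :: "real^'n \<Rightarrow> real"
 assumes u: "u \<in> L2 U" and k: "integrable MU (\<lambda>y. k y * u y)" and le: "\<And>y. \<bar>k y\<bar> \<le> c"
 shows "\<bar>LINT y|MU. k y * u y\<bar> \<le> c * (LINT y|MU. \<bar>u y\<bar>)"
proof -
 have ui: "integrable MU u" by (rule L2_integrable[OF dom_lmeasurable u])
 have "\<bar>LINT y|MU. k y * u y\<bar> \<le> (LINT y|MU. \<bar>k y * u y\<bar>)" by (rule integral_abs_bound)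
 also have "\<dots> \<le> (LINT y|MU. c * \<bar>u y\<bar>)"
  using integrable_abs[OF k] ui le by (intro integral_mono) (auto simp: abs_mult intro!: mult_right_mono)
 finally show ?thesis using ui by simp
qed

lemma mollify_has_derivative:
 assumes u: "u \<in> L2 U"
 shows "(mollify U a b u has_derivative (\<lambda>h. mollify_grad a b u x \<bullet> h)) (at x)"
 unfolding has_derivative_at_alt
proof (intro conjI allI impI)
 show "bounded_linear (\<lambda>h. mollify_grad a b u x \<bullet> h)" by (rule bounded_linear_inner_right)
 fix e :: real assume e: "0 < e"
 let ?K = "mollifier a b" let ?M = "MU"
 define m where "m = (LINT y|?M. \<bar>u y\<bar>) + 1"
 have m: "m > 0" by (simp add: m_def add_nonneg_pos)
 obtain d where d: "d > 0" and
  dd: "\<And>z h. norm h < d \<Longrightarrow> \<bar>?K (z + h) - ?K z - (\<Sum>i\<in>UNIV. pder ?K i z * h $ i)\<bar> \<le> e / m * norm h"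
  using test_uniform_linearization[OF mollifier_test, of "e / m"] e m by auto
 have "norm (mollify U a b u x' - mollify U a b u x - mollify_grad a b u x \<bullet> (x' - x)) \<le> e * norm (x' - x)"
  if x': "norm (x' - x) < d" for x'
 proof -
  define h where "h = x' - x"
  let ?L = "\<lambda>y. ?K (y - x') - ?K (y - x) + (\<Sum>i\<in>UNIV. pder ?K i (y - x) * h $ i)"
  have i1: "integrable ?M (\<lambda>y. ?K (y - x) * u y)" for x by (rule mollify_integrable[OF u])
  have i2: "integrable ?M (\<lambda>y. (pder ?K i (y - x) * u y) * h $ i)" for i
   by (intro integrable_mult_left pder_shift_integrable[OF u])
  have eq: "?L y * u y = ?K (y - x') * u y - ?K (y - x) * u y + (\<Sum>i\<in>UNIV. (pder ?K i (y - x) * u y) * h $ i)" for y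
   by (simp add: algebra_simps sum_distrib_left)
  have iL: "integrable ?M (\<lambda>y. ?L y * u y)"
   unfolding eq by (intro Bochner_Integration.integrable_add Bochner_Integration.integrable_diff
     Bochner_Integration.integrable_sum i1 i2)
  have "(LINT y|?M. ?L y * u y) = mollify U a b u x' - mollify U a b u x
    + (\<Sum>i\<in>UNIV. (LINT y|?M. pder ?K i (y - x) * u y) * h $ i)"
   unfolding eq mollify_def using i1 i2 pder_shift_integrable[OF u]
   by (subst Bochner_Integration.integral_add)
    (auto simp: Bochner_Integration.integral_sum intro!: Bochner_Integration.integrable_sum sum.cong)
  also have "(\<Sum>i\<in>UNIV. (LINT y|?M. pder ?K i (y - x) * u y) * h $ i) = - (mollify_grad a b u x \<bullet> h)"
   by (simp add: mollify_grad_def inner_vec_def sum_negf)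
  finally have "mollify U a b u x' - mollify U a b u x - mollify_grad a b u x \<bullet> h = (LINT y|?M. ?L y * u y)" by simp
  also have "\<bar>\<dots>\<bar> \<le> (e / m * norm h) * (LINT y|?M. \<bar>u y\<bar>)"
  proof (rule integral_kernel_le[OF u iL])
   fix y
   have n: "norm (- h) < d" using x' by (simp add: h_def norm_minus_commute)
   have s: "(\<Sum>i\<in>UNIV. pder ?K i (y - x) * (- h) $ i) = - (\<Sum>i\<in>UNIV. pder ?K i (y - x) * h $ i)"
    by (simp add: sum_negf)
   have "y - x + - h = y - x'" by (simp add: h_def)
   then show "\<bar>?L y\<bar> \<le> e / m * norm h" using dd[OF n, of "y - x"] by (simp only: s norm_minus_cancel diff_minus_eq_add)
  qed
  also have "\<dots> \<le> (e / m * norm h) * m" using e m by (intro mult_left_mono) (auto simp: m_def)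
  also have "\<dots> = e * norm h" using m by simp
  finally show ?thesis by (simp add: h_def)
 qed
 then show "\<exists>d>0. \<forall>x'. norm (x' - x) < d \<longrightarrow>
   norm (mollify U a b u x' - mollify U a b u x - mollify_grad a b u x \<bullet> (x' - x)) \<le> e * norm (x' - x)"
  using d by blast
qed

lemma mollify_grad_continuous:
 assumes u: "u \<in> L2 U" shows "continuous_on A (mollify_grad a b u)"
proof -
 let ?K = "mollifier a b" let ?M = "MU"
 have "continuous_on UNIV (\<lambda>x. LINT y|?M. pder ?K i (y - x) * u y)" for i
  unfolding continuous_on_iff
 proof (intro ballI allI impI)
  fix x :: "real^'n" and e :: real assume e: "0 < e"
  define m where "m = (LINT y|?M. \<bar>u y\<bar>) + 1"
  have m: "m > 0" by (simp add: m_def add_nonneg_pos)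
  obtain d where d: "d > 0" and dd: "\<And>z z'. dist z' z < d \<Longrightarrow> dist (pder ?K i z') (pder ?K i z) < e / m"
   using test_pder_uniformly_continuous[OF mollifier_test[of a b], of i] divide_pos_pos[OF e m]
   unfolding uniformly_continuous_on_def by (metis UNIV_I)
  have "dist (LINT y|?M. pder ?K i (y - x') * u y) (LINT y|?M. pder ?K i (y - x) * u y) < e"
   if x': "dist x' x < d" for x'
  proof -
   have i: "integrable ?M (\<lambda>y. pder ?K i (y - x) * u y)" for x by (rule pder_shift_integrable[OF u])
   have "(LINT y|?M. pder ?K i (y - x') * u y) - (LINT y|?M. pder ?K i (y - x) * u y)
     = (LINT y|?M. (pder ?K i (y - x') - pder ?K i (y - x)) * u y)"
    using i by (simp add: left_diff_distrib)
   also have "\<bar>\<dots>\<bar> \<le> (e / m) * (LINT y|?M. \<bar>u y\<bar>)"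
   proof (rule integral_kernel_le[OF u])
    show "integrable ?M (\<lambda>y. (pder ?K i (y - x') - pder ?K i (y - x)) * u y)"
     using i by (simp add: left_diff_distrib)
    fix y
    have "dist (y - x') (y - x) < d" using x' by (simp add: dist_norm norm_minus_commute)
    from dd[OF this] show "\<bar>pder ?K i (y - x') - pder ?K i (y - x)\<bar> \<le> e / m"
     by (simp add: dist_real_def)
   qed
   also have "\<dots> < (e / m) * m" using e m by (intro mult_strict_left_mono) (auto simp: m_def)
   also have "\<dots> = e" using m by simp
   finally show ?thesis by (simp add: dist_real_def)
  qed
  then show "\<exists>d>0. \<forall>x'\<in>UNIV. dist x' x < d \<longrightarrow>
    dist (LINT y|?M. pder ?K i (y - x') * u y) (LINT y|?M. pder ?K i (y - x) * u y) < e"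
   using d by blast
 qed
 then have "continuous_on UNIV (mollify_grad a b u)"
  unfolding mollify_grad_def[abs_def] by (intro continuous_on_vec_lambda continuous_on_minus)
 then show ?thesis by (rule continuous_on_subset) simp
qed

text \<open>Where the translated box lies in \<open>U\<close> the shifted kernel is a test function,
  and the definition of the weak gradient says exactly that gradient and mollification commute.
  Elsewhere the extension by zero would contribute a boundary term.\<close>

lemma mollify_grad_eq:
 assumes u: "u \<in> H1 U" and x: "\<And>z. z \<in> cbox a b \<Longrightarrow> x + z \<in> U"
 shows "mollify_grad a b u x $ i = mollify U a b (\<lambda>y. grad U u y $ i) x"
proof -
 have "(LINT y|MU. u y * pder (mollifier a b) i (y - x))
   = - (LINT y|MU. grad U u y $ i * mollifier a b (y - x))"
  using grad_weak[OF u, unfolded weak_gradient_iff, rule_format, OF mollifier_shift_test(1)[of a b x, OF x], of i]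
   mollifier_shift_test(2)[of a b x, OF x] by simp
 then show ?thesis by (simp add: mollify_grad_def mollify_def mult.commute)
qed

end

section \<open>Inward translations at the boundary and gluing by a partition of unity\<close>

locale lipschitz_dom = bounded_open U for U :: "(real^'n) set" +
 assumes lip: "lipschitz_boundary U"
begin

text \<open>The segment property with room to spare: near each point of the closure there are
  arbitrarily small boxes of translations that do not leave \<open>U\<close>. At a boundary point
  the box sits around a short multiple of the upward direction \<open>e\<close>; at an interior
  point any small box around 0 serves.\<close>

lemma local_translations:
 assumes x0: "x0 \<in> closure U"
 obtains r where "r > 0"
  "\<And>\<eta>. \<eta> > 0 \<Longrightarrow> \<exists>a b. box a b \<noteq> {} \<and> cbox a b \<subseteq> ball 0 \<eta> \<and> (\<forall>x\<in>U \<inter> ball x0 r. \<forall>z\<in>cbox a b. x + z \<in> U)"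
proof (cases "x0 \<in> U")
 case True
 then obtain R where R: "R > 0" "ball x0 R \<subseteq> U" using open_dom open_contains_ball by blast
 have "\<exists>a b. box a b \<noteq> {} \<and> cbox a b \<subseteq> ball 0 \<eta> \<and> (\<forall>x\<in>U \<inter> ball x0 (R/2). \<forall>z\<in>cbox a b. x + z \<in> U)" if \<eta>: "\<eta> > 0" for \<eta>
 proof -
  have "min \<eta> (R/2) > 0" using \<eta> R by simp
  then obtain a b where ab: "(0::real^'n) \<in> box a b" "cbox a b \<subseteq> ball 0 (min \<eta> (R/2))"
   using small_box by metis
  have "x + z \<in> U" if "x \<in> ball x0 (R/2)" "z \<in> cbox a b" for x z
  proof -
   have "norm z < R/2" using ab(2) that(2) by (auto simp: subset_iff)
   moreover have "norm (x0 - (x + z)) \<le> norm (x0 - x) + norm z"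
    using norm_triangle_ineq4[of "x0 - x" z] by (simp add: algebra_simps)
   ultimately have "x + z \<in> ball x0 R" using that(1) by (simp add: dist_norm)
   then show ?thesis using R by blast
  qed
  moreover have "cbox a b \<subseteq> ball 0 \<eta>" using ab(2) by (auto simp: subset_iff)
  ultimately show ?thesis using ab(1) by blast
 qed
 then show thesis using that[of "R/2"] R by auto
next
 case False
 then have "x0 \<in> frontier U" using x0 open_dom by (simp add: frontier_def interior_open)
 then obtain R e C and \<gamma> :: "real^'n \<Rightarrow> real" where R: "R > 0" and e: "norm e = 1" and \<gamma>: "C-lipschitz_on UNIV \<gamma>"
  and graph: "\<And>y. y \<in> ball x0 R \<Longrightarrow> y \<in> U \<longleftrightarrow> \<gamma> (y - (y \<bullet> e) *\<^sub>R e) < y \<bullet> e"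
  using lip unfolding lipschitz_boundary_def by metis
 have C: "C \<ge> 0" using \<gamma> by (rule lipschitz_on_nonneg)
 have ee: "e \<bullet> e = 1" using e by (simp add: norm_eq_1)
 have "\<exists>a b. box a b \<noteq> {} \<and> cbox a b \<subseteq> ball 0 \<eta> \<and> (\<forall>x\<in>U \<inter> ball x0 (R/2). \<forall>z\<in>cbox a b. x + z \<in> U)" if \<eta>: "\<eta> > 0" for \<eta>
 proof -
  define t where "t = min \<eta> R / 4"
  have t: "t > 0" "2 * t < \<eta>" "2 * t < R" using \<eta> R by (auto simp: t_def min_def)
  \<comment> \<open>A deviation \<open>w\<close> from \<open>t *\<^sub>R e\<close> moves the
    horizontal coordinates by at most twice its norm, hence the graph by at most
    \<open>2 * C\<close> times it, and costs at most its norm in height. The gain \<open>t\<close>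
    covers both as long as \<open>norm w < s\<close>.\<close>
  define s where "s = t / (2 * C + 1)"
  have s: "s > 0" using t C by (simp add: s_def)
  have st: "(2 * C + 1) * s = t" using C by (simp add: s_def)
  have s1: "s \<le> t" using t C by (simp add: s_def field_simps)
  obtain a b where ab: "t *\<^sub>R e \<in> box a b" "cbox a b \<subseteq> ball (t *\<^sub>R e) s" using small_box[OF s] by metis
  have zw: "norm (z - t *\<^sub>R e) < s" if "z \<in> cbox a b" for z
   using ab(2) that by (auto simp: subset_iff dist_norm norm_minus_commute)
  have zn: "norm z < 2 * t" if "z \<in> cbox a b" for z
  proof -
   have "norm z \<le> norm (t *\<^sub>R e) + norm (z - t *\<^sub>R e)" using norm_triangle_sub[of z "t *\<^sub>R e"] .
   then show ?thesis using zw[OF that] s1 t e by simp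
  qed
  have "x + z \<in> U" if x: "x \<in> U" "x \<in> ball x0 (R/2)" and z: "z \<in> cbox a b" for x z
  proof -
   define w where "w = z - t *\<^sub>R e"
   have w: "norm w < s" using zw[OF z] by (simp add: w_def)
   have zeq: "z = t *\<^sub>R e + w" by (simp add: w_def)
   have we: "\<bar>w \<bullet> e\<bar> \<le> norm w" using Cauchy_Schwarz_ineq2[of w e] e by simp
   let ?p = "\<lambda>y. y - (y \<bullet> e) *\<^sub>R e"
   have pz: "?p (x + z) - ?p x = w - (w \<bullet> e) *\<^sub>R e"
    by (simp add: zeq inner_add_left ee algebra_simps)
   have "norm (w - (w \<bullet> e) *\<^sub>R e) \<le> norm w + \<bar>w \<bullet> e\<bar>" using norm_triangle_ineq4[of w "(w \<bullet> e) *\<^sub>R e"] e by simp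
   then have pz2: "dist (?p (x + z)) (?p x) \<le> 2 * norm w" using pz we by (simp add: dist_norm)
   have "norm (x0 - (x + z)) \<le> norm (x0 - x) + norm z"
    using norm_triangle_ineq4[of "x0 - x" z] by (simp add: algebra_simps)
   then have inb: "x + z \<in> ball x0 R" using x(2) zn[OF z] t(3) unfolding t_def by (simp add: dist_norm)
   have xb: "x \<in> ball x0 R" using x(2) R by simp
   have "\<gamma> (?p (x + z)) \<le> \<gamma> (?p x) + C * dist (?p (x + z)) (?p x)"
    using lipschitz_onD[OF \<gamma>, of "?p (x+z)" "?p x"] by (simp add: dist_real_def)
   also have "\<dots> \<le> \<gamma> (?p x) + C * (2 * norm w)" using pz2 C by (intro add_left_mono mult_left_mono)
   also have "\<dots> < x \<bullet> e + C * (2 * norm w)" using graph[OF xb] x(1) by simp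
   also have "\<dots> \<le> x \<bullet> e + t - norm w"
   proof -
    have "(2 * C + 1) * norm w \<le> (2 * C + 1) * s" using w C by (intro mult_left_mono) auto
    then show ?thesis using st by (simp add: algebra_simps)
   qed
   also have "\<dots> \<le> (x + z) \<bullet> e" using we by (simp add: zeq inner_add_left ee)
   finally show ?thesis using graph[OF inb] by simp
  qed
  moreover have "cbox a b \<subseteq> ball 0 \<eta>" using zn t by fastforce
  ultimately show ?thesis using ab(1) by blast
 qed
 then show thesis using that[of "R/2"] R by auto
qed

text \<open>Each ball of a finite cover has its own box of inward translations, and the local
  mollifications are glued by a partition of unity. Writing the result as the quotient
  \<open>Nu / S\<close> keeps the gradient explicit: its error consists of the errors
  \<open>W\<close> of the mollified gradient components and of the errors \<open>w\<close> times
  bounded gradients of the partition.\<close>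

theorem C1_dense:
 assumes u: "u \<in> H1 U" and e: "e > 0"
 obtains v G where "C1_closure v G" "nm (\<lambda>x. v x - u x) < e" "nm (\<lambda>x. G x - grad U u x) < e"
proof -
 let ?M = "MU"
 define g where "g = grad U u"
 have uL: "u \<in> L2 U" and gL: "g \<in> L2 U" using u by (auto simp: g_def grad_L2 H1_L2)
 have giL: "(\<lambda>x. g x $ i) \<in> L2 U" for i by (rule L2_component[OF gL])
 have "\<forall>p\<in>closure U. \<exists>r>0. \<forall>\<eta>>0. \<exists>a b. box a b \<noteq> {} \<and> cbox a b \<subseteq> ball 0 \<eta> \<and> (\<forall>x\<in>U \<inter> ball p r. \<forall>z\<in>cbox a b. x + z \<in> U)"
  using local_translations by metis
 then obtain r where r: "\<And>p. p \<in> closure U \<Longrightarrow> r p > 0"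
  "\<And>p \<eta>. p \<in> closure U \<Longrightarrow> \<eta> > 0 \<Longrightarrow> \<exists>a b. box a b \<noteq> {} \<and> cbox a b \<subseteq> ball 0 \<eta> \<and> (\<forall>x\<in>U \<inter> ball p (r p). \<forall>z\<in>cbox a b. x + z \<in> U)"
  by metis
 have "closure U \<subseteq> (\<Union>p\<in>closure U. ball p (r p))" using r(1) by force
 then obtain D where D: "D \<subseteq> closure U" "finite D" "closure U \<subseteq> (\<Union>p\<in>D. ball p (r p))"
  using compactE_image[OF compact_dom, of "closure U" "\<lambda>p. ball p (r p)"] by auto
 \<comment> \<open>The square of the positive part of a quadratic is C1 and positive exactly in the
   ball; this is as smooth as the partition has to be.\<close>
 define q where "q p x = max 0 ((r p)^2 - (x - p) \<bullet> (x - p))" for p x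
 define \<beta> where "\<beta> p x = (q p x)^2" for p x
 define \<gamma> where "\<gamma> p x = (- 4 * q p x) *\<^sub>R (x - p)" for p x
 have \<beta>0: "\<beta> p x \<ge> 0" for p x by (simp add: \<beta>_def)
 have \<beta>d: "(\<beta> p has_derivative (\<lambda>h. \<gamma> p x \<bullet> h)) (at x)" for p x
 proof -
  have "((\<lambda>x. (r p)^2 - (x - p) \<bullet> (x - p)) has_derivative (\<lambda>h. - (2 * ((x - p) \<bullet> h)))) (at x)"
   by (auto intro!: derivative_eq_intros simp: inner_commute)
  from has_derivative_compose[OF this max0_square_derivative[unfolded has_field_derivative_def]]
  show ?thesis by (simp add: \<beta>_def[abs_def] \<gamma>_def q_def mult_ac)
 qed
 have qc: "continuous_on A (q p)" for A p unfolding q_def[abs_def] by (intro continuous_intros)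
 have \<beta>c: "continuous_on A (\<beta> p)" and \<gamma>c: "continuous_on A (\<gamma> p)" for A p
  unfolding \<beta>_def[abs_def] \<gamma>_def[abs_def] by (intro continuous_intros qc)+
 have \<beta>pos: "\<beta> p x > 0" if "x \<in> ball p (r p)" for p x
 proof -
  have "(dist x p)^2 < (r p)^2" using that by (intro power_strict_mono) (auto simp: dist_commute)
  then show ?thesis by (simp add: \<beta>_def q_def dist_norm power2_norm_eq_inner)
 qed
 have \<beta>ball: "x \<in> ball p (r p)" if "\<beta> p x \<noteq> 0" "p \<in> D" for p x
 proof -
  have "(r p)^2 - (x - p) \<bullet> (x - p) > 0" using that by (auto simp: \<beta>_def q_def max_def split: if_splits)
  then have "(dist x p)^2 < (r p)^2" by (simp add: dist_norm power2_norm_eq_inner)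
  moreover have "r p > 0" using r(1) D(1) that(2) by blast
  ultimately have "dist x p < r p" using power_less_imp_less_base[of "dist x p" 2 "r p"] by simp
  then show ?thesis by (simp add: dist_commute)
 qed
 define S where "S x = (\<Sum>p\<in>D. \<beta> p x)" for x
 define GS where "GS x = (\<Sum>p\<in>D. \<gamma> p x)" for x
 have Sc: "continuous_on A S" and GSc: "continuous_on A GS" for A
  unfolding S_def[abs_def] GS_def[abs_def] by (intro continuous_on_sum \<beta>c \<gamma>c)+
 have Spos: "S x > 0" if x: "x \<in> closure U" for x
 proof -
  obtain p where "p \<in> D" "x \<in> ball p (r p)" using D(3) x by blast
  then show ?thesis unfolding S_def using \<beta>pos \<beta>0 D(2) by (intro sum_pos2[of D p]) auto
 qed
 have bd: "\<exists>B\<ge>0. \<forall>x\<in>closure U. norm (f x) \<le> B" if "continuous_on (closure U) f" for f :: "real^'n \<Rightarrow> real^'n"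
 proof -
  have "bounded (f ` closure U)" using compact_continuous_image[OF that compact_dom] by (rule compact_imp_bounded)
  then obtain B where "\<forall>x\<in>closure U. norm (f x) \<le> B" by (auto simp: bounded_iff)
  then show ?thesis by (intro exI[of _ "\<bar>B\<bar>"]) force
 qed
 have Sinv: "continuous_on (closure U) (\<lambda>x. inverse (S x))"
  using Spos by (intro continuous_on_inverse Sc) force
 obtain c1 where c1: "\<And>p. c1 p \<ge> 0" "\<And>p x. x \<in> closure U \<Longrightarrow> norm (inverse (S x) *\<^sub>R \<gamma> p x) \<le> c1 p"
  using bd[OF continuous_on_scaleR[OF Sinv \<gamma>c]] by metis
 obtain c2 where c2: "c2 \<ge> 0" "\<And>x. x \<in> closure U \<Longrightarrow> norm (inverse (S x) *\<^sub>R GS x) \<le> c2"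
  using bd[OF continuous_on_scaleR[OF Sinv GSc]] by metis
 define c where "c = c2 + (\<Sum>p\<in>D. c1 p)"
 have c0: "c \<ge> 0" using c1(1) c2(1) by (simp add: c_def sum_nonneg)
 have c1c: "c1 p + c2 \<le> c" if "p \<in> D" for p
  using member_le_sum[of p D c1] that c1(1) D(2) by (simp add: c_def)
 \<comment> \<open>\<open>Z\<close> counts the error terms, each below a multiple of
   \<open>\<tau>\<close>: per ball the \<open>CARD('n)\<close> gradient components, the weight
   \<open>c\<close> that bounds the gradients of the partition, and one for the function itself. The
   final 1 makes the estimates strict.\<close>
 define Z where "Z = real (card D) * (real CARD('n) + c) + real (card D) + 1"
 have Z: "Z > 0" using c0 by (simp add: Z_def add_nonneg_pos)
 define \<tau> where "\<tau> = e / Z"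
 have \<tau>: "\<tau> > 0" using e Z by (simp add: \<tau>_def)
 obtain d0 where d0: "d0 > 0" "\<And>a b. box a b \<noteq> {} \<Longrightarrow> cbox a b \<subseteq> ball 0 d0 \<Longrightarrow> nm (\<lambda>x. mollify U a b u x - u x) < \<tau>"
  using mollify_approx[OF uL \<tau>] by blast
 let ?Q = "\<lambda>i d. d > 0 \<and> (\<forall>a b. box a b \<noteq> {} \<longrightarrow> cbox a b \<subseteq> ball 0 d \<longrightarrow>
   nm (\<lambda>x. mollify U a b (\<lambda>x. g x $ i) x - g x $ i) < \<tau>)"
 have "\<forall>i. \<exists>d. ?Q i d"
 proof
  fix i
  show "\<exists>d. ?Q i d" by (rule mollify_approx[OF giL[of i] \<tau>]) blast
 qed
 from choice[OF this] obtain d1 where d1: "\<And>i. d1 i > 0" "\<And>i a b. box a b \<noteq> {} \<Longrightarrow> cbox a b \<subseteq> ball 0 (d1 i) \<Longrightarrow>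
   nm (\<lambda>x. mollify U a b (\<lambda>x. g x $ i) x - g x $ i) < \<tau>" by blast
 define \<eta> where "\<eta> = min d0 (Min (range d1))"
 have \<eta>: "\<eta> > 0" "\<eta> \<le> d0" "\<eta> \<le> d1 i" for i
  using d0(1) d1(1) by (auto simp: \<eta>_def Min_gr_iff intro: min.coboundedI2 Min_le)
 have "\<forall>p\<in>D. \<exists>a b. box a b \<noteq> {} \<and> cbox a b \<subseteq> ball 0 \<eta> \<and> (\<forall>x\<in>U \<inter> ball p (r p). \<forall>z\<in>cbox a b. x + z \<in> U)"
  using r(2) \<eta>(1) D(1) by blast
 then obtain a b where ab: "\<And>p. p \<in> D \<Longrightarrow> box (a p) (b p) \<noteq> {}" "\<And>p. p \<in> D \<Longrightarrow> cbox (a p) (b p) \<subseteq> ball 0 \<eta>"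
  and inO: "\<And>p x z. p \<in> D \<Longrightarrow> x \<in> U \<Longrightarrow> x \<in> ball p (r p) \<Longrightarrow> z \<in> cbox (a p) (b p) \<Longrightarrow> x + z \<in> U"
  by (metis IntI)
 define V where "V p = mollify U (a p) (b p) u" for p
 define GV where "GV p = mollify_grad (a p) (b p) u" for p
 define w where "w p x = V p x - u x" for p x
 define W where "W p i x = mollify U (a p) (b p) (\<lambda>x. g x $ i) x - g x $ i" for p i x
 have wL: "w p \<in> L2 U" and wn: "nm (w p) < \<tau>" and WL: "W p i \<in> L2 U" and Wn: "nm (W p i) < \<tau>" if p: "p \<in> D" for p i
 proof -
  have s: "cbox (a p) (b p) \<subseteq> ball 0 d0" "cbox (a p) (b p) \<subseteq> ball 0 (d1 i)"
   using ab(2)[OF p] \<eta>(2) \<eta>(3)[of i] subset_ball by (meson order_trans)+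
  show "w p \<in> L2 U" "W p i \<in> L2 U"
   unfolding w_def[abs_def] W_def[abs_def] V_def
   using mollify_norm_le(1)[OF ab(1)[OF p]] uL giL by auto
  show "nm (w p) < \<tau>" "nm (W p i) < \<tau>"
   unfolding w_def[abs_def] W_def[abs_def] V_def using d0(2)[OF ab(1)[OF p] s(1)] d1(2)[OF ab(1)[OF p] s(2)] by auto
 qed
 define Nu where "Nu x = (\<Sum>p\<in>D. \<beta> p x * V p x)" for x
 define GN where "GN x = (\<Sum>p\<in>D. \<beta> p x *\<^sub>R GV p x + V p x *\<^sub>R \<gamma> p x)" for x
 define v where "v x = Nu x / S x" for x
 define G where "G x = inverse (S x) *\<^sub>R GN x - (Nu x / (S x)^2) *\<^sub>R GS x" for x
 have Vd: "(V p has_derivative (\<lambda>h. GV p x \<bullet> h)) (at x)" for p x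
  unfolding V_def GV_def by (rule mollify_has_derivative[OF uL])
 have GVc: "continuous_on A (GV p)" for A p unfolding GV_def by (rule mollify_grad_continuous[OF uL])
 have Vc: "continuous_on A (V p)" for A p
  by (intro continuous_at_imp_continuous_on ballI has_derivative_continuous[OF Vd])
 have Nd: "(Nu has_derivative (\<lambda>h. GN x \<bullet> h)) (at x)" for x
 proof -
  have "(Nu has_derivative (\<lambda>h. \<Sum>p\<in>D. \<beta> p x * (GV p x \<bullet> h) + (\<gamma> p x \<bullet> h) * V p x)) (at x)"
   unfolding Nu_def[abs_def] by (intro has_derivative_sum has_derivative_mult \<beta>d Vd)
  then show ?thesis by (simp add: GN_def inner_sum_left inner_add_left mult.commute)
 qed
 have Sd: "(S has_derivative (\<lambda>h. GS x \<bullet> h)) (at x)" for x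
  unfolding S_def[abs_def] GS_def inner_sum_left by (intro has_derivative_sum \<beta>d)
 have C1: "C1_closure v G"
  unfolding C1_closure_def
 proof (intro conjI ballI)
  show "continuous_on (closure U) G"
   unfolding G_def[abs_def] GN_def[abs_def] Nu_def[abs_def] using Spos
   by (intro continuous_intros Sinv \<beta>c GVc Vc \<gamma>c Sc GSc) (metis less_irrefl power_not_zero)
  fix x assume x: "x \<in> closure U"
  have "((\<lambda>x. Nu x / S x) has_derivative (\<lambda>h. - Nu x * (inverse (S x) * (GS x \<bullet> h) * inverse (S x)) + (GN x \<bullet> h) / S x)) (at x)"
   using Spos[OF x] by (intro has_derivative_divide Nd Sd) auto
  moreover have "(\<lambda>h. - Nu x * (inverse (S x) * (GS x \<bullet> h) * inverse (S x)) + (GN x \<bullet> h) / S x) = (\<lambda>h. G x \<bullet> h)"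
   by (simp add: G_def inner_diff_left fun_eq_iff divide_inverse power2_eq_square algebra_simps)
  ultimately show "(v has_derivative (\<lambda>h. G x \<bullet> h)) (at x)" by (simp add: v_def[abs_def])
 qed
 have vc: "continuous_on (closure U) v" and Gc: "continuous_on (closure U) G"
  using C1_closure_continuous[OF C1] C1 by (auto simp: C1_closure_def)
 have vL: "v \<in> L2 U" and GL: "G \<in> L2 U" using continuous_L2 vc Gc by auto
 have inv1: "\<beta> p x * inverse (S x) \<le> 1" if "x \<in> closure U" "p \<in> D" for p x
 proof -
  have "\<beta> p x \<le> S x" unfolding S_def using member_le_sum[of p D "\<lambda>p. \<beta> p x"] \<beta>0 D(2) that by simp
  then show ?thesis using Spos[OF that(1)] by (simp add: field_simps)
 qed
 have e1: "\<bar>v x - u x\<bar> \<le> (\<Sum>p\<in>D. norm (w p x))" if x: "x \<in> U" for x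
 proof -
  have xc: "x \<in> closure U" using x closure_subset by blast
  have "v x - u x = (Nu x - u x * S x) * inverse (S x)" using Spos[OF xc] by (simp add: v_def field_simps)
  also have "Nu x - u x * S x = (\<Sum>p\<in>D. \<beta> p x * w p x)"
   by (simp add: Nu_def S_def w_def sum_distrib_left right_diff_distrib sum_subtractf mult.commute)
  finally have "v x - u x = (\<Sum>p\<in>D. (\<beta> p x * inverse (S x)) * w p x)" by (simp add: sum_distrib_left mult_ac)
  also have "\<bar>\<dots>\<bar> \<le> (\<Sum>p\<in>D. norm (w p x))"
  proof (rule order_trans[OF sum_abs], rule sum_mono)
   fix p assume p: "p \<in> D"
   have "\<bar>\<beta> p x * inverse (S x)\<bar> * \<bar>w p x\<bar> \<le> 1 * \<bar>w p x\<bar>"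
    using inv1[OF xc p] \<beta>0[of p x] Spos[OF xc] by (intro mult_right_mono) auto
   then show "\<bar>\<beta> p x * inverse (S x) * w p x\<bar> \<le> norm (w p x)" by (simp add: abs_mult)
  qed
  finally show ?thesis .
 qed
 have "nm (\<lambda>x. v x - u x) \<le> (\<Sum>p\<in>D. nm (w p))"
  using e1 by (intro L2_norm_le_sum[OF D(2) _ wL] L2_measurable L2.S_diff vL uL AE_I2) auto
 also have "\<dots> \<le> real (card D) * \<tau>" using wn by (intro sum_bounded_above) (simp add: less_imp_le)
 also have "\<dots> < Z * \<tau>" using \<tau> c0 by (intro mult_strict_right_mono) (simp_all add: Z_def add_nonneg_pos)
 also have "\<dots> = e" using Z by (simp add: \<tau>_def)
 finally have 1: "nm (\<lambda>x. v x - u x) < e" .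
 have e2: "norm (G x - g x) \<le> (\<Sum>p\<in>D. (\<Sum>i\<in>UNIV. norm (W p i x)) + norm (c * w p x))" if x: "x \<in> U" for x
 proof -
  have xc: "x \<in> closure U" using x closure_subset by blast
  have S0: "S x > 0" by (rule Spos[OF xc])
  define Bw where "Bw = (\<Sum>p\<in>D. \<beta> p x * w p x)"
  have NuB: "Nu x = u x * S x + Bw"
   by (simp add: Nu_def S_def w_def Bw_def sum_distrib_left right_diff_distrib sum_subtractf mult.commute)
  \<comment> \<open>Subtracting \<open>g\<close> and \<open>u\<close> inside the sums isolates the
    errors; the term \<open>u x *\<^sub>R GS x\<close> later cancels against the same contribution
    from \<open>Nu x\<close>.\<close>
  have "GN x = (\<Sum>p\<in>D. \<beta> p x *\<^sub>R (GV p x - g x) + w p x *\<^sub>R \<gamma> p x) + S x *\<^sub>R g x + u x *\<^sub>R GS x"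
   by (simp add: GN_def S_def GS_def w_def sum.distrib scaleR_sum_left scaleR_sum_right algebra_simps sum_subtractf)
  then have "G x - g x = inverse (S x) *\<^sub>R (\<Sum>p\<in>D. \<beta> p x *\<^sub>R (GV p x - g x) + w p x *\<^sub>R \<gamma> p x) - (Bw / (S x)^2) *\<^sub>R GS x"
   using S0 by (simp add: G_def NuB scaleR_add_right add_divide_distrib scaleR_add_left power2_eq_square)
    (simp add: field_simps)?
  also have "\<dots> = (\<Sum>p\<in>D. (\<beta> p x * inverse (S x)) *\<^sub>R (GV p x - g x) + w p x *\<^sub>R (inverse (S x) *\<^sub>R \<gamma> p x)
    - (\<beta> p x * inverse (S x) * w p x) *\<^sub>R (inverse (S x) *\<^sub>R GS x))"
   by (simp add: Bw_def scaleR_sum_right sum_subtractf sum.distrib scaleR_sum_left sum_distrib_left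
     scaleR_add_right divide_inverse power2_eq_square mult_ac)
  finally have eq: "G x - g x = \<dots>" .
  show ?thesis
   unfolding eq
  proof (rule order_trans[OF norm_sum], rule sum_mono)
   fix p assume p: "p \<in> D"
   \<comment> \<open>Where \<open>\<beta> p x\<close> vanishes nothing is known about the mollified
     gradient; elsewhere \<open>x\<close> lies in the ball and \<open>mollify_grad_eq\<close>
     applies.\<close>
   have t1: "norm ((\<beta> p x * inverse (S x)) *\<^sub>R (GV p x - g x)) \<le> (\<Sum>i\<in>UNIV. norm (W p i x))"
   proof (cases "\<beta> p x = 0")
    case True then show ?thesis by (simp add: sum_nonneg)
   next
    case False
    have "(GV p x - g x) $ i = W p i x" for i
     using mollify_grad_eq[OF u inO[OF p x \<beta>ball[OF False p]]] by (simp add: GV_def W_def g_def)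
    then have "norm (GV p x - g x) \<le> (\<Sum>i\<in>UNIV. norm (W p i x))"
     using norm_le_l1_cart[of "GV p x - g x"] by simp
    moreover have "norm ((\<beta> p x * inverse (S x)) *\<^sub>R (GV p x - g x)) \<le> 1 * norm (GV p x - g x)"
     unfolding norm_scaleR using inv1[OF xc p] \<beta>0[of p x] S0 by (intro mult_right_mono) auto
    ultimately show ?thesis by linarith
   qed
   have t2: "norm (w p x *\<^sub>R (inverse (S x) *\<^sub>R \<gamma> p x)) \<le> \<bar>w p x\<bar> * c1 p"
    unfolding norm_scaleR[of "w p x"] using c1(2)[OF xc, of p] by (intro mult_left_mono) auto
   have "\<bar>\<beta> p x * inverse (S x) * w p x\<bar> \<le> \<bar>w p x\<bar>"
   proof -
    have "\<bar>\<beta> p x * inverse (S x)\<bar> * \<bar>w p x\<bar> \<le> 1 * \<bar>w p x\<bar>"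
     using inv1[OF xc p] \<beta>0[of p x] S0 by (intro mult_right_mono) auto
    then show ?thesis by (simp add: abs_mult)
   qed
   then have t3: "norm ((\<beta> p x * inverse (S x) * w p x) *\<^sub>R (inverse (S x) *\<^sub>R GS x)) \<le> \<bar>w p x\<bar> * c2"
    unfolding norm_scaleR[of "\<beta> p x * inverse (S x) * w p x"] using c2(2)[OF xc] by (intro mult_mono) auto
   have "\<bar>w p x\<bar> * (c1 p + c2) \<le> \<bar>w p x\<bar> * c" using c1c[OF p] by (intro mult_left_mono) auto
   then have t4: "\<bar>w p x\<bar> * c1 p + \<bar>w p x\<bar> * c2 \<le> norm (c * w p x)" using c0 by (simp add: abs_mult algebra_simps)
   show "norm ((\<beta> p x * inverse (S x)) *\<^sub>R (GV p x - g x) + w p x *\<^sub>R (inverse (S x) *\<^sub>R \<gamma> p x)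
    - (\<beta> p x * inverse (S x) * w p x) *\<^sub>R (inverse (S x) *\<^sub>R GS x)) \<le> (\<Sum>i\<in>UNIV. norm (W p i x)) + norm (c * w p x)"
    by (rule order_trans[OF norm_triangle_ineq4], rule order_trans[OF add_right_mono[OF norm_triangle_ineq]])
     (use t1 t2 t3 t4 in linarith)
  qed
 qed
 \<comment> \<open>All error functions form one family: \<open>None\<close> stands for the weighted
   error of the function, \<open>Some i\<close> for the error of the i-th gradient
   component.\<close>
 define I where "I = D \<times> (UNIV :: 'n option set)"
 define k where "k pj = (case snd pj of None \<Rightarrow> (\<lambda>x. c * w (fst pj) x) | Some i \<Rightarrow> W (fst pj) i)" for pj
 have sumk: "(\<Sum>pj\<in>I. F (k pj)) = (\<Sum>p\<in>D. (\<Sum>i\<in>UNIV. F (W p i)) + F (\<lambda>x. c * w p x))" for F :: "_ \<Rightarrow> real"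
 proof -
  have "(\<Sum>pj\<in>I. F (k pj)) = (\<Sum>p\<in>D. \<Sum>j\<in>UNIV. F (k (p, j)))"
   unfolding I_def by (rule sum_Times_pair)
  also have "\<dots> = (\<Sum>p\<in>D. (\<Sum>i\<in>UNIV. F (W p i)) + F (\<lambda>x. c * w p x))"
   unfolding k_def fst_conv snd_conv sum_option_case ..
  finally show ?thesis .
 qed
 have kL: "k pj \<in> L2 U" if "pj \<in> I" for pj
  using that wL WL by (auto simp: k_def I_def L2_scale split: option.split)
 have "nm (\<lambda>x. G x - g x) \<le> (\<Sum>pj\<in>I. nm (k pj))"
 proof (rule L2_norm_le_sum[OF _ _ kL])
  show "finite I" using D(2) by (simp add: I_def)
  show "(\<lambda>x. G x - g x) \<in> borel_measurable ?M" by (intro L2_measurable L2.S_diff GL gL)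
  show "AE x in ?M. norm (G x - g x) \<le> (\<Sum>pj\<in>I. norm (k pj x))"
   using e2 sumk[of "\<lambda>f. norm (f _)"] by (intro AE_I2) simp
 qed
 also have "\<dots> = (\<Sum>p\<in>D. (\<Sum>i\<in>UNIV. nm (W p i)) + nm (\<lambda>x. c * w p x))" by (rule sumk)
 also have "\<dots> \<le> (\<Sum>p\<in>D. real CARD('n) * \<tau> + c * \<tau>)"
 proof (intro sum_mono add_mono)
  fix p assume p: "p \<in> D"
  show "(\<Sum>i\<in>UNIV. nm (W p i)) \<le> real CARD('n) * \<tau>"
   using Wn[OF p] sum_bounded_above[of UNIV "\<lambda>i. nm (W p i)" \<tau>] by (simp add: less_imp_le)
  show "nm (\<lambda>x. c * w p x) \<le> c * \<tau>"
   using wn[OF p] c0 L2_norm_scale[OF wL[OF p], of c] by (simp add: mult_left_mono less_imp_le)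
 qed
 also have "\<dots> = (real (card D) * (real CARD('n) + c)) * \<tau>" by (simp add: algebra_simps)
 also have "\<dots> < Z * \<tau>" using \<tau> by (intro mult_strict_right_mono) (simp_all add: Z_def add_nonneg_pos)
 also have "\<dots> = e" using Z by (simp add: \<tau>_def)
 finally have 2: "nm (\<lambda>x. G x - grad U u x) < e" by (simp add: g_def)
 from that[OF C1 1 2] show thesis .
qed

lemma C1_approx_seq:
 assumes u: "u \<in> H1 U"
 obtains v G where "\<And>k::nat. C1_closure (v k) (G k)"
  "tends v u" "tends G (grad U u)"
proof -
 let ?P = "\<lambda>k p. C1_closure (fst p) (snd p) \<and> nm (\<lambda>x. fst p x - u x) < 1 / real (Suc k)
   \<and> nm (\<lambda>x. snd p x - grad U u x) < 1 / real (Suc k)"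
 have "\<exists>p. ?P k p" for k
 proof -
  have "0 < 1 / real (Suc k)" by simp
  from C1_dense[OF u this] obtain v G where "C1_closure v G" "nm (\<lambda>x. v x - u x) < 1 / real (Suc k)"
   "nm (\<lambda>x. G x - grad U u x) < 1 / real (Suc k)" .
  then have "?P k (v, G)" by simp
  then show ?thesis by blast
 qed
 then have "\<forall>k. \<exists>p. ?P k p" by blast
 from choice[OF this] obtain p where p: "\<And>k. ?P k (p k)" by blast
 define v and G where "v k = fst (p k)" and "G k = snd (p k)" for k
 have vG: "\<And>k. C1_closure (v k) (G k)" "\<And>k. nm (\<lambda>x. v k x - u x) < 1 / real (Suc k)"
  "\<And>k. nm (\<lambda>x. G k x - grad U u x) < 1 / real (Suc k)" using p by (auto simp: v_def G_def)
 have lim: "null (\<lambda>k. 1 / real (Suc k))" by real_asymp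
 have "tends v u"
  by (rule Lim_null_comparison[OF _ lim])
   (use less_imp_le[OF vG(2)] in \<open>auto simp: L2_norm_ge_0 intro!: always_eventually\<close>)
 moreover have "tends G (grad U u)"
  by (rule Lim_null_comparison[OF _ lim])
   (use less_imp_le[OF vG(3)] in \<open>auto simp: L2_norm_ge_0 intro!: always_eventually\<close>)
 ultimately show thesis using that vG(1) by blast
qed

text \<open>For C1 approximations the rule is classical, and \<open>weak_gradient_closed\<close>
  passes to the limit. Using continuity of \<open>F'\<close> requires approximations that converge
  almost everywhere, hence the extracted subsequence; boundedness of \<open>F'\<close> provides the
  dominating function.\<close>

lemma H1_chain:
 assumes u: "u \<in> H1 U" and F: "\<And>t. (F has_real_derivative F' t) (at t)"
  and F'c: "continuous_on UNIV F'" and F'b: "\<And>t. \<bar>F' t\<bar> \<le> B"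
 shows "(\<lambda>x. F (u x)) \<in> H1 U" "AE x in MU. grad U (\<lambda>x. F (u x)) x = F' (u x) *\<^sub>R grad U u x"
proof -
 let ?M = "MU"
 have B: "0 \<le> B" using F'b[of 0] by linarith
 have Flip: "\<bar>F s - F t\<bar> \<le> B * \<bar>s - t\<bar>" for s t
  using field_differentiable_bound[of UNIV F F' B s t] F F'b by simp
 have Fc: "continuous_on UNIV F" using F by (intro DERIV_continuous_on) (auto intro: DERIV_subset)
 have uL: "u \<in> L2 U" and gL: "grad U u \<in> L2 U" using u by (auto simp: H1_L2 grad_L2)
 have um: "u \<in> borel_measurable ?M" and gm: "grad U u \<in> borel_measurable ?M" using uL gL by (auto dest: L2_measurable)
 have Fm: "F \<in> borel_measurable borel" "F' \<in> borel_measurable borel"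
  using Fc F'c by (auto intro: borel_measurable_continuous_onI)
 have FuL: "(\<lambda>x. F (u x)) \<in> L2 U"
 proof -
  have "(\<lambda>x. F (u x) - F 0) \<in> L2 U"
   using Flip[of _ 0] um Fm by (intro L2_dominated[OF uL, of _ B]) (auto intro: measurable_compose)
  from L2_add[OF this L2_const[OF dom_lmeasurable, of "F 0"]] show ?thesis by simp
 qed
 have GuL: "(\<lambda>x. F' (u x) *\<^sub>R grad U u x) \<in> L2 U"
  using F'b um gm Fm by (intro L2_dominated[OF gL, of _ B])
   (auto intro!: borel_measurable_scaleR mult_right_mono intro: measurable_compose)
 obtain v0 G0 where v0: "\<And>k. C1_closure (v0 k) (G0 k)" "tends v0 u"
  "tends G0 (grad U u)" using C1_approx_seq[OF u] by blast
 have C1L: "C1_closure v G \<Longrightarrow> v \<in> L2 U" "C1_closure v G \<Longrightarrow> G \<in> L2 U" for v G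
  using continuous_L2 C1_closure_continuous by (auto simp: C1_closure_def)
 obtain r :: "nat \<Rightarrow> nat" where r: "strict_mono r" "AE x in ?M. (\<lambda>k. v0 (r k) x) \<longlonglongrightarrow> u x"
  using L2_AE_subseq[OF C1L(1)[OF v0(1)] uL v0(2)] by blast
 define v G where "v k = v0 (r k)" and "G k = G0 (r k)" for k
 have vG: "C1_closure (v k) (G k)" for k using v0(1) by (simp add: v_def G_def)
 have vl: "tends v u" and Gl: "tends G (grad U u)"
  using LIMSEQ_subseq_LIMSEQ[OF v0(2) r(1)] LIMSEQ_subseq_LIMSEQ[OF v0(3) r(1)] by (auto simp: v_def G_def o_def)
 have vL: "v k \<in> L2 U" and GL: "G k \<in> L2 U" for k using C1L[OF vG] by auto
 have FC1: "C1_closure (\<lambda>x. F (v k x)) (\<lambda>x. F' (v k x) *\<^sub>R G k x)" for k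
  unfolding C1_closure_def
 proof (intro conjI ballI)
  show "continuous_on (closure U) (\<lambda>x. F' (v k x) *\<^sub>R G k x)"
   using vG[of k] C1_closure_continuous[OF vG[of k]]
   by (intro continuous_on_scaleR continuous_on_compose2[OF F'c]) (auto simp: C1_closure_def)
  fix x assume "x \<in> closure U"
  then have "(v k has_derivative (\<lambda>h. G k x \<bullet> h)) (at x)" using vG[of k] by (auto simp: C1_closure_def)
  from has_derivative_compose[OF this F[unfolded has_field_derivative_def]]
  show "((\<lambda>x. F (v k x)) has_derivative (\<lambda>h. (F' (v k x) *\<^sub>R G k x) \<bullet> h)) (at x)" by simp
 qed
 have FvH: "(\<lambda>x. F (v k x)) \<in> H1 U" for k by (rule C1_closure_H1(1)[OF FC1])
 have FGL: "(\<lambda>x. F' (v k x) *\<^sub>R G k x) \<in> L2 U" for k by (rule C1L(2)[OF FC1])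
 have w: "weak_gradient U (\<lambda>x. F (v k x)) (\<lambda>x. F' (v k x) *\<^sub>R G k x)" for k
 proof -
  have "weak_gradient U (\<lambda>x. F (v k x)) (grad U (\<lambda>x. F (v k x)))" by (rule grad_weak[OF FvH])
  moreover have "(LINT x|?M. grad U (\<lambda>x. F (v k x)) x $ i * f x) = (LINT x|?M. (F' (v k x) *\<^sub>R G k x) $ i * f x)"
   if "f \<in> test_functions U" for f i
   using C1_closure_H1(2)[OF FC1[of k]] L2_measurable[OF L2_component[OF grad_L2[OF FvH[of k]]]]
    L2_measurable[OF L2_component[OF FGL[of k]]] L2_measurable[OF test_L2'(1)[OF that]]
   by (intro integral_cong_AE borel_measurable_times) (auto elim!: eventually_mono)
  ultimately show ?thesis by (simp add: weak_gradient_iff)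
 qed
 have l1: "null (\<lambda>k. nm (\<lambda>x. F (v k x) - F (u x)))"
 proof (rule Lim_null_comparison)
  show "\<forall>\<^sub>F k in sequentially. norm (nm (\<lambda>x. F (v k x) - F (u x))) \<le> B * nm (\<lambda>x. v k x - u x)"
   using Flip B H1_L2[OF FvH] FuL vL uL
   by (intro always_eventually allI) (auto simp: L2_norm_ge_0 intro!: L2_norm_mono L2_measurable L2.S_diff)
  show "null (\<lambda>k. B * nm (\<lambda>x. v k x - u x))" using tendsto_mult_right_zero[OF vl] .
 qed
 \<comment> \<open>\<open>X\<close> carries the error of the gradients, \<open>Y\<close> that of the
   factor \<open>F'\<close>; the latter tends to 0 by dominated convergence, without a rate.\<close>
 define X where "X k x = F' (v k x) *\<^sub>R (G k x - grad U u x)" for k x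
 define Y where "Y k x = (F' (v k x) - F' (u x)) *\<^sub>R grad U u x" for k x
 have Fvm: "(\<lambda>x. F' (v k x)) \<in> borel_measurable ?M" "(\<lambda>x. F' (u x)) \<in> borel_measurable ?M" for k
  using measurable_compose[OF L2_measurable[OF vL[of k]] Fm(2)] measurable_compose[OF um Fm(2)] by auto
 have XL: "X k \<in> L2 U" "nm (X k) \<le> B * nm (\<lambda>x. G k x - grad U u x)" for k
 proof -
  have d: "(\<lambda>x. G k x - grad U u x) \<in> L2 U" using GL gL by simp
  have m: "X k \<in> borel_measurable ?M" unfolding X_def[abs_def] using Fvm L2_measurable[OF d] by measurable
  have "AE x in ?M. norm (X k x) \<le> B * norm (G k x - grad U u x)"
   using F'b by (auto simp: X_def intro!: mult_right_mono)
  from L2_dominated[OF d m this] L2_norm_mono[OF d m B this]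
  show "X k \<in> L2 U" "nm (X k) \<le> B * nm (\<lambda>x. G k x - grad U u x)" .
 qed
 have Ym: "Y k \<in> borel_measurable ?M" for k unfolding Y_def[abs_def] using Fvm(1)[of k] Fvm(2) gm by measurable
 have Yb: "AE x in ?M. norm (Y k x) \<le> (2 * B) * norm (grad U u x)" for k
 proof -
  have "\<bar>F' s - F' t\<bar> \<le> 2 * B" for s t using F'b[of s] F'b[of t] by linarith
  then show ?thesis by (auto simp: Y_def intro!: mult_right_mono)
 qed
 have YL: "Y k \<in> L2 U" for k by (rule L2_dominated[OF gL Ym Yb])
 have Yl: "null (\<lambda>k. nm (Y k))"
 proof (rule L2_dominated_convergence[OF Ym gL _ Yb])
  show "AE x in ?M. null (\<lambda>k. Y k x)"
   using r(2)
  proof eventually_elim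
   case (elim x)
   have "(\<lambda>k. F' (v k x)) \<longlonglongrightarrow> F' (u x)"
    using elim F'c continuous_on_tendsto_compose[of UNIV F' "\<lambda>k. v k x" "u x" sequentially] by (simp add: v_def)
   from tendsto_scaleR[OF tendsto_diff[OF this tendsto_const[of "F' (u x)"]] tendsto_const[of "grad U u x"]]
   show ?case by (simp add: Y_def)
  qed
 qed
 have l2: "null (\<lambda>k. nm (\<lambda>x. F' (v k x) *\<^sub>R G k x - F' (u x) *\<^sub>R grad U u x))"
 proof (rule Lim_null_comparison)
  have eq: "(\<lambda>x. F' (v k x) *\<^sub>R G k x - F' (u x) *\<^sub>R grad U u x) = (\<lambda>x. X k x + Y k x)" for k
   by (simp add: X_def Y_def fun_eq_iff algebra_simps)
  show "\<forall>\<^sub>F k in sequentially. norm (nm (\<lambda>x. F' (v k x) *\<^sub>R G k x - F' (u x) *\<^sub>R grad U u x))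
    \<le> B * nm (\<lambda>x. G k x - grad U u x) + nm (Y k)"
  proof (intro always_eventually allI)
   fix k
   show "norm (nm (\<lambda>x. F' (v k x) *\<^sub>R G k x - F' (u x) *\<^sub>R grad U u x))
    \<le> B * nm (\<lambda>x. G k x - grad U u x) + nm (Y k)"
    unfolding eq real_norm_def abs_of_nonneg[OF L2_norm_ge_0]
    using L2_triangle[OF XL(1)[of k] YL[of k]] XL(2)[of k] by linarith
  qed
  show "null (\<lambda>k. B * nm (\<lambda>x. G k x - grad U u x) + nm (Y k))"
   using tendsto_add[OF tendsto_mult_right_zero[OF Gl] Yl] by simp
 qed
 have "weak_gradient U (\<lambda>x. F (u x)) (\<lambda>x. F' (u x) *\<^sub>R grad U u x)"
  by (rule weak_gradient_closed[OF H1_L2[OF FvH] FGL w FuL GuL l1 l2])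
 from weak_gradient_grad[OF FuL GuL this]
 show "(\<lambda>x. F (u x)) \<in> H1 U" "AE x in ?M. grad U (\<lambda>x. F (u x)) x = F' (u x) *\<^sub>R grad U u x" .
qed

end

section \<open>The eigenbasis and compactness\<close>

lemma borel_measurable_vec_components:
 fixes f :: "'a \<Rightarrow> real^'m"
 assumes "\<And>i. (\<lambda>x. f x $ i) \<in> borel_measurable M"
 shows "f \<in> borel_measurable M"
proof -
 have eq: "f = (\<lambda>x. \<Sum>i\<in>UNIV. (f x $ i) *\<^sub>R axis i 1)"
  by (simp add: fun_eq_iff vec_eq_iff axis_def if_distrib cong: if_cong)
 show ?thesis
  by (subst eq) (intro borel_measurable_sum borel_measurable_scaleR assms borel_measurable_const)
qed

lemma borel_measurable_matrix_vector:
 fixes B :: "'a \<Rightarrow> real^'m^'n" and g :: "'a \<Rightarrow> real^'m"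
 assumes B: "B \<in> borel_measurable M" and g: "g \<in> borel_measurable M"
 shows "(\<lambda>x. B x *v g x) \<in> borel_measurable M"
proof (rule borel_measurable_vec_components)
 fix i
 have "(\<lambda>x. B x $ i) \<in> borel_measurable M"
 proof -
  have "continuous_on UNIV (\<lambda>M::real^'m^'n. M $ i)" by (intro continuous_intros)
  from measurable_compose[OF B borel_measurable_continuous_onI[OF this]] show ?thesis .
 qed
 then show "(\<lambda>x. (B x *v g x) $ i) \<in> borel_measurable M"
  using g by (simp add: matrix_vector_mul_component)
qed

lemma norm_matrix_vector_le:
 fixes B :: "real^'m^'n"
 shows "norm (B *v v) \<le> norm B * norm v"
proof -
 have "norm (B *v v) = L2_set (\<lambda>i. norm ((B *v v) $ i)) UNIV" by (simp add: norm_vec_def)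
 also have "\<dots> \<le> L2_set (\<lambda>i. norm (B $ i) * norm v) UNIV"
  by (intro L2_set_mono) (auto simp: matrix_vector_mul_component Cauchy_Schwarz_ineq2)
 also have "\<dots> = norm B * norm v" by (simp add: norm_vec_def[of B] L2_set_left_distrib)
 finally show ?thesis .
qed

locale neumann = lipschitz_dom U for U :: "(real^'n) set" +
 fixes A :: "real^'n \<Rightarrow> real^'n^'n" and Q :: "real^'n \<Rightarrow> real" and \<Lambda>1 \<Lambda>2 :: real
  and lam :: "nat \<Rightarrow> real" and phi :: "nat \<Rightarrow> real^'n \<Rightarrow> real"
 assumes nonempty: "U \<noteq> {}"
  and coeffs: "elliptic_coefficients U \<Lambda>1 \<Lambda>2 A Q"
  and basis: "neumann_eigenbasis U A Q lam phi"
begin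

abbreviation "en \<equiv> energy_form U A Q"
abbreviation "cf u k \<equiv> inn u (phi k)"
abbreviation "psum u m \<equiv> (\<lambda>x. \<Sum>k<m. cf u k * phi k x)"

lemma \<Lambda>1_pos: "0 < \<Lambda>1" and \<Lambda>_le: "\<Lambda>1 \<le> \<Lambda>2"
 using coeffs by (auto simp: elliptic_coefficients_def)

lemma A_measurable: "A \<in> bm" and Q_measurable: "Q \<in> bm"
 using coeffs by (auto simp: elliptic_coefficients_def Linfty_def)

lemma A_bound: obtains c where "0 \<le> c" "AE x in MU. norm (A x) \<le> c"
proof -
 obtain c where "AE x in MU. norm (A x) \<le> c" using coeffs by (auto simp: elliptic_coefficients_def Linfty_def)
 then show thesis by (intro that[of "\<bar>c\<bar>"]) (auto elim: eventually_mono)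
qed

lemma Q_bound: obtains q where "0 \<le> q" "AE x in MU. \<bar>Q x\<bar> \<le> q"
proof -
 obtain c where "AE x in MU. norm (Q x) \<le> c" using coeffs by (auto simp: elliptic_coefficients_def Linfty_def)
 then show thesis by (intro that[of "\<bar>c\<bar>"]) (auto elim: eventually_mono)
qed

lemma A_sym: "AE x in MU. \<forall>v w. (A x *v v) \<bullet> w = (A x *v w) \<bullet> v"
proof -
 have "AE x in MU. transpose (A x) = A x" using coeffs by (auto simp: elliptic_coefficients_def elim: eventually_mono)
 then show ?thesis
 proof eventually_elim
  case (elim x)
  have "(A x *v v) \<bullet> w = v \<bullet> (transpose (A x) *v w)" for v w
   by (metis dot_lmul_matrix inner_commute transpose_matrix_vector)
  then show ?case using elim by (simp add: inner_commute)
 qed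
qed

lemma A_elliptic: "AE x in MU. \<forall>v. \<Lambda>1 * (norm v)^2 \<le> (A x *v v) \<bullet> v \<and> (A x *v v) \<bullet> v \<le> \<Lambda>2 * (norm v)^2"
 using coeffs by (auto simp: elliptic_coefficients_def elim: eventually_mono)

lemma Q_nonneg: "AE x in MU. 0 \<le> Q x"
 using coeffs by (auto simp: elliptic_coefficients_def)

lemma A_L2: "g \<in> L2 U \<Longrightarrow> (\<lambda>x. A x *v g x) \<in> L2 U"
proof -
 assume g: "g \<in> L2 U"
 obtain c where c: "0 \<le> c" "AE x in MU. norm (A x) \<le> c" using A_bound .
 show ?thesis
 proof (rule L2_dominated[OF g])
  show "(\<lambda>x. A x *v g x) \<in> bm"
   using A_measurable L2_measurable[OF g] by (rule borel_measurable_matrix_vector)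
  show "AE x in MU. norm (A x *v g x) \<le> c * norm (g x)"
   using c(2) by eventually_elim (meson norm_matrix_vector_le mult_right_mono norm_ge_zero order_trans)
 qed
qed

lemma A_L2_norm: obtains c where "0 \<le> c" "\<And>g. g \<in> L2 U \<Longrightarrow> nm (\<lambda>x. A x *v g x) \<le> c * nm g"
proof -
 obtain c where c: "0 \<le> c" "AE x in MU. norm (A x) \<le> c" using A_bound .
 have "nm (\<lambda>x. A x *v g x) \<le> c * nm g" if g: "g \<in> L2 U" for g
 proof (rule L2_norm_mono[OF g L2_measurable[OF A_L2[OF g]] c(1)])
  show "AE x in MU. norm (A x *v g x) \<le> c * norm (g x)"
   using c(2) by eventually_elim (meson norm_matrix_vector_le mult_right_mono norm_ge_zero order_trans)
 qed
 with c(1) that show thesis by blast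
qed

lemma Q_L2: "u \<in> L2 U \<Longrightarrow> (\<lambda>x. Q x * u x) \<in> L2 U"
proof -
 assume u: "u \<in> L2 U"
 obtain q where q: "0 \<le> q" "AE x in MU. \<bar>Q x\<bar> \<le> q" using Q_bound .
 show ?thesis
 proof (rule L2_dominated[OF u])
  show "(\<lambda>x. Q x * u x) \<in> bm"
   using Q_measurable L2_measurable[OF u] by measurable
  show "AE x in MU. norm (Q x * u x) \<le> q * norm (u x)"
   using q(2) by eventually_elim (simp add: abs_mult mult_right_mono)
 qed
qed

lemma energy_eq: "en u v = inn (\<lambda>x. A x *v grad U u x) (grad U v) + inn (\<lambda>x. Q x * u x) v"
 by (simp add: energy_form_def L2_inner_def)

sublocale E: semi_inner "H1 U" "energy_form U A Q"
proof
 fix u v w :: "real^'n \<Rightarrow> real" and a :: real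
 show "(\<lambda>x. 0) \<in> H1 U" by (rule const_H1)
 assume u: "u \<in> H1 U"
 have uL: "u \<in> L2 U" and gL: "grad U u \<in> L2 U" using u by (auto simp: H1_L2 grad_L2)
 have AL: "(\<lambda>x. A x *v grad U u x) \<in> L2 U" and QL: "(\<lambda>x. Q x * u x) \<in> L2 U" using uL gL by (auto simp: A_L2 Q_L2)
 show sc: "(\<lambda>x. a *\<^sub>R u x) \<in> H1 U" using H1_scale[OF u] by simp
 show "0 \<le> en u u"
 proof -
  have "0 \<le> (LINT x|MU. (A x *v grad U u x) \<bullet> grad U u x)"
  proof (rule integral_nonneg_AE, use A_elliptic in eventually_elim)
   case (elim x)
   then show ?case using \<Lambda>1_pos by (meson mult_nonneg_nonneg order_trans less_imp_le zero_le_power2)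
  qed
  moreover have "0 \<le> (LINT x|MU. Q x * u x * u x)"
   using Q_nonneg by (intro integral_nonneg_AE) (auto elim!: eventually_mono simp: mult.assoc)
  ultimately show ?thesis by (simp add: energy_form_def)
 qed
 { assume w: "w \<in> H1 U"
  have wL: "w \<in> L2 U" and gwL: "grad U w \<in> L2 U" using w by (auto simp: H1_L2 grad_L2)
  have "inn (\<lambda>x. A x *v grad U (\<lambda>x. a * u x) x) (grad U w) = inn (\<lambda>x. a *\<^sub>R (A x *v grad U u x)) (grad U w)"
  proof (rule L2_inner_cong_AE)
   show "AE x in MU. A x *v grad U (\<lambda>x. a * u x) x = a *\<^sub>R (A x *v grad U u x)"
    using grad_scale[OF u, of a] by eventually_elim (simp add: matrix_vector_mult_scaleR)
  qed (use A_L2[OF grad_L2[OF H1_scale[OF u, of a]]] AL gwL in \<open>auto intro: L2_measurable\<close>)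
  then show "en (\<lambda>x. a *\<^sub>R u x) w = a * en u w"
   using L2.ip_scale_left[OF AL gwL, of a] L2.ip_scale_left[OF QL wL, of a]
   by (simp add: energy_eq mult.left_commute distrib_left) }
 assume v: "v \<in> H1 U"
 have vL: "v \<in> L2 U" and gvL: "grad U v \<in> L2 U" using v by (auto simp: H1_L2 grad_L2)
 have AvL: "(\<lambda>x. A x *v grad U v x) \<in> L2 U" and QvL: "(\<lambda>x. Q x * v x) \<in> L2 U" using vL gvL by (auto simp: A_L2 Q_L2)
 show "(\<lambda>x. u x + v x) \<in> H1 U" by (rule H1_add[OF u v])
 show "en u v = en v u"
 proof -
  have "(LINT x|MU. (A x *v grad U u x) \<bullet> grad U v x) = (LINT x|MU. (A x *v grad U v x) \<bullet> grad U u x)"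
   using AL AvL gL gvL A_sym by (intro integral_cong_AE) (auto dest!: L2_measurable elim: eventually_mono)
  then show ?thesis by (simp add: energy_form_def mult_ac)
 qed
 assume w: "w \<in> H1 U"
 have wL: "w \<in> L2 U" and gwL: "grad U w \<in> L2 U" using w by (auto simp: H1_L2 grad_L2)
 have "inn (\<lambda>x. A x *v grad U (\<lambda>x. u x + v x) x) (grad U w) = inn (\<lambda>x. A x *v grad U u x + A x *v grad U v x) (grad U w)"
 proof (rule L2_inner_cong_AE)
  show "AE x in MU. A x *v grad U (\<lambda>x. u x + v x) x = A x *v grad U u x + A x *v grad U v x"
   using grad_add[OF u v] by eventually_elim (simp add: matrix_vector_right_distrib)
 qed (use A_L2[OF grad_L2[OF H1_add[OF u v]]] L2_add[OF AL AvL] gwL in \<open>auto intro: L2_measurable\<close>)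
 then show "en (\<lambda>x. u x + v x) w = en u w + en v w"
  using L2.ip_add_left[OF AL AvL gwL] L2.ip_add_left[OF QL QvL wL]
  by (simp add: energy_eq distrib_left)
qed

lemma energy_coercive:
 assumes u: "u \<in> H1 U" shows "\<Lambda>1 * (nm (grad U u))^2 \<le> en u u"
proof -
 have gL: "grad U u \<in> L2 U" by (rule grad_L2[OF u])
 have "(LINT x|MU. \<Lambda>1 * (norm (grad U u x))^2) \<le> (LINT x|MU. (A x *v grad U u x) \<bullet> grad U u x)"
 proof (rule integral_mono_AE)
  show "AE x in MU. \<Lambda>1 * (norm (grad U u x))^2 \<le> (A x *v grad U u x) \<bullet> grad U u x"
   using A_elliptic by eventually_elim blast
 qed (use L2_integrable_sq[OF gL] L2_inner_integrable[OF A_L2[OF gL] gL] in auto)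
 moreover have "0 \<le> (LINT x|MU. Q x * u x * u x)"
  using Q_nonneg by (intro integral_nonneg_AE) (auto elim!: eventually_mono simp: mult.assoc)
 ultimately show ?thesis by (simp add: energy_form_def L2_norm_sq_eq)
qed

lemma energy_upper:
 obtains q where "0 \<le> q" "\<And>u. u \<in> H1 U \<Longrightarrow> en u u \<le> \<Lambda>2 * (nm (grad U u))^2 + q * (nm u)^2"
proof -
 obtain q where q: "0 \<le> q" "AE x in MU. \<bar>Q x\<bar> \<le> q" using Q_bound .
 have "en u u \<le> \<Lambda>2 * (nm (grad U u))^2 + q * (nm u)^2" if u: "u \<in> H1 U" for u
 proof -
  have gL: "grad U u \<in> L2 U" and uL: "u \<in> L2 U" using u by (auto simp: H1_L2 grad_L2)
  have "(LINT x|MU. (A x *v grad U u x) \<bullet> grad U u x) \<le> (LINT x|MU. \<Lambda>2 * (norm (grad U u x))^2)"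
  proof (rule integral_mono_AE)
   show "AE x in MU. (A x *v grad U u x) \<bullet> grad U u x \<le> \<Lambda>2 * (norm (grad U u x))^2"
    using A_elliptic by eventually_elim blast
  qed (use L2_integrable_sq[OF gL] L2_inner_integrable[OF A_L2[OF gL] gL] in auto)
  moreover have "(LINT x|MU. (Q x * u x) * u x) \<le> (LINT x|MU. q * (norm (u x))^2)"
  proof (rule integral_mono_AE)
   show "AE x in MU. (Q x * u x) * u x \<le> q * (norm (u x))^2"
    using q(2) by eventually_elim (simp add: power2_eq_square mult.assoc mult_right_mono)
  qed (use L2_integrable_sq[OF uL] L2_prod_integrable[OF Q_L2[OF uL] uL] in auto)
  ultimately show ?thesis by (simp add: energy_form_def L2_norm_sq_eq)
 qed
 with q(1) that show thesis by blast
qed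

lemma phi_dia: "phi k \<in> L2_dia U Q" and phi_H1: "phi k \<in> H1 U" and lam_pos: "0 < lam k"
 and lam_mono: "mono lam" and lam_inf: "filterlim lam at_top sequentially"
 and phi_orth: "inn (phi k) (phi l) = (if k = l then 1 else 0)"
 using basis by (auto simp: neumann_eigenbasis_def neumann_operator_def)

lemma L2_dia_L2: "u \<in> L2_dia U Q \<Longrightarrow> u \<in> L2 U"
 by (auto simp: L2_dia_def split: if_splits)

lemma phi_L2 [simp]: "phi k \<in> L2 U"
 by (rule H1_L2[OF phi_H1])

lemma energy_phi: "v \<in> H1 U \<Longrightarrow> en (phi k) v = lam k * cf v k"
proof -
 assume v: "v \<in> H1 U"
 then have "en (phi k) v = inn (\<lambda>x. lam k * phi k x) v"
  using basis by (auto simp: neumann_eigenbasis_def neumann_operator_def)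
 then show ?thesis using H1_L2[OF v] by (simp add: L2_inner_scale_left L2.ip_sym)
qed

lemma energy_phi_phi: "en (phi k) (phi l) = (if k = l then lam k else 0)"
 by (simp add: energy_phi phi_H1 phi_orth)

lemma energy_bessel:
 assumes u: "u \<in> H1 U" and I: "finite I" shows "(\<Sum>k\<in>I. lam k * (cf u k)^2) \<le> en u u"
proof -
 have "(\<Sum>k\<in>I. (en u (phi k))^2 / lam k) \<le> en u u"
  by (rule E.bessel[OF I phi_H1 u energy_phi_phi lam_pos])
 moreover have "(en u (phi k))^2 / lam k = lam k * (cf u k)^2" for k
  using lam_pos[of k] u by (simp add: E.ip_sym[OF u phi_H1] energy_phi power2_eq_square)
 ultimately show ?thesis by simp
qed

lemma psum_L2 [simp]: "psum u m \<in> L2 U"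
 by (intro L2.S_sum L2_scale) simp

lemma psum_H1: "psum u m \<in> H1 U"
 by (intro E.S_sum H1_scale phi_H1)

lemma residual_norm:
 assumes "u \<in> L2 U"
 shows "(nm (\<lambda>x. u x - psum u m x))^2 = (nm u)^2 - (\<Sum>k<m. (cf u k)^2)"
 using L2.ip_orth_sub[of "{..<m}" phi U u "\<lambda>_. 1" "cf u"] assms
 by (simp add: phi_orth L2_norm_sq power2_eq_square[of "cf u _", symmetric])

lemma psum_tendsto:
 assumes "u \<in> L2_dia U Q" shows "null (\<lambda>m. nm (\<lambda>x. u x - psum u m x))"
proof -
 have "tends (psum u) u"
  using assms basis by (auto simp: neumann_eigenbasis_def L2_strong_lim_def)
 then show ?thesis using L2_norm_commute[OF L2_dia_L2[OF assms] psum_L2] by simp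
qed

lemma parseval:
 assumes "u \<in> L2_dia U Q" shows "(\<lambda>k. (cf u k)^2) sums (nm u)^2"
proof -
 have "(\<lambda>m. (nm u)^2 - (nm (\<lambda>x. u x - psum u m x))^2) \<longlonglongrightarrow> (nm u)^2 - 0^2"
  by (intro tendsto_intros psum_tendsto assms)
 then show ?thesis by (simp add: sums_def residual_norm[OF L2_dia_L2[OF assms]])
qed

text \<open>In the modes from \<open>m\<close> on, the energy is at least \<open>lam m\<close> times
  the squared L2 norm. As \<open>lam\<close> tends to infinity, functions of bounded energy are
  uniformly close to finite sums, which is the source of compactness.\<close>

lemma residual_energy:
 assumes u: "u \<in> H1 U" "u \<in> L2_dia U Q"
 shows "(nm (\<lambda>x. u x - psum u m x))^2 \<le> en u u / lam m"
proof -
 have "(\<Sum>k<M. (cf u k)^2) - (\<Sum>k<m. (cf u k)^2) \<le> en u u / lam m" for M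
 proof -
  have "(\<Sum>k<M. (cf u k)^2) - (\<Sum>k<m. (cf u k)^2) \<le> (\<Sum>k\<in>{m..<M}. (cf u k)^2)"
  proof (cases "m \<le> M")
   case True
   have "{..<M} = {..<m} \<union> {m..<M}" using True by auto
   then have "(\<Sum>k<M. (cf u k)^2) = (\<Sum>k<m. (cf u k)^2) + (\<Sum>k\<in>{m..<M}. (cf u k)^2)"
    by (simp add: sum.union_disjoint ivl_disj_int)
   then show ?thesis by simp
  next
   case False
   then have "(\<Sum>k<M. (cf u k)^2) \<le> (\<Sum>k<m. (cf u k)^2)" by (intro sum_mono2) auto
   then show ?thesis using False by simp
  qed
  also have "\<dots> \<le> (\<Sum>k\<in>{m..<M}. lam k * (cf u k)^2 / lam m)"
  proof (rule sum_mono)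
   fix k assume "k \<in> {m..<M}"
   then have "lam m \<le> lam k" using lam_mono by (auto simp: mono_def)
   then show "(cf u k)^2 \<le> lam k * (cf u k)^2 / lam m"
    using lam_pos[of m] by (simp add: pos_le_divide_eq mult.commute mult_right_mono)
  qed
  also have "\<dots> \<le> en u u / lam m"
   using energy_bessel[OF u(1), of "{m..<M}"] lam_pos[of m]
   by (simp add: sum_divide_distrib[symmetric] divide_right_mono less_imp_le)
  finally show ?thesis .
 qed
 moreover have "(\<lambda>M. (\<Sum>k<M. (cf u k)^2) - (\<Sum>k<m. (cf u k)^2)) \<longlonglongrightarrow> (nm u)^2 - (\<Sum>k<m. (cf u k)^2)"
  using parseval[OF u(2)] unfolding sums_def by (intro tendsto_diff tendsto_const)
 ultimately have "(nm u)^2 - (\<Sum>k<m. (cf u k)^2) \<le> en u u / lam m"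
  by (meson LIMSEQ_le_const2)
 then show ?thesis by (simp add: residual_norm[OF H1_L2[OF u(1)]])
qed

lemma poincare:
 assumes "u \<in> H1 U" "u \<in> L2_dia U Q" shows "lam 0 * (nm u)^2 \<le> en u u"
 using residual_energy[OF assms, of 0] lam_pos[of 0] by (simp add: field_simps)

text \<open>The constant removed by \<open>dia\<close>, taken as 0 when \<open>Q\<close> is not
  almost everywhere zero. With it both cases in the definition of \<open>L2_dia\<close> become the
  linear condition \<open>kap u = 0\<close>.\<close>

definition kap :: "(real^'n \<Rightarrow> real) \<Rightarrow> real" where
 "kap u = (if (AE x in MU. Q x = 0) then mean_value U u else 0)"

lemma dia_eq: "dia U Q u = (\<lambda>x. u x - kap u)"
 by (auto simp: dia_def kap_def)

lemma measure_pos: "0 < measure lebesgue U"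
proof -
 have "\<not> negligible U" using open_not_negligible[OF open_dom nonempty] .
 then show ?thesis using dom_lmeasurable
  by (metis measure_nonneg negligible_iff_measure0 order_le_less)
qed

lemma integral_const: "(LINT x|MU. c) = c * measure lebesgue U" for c :: real
 using dom_sets by (simp add: measure_restrict_space)

lemma L2_int: "u \<in> L2 U \<Longrightarrow> integrable MU u" for u :: "real^'n \<Rightarrow> real"
 by (rule L2_integrable[OF dom_lmeasurable])

lemma dia_L2_dia: "u \<in> L2 U \<Longrightarrow> dia U Q u \<in> L2_dia U Q"
proof -
 assume u: "u \<in> L2 U"
 have "dia U Q u \<in> L2 U" unfolding dia_eq using u L2_const[OF dom_lmeasurable, of "kap u"] by simp
 moreover have "(LINT x|MU. u x - mean_value U u) = 0"
 proof -
  have "(LINT x|MU. u x - mean_value U u) = (LINT x|MU. u x) - (LINT x|MU. mean_value U u)"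
   using L2_int[OF u] L2_int[OF L2_const[OF dom_lmeasurable]] by (rule Bochner_Integration.integral_diff)
  then show ?thesis unfolding integral_const using measure_pos by (simp add: mean_value_def)
 qed
 ultimately show ?thesis by (auto simp: L2_dia_def dia_def)
qed

lemma L2_dia_kap: "u \<in> L2_dia U Q \<longleftrightarrow> u \<in> L2 U \<and> kap u = 0"
 using measure_pos by (auto simp: L2_dia_def kap_def mean_value_def)

lemma kap_lin: "u \<in> L2 U \<Longrightarrow> v \<in> L2 U \<Longrightarrow> kap (\<lambda>x. a * u x + b * v x) = a * kap u + b * kap v"
 using L2_int[of u] L2_int[of v] by (simp add: kap_def mean_value_def add_divide_distrib)

lemma kap_diff: "u \<in> L2 U \<Longrightarrow> v \<in> L2 U \<Longrightarrow> kap (\<lambda>x. u x - v x) = kap u - kap v"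
 using kap_lin[of u v 1 "-1"] by simp

lemma kap_bound: "u \<in> L2 U \<Longrightarrow> \<bar>kap u\<bar> * sqrt (measure lebesgue U) \<le> nm u"
proof -
 assume u: "u \<in> L2 U"
 let ?m = "measure lebesgue U"
 have "\<bar>LINT x|MU. u x\<bar> \<le> sqrt ?m * nm u"
  using integral_norm_le_L2[OF dom_lmeasurable u] by (intro order_trans[OF integral_abs_bound]) simp
 then have "\<bar>mean_value U u\<bar> \<le> sqrt ?m * nm u / ?m"
  using measure_pos by (simp add: mean_value_def divide_right_mono)
 then have "\<bar>mean_value U u\<bar> * sqrt ?m \<le> sqrt ?m * nm u / ?m * sqrt ?m"
  by (intro mult_right_mono) auto
 also have "\<dots> = nm u" using measure_pos by (simp add: field_simps flip: power2_eq_square)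
 finally show ?thesis by (auto simp: kap_def L2_norm_ge_0)
qed

lemma L2_norm_const: "nm (\<lambda>x. c::real) = \<bar>c\<bar> * sqrt (measure lebesgue U)"
proof -
 have "(LINT x|MU. (norm c)^2) = c^2 * measure lebesgue U" using integral_const[of "(norm c)^2"] by simp
 then show ?thesis by (simp add: L2_norm_eq real_sqrt_mult)
qed

lemma L2_norm_dia: "u \<in> L2 U \<Longrightarrow> nm (dia U Q u) \<le> 2 * nm u"
proof -
 assume u: "u \<in> L2 U"
 have "nm (\<lambda>x. u x - kap u) \<le> nm u + nm (\<lambda>x. kap u)"
  using L2.nrm_triangle_diff[OF u L2_const[OF dom_lmeasurable, of "kap u"]] by (simp add: L2_nrm)
 then show ?thesis using kap_bound[OF u] by (simp add: dia_eq L2_norm_const)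
qed

lemma dia_diff: "u \<in> L2 U \<Longrightarrow> v \<in> L2 U \<Longrightarrow> dia U Q (\<lambda>x. u x - v x) = (\<lambda>x. dia U Q u x - dia U Q v x)"
 by (simp add: dia_eq kap_diff fun_eq_iff)

lemma dia_L2: "u \<in> L2 U \<Longrightarrow> dia U Q u \<in> L2 U"
 by (rule L2_dia_L2[OF dia_L2_dia])

lemma dia_tendsto:
 assumes "\<And>j. u j \<in> L2 U" "v \<in> L2 U" "((\<lambda>j. nm (\<lambda>x. u j x - v x)) \<longlongrightarrow> 0) F"
 shows "((\<lambda>j. nm (\<lambda>x. dia U Q (u j) x - dia U Q v x)) \<longlongrightarrow> 0) F"
proof (rule Lim_null_comparison)
 show "\<forall>\<^sub>F j in F. norm (nm (\<lambda>x. dia U Q (u j) x - dia U Q v x)) \<le> 2 * nm (\<lambda>x. u j x - v x)"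
  using L2_norm_dia[OF L2.S_diff[OF assms(1,2)]]
  by (intro always_eventually allI) (simp add: L2_norm_ge_0 dia_diff[OF assms(1,2)])
 show "((\<lambda>j. 2 * nm (\<lambda>x. u j x - v x)) \<longlongrightarrow> 0) F" using tendsto_mult_right_zero[OF assms(3)] .
qed

lemma dia_H1: "u \<in> H1 U \<Longrightarrow> dia U Q u \<in> H1 U"
 and grad_dia: "u \<in> H1 U \<Longrightarrow> AE x in MU. grad U (dia U Q u) x = grad U u x"
proof -
 assume u: "u \<in> H1 U"
 show "dia U Q u \<in> H1 U" unfolding dia_eq by (rule H1_diff[OF u const_H1(1)])
 show "AE x in MU. grad U (dia U Q u) x = grad U u x"
  unfolding dia_eq using grad_diff[OF u const_H1(1), of "kap u"] const_H1(2)[of "kap u"]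
  by eventually_elim simp
qed

lemma L2_norm_grad_dia: "u \<in> H1 U \<Longrightarrow> nm (grad U (dia U Q u)) = nm (grad U u)"
 by (intro L2_norm_cong_AE grad_dia L2_measurable grad_L2 dia_H1)

lemma L2_dia_diff: "u \<in> L2_dia U Q \<Longrightarrow> v \<in> L2_dia U Q \<Longrightarrow> (\<lambda>x. u x - v x) \<in> L2_dia U Q"
 by (simp add: L2_dia_kap kap_diff)

lemma L2_dia_closed:
 assumes u: "\<And>j. u j \<in> L2_dia U Q" and v: "v \<in> L2 U" and lim: "tends u v"
 shows "v \<in> L2_dia U Q"
proof -
 have uL: "u j \<in> L2 U" for j by (rule L2_dia_L2[OF u])
 have "\<bar>kap v\<bar> * sqrt (measure lebesgue U) \<le> nm (\<lambda>x. u j x - v x)" for j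
  using kap_bound[OF L2.S_diff[OF uL[of j] v]] u[of j] by (simp add: kap_diff[OF uL v] L2_dia_kap)
 then have "\<bar>kap v\<bar> * sqrt (measure lebesgue U) \<le> 0"
  using LIMSEQ_le_const[OF lim] by blast
 then have "kap v = 0" using measure_pos
  by (metis abs_le_zero_iff mult_le_0_iff not_less real_sqrt_gt_0_iff abs_ge_zero)
 then show ?thesis using v by (simp add: L2_dia_kap)
qed

section \<open>Spectral series in H1, weak convergence of gradients and compactness\<close>

lemma energy_psum_diff:
 assumes "m \<le> n"
 shows "en (\<lambda>x. psum u n x - psum u m x) (\<lambda>x. psum u n x - psum u m x) = (\<Sum>k\<in>{m..<n}. lam k * (cf u k)^2)"
proof -
 have "psum u n x - psum u m x = (\<Sum>k\<in>{m..<n}. cf u k *\<^sub>R phi k x)" for x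
 proof -
  have "{..<n} = {..<m} \<union> {m..<n}" using assms by auto
  then show ?thesis by (simp add: sum.union_disjoint ivl_disj_int)
 qed
 then show ?thesis
  using E.ip_orth_expansion[of "{m..<n}" phi lam "cf u" "cf u"]
  by (simp add: phi_H1 energy_phi_phi power2_eq_square mult.assoc)
qed

lemma bounded_partial_sums_summable:
 fixes f :: "nat \<Rightarrow> real"
 assumes "\<And>k. 0 \<le> f k" "\<And>m. (\<Sum>k<m. f k) \<le> K" shows "summable f"
 using assms by (intro summableI_nonneg_bounded)

text \<open>The converse of \<open>energy_bessel\<close>: bounded weighted sums make the partial
  sums Cauchy in energy, ellipticity makes their gradients Cauchy in L2, and closedness of the weak
  gradient identifies the limit.\<close>

lemma spectral_H1:
 assumes u: "u \<in> L2_dia U Q" and K: "\<And>m. (\<Sum>k<m. lam k * (cf u k)^2) \<le> K"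
 shows "u \<in> H1 U" "tends (\<lambda>m. grad U (psum u m)) (grad U u)"
proof -
 have uL: "u \<in> L2 U" by (rule L2_dia_L2[OF u])
 have gL: "grad U (psum u m) \<in> L2 U" for m by (rule grad_L2[OF psum_H1])
 have sm: "summable (\<lambda>k. lam k * (cf u k)^2)"
  using K lam_pos by (intro bounded_partial_sums_summable) (auto simp: less_imp_le)
 have cau: "\<exists>N. \<forall>i\<ge>N. \<forall>j\<ge>N. nm (\<lambda>x. grad U (psum u i) x - grad U (psum u j) x) < e" if e: "e > 0" for e
 proof -
  have "\<Lambda>1 * e^2 > 0" using e \<Lambda>1_pos by simp
  then obtain N where N: "\<And>m n. m \<ge> N \<Longrightarrow> norm (\<Sum>k\<in>{m..<n}. lam k * (cf u k)^2) < \<Lambda>1 * e^2"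
   using sm[unfolded summable_Cauchy] by blast
  have half: "nm (\<lambda>x. grad U (psum u i) x - grad U (psum u j) x) < e" if "j \<ge> N" "j \<le> i" for i j
  proof -
   have "\<Lambda>1 * (nm (grad U (\<lambda>x. psum u i x - psum u j x)))^2 \<le> (\<Sum>k\<in>{j..<i}. lam k * (cf u k)^2)"
    using energy_coercive[OF H1_diff[OF psum_H1[of u i] psum_H1[of u j]]] energy_psum_diff[OF that(2), of u] by simp
   also have "\<dots> < \<Lambda>1 * e^2" using N[OF that(1), of i] by simp
   finally have "(nm (grad U (\<lambda>x. psum u i x - psum u j x)))^2 < e^2" using \<Lambda>1_pos by simp
   then show ?thesis using e power_less_imp_less_base[of _ 2 e] by (simp add: L2_norm_grad_diff psum_H1)
  qed
  have "nm (\<lambda>x. grad U (psum u i) x - grad U (psum u j) x) < e" if "i \<ge> N" "j \<ge> N" for i j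
   using half[of i j] half[of j i] that L2_norm_commute[OF gL gL, of i j] by (cases "i \<le> j") auto
  then show ?thesis by blast
 qed
 obtain g where g: "g \<in> L2 U" and glim: "tends (\<lambda>m. grad U (psum u m)) g"
  using L2_complete[OF dom_lmeasurable gL cau] by blast
 have ulim: "tends (psum u) u"
  using psum_tendsto[OF u] L2_norm_commute[OF psum_L2 uL] by simp
 have "weak_gradient U u g"
  by (rule weak_gradient_closed[OF psum_L2 gL grad_weak[OF psum_H1] uL g ulim glim])
 from weak_gradient_grad[OF uL g this] have H: "u \<in> H1 U" and ae: "AE x in MU. grad U u x = g x" .
 show "u \<in> H1 U" by (rule H)
 have "nm (\<lambda>x. grad U (psum u m) x - grad U u x) = nm (\<lambda>x. grad U (psum u m) x - g x)" for m
  using ae gL g grad_L2[OF H] by (intro L2_norm_cong_AE L2_measurable L2.S_diff) (auto elim: eventually_mono)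
 then show "tends (\<lambda>m. grad U (psum u m)) (grad U u)" using glim by simp
qed

lemma cf_tendsto:
 assumes "\<And>j. u j \<in> L2 U" "v \<in> L2 U" "tends u v"
 shows "(\<lambda>j. cf (u j) k) \<longlonglongrightarrow> cf v k"
 using assms by (intro L2_inner_tendsto) auto

text \<open>Bounds on finitely many weighted coefficients survive L2 convergence, one coefficient at
  a time, so the limit satisfies the hypothesis of \<open>spectral_H1\<close> without any extraction
  of weakly convergent gradients.\<close>

lemma H1_limit:
 assumes u: "\<And>j. u j \<in> H1 U" and C: "\<And>j. nm (grad U (u j)) \<le> C"
  and v: "v \<in> L2 U" and lim: "tends u v"
 shows "v \<in> H1 U"
proof -
 obtain q where q: "0 \<le> q" "\<And>u. u \<in> H1 U \<Longrightarrow> en u u \<le> \<Lambda>2 * (nm (grad U u))^2 + q * (nm u)^2"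
  using energy_upper by blast
 have uL: "u j \<in> L2 U" for j by (rule H1_L2[OF u])
 let ?w = "\<lambda>j. dia U Q (u j)"
 have wlim: "tends ?w (dia U Q v)" by (rule dia_tendsto[OF uL v lim])
 have "Bseq (\<lambda>j. nm (\<lambda>x. u j x - v x))" using lim by (intro convergent_imp_Bseq) (auto simp: convergent_def)
 then obtain B where B: "\<And>j. nm (\<lambda>x. u j x - v x) \<le> B" by (auto simp: Bseq_def L2_norm_ge_0)
 have un: "nm (u j) \<le> B + nm v" for j
  using L2_triangle[OF L2.S_diff[OF uL[of j] v] v] B[of j] by simp
 have D: "0 \<le> \<Lambda>2" using \<Lambda>1_pos \<Lambda>_le by simp
 define K where "K = \<Lambda>2 * C^2 + q * (2 * (B + nm v))^2"
 have wK: "en (?w j) (?w j) \<le> K" for j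
 proof -
  have "nm (?w j) \<le> 2 * (B + nm v)" using un[of j] by (intro order_trans[OF L2_norm_dia[OF uL[of j]]]) simp
  moreover have "nm (grad U (?w j)) \<le> C" using C[of j] by (simp add: L2_norm_grad_dia[OF u])
  ultimately have "\<Lambda>2 * (nm (grad U (?w j)))^2 + q * (nm (?w j))^2 \<le> K"
   unfolding K_def using q(1) D by (intro add_mono mult_left_mono power_mono) (auto simp: L2_norm_ge_0)
  then show ?thesis using q(2)[OF dia_H1[OF u[of j]]] by linarith
 qed
 have "(\<Sum>k<m. lam k * (cf (dia U Q v) k)^2) \<le> K" for m
 proof (rule LIMSEQ_le_const2)
  show "(\<lambda>j. \<Sum>k<m. lam k * (cf (?w j) k)^2) \<longlonglongrightarrow> (\<Sum>k<m. lam k * (cf (dia U Q v) k)^2)"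
   by (intro tendsto_intros cf_tendsto dia_L2 uL v wlim)
  show "\<exists>N. \<forall>n\<ge>N. (\<Sum>k<m. lam k * (cf (?w n) k)^2) \<le> K"
   using energy_bessel[OF dia_H1[OF u], of "{..<m}"] wK by (meson finite_lessThan order_trans)
 qed
 from spectral_H1(1)[OF dia_L2_dia[OF v] this] have "dia U Q v \<in> H1 U" .
 from H1_add[OF this const_H1(1)[of "kap v"]] show ?thesis by (simp add: dia_eq)
qed

text \<open>The functional \<open>l\<close> is bounded in energy, so its values \<open>b\<close> on
  the eigenfunctions satisfy a dual Bessel inequality with weights \<open>1 / lam k\<close>. The
  tail of that series bounds the contribution of the high modes uniformly for bounded energy, which
  leaves finitely many coefficients.\<close>

lemma grad_functional_tail:
 assumes w: "w \<in> L2 U" and e: "e > 0"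
 obtains m where "\<And>v. v \<in> H1 U \<Longrightarrow> v \<in> L2_dia U Q \<Longrightarrow>
  \<bar>inn (grad U v) w\<bar> \<le> \<bar>inn (grad U (psum v m)) w\<bar> + e * sqrt (en v v)"
proof -
 define l where "l v = inn (grad U v) w" for v
 define b where "b k = l (phi k)" for k
 have ladd: "l (\<lambda>x. a * u x + c * v x) = a * l u + c * l v" if "u \<in> H1 U" "v \<in> H1 U" for a c u v
 proof -
  have "l (\<lambda>x. a * u x + c * v x) = inn (\<lambda>x. a *\<^sub>R grad U u x + c *\<^sub>R grad U v x) w"
   unfolding l_def using that grad_lin[OF that, of a c] w grad_L2
   by (intro L2_inner_cong_AE) (auto intro!: L2_measurable L2_add L2_scaleR)
  then show ?thesis using that w by (simp add: l_def grad_L2 L2.ip_add_left L2.ip_scale_left)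
 qed
 have lsum: "l (\<lambda>x. \<Sum>k\<in>I. a k * phi k x) = (\<Sum>k\<in>I. a k * b k)" if "finite I" for I a
  using that
 proof (induction I rule: finite_induct)
  case empty
  show ?case using ladd[OF phi_H1 phi_H1, of 0 0 0 0] by simp
 next
  case (insert k I)
  have "(\<lambda>x. \<Sum>k\<in>I. a k * phi k x) \<in> H1 U" by (intro E.S_sum H1_scale phi_H1)
  from ladd[OF phi_H1 this, of "a k" k 1] insert show ?case by (simp add: b_def)
 qed
 have lbound: "\<bar>l v\<bar> \<le> nm w / sqrt \<Lambda>1 * sqrt (en v v)" if v: "v \<in> H1 U" for v
 proof -
  have "sqrt (\<Lambda>1 * (nm (grad U v))^2) \<le> sqrt (en v v)"
   by (rule real_sqrt_le_mono[OF energy_coercive[OF v]])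
  then have "nm (grad U v) \<le> sqrt (en v v) / sqrt \<Lambda>1"
   using \<Lambda>1_pos by (simp add: real_sqrt_mult L2_norm_ge_0 field_simps)
  then have "nm (grad U v) * nm w \<le> sqrt (en v v) / sqrt \<Lambda>1 * nm w"
   by (rule mult_right_mono) (rule L2_norm_ge_0)
  then show ?thesis using L2_cauchy_schwarz[OF grad_L2[OF v] w] by (simp add: l_def mult_ac)
 qed
 define B where "B = nm w / sqrt \<Lambda>1"
 have bsum: "(\<Sum>k<m. (b k)^2 / lam k) \<le> B^2" for m
 proof -
  define s where "s = (\<Sum>k<m. (b k)^2 / lam k)"
  have s0: "s \<ge> 0" using lam_pos by (simp add: s_def sum_nonneg less_imp_le)
  \<comment> \<open>The Riesz representative of \<open>l\<close> on the span of the first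
    \<open>m\<close> modes: \<open>l ?z\<close> and the energy of \<open>?z\<close> both equal
    \<open>s\<close>, so the bound on \<open>l\<close> becomes
    \<open>s \<le> B * sqrt s\<close>.\<close>
  let ?z = "\<lambda>x. \<Sum>k<m. (b k / lam k) * phi k x"
  have z: "?z \<in> H1 U" by (intro E.S_sum H1_scale phi_H1)
  have "l ?z = s" using lsum[of "{..<m}" "\<lambda>k. b k / lam k"] by (simp add: s_def power2_eq_square)
  moreover have "en ?z ?z = s"
  proof -
   have "en ?z ?z = (\<Sum>k<m. lam k * (b k / lam k) * (b k / lam k))"
    using E.ip_orth_expansion[of "{..<m}" phi lam "\<lambda>k. b k / lam k" "\<lambda>k. b k / lam k"]
    by (simp add: phi_H1 energy_phi_phi)
   also have "\<dots> = s" unfolding s_def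
    by (intro sum.cong refl) (use lam_pos in \<open>simp add: power2_eq_square less_imp_neq[symmetric]\<close>)
   finally show ?thesis .
  qed
  ultimately have "s \<le> B * sqrt s" using lbound[OF z] s0 by (simp add: B_def)
  then have "sqrt s \<le> B \<or> s = 0"
   using s0 by (metis mult_le_cancel_right real_sqrt_eq_zero_cancel_iff real_sqrt_ge_0_iff real_sqrt_mult_self abs_of_nonneg order_less_le)
  then have "sqrt s \<le> B" using \<Lambda>1_pos by (auto simp: B_def L2_norm_ge_0 less_imp_le)
  then have "(sqrt s)^2 \<le> B^2" using s0 by (intro power_mono) auto
  then show ?thesis using s0 by (simp add: s_def)
 qed
 have "summable (\<lambda>k. (b k)^2 / lam k)"
  using bsum lam_pos by (intro bounded_partial_sums_summable) (auto simp: less_imp_le)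
 then obtain m where m: "\<And>n. norm (\<Sum>k\<in>{m..<n}. (b k)^2 / lam k) < e^2"
  unfolding summable_Cauchy using e by (meson order_refl zero_less_power)
 have "\<bar>l v\<bar> \<le> \<bar>l (psum v m)\<bar> + e * sqrt (en v v)" if v: "v \<in> H1 U" "v \<in> L2_dia U Q" for v
 proof (rule LIMSEQ_le_const2)
  have "tends (\<lambda>n. grad U (psum v n)) (grad U v)"
   using spectral_H1(2)[OF v(2)] energy_bessel[OF v(1)] by blast
  then have "(\<lambda>n. l (psum v n)) \<longlonglongrightarrow> l v"
   unfolding l_def by (intro L2_inner_tendsto grad_L2 psum_H1 v w)
  then show "(\<lambda>n. \<bar>l (psum v n)\<bar>) \<longlonglongrightarrow> \<bar>l v\<bar>" by (rule tendsto_rabs)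
  have "\<bar>l (psum v n)\<bar> \<le> \<bar>l (psum v m)\<bar> + e * sqrt (en v v)" if n: "n \<ge> m" for n
  proof -
   have "{..<n} = {..<m} \<union> {m..<n}" using n by auto
   then have "l (psum v n) = l (psum v m) + (\<Sum>k\<in>{m..<n}. cf v k * b k)"
    unfolding lsum[OF finite_lessThan] by (simp add: sum.union_disjoint ivl_disj_int)
   moreover have "\<bar>\<Sum>k\<in>{m..<n}. cf v k * b k\<bar> \<le> e * sqrt (en v v)"
   proof -
    \<comment> \<open>The factor \<open>sqrt (lam k)\<close> is inserted so that Cauchy-Schwarz
      pairs the energy of \<open>v\<close> with the tail of the dual series.\<close>
    have "(\<Sum>k\<in>{m..<n}. cf v k * b k) = (\<Sum>k\<in>{m..<n}. (sqrt (lam k) * cf v k) * (b k / sqrt (lam k)))"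
     using lam_pos by (intro sum.cong refl) (simp add: less_imp_neq[symmetric])
    also have "\<bar>\<dots>\<bar> \<le> (\<Sum>k\<in>{m..<n}. \<bar>sqrt (lam k) * cf v k\<bar> * \<bar>b k / sqrt (lam k)\<bar>)"
     unfolding abs_mult[symmetric] by (rule sum_abs)
    also have "\<dots> \<le> L2_set (\<lambda>k. sqrt (lam k) * cf v k) {m..<n} * L2_set (\<lambda>k. b k / sqrt (lam k)) {m..<n}"
     by (rule L2_set_mult_ineq)
    also have "\<dots> \<le> sqrt (en v v) * e"
    proof (rule mult_mono)
     have "(\<Sum>k\<in>{m..<n}. (sqrt (lam k) * cf v k)^2) \<le> en v v"
      using energy_bessel[OF v(1), of "{m..<n}"] lam_pos by (simp add: power_mult_distrib less_imp_le)
     then show "L2_set (\<lambda>k. sqrt (lam k) * cf v k) {m..<n} \<le> sqrt (en v v)"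
      unfolding L2_set_def by (rule real_sqrt_le_mono)
     have "(\<Sum>k\<in>{m..<n}. (b k / sqrt (lam k))^2) \<le> e^2"
      using m[of n] lam_pos by (simp add: power_divide less_imp_le)
     from real_sqrt_le_mono[OF this] show "L2_set (\<lambda>k. b k / sqrt (lam k)) {m..<n} \<le> e"
      using e unfolding L2_set_def by simp
    qed (use E.ip_nonneg[OF v(1)] in \<open>auto simp: L2_set_nonneg\<close>)
    finally show ?thesis by (simp add: mult.commute)
   qed
   ultimately show ?thesis by linarith
  qed
  then show "\<exists>N. \<forall>n\<ge>N. \<bar>l (psum v n)\<bar> \<le> \<bar>l (psum v m)\<bar> + e * sqrt (en v v)" by blast
 qed
 then show thesis using that unfolding l_def by blast
qed

text \<open>The difference is first passed through \<open>dia\<close>, which leaves its gradient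
  unchanged and makes it expandable in eigenfunctions. The finitely many coefficients that matter
  tend to 0 by L2 convergence.\<close>

lemma grad_weak_lim:
 assumes u: "\<And>j. u j \<in> H1 U" and C: "\<And>j. nm (grad U (u j)) \<le> C"
  and v: "v \<in> L2 U" and lim: "tends u v"
  and w: "w \<in> L2 U"
 shows "(\<lambda>j. inn (grad U (u j)) w) \<longlonglongrightarrow> inn (grad U v) w"
proof -
 have vH: "v \<in> H1 U" by (rule H1_limit[OF u C v lim])
 have uL: "u j \<in> L2 U" for j by (rule H1_L2[OF u])
 define z where "z j = dia U Q (\<lambda>x. u j x - v x)" for j
 have dH: "(\<lambda>x. u j x - v x) \<in> H1 U" for j by (rule H1_diff[OF u vH])
 have zH: "z j \<in> H1 U" and zd: "z j \<in> L2_dia U Q" for j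
  unfolding z_def by (rule dia_H1[OF dH], rule dia_L2_dia[OF H1_L2[OF dH]])
 obtain q where q: "0 \<le> q" "\<And>u. u \<in> H1 U \<Longrightarrow> en u u \<le> \<Lambda>2 * (nm (grad U u))^2 + q * (nm u)^2"
  using energy_upper by blast
 have "Bseq (\<lambda>j. nm (\<lambda>x. u j x - v x))" using lim by (intro convergent_imp_Bseq) (auto simp: convergent_def)
 then obtain B where B: "\<And>j. nm (\<lambda>x. u j x - v x) \<le> B" by (auto simp: Bseq_def L2_norm_ge_0)
 have D: "0 \<le> \<Lambda>2" using \<Lambda>1_pos \<Lambda>_le by simp
 have zl: "null (\<lambda>j. nm (z j))"
 proof (rule Lim_null_comparison)
  show "\<forall>\<^sub>F j in sequentially. norm (nm (z j)) \<le> 2 * nm (\<lambda>x. u j x - v x)"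
   using L2_norm_dia[OF H1_L2[OF dH]] by (intro always_eventually allI) (simp add: z_def L2_norm_ge_0)
  show "null (\<lambda>j. 2 * nm (\<lambda>x. u j x - v x))" using tendsto_mult_right_zero[OF lim] .
 qed
 have gz: "inn (grad U (z j)) w = inn (grad U (u j)) w - inn (grad U v) w" for j
 proof -
  have "AE x in MU. grad U (z j) x = grad U (u j) x - grad U v x"
   unfolding z_def using grad_dia[OF dH[of j]] grad_diff[OF u[of j] vH] by eventually_elim simp
  then have "inn (grad U (z j)) w = inn (\<lambda>x. grad U (u j) x - grad U v x) w"
   using zH u vH w by (intro L2_inner_cong_AE L2_measurable L2.S_diff grad_L2)
  then show ?thesis using u vH w by (simp add: L2.ip_diff_left grad_L2)
 qed
 define K where "K = \<Lambda>2 * (C + nm (grad U v))^2 + q * (2 * B)^2 + 1"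
 have K0: "K > 0" using q(1) D by (simp add: K_def add_nonneg_pos)
 have zK: "en (z j) (z j) \<le> K" for j
 proof -
  have "nm (grad U (z j)) = nm (\<lambda>x. grad U (u j) x - grad U v x)"
   unfolding z_def L2_norm_grad_dia[OF dH] by (rule L2_norm_grad_diff[OF u vH])
  also have "\<dots> \<le> nm (grad U (u j)) + nm (grad U v)"
   using L2.nrm_triangle_diff[OF grad_L2[OF u[of j]] grad_L2[OF vH]] by (simp add: L2_nrm)
  finally have 1: "nm (grad U (z j)) \<le> C + nm (grad U v)" using C[of j] by linarith
  have 2: "nm (z j) \<le> 2 * B"
   unfolding z_def using B[of j] by (intro order_trans[OF L2_norm_dia[OF H1_L2[OF dH]]]) simp
  have "\<Lambda>2 * (nm (grad U (z j)))^2 + q * (nm (z j))^2 \<le> \<Lambda>2 * (C + nm (grad U v))^2 + q * (2 * B)^2"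
   using q(1) D 1 2 by (intro add_mono mult_left_mono power_mono) (auto simp: L2_norm_ge_0)
  then show ?thesis using q(2)[OF zH[of j]] by (simp add: K_def)
 qed
 have "null (\<lambda>j. inn (grad U (z j)) w)"
 proof (rule LIMSEQ_I)
  fix r :: real assume r: "0 < r"
  define e where "e = r / (2 * sqrt K)"
  have e: "e > 0" using r K0 by (simp add: e_def)
  obtain m where m: "\<And>v. v \<in> H1 U \<Longrightarrow> v \<in> L2_dia U Q \<Longrightarrow>
   \<bar>inn (grad U v) w\<bar> \<le> \<bar>inn (grad U (psum v m)) w\<bar> + e * sqrt (en v v)"
   using grad_functional_tail[OF w e] by blast
  have fin: "inn (grad U (psum y m)) w = (\<Sum>k<m. cf y k * inn (grad U (phi k)) w)" for y
  proof (induction m)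
   case 0
   have "inn (grad U (\<lambda>x. 0)) w = inn (\<lambda>x. 0) w"
    using const_H1[of 0] w by (intro L2_inner_cong_AE L2_measurable grad_L2) auto
   then show ?case using w by (simp add: L2.ip_zero_left)
  next
   case (Suc m)
   have "inn (grad U (\<lambda>x. 1 * psum y m x + cf y m * phi m x)) w
     = inn (\<lambda>x. 1 *\<^sub>R grad U (psum y m) x + cf y m *\<^sub>R grad U (phi m) x) w"
    using grad_lin[OF psum_H1[of y m] phi_H1[of m], of 1 "cf y m"] w psum_H1 phi_H1
    by (intro L2_inner_cong_AE L2_measurable L2_add L2_scaleR grad_L2) auto
   also have "\<dots> = inn (grad U (psum y m)) w + cf y m * inn (grad U (phi m)) w"
    using w psum_H1 phi_H1 by (simp add: L2.ip_add_left L2.ip_scale_left grad_L2)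
   finally show ?case using Suc by simp
  qed
  have "(\<lambda>j. inn (grad U (psum (z j) m)) w) \<longlonglongrightarrow> (\<Sum>k<m. 0 * inn (grad U (phi k)) w)"
   unfolding fin
  proof (intro tendsto_sum tendsto_mult tendsto_const)
   fix k
   have "(\<lambda>j. cf (z j) k) \<longlonglongrightarrow> cf (\<lambda>x. 0) k"
    by (rule cf_tendsto) (use zl H1_L2[OF zH] in auto)
   then show "null (\<lambda>j. cf (z j) k)" by (simp add: L2.ip_zero_left)
  qed
  then obtain N where N: "\<And>j. j \<ge> N \<Longrightarrow> \<bar>inn (grad U (psum (z j) m)) w\<bar> < r / 2"
   using LIMSEQ_D[of _ 0 "r/2"] r by fastforce
  have "norm (inn (grad U (z j)) w - 0) < r" if "j \<ge> N" for j
  proof -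
   have "e * sqrt (en (z j) (z j)) \<le> e * sqrt K" using e zK[of j] by (intro mult_left_mono) auto
   also have "\<dots> = r / 2" using K0 by (simp add: e_def)
   finally show ?thesis using m[OF zH zd, of j] N[OF that] by simp
  qed
  then show "\<exists>no. \<forall>n\<ge>no. norm (inn (grad U (z n)) w - 0) < r" by blast
 qed
 then show ?thesis unfolding gz by (simp add: LIM_zero_iff)
qed

text \<open>Rellich's theorem read off the spectrum: along a subsequence for which the removed
  constants and every single coefficient converge, the sequence is Cauchy in L2, because the
  remaining modes are small by \<open>residual_energy\<close>.\<close>

theorem H1_compactness:
 assumes u: "\<And>j::nat. u j \<in> H1 U" and C: "\<And>j. nm (u j) \<le> C" "\<And>j. nm (grad U (u j)) \<le> C"
 obtains r :: "nat \<Rightarrow> nat" and v where "strict_mono r" "v \<in> H1 U"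
  "tends (\<lambda>j. u (r j)) v"
proof -
 have uL: "u j \<in> L2 U" for j by (rule H1_L2[OF u])
 have C0: "C \<ge> 0" using C(1)[of 0] L2_norm_ge_0[of U "u 0"] by linarith
 define w where "w j = dia U Q (u j)" for j
 have wH: "w j \<in> H1 U" and wd: "w j \<in> L2_dia U Q" and wL: "w j \<in> L2 U" for j
  unfolding w_def using dia_H1[OF u] dia_L2_dia[OF uL] dia_L2[OF uL] by auto
 obtain q where q: "0 \<le> q" "\<And>u. u \<in> H1 U \<Longrightarrow> en u u \<le> \<Lambda>2 * (nm (grad U u))^2 + q * (nm u)^2"
  using energy_upper by blast
 have D: "0 \<le> \<Lambda>2" using \<Lambda>1_pos \<Lambda>_le by simp
 define K where "K = \<Lambda>2 * (2 * C)^2 + q * (4 * C)^2"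
 have wn: "nm (w j) \<le> 2 * C" and wg: "nm (grad U (w j)) \<le> C" for j
  unfolding w_def using C(1)[of j] C(2)[of j] L2_norm_dia[OF uL[of j]] L2_norm_grad_dia[OF u[of j]] by auto
 have wK: "en (\<lambda>x. w i x - w j x) (\<lambda>x. w i x - w j x) \<le> K" for i j
 proof -
  have "nm (\<lambda>x. w i x - w j x) \<le> 4 * C"
   using L2.nrm_triangle_diff[OF wL[of i] wL[of j]] wn[of i] wn[of j] by (simp add: L2_nrm)
  moreover have "nm (grad U (\<lambda>x. w i x - w j x)) \<le> 2 * C"
   using L2.nrm_triangle_diff[OF grad_L2[OF wH[of i]] grad_L2[OF wH[of j]]] wg[of i] wg[of j]
   by (simp add: L2_nrm L2_norm_grad_diff wH)
  ultimately have "\<Lambda>2 * (nm (grad U (\<lambda>x. w i x - w j x)))^2 + q * (nm (\<lambda>x. w i x - w j x))^2 \<le> K"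
   unfolding K_def using q(1) D by (intro add_mono mult_left_mono power_mono) (auto simp: L2_norm_ge_0)
  then show ?thesis using q(2)[OF H1_diff[OF wH[of i] wH[of j]]] by linarith
 qed
 have K0: "K \<ge> 0" using wK[of 0 0] E.ip_nonneg[OF H1_diff[OF wH wH], of 0 0] by linarith
 \<comment> \<open>Index 0 holds the constant removed by \<open>dia\<close>, index
   \<open>Suc k\<close> the k-th coefficient.\<close>
 define f where "f j n = (case n of 0 \<Rightarrow> kap (u j) | Suc k \<Rightarrow> cf (w j) k)" for j n
 define F where "F = C / sqrt (measure lebesgue U) + 2 * C"
 have fb: "norm (f j n) \<le> F" for j n
 proof (cases n)
  case 0
  have "\<bar>kap (u j)\<bar> * sqrt (measure lebesgue U) \<le> C" using kap_bound[OF uL[of j]] C(1)[of j] by linarith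
  then have "\<bar>kap (u j)\<bar> \<le> C / sqrt (measure lebesgue U)" using measure_pos by (simp add: pos_le_divide_eq)
  then show ?thesis using 0 C0 by (simp add: f_def F_def)
 next
  case (Suc k)
  have "nm (phi k) = 1" by (simp add: L2_norm_def phi_orth)
  then have "\<bar>cf (w j) k\<bar> \<le> 2 * C" using L2_cauchy_schwarz[OF wL[of j] phi_L2[of k]] wn[of j] by simp
  moreover have "0 \<le> C / sqrt (measure lebesgue U)" using C0 by simp
  ultimately have "\<bar>cf (w j) k\<bar> \<le> F" unfolding F_def by linarith
  then show ?thesis using Suc by (simp add: f_def)
 qed
 obtain r :: "nat \<Rightarrow> nat" where r: "strict_mono r" and fl: "\<And>n. \<exists>l. (\<lambda>j. f (r j) n) \<longlonglongrightarrow> l"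
  by (rule function_convergent_subsequence[of "UNIV :: nat set" f F]) (use fb in auto)
 have cfC: "Cauchy (\<lambda>j. cf (w (r j)) k)" for k
  using fl[of "Suc k"] by (auto simp: f_def intro: convergent_Cauchy convergentI)
 have cau: "\<exists>N. \<forall>i\<ge>N. \<forall>j\<ge>N. nm (\<lambda>x. w (r i) x - w (r j) x) < e" if e: "e > 0" for e
 proof -
  have "\<forall>\<^sub>F m in sequentially. 2 * K / e^2 < lam m" using lam_inf by (simp add: filterlim_at_top_dense)
  then obtain m where m: "2 * K / e^2 < lam m" using eventually_happens'[OF sequentially_bot] by blast
  have Km: "K / lam m < e^2 / 2" using m e lam_pos[of m] by (simp add: field_simps)
  \<comment> \<open>The \<open>m\<close> coefficients, each off by less than \<open>d\<close>,
    contribute at most half of the squared tolerance; \<open>m + 1\<close> avoids a division by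
    zero.\<close>
  define d where "d = sqrt (e^2 / (2 * (real m + 1)))"
  have d: "d > 0" "d^2 = e^2 / (2 * (real m + 1))" using e by (auto simp: d_def)
  have "\<forall>k. \<exists>N. \<forall>i\<ge>N. \<forall>j\<ge>N. \<bar>cf (w (r i)) k - cf (w (r j)) k\<bar> < d"
   using cfC[unfolded Cauchy_def] d(1) by (auto simp: dist_real_def)
  then obtain N where N: "\<And>k i j. i \<ge> N k \<Longrightarrow> j \<ge> N k \<Longrightarrow> \<bar>cf (w (r i)) k - cf (w (r j)) k\<bar> < d" by metis
  define N0 where "N0 = Max (N ` {..m})"
  have N0: "N k \<le> N0" if "k < m" for k unfolding N0_def using that by (intro Max_ge) auto
  have "nm (\<lambda>x. w (r i) x - w (r j) x) < e" if ij: "i \<ge> N0" "j \<ge> N0" for i j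
  proof -
   let ?z = "\<lambda>x. w (r i) x - w (r j) x"
   have zH: "?z \<in> H1 U" by (rule H1_diff[OF wH wH])
   have zd: "?z \<in> L2_dia U Q" by (rule L2_dia_diff[OF wd wd])
   have "(nm ?z)^2 = (\<Sum>k<m. (cf ?z k)^2) + (nm (\<lambda>x. ?z x - psum ?z m x))^2"
    using residual_norm[OF H1_L2[OF zH], of m] by simp
   also have "\<dots> \<le> (\<Sum>k<m. d^2) + K / lam m"
   proof (intro add_mono sum_mono)
    fix k assume "k \<in> {..<m}"
    then have "\<bar>cf ?z k\<bar> < d" using N[of k i j] N0[of k] ij by (simp add: L2.ip_diff_left wL)
    then have "\<bar>cf ?z k\<bar>^2 \<le> d^2" by (intro power_mono) auto
    then show "(cf ?z k)^2 \<le> d^2" by simp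
   next
    show "(nm (\<lambda>x. ?z x - psum ?z m x))^2 \<le> K / lam m"
     using residual_energy[OF zH zd, of m] wK[of "r i" "r j"] lam_pos[of m]
     by (meson divide_right_mono less_imp_le order_trans)
   qed
   also have "(\<Sum>k<m. d^2) \<le> e^2 / 2" using e by (simp add: d(2) field_simps)
   finally have "(nm ?z)^2 < e^2" using Km by linarith
   then show ?thesis using e power_less_imp_less_base[of "nm ?z" 2 e] by simp
  qed
  then show ?thesis by blast
 qed
 obtain z where z: "z \<in> L2 U" and zl: "tends (\<lambda>j. w (r j)) z"
  using L2_complete[OF dom_lmeasurable wL cau] by blast
 have zH: "z \<in> H1 U" by (rule H1_limit[OF wH wg z zl])
 obtain \<kappa> where \<kappa>: "(\<lambda>j. kap (u (r j))) \<longlonglongrightarrow> \<kappa>" using fl[of 0] by (auto simp: f_def)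
 define v where "v x = z x + \<kappa>" for x
 have vH: "v \<in> H1 U" unfolding v_def[abs_def] by (rule H1_add[OF zH const_H1(1)])
 have "tends (\<lambda>j. u (r j)) v"
 proof (rule Lim_null_comparison)
  show "\<forall>\<^sub>F j in sequentially. norm (nm (\<lambda>x. u (r j) x - v x))
    \<le> nm (\<lambda>x. w (r j) x - z x) + \<bar>kap (u (r j)) - \<kappa>\<bar> * sqrt (measure lebesgue U)"
  proof (intro always_eventually allI)
   fix j
   have "(\<lambda>x. u (r j) x - v x) = (\<lambda>x. (w (r j) x - z x) + (kap (u (r j)) - \<kappa>))"
    by (simp add: w_def v_def dia_eq algebra_simps)
   then show "norm (nm (\<lambda>x. u (r j) x - v x))
    \<le> nm (\<lambda>x. w (r j) x - z x) + \<bar>kap (u (r j)) - \<kappa>\<bar> * sqrt (measure lebesgue U)"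
    using L2_triangle[OF L2.S_diff[OF wL[of "r j"] z] L2_const[OF dom_lmeasurable, of "kap (u (r j)) - \<kappa>"]]
    by (simp add: L2_norm_ge_0 L2_norm_const)
  qed
  have "(\<lambda>j. nm (\<lambda>x. w (r j) x - z x) + \<bar>kap (u (r j)) - \<kappa>\<bar> * sqrt (measure lebesgue U))
    \<longlonglongrightarrow> 0 + \<bar>\<kappa> - \<kappa>\<bar> * sqrt (measure lebesgue U)"
   by (intro tendsto_intros zl \<kappa>)
  then show "null (\<lambda>j. nm (\<lambda>x. w (r j) x - z x) + \<bar>kap (u (r j)) - \<kappa>\<bar> * sqrt (measure lebesgue U))"
   by simp
 qed
 with r vH that show thesis by blast
qed

end

section \<open>Finite element functions\<close>

lemma matrix_inv_right:
 fixes B :: "real^'n^'n"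
 assumes "invertible B" shows "B ** matrix_inv B = mat 1"
 using someI_ex[OF assms[unfolded invertible_def]] by (simp add: matrix_inv_def)

text \<open>The columns are the edges leaving \<open>p None\<close>, and affine independence of the
  vertices is linear independence of these edges.\<close>

lemma simplex_matrix_invertible:
 fixes p :: "'n::finite option \<Rightarrow> real^'n"
 assumes inj: "inj p" and ind: "\<not> affine_dependent (range p)"
 shows "invertible (simplex_matrix p)"
proof -
 define e where "e j = p (Some j) - p None" for j
 have "range p - {p None} = range (\<lambda>j. p (Some j))"
 proof -
  have "range p = insert (p None) (range (\<lambda>j. p (Some j)))"
   by (subst UNIV_option_conv) (auto simp: image_image)
  moreover have "p None \<notin> range (\<lambda>j. p (Some j))" using inj by (auto dest: injD)
  ultimately show ?thesis by auto
 qed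
 then have "(\<lambda>x. - p None + x) ` (range p - {p None}) = range e" by (auto simp: image_image e_def)
 then have li: "independent (range e)"
  using ind affine_dependent_iff_dependent2[of "p None" "range p"] by simp
 have inje: "inj e" using inj by (auto simp: inj_def e_def)
 have "c = 0" if c: "simplex_matrix p *v c = 0" for c
 proof -
  have "(\<Sum>j\<in>UNIV. (c $ j) *\<^sub>R e j) = 0"
  proof -
   have "(\<Sum>j\<in>UNIV. (c $ j) *\<^sub>R e j) $ i = (simplex_matrix p *v c) $ i" for i
    by (simp add: e_def simplex_matrix_def matrix_vector_mult_def mult.commute)
   then show ?thesis using c by (simp add: vec_eq_iff)
  qed
  then have "(\<Sum>v\<in>range e. (c $ (inv e v)) *\<^sub>R v) = 0"
   by (simp add: sum.reindex[OF inje] inv_f_f[OF inje])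
  then have "\<forall>v\<in>range e. c $ (inv e v) = 0"
   using conjunct2[OF li[unfolded independent_explicit], THEN spec, of "\<lambda>v. c $ (inv e v)"] by simp
  then show "c = 0" by (simp add: vec_eq_iff inv_f_f[OF inje])
 qed
 then show ?thesis unfolding invertible_left_inverse matrix_left_invertible_ker by blast
qed

lemma transpose_simplex_matrix: "(transpose (simplex_matrix p) *v a) $ j = a \<bullet> (p (Some j) - p None)"
 by (simp add: transpose_def simplex_matrix_def matrix_vector_mult_def inner_vec_def mult.commute)

lemma edge_system_solvable:
 fixes p :: "'n::finite option \<Rightarrow> real^'n"
 assumes "inj p" "\<not> affine_dependent (range p)"
 shows "\<exists>a. \<forall>j. a \<bullet> (p (Some j) - p None) = c j"
proof -
 have "invertible (transpose (simplex_matrix p))"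
  using simplex_matrix_invertible[OF assms] by (rule transpose_invertible)
 then have "transpose (simplex_matrix p) *v (matrix_inv (transpose (simplex_matrix p)) *v (\<chi> j. c j)) = (\<chi> j. c j)"
  by (simp add: matrix_vector_mul_assoc matrix_inv_right)
 then have "\<forall>j. (matrix_inv (transpose (simplex_matrix p)) *v (\<chi> j. c j)) \<bullet> (p (Some j) - p None) = c j"
  by (metis transpose_simplex_matrix vec_lambda_beta)
 then show ?thesis by blast
qed

locale fe_mesh = lipschitz_dom U for U :: "(real^'n) set" +
 fixes T :: "(real^'n) set set" and P :: "(real^'n) set \<Rightarrow> 'n option \<Rightarrow> real^'n" and h \<kappa> :: real
 assumes nonempty: "U \<noteq> {}"
  and lab: "labelled_triangulation U T P"
  and diam: "\<And>K. K \<in> T \<Longrightarrow> diameter K \<le> h"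
  and \<kappa>: "\<kappa> > 0" "\<And>K. K \<in> T \<Longrightarrow> \<exists>x. cball x (\<kappa> * diameter K) \<subseteq> K"
begin

abbreviation "Vh \<equiv> fe_space U T"
abbreviation "pih \<equiv> nodal_interpolant U T"

lemma finite_T: "finite T" and T_cover: "\<Union>T = closure U"
 and P_inj: "K \<in> T \<Longrightarrow> inj (P K)" and P_ind: "K \<in> T \<Longrightarrow> \<not> affine_dependent (range (P K))"
 and K_eq: "K \<in> T \<Longrightarrow> K = convex hull (range (P K))"
 and T_face: "K \<in> T \<Longrightarrow> K' \<in> T \<Longrightarrow> (K \<inter> K') face_of K"
 using lab by (auto simp: labelled_triangulation_def triangulation_def)

lemma K_compact: "K \<in> T \<Longrightarrow> compact K" and K_convex: "K \<in> T \<Longrightarrow> convex K"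
 using K_eq by (metis compact_convex_hull finite_imp_compact finite finite_imageI, metis convex_convex_hull)

lemma K_closed: "K \<in> T \<Longrightarrow> closed K" and K_bounded: "K \<in> T \<Longrightarrow> bounded K"
 using K_compact compact_imp_closed compact_imp_bounded by auto

lemma K_sub: "K \<in> T \<Longrightarrow> x \<in> K \<Longrightarrow> x \<in> closure U"
 using T_cover by auto

lemma P_in: "K \<in> T \<Longrightarrow> P K i \<in> K"
 using K_eq hull_inc[of "P K i" "range (P K)" convex] by simp

lemma K_dist: "K \<in> T \<Longrightarrow> x \<in> K \<Longrightarrow> y \<in> K \<Longrightarrow> dist x y \<le> diameter K"
 by (rule diameter_bounded_bound[OF K_bounded])

lemma diam_pos: "K \<in> T \<Longrightarrow> 0 < diameter K"
proof -
 assume K: "K \<in> T"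
 have "P K None \<noteq> P K (Some undefined)" using P_inj[OF K] by (auto dest: injD)
 then have "0 < dist (P K None) (P K (Some undefined))" by simp
 also have "\<dots> \<le> diameter K" by (intro K_dist P_in K)
 finally show ?thesis .
qed

lemma vertices_eq: "vertices T = (\<Union>K\<in>T. range (P K))"
proof -
 have "p extreme_point_of K \<longleftrightarrow> p \<in> range (P K)" if "K \<in> T" for p K
  using extreme_point_of_convex_hull_affine_independent[OF P_ind[OF that]] K_eq[OF that] by metis
 then show ?thesis by (auto simp: vertices_def)
qed

lemma P_vertex: "K \<in> T \<Longrightarrow> P K i \<in> vertices T"
 by (auto simp: vertices_eq)

lemma barycentric:
 assumes K: "K \<in> T" and x: "x \<in> K"
 obtains l where "\<And>i. 0 \<le> l i" "(\<Sum>i\<in>UNIV. l i) = 1" "x = (\<Sum>i\<in>UNIV. l i *\<^sub>R P K i)"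
proof -
 have "x \<in> convex hull (range (P K))" using x K_eq[OF K] by simp
 then obtain u where u: "\<forall>y\<in>range (P K). 0 \<le> u y" "sum u (range (P K)) = 1" "(\<Sum>y\<in>range (P K). u y *\<^sub>R y) = x"
  by (auto simp: convex_hull_finite)
 show thesis
  by (rule that[of "\<lambda>i. u (P K i)"]) (use u in \<open>auto simp: sum.reindex[OF P_inj[OF K]]\<close>)
qed

lemma fe_affine: "v \<in> Vh \<Longrightarrow> K \<in> T \<Longrightarrow> \<exists>a b. \<forall>x\<in>K. v x = a \<bullet> x + b"
 and fe_continuous: "v \<in> Vh \<Longrightarrow> continuous_on (closure U) v"
 by (auto simp: fe_space_def)

lemma fe_bary:
 assumes K: "K \<in> T" and x: "x \<in> K"
 obtains l where "\<And>i. 0 \<le> l i" "(\<Sum>i\<in>UNIV. l i) = 1" "\<And>v. v \<in> Vh \<Longrightarrow> v x = (\<Sum>i\<in>UNIV. l i * v (P K i))"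
proof -
 obtain l where l: "\<And>i. 0 \<le> l i" "(\<Sum>i\<in>UNIV. l i) = 1" "x = (\<Sum>i\<in>UNIV. l i *\<^sub>R P K i)"
  using barycentric[OF K x] by metis
 have "v x = (\<Sum>i\<in>UNIV. l i * v (P K i))" if v: "v \<in> Vh" for v
 proof -
  obtain a b where ab: "\<And>x. x \<in> K \<Longrightarrow> v x = a \<bullet> x + b" using fe_affine[OF v K] by auto
  have "v x = a \<bullet> (\<Sum>i\<in>UNIV. l i *\<^sub>R P K i) + b * (\<Sum>i\<in>UNIV. l i)" using ab[OF x] l by simp
  also have "\<dots> = (\<Sum>i\<in>UNIV. l i * v (P K i))"
   by (simp add: ab[OF P_in[OF K]] inner_sum_right distrib_left sum.distrib sum_distrib_left mult.commute)
  finally show ?thesis .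
 qed
 with l that show thesis by blast
qed

lemma fe_add: "u \<in> Vh \<Longrightarrow> v \<in> Vh \<Longrightarrow> (\<lambda>x. u x + v x) \<in> Vh"
proof -
 assume uv: "u \<in> Vh" "v \<in> Vh"
 have "\<exists>a b. \<forall>x\<in>K. u x + v x = a \<bullet> x + b" if K: "K \<in> T" for K
 proof -
  obtain a b c d where "\<forall>x\<in>K. u x = a \<bullet> x + b" "\<forall>x\<in>K. v x = c \<bullet> x + d"
   using fe_affine[OF uv(1) K] fe_affine[OF uv(2) K] by blast
  then have "\<forall>x\<in>K. u x + v x = (a + c) \<bullet> x + (b + d)" by (simp add: inner_add_left)
  then show ?thesis by blast
 qed
 then show ?thesis using uv by (auto simp: fe_space_def intro: continuous_on_add)
qed

lemma fe_scale: "u \<in> Vh \<Longrightarrow> (\<lambda>x. c * u x) \<in> Vh"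
proof -
 assume u: "u \<in> Vh"
 have "\<exists>a b. \<forall>x\<in>K. c * u x = a \<bullet> x + b" if K: "K \<in> T" for K
 proof -
  obtain a b where "\<forall>x\<in>K. u x = a \<bullet> x + b" using fe_affine[OF u K] by blast
  then have "\<forall>x\<in>K. c * u x = (c *\<^sub>R a) \<bullet> x + c * b" by (simp add: distrib_left)
  then show ?thesis by blast
 qed
 then show ?thesis using u by (auto simp: fe_space_def intro!: continuous_intros)
qed

lemma fe_const: "(\<lambda>x. c) \<in> Vh"
 by (auto simp: fe_space_def intro: exI[of _ 0] exI[of _ c])

lemma fe_diff: "u \<in> Vh \<Longrightarrow> v \<in> Vh \<Longrightarrow> (\<lambda>x. u x - v x) \<in> Vh"
 using fe_add[of u "\<lambda>x. (-1) * v x"] fe_scale[of v "-1"] by simp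

text \<open>The difference of the affine function with gradient \<open>a\<close> between two points of the inscribed
 ball is controlled by its values at the vertices.\<close>

lemma gradient_bound:
 assumes K: "K \<in> T" and m: "\<And>j. \<bar>a \<bullet> (P K (Some j) - P K None)\<bar> \<le> m" and m0: "0 \<le> m"
 shows "norm a * (\<kappa> * diameter K) \<le> m"
proof (cases "a = 0")
 case False
 let ?C = "{y. \<bar>a \<bullet> (y - P K None)\<bar> \<le> m}"
 have "?C = {y. a \<bullet> y \<le> m + a \<bullet> P K None} \<inter> {y. a \<bullet> y \<ge> a \<bullet> P K None - m}" by (auto simp: inner_diff_right abs_le_iff)
 then have "convex ?C" using convex_halfspace_le convex_halfspace_ge convex_Int by metis
 moreover have "range (P K) \<subseteq> ?C"
 proof
  fix y assume "y \<in> range (P K)"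
  then obtain i where "y = P K i" by blast
  then show "y \<in> ?C" using m m0 by (cases i) auto
 qed
 ultimately have KC: "K \<subseteq> ?C" using hull_minimal[of "range (P K)" ?C convex] K_eq[OF K] by simp
 obtain x where x: "cball x (\<kappa> * diameter K) \<subseteq> K" using \<kappa>(2)[OF K] by blast
 \<comment> \<open>The radius of the inscribed ball in the direction of \<open>a\<close>. The affine
   function differs between the two antipodal points by twice
   \<open>norm a * (\<kappa> * diameter K)\<close>, while at both it is within \<open>m\<close> of
   its value at \<open>P K None\<close>.\<close>
 define e where "e = (\<kappa> * diameter K / norm a) *\<^sub>R a"
 have ne: "norm e = \<kappa> * diameter K" using False \<kappa>(1) diam_pos[OF K] by (simp add: e_def)
 have "x + e \<in> K" "x - e \<in> K" using x ne by (auto simp: subset_iff dist_norm)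
 then have "\<bar>a \<bullet> (x + e - P K None)\<bar> \<le> m" "\<bar>a \<bullet> (x - e - P K None)\<bar> \<le> m" using KC by auto
 then have "\<bar>a \<bullet> (x + e - P K None) - a \<bullet> (x - e - P K None)\<bar> \<le> 2 * m" by linarith
 moreover have "a \<bullet> (x + e - P K None) - a \<bullet> (x - e - P K None) = 2 * (a \<bullet> e)"
  by (simp add: inner_add_right inner_diff_right)
 moreover have "a \<bullet> e = norm a * (\<kappa> * diameter K)" using False
  by (simp add: e_def power2_norm_eq_inner[symmetric] power2_eq_square)
 ultimately show ?thesis by linarith
qed (use m0 in simp)

lemma affine_eq_on:
 fixes a :: "real^'n"
 assumes "x \<in> convex hull C" "\<And>y. y \<in> C \<Longrightarrow> a \<bullet> y + b = a' \<bullet> y + b'"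
 shows "a \<bullet> x + b = a' \<bullet> x + b'"
proof -
 have eq: "{y. a \<bullet> y + b = a' \<bullet> y + b'} = {y. (a - a') \<bullet> y = b' - b}"
  by (auto simp: inner_diff_left algebra_simps)
 have "convex {y. a \<bullet> y + b = a' \<bullet> y + b'}" unfolding eq by (rule convex_hyperplane)
 then have "convex hull C \<subseteq> {y. a \<bullet> y + b = a' \<bullet> y + b'}" using assms(2) by (intro hull_minimal) auto
 then show ?thesis using assms(1) by blast
qed

text \<open>The affine pieces are fixed by their vertex values. On an intersection of two elements
  they agree because it is a common face, the convex hull of vertices that belong to both.\<close>

lemma interpolant_exists: "\<exists>v. v \<in> Vh \<and> (\<forall>p\<in>vertices T. v p = f p)"
proof -
 have "\<exists>a b. \<forall>i. a \<bullet> P K i + b = f (P K i)" if K: "K \<in> T" for K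
 proof -
  obtain a where a: "\<And>j. a \<bullet> (P K (Some j) - P K None) = f (P K (Some j)) - f (P K None)"
   using edge_system_solvable[OF P_inj[OF K] P_ind[OF K], of "\<lambda>j. f (P K (Some j)) - f (P K None)"] by blast
  have "a \<bullet> P K i + (f (P K None) - a \<bullet> P K None) = f (P K i)" for i
   using a by (cases i) (auto simp: inner_diff_right algebra_simps)
  then show ?thesis by blast
 qed
 then obtain a b where ab: "\<And>K i. K \<in> T \<Longrightarrow> a K \<bullet> P K i + b K = f (P K i)" by metis
 define v where "v x = (let K = (SOME K. K \<in> T \<and> x \<in> K) in a K \<bullet> x + b K)" for x
 have agree: "a K \<bullet> x + b K = a K' \<bullet> x + b K'" if K: "K \<in> T" "K' \<in> T" and x: "x \<in> K" "x \<in> K'" for K K' x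
 proof -
  have "(K \<inter> K') face_of convex hull (range (P K))" using T_face[OF K] K_eq[OF K(1)] by simp
  then obtain C where C: "C \<subseteq> range (P K)" "K \<inter> K' = convex hull C"
   using face_of_convex_hull_affine_independent[OF P_ind[OF K(1)]] by auto
  have Cind: "\<not> affine_dependent C" using affine_independent_subset[OF P_ind[OF K(1)] C(1)] .
  have "a K \<bullet> y + b K = a K' \<bullet> y + b K'" if y: "y \<in> C" for y
  proof -
   have "y extreme_point_of (K \<inter> K')"
    using extreme_point_of_convex_hull_affine_independent[OF Cind] y C(2) by simp
   moreover have "(K \<inter> K') face_of K'" using T_face[OF K(2,1)] by (simp add: Int_commute)
   ultimately have "y extreme_point_of K'" using extreme_point_of_face by blast
   then have "y \<in> range (P K')"
    using extreme_point_of_convex_hull_affine_independent[OF P_ind[OF K(2)]] K_eq[OF K(2)] by metis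
   then show ?thesis using ab[OF K(1)] ab[OF K(2)] y C(1) by fastforce
  qed
  moreover have "x \<in> convex hull C" using x C(2) by blast
  ultimately show ?thesis using affine_eq_on by blast
 qed
 have vK: "v x = a K \<bullet> x + b K" if K: "K \<in> T" and x: "x \<in> K" for K x
 proof -
  have "(SOME K. K \<in> T \<and> x \<in> K) \<in> T \<and> x \<in> (SOME K. K \<in> T \<and> x \<in> K)"
   using K x by (intro someI[of "\<lambda>K. K \<in> T \<and> x \<in> K"]) auto
  then show ?thesis using agree[OF _ K _ x] unfolding v_def Let_def by blast
 qed
 have "continuous_on (\<Union>K\<in>T. K) v"
 proof (rule continuous_on_closed_Union[OF finite_T])
  fix K assume K: "K \<in> T"
  show "closed K" by (rule K_closed[OF K])
  have "continuous_on K (\<lambda>x. a K \<bullet> x + b K)" by (intro continuous_intros)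
  then show "continuous_on K v" using vK[OF K] by (simp cong: continuous_on_cong)
 qed
 then have "continuous_on (closure U) v" using T_cover by simp
 then have "v \<in> Vh" using vK by (auto simp: fe_space_def)
 moreover have "v p = f p" if "p \<in> vertices T" for p
  using that vK[OF _ P_in] ab by (auto simp: vertices_eq)
 ultimately show ?thesis by blast
qed

lemma pih_fe: "pih f \<in> Vh" and pih_vertex: "p \<in> vertices T \<Longrightarrow> pih f p = f p"
proof -
 have "pih f \<in> Vh \<and> (\<forall>p\<in>vertices T. pih f p = f p)"
  unfolding nodal_interpolant_def by (rule someI_ex[OF interpolant_exists])
 then show "pih f \<in> Vh" "p \<in> vertices T \<Longrightarrow> pih f p = f p" by auto
qed

lemma pih_P: "K \<in> T \<Longrightarrow> pih f (P K i) = f (P K i)"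
 by (rule pih_vertex[OF P_vertex])

text \<open>One set of weights for all finite element functions and all interpolants at once, so
  that the interpolant of a nonlinear expression can be compared with the expression itself by
  convexity.\<close>

definition bary where "bary K x l \<longleftrightarrow> (\<forall>i. 0 \<le> l i) \<and> (\<Sum>i\<in>UNIV. l i) = 1
 \<and> (\<forall>v\<in>Vh. v x = (\<Sum>i\<in>UNIV. l i * v (P K i))) \<and> (\<forall>f. pih f x = (\<Sum>i\<in>UNIV. l i * f (P K i)))"

lemma baryD:
 assumes "bary K x l"
 shows "0 \<le> l i" "(\<Sum>i\<in>UNIV. l i) = 1" "v \<in> Vh \<Longrightarrow> v x = (\<Sum>i\<in>UNIV. l i * v (P K i))"
  "pih f x = (\<Sum>i\<in>UNIV. l i * f (P K i))"
 using assms by (auto simp: bary_def)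

lemma bary_exists:
 assumes K: "K \<in> T" and x: "x \<in> K"
 shows "\<exists>l. bary K x l"
proof -
 obtain l where l: "\<And>i. 0 \<le> l i" "(\<Sum>i\<in>UNIV. l i) = 1" "\<And>v. v \<in> Vh \<Longrightarrow> v x = (\<Sum>i\<in>UNIV. l i * v (P K i))"
  using fe_bary[OF K x] by blast
 have "pih f x = (\<Sum>i\<in>UNIV. l i * f (P K i))" for f using l(3)[OF pih_fe] by (simp add: pih_P[OF K])
 with l show ?thesis unfolding bary_def by blast
qed

text \<open>The elements cover the closure, so an interior point of an element might a priori lie on
  an inner boundary such as a slit. The graph condition excludes this: directly below a boundary
  point there is an open set that misses \<open>U\<close>, hence a point of the element outside the
  closure.\<close>

lemma interior_sub: "K \<in> T \<Longrightarrow> interior K \<subseteq> U"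
proof (rule subsetI, rule ccontr)
 fix x assume K: "K \<in> T" and x: "x \<in> interior K" and n: "x \<notin> U"
 have "x \<in> closure U" using K_sub[OF K] x interior_subset by blast
 then have "x \<in> frontier U" using n open_dom by (simp add: frontier_def interior_open)
 then obtain R e C and \<gamma> :: "real^'n \<Rightarrow> real" where R: "R > 0" and e: "norm e = 1" and \<gamma>: "C-lipschitz_on UNIV \<gamma>"
  and graph: "\<And>y. y \<in> ball x R \<Longrightarrow> y \<in> U \<longleftrightarrow> \<gamma> (y - (y \<bullet> e) *\<^sub>R e) < y \<bullet> e"
  using lip unfolding lipschitz_boundary_def by metis
 have ee: "e \<bullet> e = 1" using e by (simp add: norm_eq_1)
 obtain d where d: "d > 0" "ball x d \<subseteq> K" using x by (auto simp: mem_interior)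
 define t where "t = min d R / 2"
 have t: "t > 0" "t < d" "t < R" using d R by (auto simp: t_def min_def)
 define y where "y = x - t *\<^sub>R e"
 have "y \<in> K" using d t e by (auto simp: y_def subset_iff dist_norm)
 then have yc: "y \<in> closure U" using K_sub[OF K] by blast
 have \<gamma>c: "continuous_on UNIV \<gamma>" using \<gamma> by (rule lipschitz_on_continuous_on)
 define W where "W = ball x R \<inter> {z. z \<bullet> e < \<gamma> (z - (z \<bullet> e) *\<^sub>R e)}"
 have "open {z. z \<bullet> e < \<gamma> (z - (z \<bullet> e) *\<^sub>R e)}"
  by (intro open_Collect_less continuous_intros continuous_on_compose2[OF \<gamma>c]) auto
 then have "open W" by (simp add: W_def open_Int)
 moreover have "y \<in> W"
 proof -
  have p: "y - (y \<bullet> e) *\<^sub>R e = x - (x \<bullet> e) *\<^sub>R e" by (simp add: y_def inner_diff_left ee algebra_simps)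
  have "x \<bullet> e \<le> \<gamma> (x - (x \<bullet> e) *\<^sub>R e)" using graph[of x] n R by simp
  moreover have "y \<bullet> e = x \<bullet> e - t" by (simp add: y_def inner_diff_left ee)
  ultimately have "y \<bullet> e < \<gamma> (y - (y \<bullet> e) *\<^sub>R e)" unfolding p using t by simp
  moreover have "y \<in> ball x R" using t e by (simp add: y_def dist_norm)
  ultimately show ?thesis unfolding W_def by blast
 qed
 ultimately obtain z where "z \<in> U" "z \<in> W" using yc by (meson closure_iff_nhds_not_empty disjoint_iff open_contains_ball subset_iff)
 then show False using graph[of z] by (auto simp: W_def)
qed

lemma interior_unique: "K \<in> T \<Longrightarrow> K' \<in> T \<Longrightarrow> x \<in> interior K \<Longrightarrow> x \<in> interior K' \<Longrightarrow> K = K'"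
proof -
 have sub: "K \<subseteq> K'" if "K \<in> T" "K' \<in> T" "x \<in> interior K" "x \<in> interior K'" for K K'
 proof -
  have "rel_interior K = interior K" using that(3) by (intro rel_interior_nonempty_interior) auto
  then have "(K \<inter> K') \<inter> rel_interior K \<noteq> {}" using that interior_subset by blast
  then have "K \<subseteq> K \<inter> K'" using subset_of_face_of[OF T_face[OF that(1,2)] order_refl] by blast
  then show ?thesis by blast
 qed
 assume "K \<in> T" "K' \<in> T" "x \<in> interior K" "x \<in> interior K'"
 then show "K = K'" using sub[of K K'] sub[of K' K] by blast
qed

lemma AE_interior: "AE x in MU. \<exists>K\<in>T. x \<in> interior K"
proof -
 have "negligible (\<Union>K\<in>T. frontier K)"
  using finite_T K_convex by (intro negligible_Union) (auto intro: negligible_convex_frontier)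
 then have "AE x in lebesgue. x \<notin> (\<Union>K\<in>T. frontier K)"
  unfolding negligible_iff_null_sets by (rule AE_not_in)
 then have "AE x in lebesgue. x \<in> U \<longrightarrow> (\<exists>K\<in>T. x \<in> interior K)"
 proof eventually_elim
  case (elim x)
  show ?case
  proof
   assume "x \<in> U"
   then obtain K where K: "K \<in> T" "x \<in> K" using T_cover closure_subset by blast
   then have "x \<in> interior K" using elim K_closed[OF K(1)] by (auto simp: frontier_def)
   then show "\<exists>K\<in>T. x \<in> interior K" using K by blast
  qed
 qed
 then show ?thesis using dom_sets by (simp add: AE_restrict_space_iff)
qed

lemma fe_L2: "v \<in> Vh \<Longrightarrow> v \<in> L2 U"
 by (rule continuous_L2[OF fe_continuous])

lemma indK_measurable: "indicat_real (interior K) \<in> bm"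
 by (intro measurable_restrict_space1 borel_measurable_indicator) simp

text \<open>The Lipschitz bound is checked along segments in \<open>U\<close>, which the finitely
  many elements cut into closed pieces where the function is affine. The second claim lets
  \<open>grad U v x\<close> at almost every point stand for the gradient on the whole element around
  it.\<close>

lemma fe_H1:
 assumes v: "v \<in> Vh"
 shows "v \<in> H1 U"
  and "AE x in MU. \<forall>K\<in>T. x \<in> interior K \<longrightarrow> (\<exists>b. \<forall>y\<in>K. v y = grad U v x \<bullet> y + b)"
proof -
 let ?M = "MU"
 obtain a b where ab: "\<And>K x. K \<in> T \<Longrightarrow> x \<in> K \<Longrightarrow> v x = a K \<bullet> x + b K"
  using fe_affine[OF v] by metis
 define g where "g x = (\<Sum>K\<in>T. indicat_real (interior K) x *\<^sub>R a K)" for x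
 have gK: "g x = a K" if K: "K \<in> T" and x: "x \<in> interior K" for x K
 proof -
  have "indicat_real (interior K') x *\<^sub>R a K' = (if K' = K then a K else 0)" if K': "K' \<in> T" for K'
  proof (cases "x \<in> interior K'")
   case True
   then have "K' = K" by (rule interior_unique[OF K' K _ x])
   then show ?thesis using x by simp
  next
   case False
   then show ?thesis using x by auto
  qed
  then have "g x = (\<Sum>K'\<in>T. if K' = K then a K else 0)" unfolding g_def by (intro sum.cong) auto
  then show ?thesis using finite_T K by simp
 qed
 define M where "M = (\<Sum>K\<in>T. norm (a K))"
 have M0: "0 \<le> M" by (simp add: M_def sum_nonneg)
 have aM: "norm (a K) \<le> M" if "K \<in> T" for K unfolding M_def using finite_T that by (intro member_le_sum) auto
 have gm: "g \<in> borel_measurable ?M"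
 proof -
  have "(\<lambda>x. indicat_real (interior K) x *\<^sub>R a K) \<in> borel_measurable ?M" for K
   by (intro borel_measurable_scaleR indK_measurable borel_measurable_const)
  then show ?thesis unfolding g_def[abs_def] by (intro borel_measurable_sum)
 qed
 have gb: "norm (g x) \<le> M" for x
  unfolding g_def M_def by (intro order_trans[OF norm_sum] sum_mono) (auto simp: indicator_def)
 have gL: "g \<in> L2 U" using gb M0 by (intro L2_bounded(1)[OF dom_lmeasurable gm, of M]) auto
 have "weak_gradient U v g"
 proof (rule weak_gradient_lipschitz[OF fe_L2[OF v] M0 _ _ gL])
  fix x y assume s: "closed_segment x y \<subseteq> U"
  define p where "p t = x + t *\<^sub>R (y - x)" for t :: real
  have pc: "continuous_on UNIV p" unfolding p_def by (intro continuous_intros)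
  have "lipschitz_on (M * dist x y) {0..1} (v \<circ> p)"
  proof (rule lipschitz_on_closed_Union[where I=T and U="\<lambda>K. {0..1} \<inter> p -` K"])
   fix K assume K: "K \<in> T"
   show "closed ({0..1} \<inter> p -` K)" using continuous_closed_vimage[OF K_closed[OF K], of p] pc
    by (intro closed_Int) (auto simp: continuous_on_eq_continuous_within)
   show "lipschitz_on (M * dist x y) ({0..1} \<inter> p -` K) (v \<circ> p)"
   proof (rule lipschitz_onI)
    fix s t assume "s \<in> {0..1} \<inter> p -` K" "t \<in> {0..1} \<inter> p -` K"
    then have "v (p s) - v (p t) = (s - t) * (a K \<bullet> (y - x))"
     using ab[OF K] by (simp add: p_def inner_add_right algebra_simps)
    then have "dist (v (p s)) (v (p t)) = \<bar>s - t\<bar> * \<bar>a K \<bullet> (y - x)\<bar>" by (simp add: dist_real_def abs_mult)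
    also have "\<dots> \<le> \<bar>s - t\<bar> * (M * dist x y)"
    proof (rule mult_left_mono)
     have "\<bar>a K \<bullet> (y - x)\<bar> \<le> norm (a K) * norm (y - x)" by (rule Cauchy_Schwarz_ineq2)
     also have "\<dots> \<le> M * dist x y" using aM[OF K] by (simp add: dist_norm norm_minus_commute mult_right_mono)
     finally show "\<bar>a K \<bullet> (y - x)\<bar> \<le> M * dist x y" .
    qed simp
    finally show "dist ((v \<circ> p) s) ((v \<circ> p) t) \<le> M * dist x y * dist s t" by (simp add: dist_real_def mult.commute)
   qed (use M0 in simp)
  next
   show "{0..1} \<subseteq> (\<Union>K\<in>T. {0..1} \<inter> p -` K)"
   proof
    fix t :: real assume t: "t \<in> {0..1}"
    then have "p t \<in> closed_segment x y" by (auto simp: p_def in_segment algebra_simps intro!: exI[of _ t])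
    then have "p t \<in> \<Union>T" using s T_cover closure_subset by blast
    then show "t \<in> (\<Union>K\<in>T. {0..1} \<inter> p -` K)" using t by auto
   qed
  qed (use finite_T M0 in auto)
  from lipschitz_onD[OF this, of 0 1] show "\<bar>v x - v y\<bar> \<le> M * dist x y"
   by (simp add: p_def dist_real_def)
 next
  show "AE x in ?M. \<forall>i. ((\<lambda>t. v (x + t *\<^sub>R axis i 1)) has_real_derivative g x $ i) (at 0)"
   using AE_interior
  proof eventually_elim
   case (elim x)
   then obtain K where K: "K \<in> T" "x \<in> interior K" by blast
   show ?case
   proof
    fix i
    let ?q = "\<lambda>t. x + t *\<^sub>R axis i (1::real)"
    have o: "open (?q -` interior K)" by (intro open_vimage open_interior continuous_intros)
    have "((\<lambda>t. a K \<bullet> ?q t + b K) has_real_derivative a K $ i) (at 0)"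
     by (auto simp: inner_add_right inner_axis intro!: derivative_eq_intros)
    then have "((\<lambda>t. v (?q t)) has_real_derivative a K $ i) (at 0)"
     by (rule has_field_derivative_transform_within_open[OF _ o])
      (use K ab[OF K(1)] in \<open>auto dest: subsetD[OF interior_subset]\<close>)
    then show "((\<lambda>t. v (?q t)) has_real_derivative g x $ i) (at 0)" by (simp add: gK[OF K])
   qed
  qed
 qed
 from weak_gradient_grad[OF fe_L2[OF v] gL this]
 show "v \<in> H1 U" and ae: "AE x in ?M. \<forall>K\<in>T. x \<in> interior K \<longrightarrow> (\<exists>b. \<forall>y\<in>K. v y = grad U v x \<bullet> y + b)"
  by (auto elim!: eventually_mono) (use gK ab in metis)
qed

lemma integral_split:
 fixes f :: "real^'n \<Rightarrow> real"
 assumes f: "integrable MU f"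
 shows "(LINT x|MU. f x) = (\<Sum>K\<in>T. LINT x|MU. indicat_real (interior K) x * f x)"
proof -
 have m: "indicat_real (interior K) \<in> bm" for K
  by (rule indK_measurable)
 have i: "integrable MU (\<lambda>x. indicat_real (interior K) x * f x)" if "K \<in> T" for K
 proof -
  have "interior K \<in> sets MU"
   using interior_sub[OF that] by (auto simp: sets_restrict_space_iff dom_sets)
  from integrable_mult_indicator[OF this f] show ?thesis by simp
 qed
 have "(LINT x|MU. f x) = (LINT x|MU. (\<Sum>K\<in>T. indicat_real (interior K) x * f x))"
 proof (rule integral_cong_AE)
  show "AE x in MU. f x = (\<Sum>K\<in>T. indicat_real (interior K) x * f x)"
   using AE_interior
  proof eventually_elim
   case (elim x)
   then obtain K where K: "K \<in> T" "x \<in> interior K" by blast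
   have "indicat_real (interior K') x * f x = (if K' = K then f x else 0)" if "K' \<in> T" for K'
    using interior_unique[OF that K(1) _ K(2)] K(2) by (cases "x \<in> interior K'") auto
   then have "(\<Sum>K'\<in>T. indicat_real (interior K') x * f x) = (\<Sum>K'\<in>T. if K' = K then f x else 0)"
    by (intro sum.cong) auto
   then show ?case using finite_T K by simp
  qed
 qed (use f m in auto)
 also have "\<dots> = (\<Sum>K\<in>T. LINT x|MU. indicat_real (interior K) x * f x)"
  using i by (rule Bochner_Integration.integral_sum)
 finally show ?thesis .
qed

text \<open>The constant of the norm equivalence: a quarter-size copy of the element at the vertex where
 the modulus is largest already carries enough mass.\<close>

definition Clump :: real where "Clump = 4 * 4 ^ CARD('n)"

text \<open>Compares any quantity bounded by squared nodal maxima with the exact L2 norm, uniformly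
  in the mesh. It is applied to interpolants of absolute values and of squares.\<close>

lemma nodal_mass_bound:
 assumes u: "u \<in> Vh" and f: "f \<in> bm"
  and le: "\<And>K x m. K \<in> T \<Longrightarrow> x \<in> K \<Longrightarrow> (\<And>i. \<bar>u (P K i)\<bar> \<le> m) \<Longrightarrow> 0 \<le> f x \<and> f x \<le> m^2"
 shows "integrable MU f" "(LINT x|MU. f x) \<le> Clump * (nm u)^2"
proof -
 let ?M = "MU"
 interpret finite_measure ?M by (rule finite_measure_lebesgue_on[OF dom_lmeasurable])
 define mx where "mx K = Max (range (\<lambda>i. \<bar>u (P K i)\<bar>))" for K
 have mx: "\<bar>u (P K i)\<bar> \<le> mx K" for K i unfolding mx_def by (intro Max_ge) auto
 have mx_ex: "\<exists>i. \<bar>u (P K i)\<bar> = mx K" for K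
  unfolding mx_def using Max_in[of "range (\<lambda>i. \<bar>u (P K i)\<bar>)"] by (metis (mono_tags, lifting) empty_not_UNIV finite finite_imageI image_is_empty rangeE)
 have mx0: "0 \<le> mx K" for K using mx[of K None] by linarith
 have fK: "0 \<le> f x" "f x \<le> (mx K)^2" if "K \<in> T" "x \<in> K" for K x using le[OF that mx] by auto
 have im: "interior K \<in> sets ?M" if "K \<in> T" for K
  using interior_sub[OF that] by (auto simp: sets_restrict_space_iff dom_sets)
 have "AE x in ?M. norm (f x) \<le> (\<Sum>K\<in>T. (mx K)^2)"
  using AE_interior
 proof eventually_elim
  case (elim x)
  then obtain K where K: "K \<in> T" "x \<in> K" using interior_subset by blast
  have "(mx K)^2 \<le> (\<Sum>K\<in>T. (mx K)^2)" using finite_T K by (intro member_le_sum) auto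
  then show ?case using fK[OF K] by simp
 qed
 then show fi: "integrable ?M f" by (intro integrable_const_bound f)
 have u2: "integrable ?M (\<lambda>x. (u x)^2)" using L2_integrable_sq[OF fe_L2[OF u]] by simp
 have K_est: "(LINT x|?M. indicat_real (interior K) x * f x) \<le> Clump * (LINT x|?M. indicat_real (interior K) x * (u x)^2)"
  if K: "K \<in> T" for K
 proof -
  have mI: "indicat_real (interior K) \<in> borel_measurable ?M" using im[OF K] by measurable
  have f1: "integrable ?M (\<lambda>x. indicat_real (interior K) x * f x)" "integrable ?M (\<lambda>x. indicat_real (interior K) x * (u x)^2)"
   using integrable_mult_indicator[OF im[OF K] fi] integrable_mult_indicator[OF im[OF K] u2] by auto
  have f2: "integrable ?M (\<lambda>x. indicat_real B x * c)" if "B \<in> sets ?M" for B and c :: real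
   using integrable_mult_indicator[OF that integrable_const, of c] by simp
  note f2 = f2[OF im[OF K]] and f2' = f2
  have "(LINT x|?M. indicat_real (interior K) x * f x) \<le> (LINT x|?M. indicat_real (interior K) x * (mx K)^2)"
   using f1(1) f2 fK[OF K] interior_subset[of K] by (intro integral_mono) (auto simp: indicator_def)
  also have "\<dots> = measure ?M (interior K) * (mx K)^2"
   using im[OF K] by (simp add: Int_absorb2[OF interior_sub[OF K]])
  also have "measure ?M (interior K) = measure lebesgue (interior K)"
   using interior_sub[OF K] dom_sets by (simp add: measure_restrict_space)
  finally have 1: "(LINT x|?M. indicat_real (interior K) x * f x) \<le> measure lebesgue (interior K) * (mx K)^2" .
  obtain i where i: "\<bar>u (P K i)\<bar> = mx K" using mx_ex by blast
  \<comment> \<open>Contraction by 1/4 towards the vertex \<open>P K i\<close> where the maximum is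
    attained; the image stays in the element by convexity.\<close>
  define S where "S = (\<lambda>x. (1/4) *\<^sub>R x + (3/4) *\<^sub>R P K i) ` interior K"
  have SK: "S \<subseteq> interior K"
  proof
   fix y assume "y \<in> S"
   then obtain x where x: "x \<in> interior K" "y = (1/4) *\<^sub>R x + (3/4) *\<^sub>R P K i" by (auto simp: S_def)
   have "P K i - (1/4) *\<^sub>R (P K i - x) \<in> interior K"
    by (rule mem_interior_convex_shrink[OF K_convex[OF K] x(1) P_in[OF K]]) auto
   moreover have "y = P K i - (1/4) *\<^sub>R (P K i - x)"
   proof -
    have "(3/4) *\<^sub>R P K i = (1 - 1/4) *\<^sub>R P K i" by simp
    then show ?thesis unfolding x(2) by (simp only: scaleR_diff_left scaleR_diff_right) simp
   qed
   ultimately show "y \<in> interior K" by simp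
  qed
  have Sleb: "S \<in> sets lebesgue"
  proof -
   have "S = (\<lambda>y. 4 *\<^sub>R y - 3 *\<^sub>R P K i) -` interior K"
   proof (intro set_eqI iffI)
    fix y assume "y \<in> S" then show "y \<in> (\<lambda>y. 4 *\<^sub>R y - 3 *\<^sub>R P K i) -` interior K" by (auto simp: S_def scaleR_add_right)
   next
    fix y assume "y \<in> (\<lambda>y. 4 *\<^sub>R y - 3 *\<^sub>R P K i) -` interior K"
    then show "y \<in> S" unfolding S_def by (intro image_eqI[of _ _ "4 *\<^sub>R y - 3 *\<^sub>R P K i"]) (auto simp: scaleR_diff_right)
   qed
   then have "open S" by (simp only:) (intro open_vimage open_interior continuous_intros)
   then show ?thesis by simp
  qed
  have Sm: "S \<in> sets ?M" using SK interior_sub[OF K] Sleb by (auto simp: sets_restrict_space_iff dom_sets)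
  have meas: "measure ?M S = (1/4) ^ CARD('n) * measure lebesgue (interior K)"
  proof -
   have "measure ?M S = measure lebesgue S" using SK interior_sub[OF K] dom_sets by (intro measure_restrict_space) auto
   also have "\<dots> = \<bar>1/4\<bar> ^ DIM(real^'n) * measure lebesgue (interior K)" unfolding S_def by (rule measure_lebesgue_affine)
   finally show ?thesis by simp
  qed
  have uS: "(mx K)^2 / 4 \<le> (u y)^2" if yS: "y \<in> S" for y
  proof -
   obtain x where x: "x \<in> interior K" "y = (1/4) *\<^sub>R x + (3/4) *\<^sub>R P K i" using yS by (auto simp: S_def)
   have xK: "x \<in> K" and yK: "y \<in> K" using x(1) SK yS interior_subset by blast+
   obtain a b where ab: "\<And>x. x \<in> K \<Longrightarrow> u x = a \<bullet> x + b" using fe_affine[OF u K] by blast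
   have uy: "u y = (1/4) * u x + (3/4) * u (P K i)"
   proof -
    have "u y = (1/4) * (a \<bullet> x) + (3/4) * (a \<bullet> P K i) + b"
     using ab[OF yK] unfolding x(2) by (simp add: inner_add_right)
    then show ?thesis using ab[OF xK] ab[OF P_in[OF K, of i]] by (simp add: algebra_simps add_divide_distrib)
   qed
   have "\<bar>u x\<bar> \<le> mx K"
   proof -
    obtain l where l: "\<And>i. 0 \<le> l i" "(\<Sum>i\<in>UNIV. l i) = 1" "\<And>v. v \<in> Vh \<Longrightarrow> v x = (\<Sum>i\<in>UNIV. l i * v (P K i))"
     using fe_bary[OF K xK] by blast
    have "\<bar>u x\<bar> \<le> (\<Sum>i\<in>UNIV. l i * mx K)" unfolding l(3)[OF u]
     by (rule order_trans[OF sum_abs]) (intro sum_mono, simp add: abs_mult l(1) mx mult_left_mono)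
    then show ?thesis using l(2) by (simp add: sum_distrib_right[symmetric])
   qed
   \<comment> \<open>At least 3/4 of the maximum comes from the vertex, and at most 1/4 of it is
     lost through \<open>x\<close>. Squaring gives the factor 4 in \<open>Clump\<close>, the volume
     of \<open>S\<close> the factor \<open>4 ^ CARD('n)\<close>.\<close>
   then have "mx K / 2 \<le> \<bar>u y\<bar>" using uy i by linarith
   then have "(mx K / 2)^2 \<le> \<bar>u y\<bar>^2" using mx0 by (intro power_mono) auto
   then show ?thesis by (simp add: power_divide)
  qed
  have "(1/4) ^ CARD('n) * measure lebesgue (interior K) * ((mx K)^2 / 4) = (LINT x|?M. indicat_real S x * ((mx K)^2 / 4))"
   using Sm by (simp add: meas Int_absorb2[OF order_trans[OF SK interior_sub[OF K]]])
  also have "\<dots> \<le> (LINT x|?M. indicat_real (interior K) x * (u x)^2)"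
   using f1(2) f2'[OF Sm] uS SK by (intro integral_mono) (auto simp: indicator_def)
  finally have 2: "(1/4) ^ CARD('n) * measure lebesgue (interior K) * ((mx K)^2 / 4) \<le> (LINT x|?M. indicat_real (interior K) x * (u x)^2)" .
  have "measure lebesgue (interior K) * (mx K)^2 = Clump * ((1/4) ^ CARD('n) * measure lebesgue (interior K) * ((mx K)^2 / 4))"
   by (simp add: Clump_def power_divide)
  also have "\<dots> \<le> Clump * (LINT x|?M. indicat_real (interior K) x * (u x)^2)"
   using 2 by (intro mult_left_mono) (simp_all add: Clump_def)
  finally show ?thesis using 1 by linarith
 qed
 have "(LINT x|?M. f x) = (\<Sum>K\<in>T. LINT x|?M. indicat_real (interior K) x * f x)" by (rule integral_split[OF fi])
 also have "\<dots> \<le> (\<Sum>K\<in>T. Clump * (LINT x|?M. indicat_real (interior K) x * (u x)^2))" by (intro sum_mono K_est)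
 also have "\<dots> = Clump * (LINT x|?M. (u x)^2)" by (simp add: integral_split[OF u2] sum_distrib_left)
 finally show "(LINT x|?M. f x) \<le> Clump * (nm u)^2" by (simp add: L2_norm_sq_eq)
qed

end

section \<open>The regularized entropy and its derivatives\<close>

lemma DERIV_join:
 fixes f :: "real \<Rightarrow> real"
 assumes f1: "(f1 has_real_derivative D) (at a)" and f2: "(f2 has_real_derivative D) (at a)"
  and e1: "\<And>x. x \<le> a \<Longrightarrow> c < x \<Longrightarrow> f x = f1 x" and e2: "\<And>x. a \<le> x \<Longrightarrow> x < d \<Longrightarrow> f x = f2 x"
  and cd: "c < a" "a < d"
 shows "(f has_real_derivative D) (at a)"
proof -
 have 1: "((\<lambda>x. (f x - f a) / (x - a)) \<longlongrightarrow> D) (at_left a)"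
 proof (rule Lim_transform_eventually)
  show "((\<lambda>x. (f1 x - f1 a) / (x - a)) \<longlongrightarrow> D) (at_left a)"
   using f1 unfolding has_field_derivative_iff by (rule tendsto_within_subset) simp
  show "\<forall>\<^sub>F x in at_left a. (f1 x - f1 a) / (x - a) = (f x - f a) / (x - a)"
   using e1 cd by (auto simp: eventually_at_left_field intro!: exI[of _ c])
 qed
 have 2: "((\<lambda>x. (f x - f a) / (x - a)) \<longlongrightarrow> D) (at_right a)"
 proof (rule Lim_transform_eventually)
  show "((\<lambda>x. (f2 x - f2 a) / (x - a)) \<longlongrightarrow> D) (at_right a)"
   using f2 unfolding has_field_derivative_iff by (rule tendsto_within_subset) simp
  show "\<forall>\<^sub>F x in at_right a. (f2 x - f2 a) / (x - a) = (f x - f a) / (x - a)"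
   using e2 cd by (auto simp: eventually_at_right_field intro!: exI[of _ d])
 qed
 show ?thesis unfolding has_field_derivative_iff by (rule filterlim_split_at[OF 1 2])
qed

definition entropy_cut' :: "real \<Rightarrow> real \<Rightarrow> real \<Rightarrow> real" where
 "entropy_cut' \<delta> L t = (if t \<le> \<delta> then t / \<delta> + ln \<delta> - 1 else if t < L then ln t else t / L + ln L - 1)"

lemma DERIV_local:
 fixes f :: "real \<Rightarrow> real"
 assumes "(g has_real_derivative D) (at a)" "open S" "a \<in> S" "\<And>x. x \<in> S \<Longrightarrow> g x = f x"
 shows "(f has_real_derivative D) (at a)"
 using assms by (rule has_field_derivative_transform_within_open)

lemma entropy_cut_derivative:
 assumes d: "0 < \<delta>" "\<delta> < L"
 shows "(entropy_cut \<delta> L has_real_derivative entropy_cut' \<delta> L t) (at t)"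
proof -
 have lo: "((\<lambda>t. (t^2 - c^2) / (2 * c) + (ln c - 1) * t + 1) has_real_derivative t / c + ln c - 1) (at t)" if "c > 0" for c t
  using that by (auto intro!: derivative_eq_intros simp: field_simps)
 have mid: "((\<lambda>t. t * (ln t - 1) + 1) has_real_derivative ln t) (at t)" if "t > 0" for t :: real
  using that by (auto intro!: derivative_eq_intros simp: field_simps)
 consider "t < \<delta>" | "t = \<delta>" | "\<delta> < t" "t < L" | "t = L" | "L < t" by linarith
 then show ?thesis
 proof cases
  case 1
  show ?thesis
   by (rule DERIV_local[where S="{..<\<delta>}" and g="\<lambda>t. (t^2 - \<delta>^2) / (2 * \<delta>) + (ln \<delta> - 1) * t + 1"])
    (use 1 lo[OF d(1), of t] in \<open>auto simp: entropy_cut_def entropy_cut'_def\<close>)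
 next
  case 2
  show ?thesis
   by (rule DERIV_join[where ?f1.0="\<lambda>t. (t^2 - \<delta>^2) / (2 * \<delta>) + (ln \<delta> - 1) * t + 1"
      and ?f2.0="\<lambda>t. t * (ln t - 1) + 1" and c="\<delta> - 1" and d=L])
    (use 2 lo[OF d(1), of \<delta>] mid[OF d(1)] d in \<open>auto simp: entropy_cut_def entropy_cut'_def entropy_def mult.commute\<close>)
 next
  case 3
  show ?thesis
   by (rule DERIV_local[where S="{\<delta><..<L}" and g="\<lambda>t. t * (ln t - 1) + 1"])
    (use 3 mid[of t] d in \<open>auto simp: entropy_cut_def entropy_cut'_def entropy_def\<close>)
 next
  case 4
  show ?thesis
   by (rule DERIV_join[where ?f1.0="\<lambda>t. t * (ln t - 1) + 1"
      and ?f2.0="\<lambda>t. (t^2 - L^2) / (2 * L) + (ln L - 1) * t + 1" and c=\<delta> and d="L + 1"])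
    (use 4 lo[of L L] mid[of L] d in \<open>auto simp: entropy_cut_def entropy_cut'_def entropy_def mult.commute\<close>)
 next
  case 5
  show ?thesis
   by (rule DERIV_local[where S="{L<..}" and g="\<lambda>t. (t^2 - L^2) / (2 * L) + (ln L - 1) * t + 1"])
    (use 5 lo[of L t] d in \<open>auto simp: entropy_cut_def entropy_cut'_def\<close>)
 qed
qed

lemma entropy_cut'_derivative:
 assumes d: "0 < \<delta>" "\<delta> < L"
 shows "(entropy_cut' \<delta> L has_real_derivative 1 / \<beta>_cut \<delta> L t) (at t)"
proof -
 have lo: "((\<lambda>t. t / c + ln c - 1) has_real_derivative 1 / c) (at t)" if "c > 0" for c t :: real
  using that by (auto intro!: derivative_eq_intros)
 have mid: "(ln has_real_derivative 1 / t) (at t)" if "t > 0" for t :: real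
  using that by (auto intro!: derivative_eq_intros simp: field_simps)
 consider "t < \<delta>" | "t = \<delta>" | "\<delta> < t" "t < L" | "t = L" | "L < t" by linarith
 then show ?thesis
 proof cases
  case 1
  show ?thesis
   by (rule DERIV_local[where S="{..<\<delta>}" and g="\<lambda>t. t / \<delta> + ln \<delta> - 1"])
    (use 1 lo[OF d(1), of t] d in \<open>auto simp: \<beta>_cut_def entropy_cut'_def\<close>)
 next
  case 2
  show ?thesis
   by (rule DERIV_join[where ?f1.0="\<lambda>t. t / \<delta> + ln \<delta> - 1" and ?f2.0=ln and c="\<delta> - 1" and d=L])
    (use 2 lo[OF d(1), of \<delta>] mid[OF d(1)] d in \<open>auto simp: \<beta>_cut_def entropy_cut'_def\<close>)
 next
  case 3
  show ?thesis
   by (rule DERIV_local[where S="{\<delta><..<L}" and g=ln])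
    (use 3 mid[of t] d in \<open>auto simp: \<beta>_cut_def entropy_cut'_def\<close>)
 next
  case 4
  show ?thesis
   by (rule DERIV_join[where ?f1.0=ln and ?f2.0="\<lambda>t. t / L + ln L - 1" and c=\<delta> and d="L + 1"])
    (use 4 lo[of L L] mid[of L] d in \<open>auto simp: \<beta>_cut_def entropy_cut'_def\<close>)
 next
  case 5
  show ?thesis
   by (rule DERIV_local[where S="{L<..}" and g="\<lambda>t. t / L + ln L - 1"])
    (use 5 lo[of L t] d in \<open>auto simp: \<beta>_cut_def entropy_cut'_def\<close>)
 qed
qed

lemma \<beta>_cut_lipschitz: "\<bar>\<beta>_cut \<delta> L s - \<beta>_cut \<delta> L t\<bar> \<le> \<bar>s - t\<bar>"
 by (auto simp: \<beta>_cut_def max_def min_def)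

lemma \<beta>_cut_bounds: "0 < \<delta> \<Longrightarrow> \<delta> < L \<Longrightarrow> \<delta> \<le> \<beta>_cut \<delta> L t \<and> \<beta>_cut \<delta> L t \<le> L"
 by (auto simp: \<beta>_cut_def)

text \<open>Since the second derivative of the entropy is \<open>1 / \<beta>_cut\<close>, the mean
  value theorem turns the inverse difference quotient into a value of \<open>\<beta>_cut\<close>
  between the nodal values. The entropy enters the rest of the proof only in this way.\<close>

lemma entropy_quotient_gt:
 assumes d: "0 < \<delta>" "\<delta> < L" and ab: "a < b"
 shows "\<exists>\<xi>. a \<le> \<xi> \<and> \<xi> \<le> b \<and>
  (b - a) / (deriv (entropy_cut \<delta> L) b - deriv (entropy_cut \<delta> L) a) = \<beta>_cut \<delta> L \<xi>"
proof -
 have g: "deriv (entropy_cut \<delta> L) t = entropy_cut' \<delta> L t" for t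
  by (rule DERIV_imp_deriv[OF entropy_cut_derivative[OF d]])
 obtain \<xi> where \<xi>: "a < \<xi>" "\<xi> < b" "entropy_cut' \<delta> L b - entropy_cut' \<delta> L a = (b - a) * (1 / \<beta>_cut \<delta> L \<xi>)"
  using MVT2[OF ab entropy_cut'_derivative[OF d]] by blast
 have "\<beta>_cut \<delta> L \<xi> > 0" using \<beta>_cut_bounds[OF d, of \<xi>] d by linarith
 then show ?thesis using \<xi> ab by (intro exI[of _ \<xi>]) (simp add: g)
qed

lemma \<Theta>_ref_diag:
 assumes d: "0 < \<delta>" "\<delta> < L"
 obtains \<xi> where "\<And>j. min (f (p None)) (f (p (Some j))) \<le> \<xi> j" "\<And>j. \<xi> j \<le> max (f (p None)) (f (p (Some j)))"
  "\<Theta>_ref \<delta> L p f = (\<chi> i j. if i = j then \<beta>_cut \<delta> L (\<xi> j) else 0)"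
proof -
 have "\<exists>\<xi>. min (f (p None)) (f (p (Some j))) \<le> \<xi> \<and> \<xi> \<le> max (f (p None)) (f (p (Some j))) \<and>
   (if f (p (Some j)) \<noteq> f (p None)
    then (f (p (Some j)) - f (p None)) /
      (deriv (entropy_cut \<delta> L) (f (p (Some j))) - deriv (entropy_cut \<delta> L) (f (p None)))
   else \<beta>_cut \<delta> L (f (p (Some j)))) = \<beta>_cut \<delta> L \<xi>" for j
 proof (cases "f (p (Some j))" "f (p None)" rule: linorder_cases)
  case greater
  then show ?thesis using entropy_quotient_gt[OF d greater] by auto
 next
  case less
  then obtain \<xi> where \<xi>: "f (p (Some j)) \<le> \<xi>" "\<xi> \<le> f (p None)" "(f (p None) - f (p (Some j))) /
      (deriv (entropy_cut \<delta> L) (f (p None)) - deriv (entropy_cut \<delta> L) (f (p (Some j)))) = \<beta>_cut \<delta> L \<xi>"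
   using entropy_quotient_gt[OF d less] by blast
  have "(f (p (Some j)) - f (p None)) /
      (deriv (entropy_cut \<delta> L) (f (p (Some j))) - deriv (entropy_cut \<delta> L) (f (p None))) = \<beta>_cut \<delta> L \<xi>"
   using \<xi>(3) by (metis minus_diff_eq minus_divide_divide)
  then show ?thesis using \<xi>(1,2) less by (intro exI[of _ \<xi>]) auto
 qed auto
 then obtain \<xi> where \<xi>: "\<And>j. min (f (p None)) (f (p (Some j))) \<le> \<xi> j" "\<And>j. \<xi> j \<le> max (f (p None)) (f (p (Some j)))"
   "\<And>j. (if f (p (Some j)) \<noteq> f (p None)
    then (f (p (Some j)) - f (p None)) /
      (deriv (entropy_cut \<delta> L) (f (p (Some j))) - deriv (entropy_cut \<delta> L) (f (p None)))
   else \<beta>_cut \<delta> L (f (p (Some j)))) = \<beta>_cut \<delta> L (\<xi> j)" by metis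
 have "\<Theta>_ref \<delta> L p f = (\<chi> i j. if i = j then \<beta>_cut \<delta> L (\<xi> j) else 0)"
  unfolding \<Theta>_ref_def by (simp add: vec_eq_iff \<xi>(3))
 with \<xi>(1,2) that show thesis by blast
qed

text \<open>The norm of a matrix is here that of the vector of its rows, not the operator norm.
  Bounding every entry by the operator bound gives the crude factor.\<close>

lemma matrix_norm_le:
 fixes M :: "real^'n^'n"
 assumes "\<And>v. norm (M *v v) \<le> c * norm v"
 shows "norm M \<le> (real CARD('n))^2 * c"
proof -
 have e: "\<bar>M $ i $ j\<bar> \<le> c" for i j
 proof -
  have "M $ i $ j = (M *v axis j 1) $ i" by (simp add: matrix_vector_mult_basis column_def)
  then have "\<bar>M $ i $ j\<bar> \<le> norm (M *v axis j 1)" using component_le_norm_cart by metis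
  also have "\<dots> \<le> c" using assms[of "axis j 1"] by simp
  finally show ?thesis .
 qed
 have "norm M \<le> (\<Sum>i\<in>UNIV. norm (M $ i))" unfolding norm_vec_def by (rule L2_set_le_sum) auto
 also have "\<dots> \<le> (\<Sum>i\<in>(UNIV::'n set). real CARD('n) * c)"
 proof (rule sum_mono)
  fix i
  have "norm (M $ i) \<le> (\<Sum>j\<in>UNIV. \<bar>M $ i $ j\<bar>)" by (rule norm_le_l1_cart)
  also have "\<dots> \<le> real CARD('n) * c" using sum_bounded_above[of UNIV "\<lambda>j. \<bar>M $ i $ j\<bar>" c] e by simp
  finally show "norm (M $ i) \<le> real CARD('n) * c" .
 qed
 finally show ?thesis by (simp add: power2_eq_square mult.assoc)
qed

lemma mat_vector: "mat c *v v = c *\<^sub>R (v :: real^'n)"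
proof -
 have "(mat c *v v) $ i = c * v $ i" for i
 proof -
  have "(mat c *v v) $ i = (\<Sum>j\<in>UNIV. (if i = j then c else 0) * v $ j)"
   by (simp add: matrix_vector_mult_def mat_def)
  also have "\<dots> = (\<Sum>j\<in>UNIV. if i = j then c * v $ j else 0)" by (intro sum.cong) auto
  finally show ?thesis by simp
 qed
 then show ?thesis by (simp add: vec_eq_iff)
qed

lemma norm_mat_le: "norm (mat c :: real^'n^'n) \<le> (real CARD('n))^2 * \<bar>c\<bar>"
 by (rule matrix_norm_le) (simp add: mat_vector)

lemma mat_diff: "mat a - mat b = (mat (a - b) :: real^'n^'n)"
 by (simp add: mat_def vec_eq_iff)

section \<open>Bounds and deviation of the mobility matrix\<close>

context fe_mesh
begin

definition Nn :: real where "Nn = (real CARD('n))^2"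

lemma Nn_pos: "Nn > 0"
 by (simp add: Nn_def)

text \<open>The transposed edge matrix diagonalizes \<open>\<Theta>_elem\<close>: along each edge
  the component of the image is that of \<open>v\<close> times a value of
  \<open>\<beta>_cut\<close>. Reading the vector \<open>a\<close> as the gradient of an affine
  function, its edge differences are at most \<open>m * (norm v * diameter K)\<close>, and
  \<open>gradient_bound\<close> costs the factor \<open>1 / \<kappa>\<close>.\<close>

lemma \<Theta>_elem_deviation:
 assumes d: "0 < \<delta>" "\<delta> < L" and K: "K \<in> T" and m: "0 \<le> m"
  and dev: "\<And>t. (\<exists>i. f (P K i) \<le> t) \<Longrightarrow> (\<exists>i. t \<le> f (P K i)) \<Longrightarrow> \<bar>\<beta>_cut \<delta> L t - b\<bar> \<le> m"
 shows "norm (\<Theta>_elem \<delta> L (P K) f - mat b) \<le> Nn * (m / \<kappa>)"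
 unfolding Nn_def
proof (rule matrix_norm_le)
 fix v
 let ?B = "transpose (simplex_matrix (P K))"
 obtain \<xi> where \<xi>: "\<And>j. min (f (P K None)) (f (P K (Some j))) \<le> \<xi> j" "\<And>j. \<xi> j \<le> max (f (P K None)) (f (P K (Some j)))"
  "\<Theta>_ref \<delta> L (P K) f = (\<chi> i j. if i = j then \<beta>_cut \<delta> L (\<xi> j) else 0)"
  using \<Theta>_ref_diag[OF d, where f=f and p="P K"] by blast
 have \<xi>d: "\<bar>\<beta>_cut \<delta> L (\<xi> j) - b\<bar> \<le> m" for j
  using \<xi>(1)[of j] \<xi>(2)[of j] by (intro dev) (auto simp: min_def max_def split: if_splits)
 define a where "a = (\<Theta>_elem \<delta> L (P K) f - mat b) *v v"
 have inv: "invertible ?B" using simplex_matrix_invertible[OF P_inj[OF K] P_ind[OF K]] by (rule transpose_invertible)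
 have "?B *v (\<Theta>_elem \<delta> L (P K) f *v v) = (?B ** matrix_inv ?B) *v (\<Theta>_ref \<delta> L (P K) f *v (?B *v v))"
  by (simp add: \<Theta>_elem_def matrix_vector_mul_assoc matrix_mul_assoc del: transpose_matrix_vector)
 then have Ba: "?B *v (\<Theta>_elem \<delta> L (P K) f *v v) = \<Theta>_ref \<delta> L (P K) f *v (?B *v v)"
  by (simp add: matrix_inv_right[OF inv] del: transpose_matrix_vector)
 have edge: "a \<bullet> (P K (Some j) - P K None) = (\<beta>_cut \<delta> L (\<xi> j) - b) * (v \<bullet> (P K (Some j) - P K None))" for j
 proof -
  have "(\<Theta>_ref \<delta> L (P K) f *v w) $ j = \<beta>_cut \<delta> L (\<xi> j) * w $ j" for w
  proof -
   have "(\<Theta>_ref \<delta> L (P K) f *v w) $ j = (\<Sum>l\<in>UNIV. (if j = l then \<beta>_cut \<delta> L (\<xi> l) else 0) * w $ l)"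
    by (simp add: \<xi>(3) matrix_vector_mult_def)
   also have "\<dots> = (\<Sum>l\<in>UNIV. if j = l then \<beta>_cut \<delta> L (\<xi> j) * w $ j else 0)" by (intro sum.cong) auto
   finally show ?thesis by simp
  qed
  from this[of "?B *v v"]
  have "(?B *v (\<Theta>_elem \<delta> L (P K) f *v v)) $ j = \<beta>_cut \<delta> L (\<xi> j) * (?B *v v) $ j" using Ba by simp
  then have "(\<Theta>_elem \<delta> L (P K) f *v v) \<bullet> (P K (Some j) - P K None) = \<beta>_cut \<delta> L (\<xi> j) * (v \<bullet> (P K (Some j) - P K None))"
   by (simp add: transpose_simplex_matrix del: transpose_matrix_vector)
  then show ?thesis
   by (simp add: a_def matrix_vector_mult_diff_rdistrib mat_vector inner_diff_left left_diff_distrib)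
 qed
 have "norm a * (\<kappa> * diameter K) \<le> m * (norm v * diameter K)"
 proof (rule gradient_bound[OF K])
  fix j
  have "\<bar>v \<bullet> (P K (Some j) - P K None)\<bar> \<le> norm v * norm (P K (Some j) - P K None)" by (rule Cauchy_Schwarz_ineq2)
  also have "\<dots> \<le> norm v * diameter K"
   using K_dist[OF K P_in[OF K, of "Some j"] P_in[OF K, of None]] by (simp add: dist_norm mult_left_mono)
  finally show "\<bar>a \<bullet> (P K (Some j) - P K None)\<bar> \<le> m * (norm v * diameter K)"
   unfolding edge abs_mult using m by (intro mult_mono \<xi>d) auto
 qed (use m diam_pos[OF K] in simp)
 then have "norm a * \<kappa> \<le> m * norm v" using diam_pos[OF K] by (simp add: mult.assoc[symmetric])
 then show "norm ((\<Theta>_elem \<delta> L (P K) f - mat b) *v v) \<le> m / \<kappa> * norm v"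
  using \<kappa>(1) by (simp add: a_def[symmetric] field_simps)
qed

lemma \<Theta>_interior:
 assumes K: "K \<in> T" "x \<in> interior K" shows "\<Theta> T P \<delta> L f x = \<Theta>_elem \<delta> L (P K) f"
proof -
 have "(THE K. K \<in> T \<and> x \<in> interior K) = K" using K interior_unique by (intro the_equality) blast+
 then show ?thesis using K by (auto simp: \<Theta>_def)
qed

lemma \<Theta>_measurable: "\<Theta> T P \<delta> L f \<in> bm"
proof -
 have eq: "\<Theta> T P \<delta> L f x = (\<Sum>K\<in>T. indicat_real (interior K) x *\<^sub>R \<Theta>_elem \<delta> L (P K) f)" for x
 proof (cases "\<exists>K\<in>T. x \<in> interior K")
  case True
  then obtain K where K: "K \<in> T" "x \<in> interior K" by blast
  have "indicat_real (interior K') x *\<^sub>R \<Theta>_elem \<delta> L (P K') f = (if K' = K then \<Theta>_elem \<delta> L (P K) f else 0)" if "K' \<in> T" for K'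
   using interior_unique[OF that K(1) _ K(2)] K(2) by (cases "x \<in> interior K'") auto
  then have "(\<Sum>K'\<in>T. indicat_real (interior K') x *\<^sub>R \<Theta>_elem \<delta> L (P K') f) = (\<Sum>K'\<in>T. if K' = K then \<Theta>_elem \<delta> L (P K) f else 0)"
   by (intro sum.cong) auto
  then show ?thesis using finite_T K by (simp add: \<Theta>_interior)
 next
  case False
  then show ?thesis by (auto simp: \<Theta>_def intro!: sum.neutral[symmetric])
 qed
 show ?thesis
  by (subst ext[OF eq]) (intro borel_measurable_sum borel_measurable_scaleR indK_measurable borel_measurable_const)
qed

lemma \<Theta>_bound:
 assumes d: "0 < \<delta>" "\<delta> < L"
 shows "norm (\<Theta> T P \<delta> L f x) \<le> Nn * (L / \<kappa>)"
proof (cases "\<exists>K\<in>T. x \<in> interior K")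
 case True
 then obtain K where K: "K \<in> T" "x \<in> interior K" by blast
 \<comment> \<open>A bound on the matrix is a deviation from the zero matrix.\<close>
 have "\<bar>\<beta>_cut \<delta> L t - 0\<bar> \<le> L" for t using \<beta>_cut_bounds[OF d, of t] d by linarith
 then have "norm (\<Theta>_elem \<delta> L (P K) f - mat 0) \<le> Nn * (L / \<kappa>)"
  using d by (intro \<Theta>_elem_deviation K(1)) auto
 then show ?thesis by (simp add: \<Theta>_interior[OF K])
next
 case False
 then have "\<Theta> T P \<delta> L f x = 0" by (simp add: \<Theta>_def)
 then show ?thesis using d Nn_pos \<kappa>(1) by simp
qed

lemma fe_osc:
 assumes u: "u \<in> Vh" and K: "K \<in> T" and g: "\<And>y. y \<in> K \<Longrightarrow> u y = g \<bullet> y + b" and xy: "x \<in> K" "y \<in> K"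
 shows "\<bar>u x - u y\<bar> \<le> h * norm g"
proof -
 have "\<bar>u x - u y\<bar> = \<bar>g \<bullet> (x - y)\<bar>" using g xy by (simp add: inner_diff_right)
 also have "\<dots> \<le> norm g * norm (x - y)" by (rule Cauchy_Schwarz_ineq2)
 also have "\<dots> \<le> norm g * h" using K_dist[OF K xy] diam[OF K] by (intro mult_left_mono) (auto simp: dist_norm)
 finally show ?thesis by (simp add: mult.commute)
qed

lemma AE_element_gradient:
 assumes u: "u \<in> Vh"
 shows "AE x in MU. \<exists>K\<in>T. x \<in> interior K \<and> (\<exists>b. \<forall>y\<in>K. u y = grad U u x \<bullet> y + b)"
 using AE_interior fe_H1(2)[OF u] by eventually_elim blast

lemma \<Theta>_deviation:
 assumes d: "0 < \<delta>" "\<delta> < L" and u: "u \<in> Vh"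
 shows "AE x in MU. norm (\<Theta> T P \<delta> L u x - mat (\<beta>_cut \<delta> L (u x))) \<le> Nn / \<kappa> * h * norm (grad U u x)"
 using AE_element_gradient[OF u]
proof eventually_elim
 case (elim x)
 then obtain K b where K: "K \<in> T" "x \<in> interior K" and g: "\<And>y. y \<in> K \<Longrightarrow> u y = grad U u x \<bullet> y + b" by blast
 have xK: "x \<in> K" using K interior_subset by blast
 have osc: "\<bar>u (P K i) - u x\<bar> \<le> h * norm (grad U u x)" for i
  by (rule fe_osc[OF u K(1) g P_in[OF K(1)] xK])
 have h0: "0 \<le> h" using diam[OF K(1)] diam_pos[OF K(1)] by linarith
 have "norm (\<Theta>_elem \<delta> L (P K) u - mat (\<beta>_cut \<delta> L (u x))) \<le> Nn * (h * norm (grad U u x) / \<kappa>)"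
 proof (rule \<Theta>_elem_deviation[OF d K(1)])
  fix t assume "\<exists>i. u (P K i) \<le> t" "\<exists>i. t \<le> u (P K i)"
  then obtain i j where "u (P K i) \<le> t" "t \<le> u (P K j)" by blast
  then have "\<bar>t - u x\<bar> \<le> h * norm (grad U u x)" using osc[of i] osc[of j] by linarith
  then show "\<bar>\<beta>_cut \<delta> L t - \<beta>_cut \<delta> L (u x)\<bar> \<le> h * norm (grad U u x)" using \<beta>_cut_lipschitz[of \<delta> L t "u x"] by linarith
 qed (use h0 in simp)
 then show ?case by (simp add: \<Theta>_interior[OF K] mult.assoc)
qed

text \<open>Where the whole element lies in the region of negative values, the matrix is a multiple of
 the identity of size \<open>\<delta>\<close>.\<close>

lemma \<Theta>_negative:
 assumes d: "0 < \<delta>" "\<delta> < L" and u: "u \<in> Vh" and c: "c > 0"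
 shows "AE x in MU. u x + h * norm (grad U u x) < 0 \<longrightarrow> norm (\<Theta> T P \<delta> L (\<lambda>x. c * u x) x) \<le> Nn * \<delta>"
 using AE_element_gradient[OF u]
proof eventually_elim
 case (elim x)
 then obtain K b where K: "K \<in> T" "x \<in> interior K" and g: "\<And>y. y \<in> K \<Longrightarrow> u y = grad U u x \<bullet> y + b" by blast
 have xK: "x \<in> K" using K interior_subset by blast
 have osc: "\<bar>u (P K i) - u x\<bar> \<le> h * norm (grad U u x)" for i
  by (rule fe_osc[OF u K(1) g P_in[OF K(1)] xK])
 show ?case
 proof
  assume neg: "u x + h * norm (grad U u x) < 0"
  \<comment> \<open>With all vertex values negative, \<open>\<beta>_cut\<close> is constantly
    \<open>\<delta>\<close> between them, so the deviation is zero; the positive factor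
    \<open>c\<close> does not affect the sign.\<close>
  have "norm (\<Theta>_elem \<delta> L (P K) (\<lambda>x. c * u x) - mat \<delta>) \<le> Nn * (0 / \<kappa>)"
  proof (rule \<Theta>_elem_deviation[OF d K(1)])
   fix t assume "\<exists>i. t \<le> c * u (P K i)"
   then obtain i where i: "t \<le> c * u (P K i)" by blast
   have "u (P K i) < 0" using osc[of i] neg by linarith
   then have "t \<le> 0" using i c mult_pos_neg[of c "u (P K i)"] by linarith
   then show "\<bar>\<beta>_cut \<delta> L t - \<delta>\<bar> \<le> 0" using d by (simp add: \<beta>_cut_def)
  qed simp
  then have "\<Theta> T P \<delta> L (\<lambda>x. c * u x) x = mat \<delta>" by (simp add: \<Theta>_interior[OF K])
  then show "norm (\<Theta> T P \<delta> L (\<lambda>x. c * u x) x) \<le> Nn * \<delta>"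
   using norm_mat_le[of \<delta>, where 'n='n] d by (simp add: Nn_def)
 qed
qed

section \<open>Mass lumping and nodal interpolation\<close>

lemma closure_K: "x \<in> closure U \<Longrightarrow> \<exists>K\<in>T. x \<in> K"
 using T_cover by blast

lemma dom_K: "x \<in> U \<Longrightarrow> \<exists>K\<in>T. x \<in> K"
 using closure_K closure_subset by blast

lemma pih_L2: "pih f \<in> L2 U"
 by (rule fe_L2[OF pih_fe])

lemma pih_int: "integrable MU (pih f)"
 by (rule L2_integrable[OF dom_lmeasurable pih_L2])

lemma pih_abs_norm:
 assumes u: "u \<in> Vh" shows "(nm (pih (\<lambda>y. \<bar>u y\<bar>)))^2 \<le> Clump * (nm u)^2"
proof -
 let ?w = "pih (\<lambda>y. \<bar>u y\<bar>)"
 have "(LINT x|MU. (?w x)^2) \<le> Clump * (nm u)^2"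
 proof (rule nodal_mass_bound(2)[OF u])
  show "(\<lambda>x. (?w x)^2) \<in> bm" using L2_measurable[OF pih_L2] by measurable
  fix K x m assume K: "K \<in> T" "x \<in> K" and m: "\<And>i. \<bar>u (P K i)\<bar> \<le> m"
  obtain l where "bary K x l" using bary_exists[OF K] by blast
  note l = baryD[OF this]
  have "0 \<le> ?w x" unfolding l(4) using l(1) by (intro sum_nonneg) simp
  moreover have "?w x \<le> (\<Sum>i\<in>UNIV. l i * m)" unfolding l(4) using l(1) m by (intro sum_mono mult_left_mono) auto
  ultimately show "0 \<le> (?w x)^2 \<and> (?w x)^2 \<le> m^2" using l(2) by (simp add: sum_distrib_right[symmetric])
 qed
 then show ?thesis by (simp add: L2_norm_sq_eq)
qed

text \<open>With barycentric weights the error at a point is a weighted sum of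
  \<open>u (P K i) * (f (P K i) - f x)\<close>. Thus only the oscillation of \<open>f\<close>
  enters, and \<open>u\<close> only through the interpolant of its modulus, whose norm is controlled
  without a gradient of \<open>u\<close>.\<close>

lemma lumping_error:
 assumes u: "u \<in> Vh" and f: "f \<in> Vh" and osc: "\<And>K x y. K \<in> T \<Longrightarrow> x \<in> K \<Longrightarrow> y \<in> K \<Longrightarrow> \<bar>f x - f y\<bar> \<le> e" and e: "0 \<le> e"
 shows "\<bar>(LINT x|MU. pih (\<lambda>y. u y * f y) x) - (LINT x|MU. u x * f x)\<bar>
  \<le> e * (sqrt (measure lebesgue U) * (sqrt Clump * nm u))"
proof -
 let ?M = "MU" let ?w = "pih (\<lambda>y. \<bar>u y\<bar>)"
 have i1: "integrable ?M (\<lambda>x. u x * f x)" by (rule L2_prod_integrable[OF fe_L2[OF u] fe_L2[OF f]])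
 have w0: "0 \<le> ?w x" and pw: "\<bar>pih (\<lambda>y. u y * f y) x - u x * f x\<bar> \<le> e * ?w x" if x: "x \<in> U" for x
 proof -
  obtain K where K: "K \<in> T" "x \<in> K" using dom_K[OF x] by blast
  obtain l where "bary K x l" using bary_exists[OF K] by blast
  note l = baryD[OF this]
  show "0 \<le> ?w x" unfolding l(4) using l(1) by (intro sum_nonneg) simp
  have "pih (\<lambda>y. u y * f y) x - u x * f x = (\<Sum>i\<in>UNIV. l i * (u (P K i) * (f (P K i) - f x)))"
   by (simp add: l(4) l(3)[OF u] sum_distrib_right right_diff_distrib sum_subtractf mult.assoc)
  also have "\<bar>\<dots>\<bar> \<le> (\<Sum>i\<in>UNIV. l i * (\<bar>u (P K i)\<bar> * e))"
   by (rule order_trans[OF sum_abs])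
    (intro sum_mono, simp add: abs_mult l(1) mult_left_mono osc[OF K(1) P_in[OF K(1)] K(2)])
  also have "\<dots> = e * ?w x" by (simp add: l(4) sum_distrib_left mult_ac)
  finally show "\<bar>pih (\<lambda>y. u y * f y) x - u x * f x\<bar> \<le> e * ?w x" .
 qed
 have "\<bar>(LINT x|?M. pih (\<lambda>y. u y * f y) x) - (LINT x|?M. u x * f x)\<bar> = \<bar>LINT x|?M. pih (\<lambda>y. u y * f y) x - u x * f x\<bar>"
  using i1 pih_int by simp
 also have "\<dots> \<le> (LINT x|?M. \<bar>pih (\<lambda>y. u y * f y) x - u x * f x\<bar>)" by (rule integral_abs_bound)
 also have "\<dots> \<le> (LINT x|?M. e * norm (?w x))"
  using i1 pih_int pw w0 by (intro integral_mono) auto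
 also have "\<dots> = e * (LINT x|?M. norm (?w x))" by simp
 also have "\<dots> \<le> e * (sqrt (measure lebesgue U) * nm ?w)"
  using e by (intro mult_left_mono integral_norm_le_L2[OF dom_lmeasurable pih_L2])
 also have "\<dots> \<le> e * (sqrt (measure lebesgue U) * (sqrt Clump * nm u))"
 proof -
  have "sqrt ((nm ?w)^2) \<le> sqrt (Clump * (nm u)^2)" by (rule real_sqrt_le_mono[OF pih_abs_norm[OF u]])
  then have "nm ?w \<le> sqrt Clump * nm u" by (simp add: real_sqrt_mult L2_norm_ge_0)
  then show ?thesis using e by (intro mult_left_mono) auto
 qed
 finally show ?thesis .
qed

lemma pih_square_upper:
 assumes u: "u \<in> Vh" shows "(LINT x|MU. pih (\<lambda>y. u y * u y) x) \<le> Clump * (nm u)^2"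
proof (rule nodal_mass_bound(2)[OF u])
 show "pih (\<lambda>y. u y * u y) \<in> bm" by (rule L2_measurable[OF pih_L2])
 fix K x m assume K: "K \<in> T" "x \<in> K" and m: "\<And>i. \<bar>u (P K i)\<bar> \<le> m"
 obtain l where "bary K x l" using bary_exists[OF K] by blast
 note l = baryD[OF this]
 have "0 \<le> pih (\<lambda>y. u y * u y) x" unfolding l(4) using l(1) by (intro sum_nonneg) simp
 moreover have "pih (\<lambda>y. u y * u y) x \<le> (\<Sum>i\<in>UNIV. l i * m^2)"
  unfolding l(4)
 proof (intro sum_mono mult_left_mono l(1))
  fix i
  have "\<bar>u (P K i)\<bar>^2 \<le> m^2" using m[of i] by (intro power_mono) auto
  then show "u (P K i) * u (P K i) \<le> m^2" by (simp add: power2_eq_square)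
 qed
 ultimately show "0 \<le> pih (\<lambda>y. u y * u y) x \<and> pih (\<lambda>y. u y * u y) x \<le> m^2"
  using l(2) by (simp add: sum_distrib_right[symmetric])
qed

text \<open>Jensen's inequality, in the form that the variance of the vertex values under the
  barycentric weights is nonnegative.\<close>

lemma pih_square_lower:
 assumes u: "u \<in> Vh" shows "(nm u)^2 \<le> (LINT x|MU. pih (\<lambda>y. u y * u y) x)"
proof -
 have "(u x)^2 \<le> pih (\<lambda>y. u y * u y) x" if x: "x \<in> U" for x
 proof -
  obtain K where K: "K \<in> T" "x \<in> K" using dom_K[OF x] by blast
  obtain l where "bary K x l" using bary_exists[OF K] by blast
  note l = baryD[OF this]
  have "0 \<le> (\<Sum>i\<in>UNIV. l i * (u (P K i) - u x)^2)" using l(1) by (intro sum_nonneg) simp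
  also have "\<dots> = (\<Sum>i\<in>UNIV. l i * (u (P K i) * u (P K i)) - 2 * u x * (l i * u (P K i)) + (u x)^2 * l i)"
   by (intro sum.cong refl) (simp add: power2_eq_square algebra_simps)
  also have "\<dots> = pih (\<lambda>y. u y * u y) x - 2 * u x * u x + (u x)^2 * 1"
   unfolding sum.distrib sum_subtractf sum_distrib_left[symmetric]
   using l(4)[of "\<lambda>y. u y * u y"] l(3)[OF u] l(2) by simp
  finally show ?thesis by (simp add: power2_eq_square)
 qed
 then show ?thesis
  unfolding L2_norm_sq_eq using L2_integrable_sq[OF fe_L2[OF u]] pih_int by (intro integral_mono) auto
qed

text \<open>At the vertices, \<open>2 * a * (a - b)\<close> exceeds \<open>a^2 - b^2\<close> by a
  square; this is the stability of the implicit Euler step. Interpolants see only vertex values, so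
  \<open>u\<close> and \<open>v\<close> are arbitrary.\<close>

lemma pih_step_lower:
 assumes dt: "dt > 0"
 shows "((LINT x|MU. pih (\<lambda>y. u y * u y) x) - (LINT x|MU. pih (\<lambda>y. v y * v y) x)) / (2 * dt)
  \<le> (LINT x|MU. pih (\<lambda>y. (u y - v y) / dt * u y) x)"
proof -
 have pw: "pih (\<lambda>y. u y * u y) x / (2 * dt) - pih (\<lambda>y. v y * v y) x / (2 * dt) \<le> pih (\<lambda>y. (u y - v y) / dt * u y) x" if x: "x \<in> U" for x
 proof -
  obtain K where K: "K \<in> T" "x \<in> K" using dom_K[OF x] by blast
  obtain l where "bary K x l" using bary_exists[OF K] by blast
  note l = baryD[OF this]
  have "(\<Sum>i\<in>UNIV. l i * ((u (P K i) * u (P K i)) / (2 * dt) - (v (P K i) * v (P K i)) / (2 * dt)))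
    \<le> (\<Sum>i\<in>UNIV. l i * ((u (P K i) - v (P K i)) / dt * u (P K i)))"
  proof (intro sum_mono mult_left_mono l(1))
   fix i
   have "u (P K i) * u (P K i) - v (P K i) * v (P K i) \<le> 2 * ((u (P K i) - v (P K i)) * u (P K i))"
    using zero_le_square[of "u (P K i) - v (P K i)"] by (simp add: algebra_simps)
   then have "(u (P K i) * u (P K i) - v (P K i) * v (P K i)) / (2 * dt) \<le> (2 * ((u (P K i) - v (P K i)) * u (P K i))) / (2 * dt)"
    using dt by (intro divide_right_mono) auto
   then show "u (P K i) * u (P K i) / (2 * dt) - v (P K i) * v (P K i) / (2 * dt) \<le> (u (P K i) - v (P K i)) / dt * u (P K i)"
    by (simp add: diff_divide_distrib[of "u (P K i) * u (P K i)"])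
  qed
  then show ?thesis by (simp add: l(4) right_diff_distrib sum_subtractf sum_divide_distrib)
 qed
 have "((LINT x|MU. pih (\<lambda>y. u y * u y) x) - (LINT x|MU. pih (\<lambda>y. v y * v y) x)) / (2 * dt)
   = (LINT x|MU. pih (\<lambda>y. u y * u y) x / (2 * dt) - pih (\<lambda>y. v y * v y) x / (2 * dt))"
  using pih_int by (simp add: diff_divide_distrib)
 also have "\<dots> \<le> (LINT x|MU. pih (\<lambda>y. (u y - v y) / dt * u y) x)"
  using pih_int pw by (intro integral_mono) auto
 finally show ?thesis .
qed

lemma pih_scale: "(LINT x|MU. pih (\<lambda>y. c * f y) x) = c * (LINT x|MU. pih f x)"
proof -
 have "pih (\<lambda>y. c * f y) x = c * pih f x" if x: "x \<in> U" for x
 proof -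
  obtain K where K: "K \<in> T" "x \<in> K" using dom_K[OF x] by blast
  obtain l where "bary K x l" using bary_exists[OF K] by blast
  note l = baryD[OF this]
  show ?thesis by (simp add: l(4) sum_distrib_left mult_ac)
 qed
 then have "(LINT x|MU. pih (\<lambda>y. c * f y) x) = (LINT x|MU. c * pih f x)"
  by (intro Bochner_Integration.integral_cong) auto
 then show ?thesis by simp
qed

text \<open>The first claim compares the interpolant with \<open>f\<close> at any other point of the
  same element, which later also yields the oscillation of the interpolant. For the gradient, each
  edge difference of \<open>f\<close> involves \<open>G\<close> at one point of that edge, and
  \<open>gradient_bound\<close> passes from edges to the full vector.\<close>

lemma interpolation_error:
 assumes C1: "C1_closure f G"
  and osc: "\<And>x y. x \<in> closure U \<Longrightarrow> y \<in> closure U \<Longrightarrow> dist x y \<le> h \<Longrightarrow> \<bar>f x - f y\<bar> \<le> e \<and> norm (G x - G y) \<le> e"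
 shows "\<And>K x z. K \<in> T \<Longrightarrow> x \<in> K \<Longrightarrow> z \<in> K \<Longrightarrow> \<bar>pih f x - f z\<bar> \<le> e"
  and "AE x in MU. norm (grad U (pih f) x - G x) \<le> e / \<kappa>"
proof -
 have near: "dist x y \<le> h" if "K \<in> T" "x \<in> K" "y \<in> K" for K x y using K_dist[OF that] diam[OF that(1)] by linarith
 show "\<bar>pih f x - f z\<bar> \<le> e" if K: "K \<in> T" and x: "x \<in> K" and z: "z \<in> K" for K x z
 proof -
  obtain l where "bary K x l" using bary_exists[OF K x] by blast
  note l = baryD[OF this]
  have "pih f x - f z = (\<Sum>i\<in>UNIV. l i * (f (P K i) - f z))"
   by (simp add: l(4) right_diff_distrib sum_subtractf sum_distrib_right[symmetric] l(2))
  also have "\<bar>\<dots>\<bar> \<le> (\<Sum>i\<in>UNIV. l i * e)"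
   using osc[OF K_sub[OF K P_in[OF K]] K_sub[OF K z] near[OF K P_in[OF K] z]]
   by (intro order_trans[OF sum_abs] sum_mono) (simp add: abs_mult l(1) mult_left_mono)
  finally show ?thesis using l(2) by (simp add: sum_distrib_right[symmetric])
 qed
 show "AE x in MU. norm (grad U (pih f) x - G x) \<le> e / \<kappa>"
  using AE_element_gradient[OF pih_fe[of f]]
 proof eventually_elim
  case (elim x)
  then obtain K b where K: "K \<in> T" "x \<in> interior K" and g: "\<And>y. y \<in> K \<Longrightarrow> pih f y = grad U (pih f) x \<bullet> y + b" by blast
  have xK: "x \<in> K" using K interior_subset by blast
  let ?a = "grad U (pih f) x - G x"
  have e0: "0 \<le> e" using osc[OF K_sub[OF K(1) xK] K_sub[OF K(1) xK] near[OF K(1) xK xK]] by simp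
  have "norm ?a * (\<kappa> * diameter K) \<le> e * diameter K"
  proof (rule gradient_bound[OF K(1)])
   fix j
   let ?d = "P K (Some j) - P K None"
   have seg: "closed_segment (P K None) (P K (Some j)) \<subseteq> K"
    using closed_segment_subset[OF P_in[OF K(1)] P_in[OF K(1)] K_convex[OF K(1)]] .
   have "(f has_derivative (\<lambda>h. G z \<bullet> h)) (at z)" if "z \<in> closed_segment (P K None) (P K (Some j))" for z
    using C1 K_sub[OF K(1)] seg that unfolding C1_closure_def by blast
   from segment_mvt[of "P K None" "P K (Some j)", OF this] obtain z where
    z: "z \<in> closed_segment (P K None) (P K (Some j))" "f (P K (Some j)) - f (P K None) = G z \<bullet> ?d" by blast
   have zK: "z \<in> K" using z(1) seg by blast
   have "grad U (pih f) x \<bullet> ?d = pih f (P K (Some j)) - pih f (P K None)"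
    using g[OF P_in[OF K(1)]] by (simp add: inner_diff_right)
   then have "?a \<bullet> ?d = (G z - G x) \<bullet> ?d"
    using z(2) by (simp add: pih_P[OF K(1)] inner_diff_left)
   then have "\<bar>?a \<bullet> ?d\<bar> \<le> norm (G z - G x) * norm ?d" using Cauchy_Schwarz_ineq2[of "G z - G x" ?d] by simp
   also have "\<dots> \<le> e * diameter K"
    using osc[OF K_sub[OF K(1) zK] K_sub[OF K(1) xK] near[OF K(1) zK xK]] K_dist[OF K(1) P_in[OF K(1), of "Some j"] P_in[OF K(1), of None]] e0
    by (intro mult_mono) (auto simp: dist_norm)
   finally show "\<bar>?a \<bullet> ?d\<bar> \<le> e * diameter K" .
  qed (use e0 diam_pos[OF K(1)] in simp)
  then have "norm ?a * \<kappa> \<le> e" using diam_pos[OF K(1)] by (simp add: mult.assoc[symmetric])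
  then show ?case using \<kappa>(1) by (simp add: field_simps)
 qed
qed

end

section \<open>The discrete fractional operator\<close>

text \<open>For exponents between 0 and 1 the power lies between 1 and \<open>t\<close>.\<close>

lemma powr_minus_one_le:
 fixes t s :: real
 assumes t: "t > 0" and s: "0 < s" "s < 1"
 shows "\<bar>t powr s - 1\<bar> \<le> \<bar>t - 1\<bar>"
proof (cases "t \<ge> 1")
 case True
 have "t powr 0 \<le> t powr s" "t powr s \<le> t powr 1" using True s by (intro powr_mono; simp)+
 then show ?thesis using True t by simp
next
 case False
 have "t powr 1 \<le> t powr s" "t powr s \<le> t powr 0" using False t s by (intro powr_mono'; simp)+
 then show ?thesis using False t by simp
qed

locale fe_neumann = neumann U A Q \<Lambda>1 \<Lambda>2 lam phi + fe_mesh U T P h \<kappa>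
 for U :: "(real^'n) set" and A Q \<Lambda>1 \<Lambda>2 lam phi T P h \<kappa> +
 fixes m :: nat and mu :: "nat \<Rightarrow> real" and psi :: "nat \<Rightarrow> real^'n \<Rightarrow> real"
 assumes dbasis: "discrete_eigenbasis U A Q T m mu psi"
begin

abbreviation "Vd \<equiv> Vh \<inter> L2_dia U Q"

lemma psi_Vd: "k < m \<Longrightarrow> psi k \<in> Vd" and mu_pos: "k < m \<Longrightarrow> 0 < mu k"
 and psi_energy: "k < m \<Longrightarrow> v \<in> Vd \<Longrightarrow> en (psi k) v = mu k * inn (psi k) v"
 and psi_orth: "k < m \<Longrightarrow> l < m \<Longrightarrow> inn (psi k) (psi l) = (if k = l then 1 else 0)"
 and psi_span: "v \<in> Vd \<Longrightarrow> x \<in> closure U \<Longrightarrow> v x = (\<Sum>k<m. inn v (psi k) * psi k x)"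
 using dbasis by (auto simp: discrete_eigenbasis_def)

lemma psi_H1: "k < m \<Longrightarrow> psi k \<in> H1 U"
 using psi_Vd fe_H1(1) by blast

lemma psi_L2: "k < m \<Longrightarrow> psi k \<in> L2 U"
 by (rule H1_L2[OF psi_H1])

lemma psi_energy_orth: "k < m \<Longrightarrow> l < m \<Longrightarrow> en (psi k) (psi l) = (if k = l then mu k else 0)"
 using psi_energy[of k "psi l"] psi_Vd[of l] psi_orth[of k l] by simp

text \<open>The finite elements are conforming, so the continuous Poincare inequality applies to the
  discrete eigenfunctions. This makes the bounds below uniform in the mesh.\<close>

lemma mu_ge: "k < m \<Longrightarrow> lam 0 \<le> mu k"
 using poincare[OF psi_H1, of k] psi_Vd[of k] by (auto simp: psi_energy_orth L2_norm_sq[OF psi_L2] psi_orth)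

lemma L2_bessel: "u \<in> L2 U \<Longrightarrow> (\<Sum>k<m. (inn u (psi k))^2) \<le> (nm u)^2"
 using L2.bessel[of "{..<m}" psi U u "\<lambda>_. 1"] psi_L2 psi_orth by (simp add: L2_norm_sq)

lemma comb_H1: "(\<lambda>x. \<Sum>k<m. a k * psi k x) \<in> H1 U"
 by (intro E.S_sum H1_scale psi_H1) auto

lemma comb_norm: "(nm (\<lambda>x. \<Sum>k<m. a k * psi k x))^2 = (\<Sum>k<m. (a k)^2)"
 using L2.ip_orth_expansion[of "{..<m}" psi U "\<lambda>_. 1" a a] psi_L2 psi_orth L2_norm_sq[OF H1_L2[OF comb_H1[of a]]]
 by (simp add: power2_eq_square)

lemma comb_energy: "en (\<lambda>x. \<Sum>k<m. a k * psi k x) (\<lambda>x. \<Sum>k<m. a k * psi k x) = (\<Sum>k<m. mu k * (a k)^2)"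
 using E.ip_orth_expansion[of "{..<m}" psi mu a a] psi_H1 psi_energy_orth
 by (simp add: power2_eq_square mult.assoc)

lemma comb_inner: "u \<in> L2 U \<Longrightarrow> inn (\<lambda>x. \<Sum>k<m. a k * psi k x) u = (\<Sum>k<m. a k * inn (psi k) u)"
 using psi_L2 by (subst L2.ip_sum_left) (auto intro!: L2_scale sum.cong simp: L2_inner_scale_left)

text \<open>In the discrete eigenbasis the energy of the solution is a sum of squared coefficients
  of \<open>f\<close> with weights \<open>mu k powr (1 - 2 * s)\<close>. For \<open>s\<close> above
  1/2 this power is decreasing, so \<open>mu_ge\<close> bounds it.\<close>

lemma solution_bounds:
 assumes sol: "discrete_fractional_solution U Q T m mu psi s f c" and f: "f \<in> L2 U" and s: "1 / 2 < s"
 shows "en c c \<le> lam 0 powr (1 - 2 * s) * (nm f)^2"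
proof -
 define a where "a k = - (mu k powr (- s) * inn f (psi k))" for k
 have c: "c \<in> Vd" "\<And>x. x \<in> closure U \<Longrightarrow> c x = (\<Sum>k<m. a k * psi k x)"
  using sol by (auto simp: discrete_fractional_solution_def a_def sum_negf)
 have cH: "c \<in> H1 U" using c fe_H1(1) by blast
 \<comment> \<open>\<open>c\<close> equals the sum only on the closure of \<open>U\<close>; since
   \<open>grad\<close> is the same for functions that agree almost everywhere, the energies
   coincide.\<close>
 have "AE x in MU. c x = (\<Sum>k<m. a k * psi k x)"
  using c(2) closure_subset by (intro AE_I2) auto
 then have g: "grad U (\<lambda>x. \<Sum>k<m. a k * psi k x) = grad U c"
  by (intro H1_cong_AE(2)[OF cH] L2_measurable H1_L2 comb_H1)
 have "en c c = en (\<lambda>x. \<Sum>k<m. a k * psi k x) (\<lambda>x. \<Sum>k<m. a k * psi k x)"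
  unfolding energy_form_def g using c(2) closure_subset[of U]
  by (intro arg_cong2[where f="(+)"] refl Bochner_Integration.integral_cong) auto
 also have "\<dots> = (\<Sum>k<m. mu k * (a k)^2)" by (rule comb_energy)
 also have "\<dots> \<le> (\<Sum>k<m. lam 0 powr (1 - 2 * s) * (inn f (psi k))^2)"
 proof (rule sum_mono)
  fix k assume "k \<in> {..<m}"
  then have k: "k < m" by simp
  have "mu k * (mu k powr (- s))^2 = mu k powr (1 - 2 * s)"
  proof -
   have "mu k * (mu k powr (- s))^2 = mu k powr 1 * (mu k powr (- s) * mu k powr (- s))"
    using mu_pos[OF k] by (simp add: power2_eq_square)
   also have "\<dots> = mu k powr (1 - 2 * s)" unfolding powr_add[symmetric] by simp
   finally show ?thesis .
  qed
  also have "\<dots> \<le> lam 0 powr (1 - 2 * s)" using mu_ge[OF k] lam_pos[of 0] s by (intro powr_mono2') auto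
  finally have "mu k * (mu k powr (- s))^2 * (inn f (psi k))^2 \<le> lam 0 powr (1 - 2 * s) * (inn f (psi k))^2"
   by (rule mult_right_mono) simp
  then show "mu k * (a k)^2 \<le> lam 0 powr (1 - 2 * s) * (inn f (psi k))^2"
   by (simp add: a_def power_mult_distrib mult.assoc)
 qed
 also have "\<dots> \<le> lam 0 powr (1 - 2 * s) * (nm f)^2"
  unfolding sum_distrib_left[symmetric] by (intro mult_left_mono L2_bessel f) auto
 finally show ?thesis .
qed

text \<open>The discrete inverse power is symmetric and can be moved from the varying datum to a
  fixed \<open>u\<close>. With \<open>u\<close> an eigenfunction of the continuous operator, each
  coefficient of the solution depends on a single image under the discrete operator.\<close>

lemma solution_inner:
 assumes sol: "discrete_fractional_solution U Q T m mu psi s f c" and f: "f \<in> L2 U" and u: "u \<in> L2 U"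
 shows "inn c u = - inn f (\<lambda>x. \<Sum>k<m. mu k powr (- s) * inn u (psi k) * psi k x)"
proof -
 define a where "a k = - (mu k powr (- s) * inn f (psi k))" for k
 have c: "c \<in> Vd" "\<And>x. x \<in> closure U \<Longrightarrow> c x = (\<Sum>k<m. a k * psi k x)"
  using sol by (auto simp: discrete_fractional_solution_def a_def sum_negf)
 have "inn c u = inn (\<lambda>x. \<Sum>k<m. a k * psi k x) u"
  unfolding L2_inner_def using c(2) closure_subset[of U] by (intro Bochner_Integration.integral_cong) auto
 also have "\<dots> = (\<Sum>k<m. a k * inn (psi k) u)" by (rule comb_inner[OF u])
 also have "\<dots> = - (\<Sum>k<m. (mu k powr (- s) * inn u (psi k)) * inn (psi k) f)"
  using f u psi_L2 by (simp add: a_def sum_negf[symmetric] L2.ip_sym[of f] L2.ip_sym[of u] mult_ac)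
 also have "(\<Sum>k<m. (mu k powr (- s) * inn u (psi k)) * inn (psi k) f)
   = inn (\<lambda>x. \<Sum>k<m. (mu k powr (- s) * inn u (psi k)) * psi k x) f"
  by (rule comb_inner[OF f, symmetric])
 also have "\<dots> = inn f (\<lambda>x. \<Sum>k<m. mu k powr (- s) * inn u (psi k) * psi k x)"
  by (rule L2.ip_sym[OF H1_L2[OF comb_H1] f])
 finally show ?thesis .
qed

text \<open>The coefficients \<open>(\<lambda> / \<mu> - 1) b\<close> of an eigenfunction with eigenvalue \<open>\<lambda>\<close> are expressed
 by the error of an arbitrary discrete approximation \<open>w\<close>, and \<open>|t\<^sup>s - 1| \<le> |t - 1|\<close>.\<close>

lemma eigenfunction_approx:
 assumes s: "0 < s" "s < 1" and w: "w \<in> Vd"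
 shows "nm (\<lambda>x. (\<Sum>l<m. mu l powr (- s) * cf (psi l) k * psi l x) - lam k powr (- s) * phi k x)
  \<le> lam k powr (- s) * (sqrt (en (\<lambda>x. phi k x - w x) (\<lambda>x. phi k x - w x) / lam 0) + 2 * nm (\<lambda>x. phi k x - w x))"
proof -
 define b where "b l = cf (psi l) k" for l
 define \<omega> where "\<omega> l = inn w (psi l)" for l
 let ?lk = "lam k"
 define d where "d x = phi k x - w x" for x
 have wH: "w \<in> H1 U" using w fe_H1(1) by blast
 have wL: "w \<in> L2 U" by (rule H1_L2[OF wH])
 have dH: "d \<in> H1 U" unfolding d_def[abs_def] by (rule H1_diff[OF phi_H1 wH])
 have dL: "d \<in> L2 U" by (rule H1_L2[OF dH])
 have l0: "lam 0 > 0" by (rule lam_pos)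
 \<comment> \<open>The eigenvalue identities for \<open>phi k\<close> and \<open>psi l\<close> leave
   the coefficient \<open>\<omega> l\<close> of \<open>w\<close> with equal weights in both terms on
   the right, so it cancels.\<close>
 have key: "(?lk / mu l - 1) * b l = en d (psi l) / mu l - inn d (psi l)" if l: "l < m" for l
 proof -
  have 1: "en d (psi l) = ?lk * b l - mu l * \<omega> l"
   unfolding d_def[abs_def] using l wH w
   by (simp add: E.ip_diff_left phi_H1 psi_H1 energy_phi b_def E.ip_sym[OF wH] psi_energy \<omega>_def L2.ip_sym[OF wL psi_L2])
  have 2: "inn d (psi l) = b l - \<omega> l"
   unfolding d_def[abs_def] using l wL by (simp add: L2.ip_diff_left psi_L2 b_def \<omega>_def L2.ip_sym[OF phi_L2 psi_L2])
  show ?thesis unfolding 1 2 using mu_pos[OF l] by (simp add: field_simps)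
 qed
 define a where "a l = (mu l powr (- s) - ?lk powr (- s)) * b l" for l
 have a_le: "\<bar>a l\<bar> \<le> ?lk powr (- s) * \<bar>(?lk / mu l - 1) * b l\<bar>" if l: "l < m" for l
 proof -
  have "mu l powr (- s) = ?lk powr (- s) * (?lk / mu l) powr s"
   using mu_pos[OF l] lam_pos[of k] by (simp add: powr_divide powr_minus field_simps)
  then have "a l = ?lk powr (- s) * (((?lk / mu l) powr s - 1) * b l)" by (simp add: a_def algebra_simps)
  then have "\<bar>a l\<bar> = ?lk powr (- s) * (\<bar>(?lk / mu l) powr s - 1\<bar> * \<bar>b l\<bar>)" by (simp add: abs_mult)
  also have "\<dots> \<le> ?lk powr (- s) * (\<bar>?lk / mu l - 1\<bar> * \<bar>b l\<bar>)"
   using powr_minus_one_le[of "?lk / mu l" s] mu_pos[OF l] lam_pos[of k] s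
   by (intro mult_left_mono mult_right_mono) auto
  finally show ?thesis by (simp add: abs_mult)
 qed
 have n1: "nm (\<lambda>x. \<Sum>l<m. a l * psi l x) \<le> ?lk powr (- s) * (sqrt (en d d / lam 0) + nm d)"
 proof -
  have "nm (\<lambda>x. \<Sum>l<m. a l * psi l x) = L2_set a {..<m}"
   unfolding L2_set_def comb_norm[symmetric] by (simp add: L2_norm_ge_0)
  also have "\<dots> = L2_set (\<lambda>l. \<bar>a l\<bar>) {..<m}" by (simp add: L2_set_def)
  also have "\<dots> \<le> L2_set (\<lambda>l. ?lk powr (- s) * (\<bar>en d (psi l) / mu l\<bar> + \<bar>inn d (psi l)\<bar>)) {..<m}"
  proof (rule L2_set_mono)
   fix l assume "l \<in> {..<m}"
   then have l: "l < m" by simp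
   have "\<bar>(?lk / mu l - 1) * b l\<bar> \<le> \<bar>en d (psi l) / mu l\<bar> + \<bar>inn d (psi l)\<bar>" unfolding key[OF l] by linarith
   then show "\<bar>a l\<bar> \<le> ?lk powr (- s) * (\<bar>en d (psi l) / mu l\<bar> + \<bar>inn d (psi l)\<bar>)"
    using a_le[OF l] by (meson mult_left_mono order_trans powr_ge_zero)
  qed auto
  also have "\<dots> = ?lk powr (- s) * L2_set (\<lambda>l. \<bar>en d (psi l) / mu l\<bar> + \<bar>inn d (psi l)\<bar>) {..<m}"
   by (rule L2_set_right_distrib[symmetric]) simp
  also have "\<dots> \<le> ?lk powr (- s) * (L2_set (\<lambda>l. \<bar>en d (psi l) / mu l\<bar>) {..<m} + L2_set (\<lambda>l. \<bar>inn d (psi l)\<bar>) {..<m})"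
   by (intro mult_left_mono L2_set_triangle_ineq) simp
  also have "\<dots> \<le> ?lk powr (- s) * (sqrt (en d d / lam 0) + nm d)"
  proof (intro mult_left_mono add_mono)
   have "(\<Sum>l<m. \<bar>en d (psi l) / mu l\<bar>^2) \<le> (\<Sum>l<m. (en d (psi l))^2 / mu l / lam 0)"
   proof (rule sum_mono)
    fix l assume "l \<in> {..<m}"
    then have l: "l < m" by simp
    have "(en d (psi l))^2 / (mu l * mu l) \<le> (en d (psi l))^2 / (mu l * lam 0)"
     using mu_ge[OF l] l0 mu_pos[OF l] by (intro divide_left_mono mult_left_mono) auto
    then show "\<bar>en d (psi l) / mu l\<bar>^2 \<le> (en d (psi l))^2 / mu l / lam 0"
     by (simp add: power_divide power2_eq_square[of "mu l"])
   qed
   also have "\<dots> = (\<Sum>l<m. (en d (psi l))^2 / mu l) / lam 0" by (simp add: sum_divide_distrib)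
   also have "\<dots> \<le> en d d / lam 0"
    using E.bessel[of "{..<m}" psi d mu] psi_H1 dH psi_energy_orth mu_pos l0 by (intro divide_right_mono) auto
   finally show "L2_set (\<lambda>l. \<bar>en d (psi l) / mu l\<bar>) {..<m} \<le> sqrt (en d d / lam 0)"
    unfolding L2_set_def by (rule real_sqrt_le_mono)
   have "sqrt (\<Sum>l<m. (inn d (psi l))^2) \<le> sqrt ((nm d)^2)" by (rule real_sqrt_le_mono[OF L2_bessel[OF dL]])
   then show "L2_set (\<lambda>l. \<bar>inn d (psi l)\<bar>) {..<m} \<le> nm d"
    by (simp add: L2_set_def L2_norm_ge_0)
  qed simp
  finally show ?thesis .
 qed
 \<comment> \<open>\<open>b\<close> are the coefficients of the L2 projection of
   \<open>phi k\<close>, which is at least as close as \<open>w\<close>.\<close>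
 have n2: "nm (\<lambda>x. phi k x - (\<Sum>l<m. b l * psi l x)) \<le> nm d"
 proof (rule power2_le_imp_le)
  have bo: "inn (phi k) (psi l) = b l" if "l < m" for l using that by (simp add: b_def L2.ip_sym[OF phi_L2 psi_L2])
  have e: "(nm (\<lambda>x. phi k x - (\<Sum>l<m. c l * psi l x)))^2 = inn (phi k) (phi k) - 2 * (\<Sum>l<m. c l * b l) + (\<Sum>l<m. (c l)^2)" for c
   using L2.ip_orth_sub[of "{..<m}" psi U "phi k" "\<lambda>_. 1" c] psi_L2 psi_orth bo
   by (simp add: L2_norm_sq[OF L2.S_diff[OF phi_L2 H1_L2[OF comb_H1]]])
  have dd: "nm d = nm (\<lambda>x. phi k x - (\<Sum>l<m. \<omega> l * psi l x))"
   unfolding d_def[abs_def] L2_norm_eq \<omega>_def using psi_span[OF w] closure_subset[of U]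
   by (intro arg_cong[where f=sqrt] Bochner_Integration.integral_cong) (auto simp: subset_iff)
  have "(nm d)^2 - (nm (\<lambda>x. phi k x - (\<Sum>l<m. b l * psi l x)))^2 = (\<Sum>l<m. (\<omega> l - b l)^2)"
   unfolding dd e by (simp add: power2_diff sum.distrib sum_subtractf sum_distrib_left power2_eq_square algebra_simps)
  moreover have "0 \<le> (\<Sum>l<m. (\<omega> l - b l)^2)" by (intro sum_nonneg) simp
  ultimately show "(nm (\<lambda>x. phi k x - (\<Sum>l<m. b l * psi l x)))^2 \<le> (nm d)^2" by linarith
 qed (rule L2_norm_ge_0)
 let ?Pb = "\<lambda>x. \<Sum>l<m. b l * psi l x"
 have PbL: "?Pb \<in> L2 U" by (rule H1_L2[OF comb_H1])
 have aL: "(\<lambda>x. \<Sum>l<m. a l * psi l x) \<in> L2 U" by (rule H1_L2[OF comb_H1])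
 have eq: "(\<Sum>l<m. mu l powr (- s) * cf (psi l) k * psi l x) - ?lk powr (- s) * phi k x
   = (\<Sum>l<m. a l * psi l x) - ?lk powr (- s) * (phi k x - ?Pb x)" for x
  by (simp add: a_def b_def sum_subtractf sum_distrib_left left_diff_distrib right_diff_distrib mult_ac)
 have "nm (\<lambda>x. (\<Sum>l<m. a l * psi l x) - ?lk powr (- s) * (phi k x - ?Pb x))
   \<le> nm (\<lambda>x. \<Sum>l<m. a l * psi l x) + nm (\<lambda>x. ?lk powr (- s) * (phi k x - ?Pb x))"
  using L2.nrm_triangle_diff[OF aL L2_scale[OF L2.S_diff[OF phi_L2 PbL]]] by (simp add: L2_nrm)
 also have "nm (\<lambda>x. ?lk powr (- s) * (phi k x - ?Pb x)) = ?lk powr (- s) * nm (\<lambda>x. phi k x - ?Pb x)"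
  using L2_norm_scale[OF L2.S_diff[OF phi_L2 PbL], of "?lk powr (- s)"] by simp
 also have "\<dots> \<le> ?lk powr (- s) * nm d" using n2 by (intro mult_left_mono) auto
 finally show ?thesis using n1 unfolding eq d_def[symmetric, abs_def] by (simp add: algebra_simps d_def[abs_def])
qed

end

section \<open>Families of meshes and convergence of the discrete fractional problem\<close>

locale fe_family = neumann U A Q \<Lambda>1 \<Lambda>2 lam phi
 for U :: "(real^'n) set" and A Q \<Lambda>1 \<Lambda>2 lam phi +
 fixes H :: "real set" and T :: "real \<Rightarrow> (real^'n) set set"
  and P :: "real \<Rightarrow> (real^'n) set \<Rightarrow> 'n option \<Rightarrow> real^'n" and \<kappa> :: real
  and m :: "real \<Rightarrow> nat" and mu :: "real \<Rightarrow> nat \<Rightarrow> real" and psi :: "real \<Rightarrow> nat \<Rightarrow> real^'n \<Rightarrow> real"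
 assumes meshes: "\<And>h. h \<in> H \<Longrightarrow> fe_mesh U (T h) (P h) h \<kappa>"
  and dbases: "\<And>h. h \<in> H \<Longrightarrow> discrete_eigenbasis U A Q (T h) (m h) (mu h) (psi h)"
begin

abbreviation "V h \<equiv> fe_space U (T h)"
abbreviation "Ih h \<equiv> nodal_interpolant U (T h)"

lemma disc: "h \<in> H \<Longrightarrow> fe_neumann U A Q \<Lambda>1 \<Lambda>2 lam phi (T h) (P h) h \<kappa> (m h) (mu h) (psi h)"
 by (intro fe_neumann.intro neumann_axioms meshes fe_neumann_axioms.intro dbases)

lemma V_H1: "h \<in> H \<Longrightarrow> v \<in> V h \<Longrightarrow> v \<in> H1 U"
 using fe_mesh.fe_H1(1)[OF meshes] .

lemma V_L2: "h \<in> H \<Longrightarrow> v \<in> V h \<Longrightarrow> v \<in> L2 U"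
 by (rule H1_L2[OF V_H1])

lemma Ih_V: "h \<in> H \<Longrightarrow> Ih h f \<in> V h"
 by (rule fe_mesh.pih_fe[OF meshes])

lemma interpolation_uniform:
 assumes C1: "C1_closure f G" and e: "e > 0"
 obtains \<eta> where "\<eta> > 0"
  "\<And>h K x z. h \<in> H \<Longrightarrow> h < \<eta> \<Longrightarrow> K \<in> T h \<Longrightarrow> x \<in> K \<Longrightarrow> z \<in> K \<Longrightarrow> \<bar>Ih h f x - f z\<bar> \<le> e"
  "\<And>h. h \<in> H \<Longrightarrow> h < \<eta> \<Longrightarrow> AE x in MU. norm (grad U (Ih h f) x - G x) \<le> e"
proof (cases "H = {}")
 case True
 then show thesis using that[of 1] by simp
next
 case False
 then have k0: "\<kappa> > 0" using meshes fe_mesh.\<kappa>(1) by blast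
 \<comment> \<open>Anticipates the factor \<open>1 / \<kappa>\<close> in the gradient error.\<close>
 define e' where "e' = min e (e * \<kappa>)"
 have e': "e' > 0" "e' \<le> e" "e' / \<kappa> \<le> e" using e k0 by (auto simp: e'_def field_simps)
 have "uniformly_continuous_on (closure U) f" "uniformly_continuous_on (closure U) G"
  using C1_closure_continuous[OF C1] C1 compact_dom by (auto simp: C1_closure_def intro!: compact_uniformly_continuous)
 then obtain d1 d2 where d: "d1 > 0" "d2 > 0"
  "\<And>x x'. x \<in> closure U \<Longrightarrow> x' \<in> closure U \<Longrightarrow> dist x' x < d1 \<Longrightarrow> dist (f x') (f x) < e'"
  "\<And>x x'. x \<in> closure U \<Longrightarrow> x' \<in> closure U \<Longrightarrow> dist x' x < d2 \<Longrightarrow> dist (G x') (G x) < e'"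
  using e'(1) unfolding uniformly_continuous_on_def by metis
 have osc: "\<bar>f x - f y\<bar> \<le> e' \<and> norm (G x - G y) \<le> e'"
  if "h < min d1 d2" "x \<in> closure U" "y \<in> closure U" "dist x y \<le> h" for h x y
  using d(3)[OF that(3,2)] d(4)[OF that(3,2)] that by (auto simp: dist_real_def dist_norm less_imp_le)
 show thesis
 proof (rule that[of "min d1 d2"])
  show "min d1 d2 > 0" using d by simp
  fix h assume h: "h \<in> H" "h < min d1 d2"
  interpret fe_mesh U "T h" "P h" h \<kappa> by (rule meshes[OF h(1)])
  have "\<And>x y. x \<in> closure U \<Longrightarrow> y \<in> closure U \<Longrightarrow> dist x y \<le> h
    \<Longrightarrow> \<bar>f x - f y\<bar> \<le> e' \<and> norm (G x - G y) \<le> e'"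
   by (rule osc[OF h(2)])
  note osc' = this
  show "\<bar>Ih h f x - f z\<bar> \<le> e" if K: "K \<in> T h" "x \<in> K" "z \<in> K" for K x z
   using interpolation_error(1)[where e=e', OF C1 _ K] osc' e'(2) by fastforce
  have "AE x in MU. norm (grad U (Ih h f) x - G x) \<le> e' / \<kappa>"
   by (rule interpolation_error(2)[OF C1]) (rule osc')
  then show "AE x in MU. norm (grad U (Ih h f) x - G x) \<le> e"
   by eventually_elim (use e'(3) in simp)
 qed
qed

text \<open>Nodal values make no sense in \<open>H1\<close>, so a fixed C1 function near
  \<open>u\<close> is interpolated; the threshold \<open>\<eta>\<close> depends on that
  function.\<close>

lemma fe_dense:
 assumes u: "u \<in> H1 U" and e: "e > 0"
 obtains \<eta> where "\<eta> > 0"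
  "\<And>h. h \<in> H \<Longrightarrow> h < \<eta> \<Longrightarrow> \<exists>w\<in>V h. nm (\<lambda>x. u x - w x) < e \<and> nm (\<lambda>x. grad U u x - grad U w x) < e"
proof -
 define S where "S = sqrt (measure lebesgue U) + 1"
 have S: "S > 0" by (simp add: S_def add_nonneg_pos)
 obtain v G where vG: "C1_closure v G" "nm (\<lambda>x. v x - u x) < e / 2" "nm (\<lambda>x. G x - grad U u x) < e / 2"
  using C1_dense[OF u, of "e/2"] e by auto
 have vL: "v \<in> L2 U" and GL: "G \<in> L2 U" using continuous_L2 C1_closure_continuous[OF vG(1)] vG(1) by (auto simp: C1_closure_def)
 have gL: "grad U u \<in> L2 U" and uL: "u \<in> L2 U" using u by (auto simp: grad_L2 H1_L2)
 have eS: "e / (2 * S) > 0" using e S by simp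
 obtain \<eta> where \<eta>: "\<eta> > 0"
  "\<And>h K x z. h \<in> H \<Longrightarrow> h < \<eta> \<Longrightarrow> K \<in> T h \<Longrightarrow> x \<in> K \<Longrightarrow> z \<in> K \<Longrightarrow> \<bar>Ih h v x - v z\<bar> \<le> e / (2 * S)"
  "\<And>h. h \<in> H \<Longrightarrow> h < \<eta> \<Longrightarrow> AE x in MU. norm (grad U (Ih h v) x - G x) \<le> e / (2 * S)"
  using interpolation_uniform[OF vG(1) eS] by blast
 have bnd: "e / (2 * S) * sqrt (measure lebesgue U) < e / 2"
 proof -
  have "e / (2 * S) * sqrt (measure lebesgue U) < e / (2 * S) * S" using eS by (intro mult_strict_left_mono) (auto simp: S_def)
  then show ?thesis using S by simp
 qed
 have "\<exists>w\<in>V h. nm (\<lambda>x. u x - w x) < e \<and> nm (\<lambda>x. grad U u x - grad U w x) < e"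
  if h: "h \<in> H" "h < \<eta>" for h
 proof (intro bexI[of _ "Ih h v"] conjI)
  show wV: "Ih h v \<in> V h" by (rule Ih_V[OF h(1)])
  interpret fe_mesh U "T h" "P h" h \<kappa> by (rule meshes[OF h(1)])
  have wL: "Ih h v \<in> L2 U" and gwL: "grad U (Ih h v) \<in> L2 U" using V_L2[OF h(1) wV] grad_L2[OF V_H1[OF h(1) wV]] by auto
  have "AE x in MU. norm (Ih h v x - v x) \<le> e / (2 * S)"
   using \<eta>(2)[OF h] dom_K by (intro AE_I2) fastforce
  then have "nm (\<lambda>x. Ih h v x - v x) \<le> e / (2 * S) * sqrt (measure lebesgue U)"
   using eS wL vL by (intro L2_bounded(2)[OF dom_lmeasurable] L2_measurable[OF L2.S_diff]) auto
  then show "nm (\<lambda>x. u x - Ih h v x) < e"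
   using bnd vG(2) L2_triangle3[OF uL vL wL] L2_norm_commute[OF uL vL] L2_norm_commute[OF vL wL] by linarith
  have "nm (\<lambda>x. grad U (Ih h v) x - G x) \<le> e / (2 * S) * sqrt (measure lebesgue U)"
   using eS gwL GL \<eta>(3)[OF h] by (intro L2_bounded(2)[OF dom_lmeasurable] L2_measurable[OF L2.S_diff]) auto
  then show "nm (\<lambda>x. grad U u x - grad U (Ih h v) x) < e"
   using bnd vG(3) L2_triangle3[OF gL GL gwL] L2_norm_commute[OF gL GL] L2_norm_commute[OF GL gwL] by linarith
 qed
 with \<eta>(1) that show thesis by blast
qed

lemma solution_bound:
 assumes s: "1 / 2 < s"
 obtains C where "C > 0" "\<And>h f c. h \<in> H \<Longrightarrow> f \<in> L2 U \<Longrightarrow>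
  discrete_fractional_solution U Q (T h) (m h) (mu h) (psi h) s f c \<Longrightarrow>
  c \<in> V h \<and> c \<in> H1 U \<and> c \<in> L2_dia U Q \<and> nm c \<le> C * nm f \<and> nm (grad U c) \<le> C * nm f"
proof -
 define B where "B = lam 0 powr (1 - 2 * s)"
 define C where "C = sqrt (B / lam 0) + sqrt (B / \<Lambda>1) + 1"
 have l0: "lam 0 > 0" by (rule lam_pos)
 have B: "B > 0" using l0 by (simp add: B_def)
 have C: "sqrt (B / lam 0) \<le> C" "sqrt (B / \<Lambda>1) \<le> C" "C > 0"
  using B l0 \<Lambda>1_pos by (auto simp: C_def add_nonneg_pos)
 have "c \<in> V h \<and> c \<in> H1 U \<and> c \<in> L2_dia U Q \<and> nm c \<le> C * nm f \<and> nm (grad U c) \<le> C * nm f"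
  if h: "h \<in> H" and f: "f \<in> L2 U" and sol: "discrete_fractional_solution U Q (T h) (m h) (mu h) (psi h) s f c" for h f c
 proof -
  have cV: "c \<in> V h" "c \<in> L2_dia U Q" using sol by (auto simp: discrete_fractional_solution_def)
  have cH: "c \<in> H1 U" by (rule V_H1[OF h cV(1)])
  have en: "en c c \<le> B * (nm f)^2"
   unfolding B_def by (rule fe_neumann.solution_bounds[OF disc[OF h] sol f s])
  have "(nm c)^2 \<le> B / lam 0 * (nm f)^2"
   using poincare[OF cH cV(2)] en l0 by (simp add: field_simps)
  from real_sqrt_le_mono[OF this] have "nm c \<le> sqrt (B / lam 0) * nm f"
   by (simp add: real_sqrt_mult real_sqrt_divide L2_norm_ge_0)
  moreover have "(nm (grad U c))^2 \<le> B / \<Lambda>1 * (nm f)^2"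
   using energy_coercive[OF cH] en \<Lambda>1_pos by (simp add: field_simps)
  from real_sqrt_le_mono[OF this] have "nm (grad U c) \<le> sqrt (B / \<Lambda>1) * nm f"
   by (simp add: real_sqrt_mult real_sqrt_divide L2_norm_ge_0)
  ultimately show ?thesis
   using cV cH mult_right_mono[OF C(1) L2_norm_ge_0[of U f]] mult_right_mono[OF C(2) L2_norm_ge_0[of U f]] by auto
 qed
 with C(3) that show thesis by blast
qed

text \<open>The relation between the coefficients turns the weighted sum with exponent
  \<open>2 * s\<close> into the Parseval sum of \<open>g\<close>, so \<open>c\<close> lies in the
  domain automatically.\<close>

lemma fractional_power_coefficients:
 assumes s: "0 < s" and g: "g \<in> L2_dia U Q" and c: "c \<in> L2_dia U Q"
  and cg: "\<And>k. cf c k = - (lam k powr (- s) * cf g k)"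
 shows "fractional_power U Q lam phi s c (\<lambda>x. - g x)"
proof -
 have 1: "lam k powr s * cf c k = - cf g k" for k
  using lam_pos[of k] by (simp add: cg powr_minus field_simps)
 have 2: "lam k powr (2 * s) * (cf c k)^2 = (cf g k)^2" for k
 proof -
  have "lam k powr (2 * s) * (cf c k)^2 = (lam k powr s * cf c k)^2"
   by (simp add: power_mult_distrib power2_eq_square powr_add[symmetric])
  then show ?thesis by (simp add: 1)
 qed
 have gL: "g \<in> L2 U" by (rule L2_dia_L2[OF g])
 have "c \<in> Hr_dia U Q lam phi (2 * s)"
  using c parseval[OF g] by (auto simp: Hr_dia_def 2 sums_iff)
 moreover have "L2_strong_lim U (\<lambda>m x. \<Sum>k<m. lam k powr s * cf c k * phi k x) (\<lambda>x. - g x) sequentially"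
 proof -
  have "nm (\<lambda>x. (\<Sum>k<m. lam k powr s * cf c k * phi k x) - - g x) = nm (\<lambda>x. g x - psum g m x)" for m
   by (simp add: 1 sum_negf)
  moreover have "(\<lambda>x. \<Sum>k<m. lam k powr s * cf c k * phi k x) \<in> L2 U" for m
   by (intro L2.S_sum L2_scale) simp
  ultimately show ?thesis using psum_tendsto[OF g] gL by (simp add: L2_strong_lim_def)
 qed
 ultimately show ?thesis by (simp add: fractional_power_def)
qed

lemma fractional_convergence:
 assumes s: "1 / 2 < s" "s < 1" and hs: "\<And>j::nat. hs j \<in> H" "hs \<longlonglongrightarrow> 0"
  and g: "\<And>j. g j \<in> L2_dia U Q" "g0 \<in> L2_dia U Q" "tends g g0"
  and sol: "\<And>j. discrete_fractional_solution U Q (T (hs j)) (m (hs j)) (mu (hs j)) (psi (hs j)) s (g j) (c j)"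
 obtains r :: "nat \<Rightarrow> nat" and c0 where "strict_mono r" "c0 \<in> H1 U" "c0 \<in> L2_dia U Q"
  "tends (\<lambda>j. c (r j)) c0" "fractional_power U Q lam phi s c0 (\<lambda>x. - g0 x)"
proof -
 have gL: "g j \<in> L2 U" and g0L: "g0 \<in> L2 U" for j using g L2_dia_L2 by auto
 obtain C where C: "C > 0" "\<And>h f c. h \<in> H \<Longrightarrow> f \<in> L2 U \<Longrightarrow>
  discrete_fractional_solution U Q (T h) (m h) (mu h) (psi h) s f c \<Longrightarrow>
  c \<in> V h \<and> c \<in> H1 U \<and> c \<in> L2_dia U Q \<and> nm c \<le> C * nm f \<and> nm (grad U c) \<le> C * nm f"
  using solution_bound[OF s(1)] by blast
 note cj = C(2)[OF hs(1) gL sol]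
 have "Bseq (\<lambda>j. nm (\<lambda>x. g j x - g0 x))" using g(3) by (intro convergent_imp_Bseq) (auto simp: convergent_def)
 then obtain B where B: "\<And>j. nm (\<lambda>x. g j x - g0 x) \<le> B" by (auto simp: Bseq_def L2_norm_ge_0)
 have gn: "nm (g j) \<le> B + nm g0" for j
  using L2_triangle[OF L2.S_diff[OF gL[of j] g0L] g0L] B[of j] by simp
 define D where "D = C * (B + nm g0)"
 have cn: "nm (c j) \<le> D" "nm (grad U (c j)) \<le> D" for j
  using cj[of j] mult_left_mono[OF gn[of j], of C] C(1) unfolding D_def by linarith+
 have cH: "c j \<in> H1 U" and cd: "c j \<in> L2_dia U Q" for j using cj by auto
 obtain r c0 where r: "strict_mono (r :: nat \<Rightarrow> nat)" and c0: "c0 \<in> H1 U"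
  and lim: "tends (\<lambda>j. c (r j)) c0"
  by (rule H1_compactness[OF cH cn])
 have c0d: "c0 \<in> L2_dia U Q" by (rule L2_dia_closed[OF cd H1_L2[OF c0] lim])
 \<comment> \<open>The discrete inverse power of \<open>phi k\<close>. By symmetry, the k-th
   coefficient of \<open>c j\<close> depends on the mesh only through it and the datum
   \<open>g j\<close>.\<close>
 define z where "z k j = (\<lambda>x. \<Sum>l<m (hs j). mu (hs j) l powr (- s) * cf (psi (hs j) l) k * psi (hs j) l x)" for k j
 have zl: "null (\<lambda>j. nm (\<lambda>x. z k j x - lam k powr (- s) * phi k x))" for k
 proof (rule LIMSEQ_I)
  fix e :: real assume e: "0 < e"
  obtain q where q: "0 \<le> q" "\<And>u. u \<in> H1 U \<Longrightarrow> en u u \<le> \<Lambda>2 * (nm (grad U u))^2 + q * (nm u)^2"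
   using energy_upper by blast
  have D: "0 \<le> \<Lambda>2" using \<Lambda>1_pos \<Lambda>_le by simp
  \<comment> \<open>Collects the factor of \<open>d\<close> in \<open>eigenfunction_approx\<close>
    for an approximation with L2 error \<open>2 * d\<close> and gradient error \<open>d\<close>; the
    final 1 makes the estimate strict.\<close>
  define F where "F = lam k powr (- s) * (sqrt ((\<Lambda>2 + 4 * q) / lam 0) + 4) + 1"
  have F: "F > 0" using q D lam_pos[of 0] by (simp add: F_def add_nonneg_pos)
  define d where "d = e / F"
  have d: "d > 0" using e F by (simp add: d_def)
  obtain \<eta> where \<eta>: "\<eta> > 0" "\<And>h. h \<in> H \<Longrightarrow> h < \<eta> \<Longrightarrow>
    \<exists>w\<in>V h. nm (\<lambda>x. phi k x - w x) < d \<and> nm (\<lambda>x. grad U (phi k) x - grad U w x) < d"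
   using fe_dense[OF phi_H1 d] by blast
  obtain N where N: "\<And>j. j \<ge> N \<Longrightarrow> hs j < \<eta>" using order_tendstoD(2)[OF hs(2) \<eta>(1)] by (auto simp: eventually_sequentially)
  have "nm (\<lambda>x. z k j x - lam k powr (- s) * phi k x) < e" if jN: "j \<ge> N" for j
  proof -
   interpret fe_neumann U A Q \<Lambda>1 \<Lambda>2 lam phi "T (hs j)" "P (hs j)" "hs j" \<kappa> "m (hs j)" "mu (hs j)" "psi (hs j)"
    by (rule disc[OF hs(1)])
   obtain w0 where w0: "w0 \<in> V (hs j)" "nm (\<lambda>x. phi k x - w0 x) < d" "nm (\<lambda>x. grad U (phi k) x - grad U w0 x) < d"
    using \<eta>(2)[OF hs(1) N[OF jN]] by blast
   have w0H: "w0 \<in> H1 U" by (rule V_H1[OF hs(1) w0(1)])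
   have w0L: "w0 \<in> L2 U" by (rule H1_L2[OF w0H])
   \<comment> \<open>The approximation must lie in \<open>L2_dia\<close>. Removing the constant
     keeps it a finite element function, leaves the gradient alone and at most doubles the L2 error,
     since \<open>dia\<close> fixes \<open>phi k\<close>.\<close>
   define w where "w = dia U Q w0"
   have wV: "w \<in> V (hs j)" unfolding w_def dia_eq by (rule fe_diff[OF w0(1) fe_const])
   have wd: "w \<in> L2_dia U Q" unfolding w_def by (rule dia_L2_dia[OF w0L])
   have dH: "(\<lambda>x. phi k x - w0 x) \<in> H1 U" by (rule H1_diff[OF phi_H1 w0H])
   have pd: "dia U Q (phi k) = phi k" using phi_dia[of k] by (simp add: dia_eq L2_dia_kap)
   have weq: "(\<lambda>x. phi k x - w x) = dia U Q (\<lambda>x. phi k x - w0 x)"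
    using dia_diff[OF phi_L2 w0L] by (simp add: pd w_def)
   have n1: "nm (\<lambda>x. phi k x - w x) \<le> 2 * d"
    unfolding weq using w0(2) by (intro order_trans[OF L2_norm_dia[OF H1_L2[OF dH]]]) simp
   have n2: "nm (grad U (\<lambda>x. phi k x - w x)) \<le> d"
    unfolding weq L2_norm_grad_dia[OF dH] L2_norm_grad_diff[OF phi_H1 w0H] using w0(3) by simp
   have wH: "w \<in> H1 U" by (rule V_H1[OF hs(1) wV])
   have "en (\<lambda>x. phi k x - w x) (\<lambda>x. phi k x - w x) \<le> \<Lambda>2 * d^2 + q * (2 * d)^2"
   proof -
    have "\<Lambda>2 * (nm (grad U (\<lambda>x. phi k x - w x)))^2 + q * (nm (\<lambda>x. phi k x - w x))^2 \<le> \<Lambda>2 * d^2 + q * (2 * d)^2"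
     using q(1) D n1 n2 by (intro add_mono mult_left_mono power_mono) (auto simp: L2_norm_ge_0)
    then show ?thesis using q(2)[OF H1_diff[OF phi_H1[of k] wH]] by linarith
   qed
   also have "\<dots> = (\<Lambda>2 + 4 * q) * d^2" by (simp add: power_mult_distrib algebra_simps)
   finally have "en (\<lambda>x. phi k x - w x) (\<lambda>x. phi k x - w x) / lam 0 \<le> (\<Lambda>2 + 4 * q) / lam 0 * d^2"
    using lam_pos[of 0] by (simp add: divide_right_mono)
   moreover have "sqrt ((\<Lambda>2 + 4 * q) / lam 0 * d^2) = sqrt ((\<Lambda>2 + 4 * q) / lam 0) * d"
    unfolding real_sqrt_mult using d by simp
   ultimately have n3: "sqrt (en (\<lambda>x. phi k x - w x) (\<lambda>x. phi k x - w x) / lam 0) \<le> sqrt ((\<Lambda>2 + 4 * q) / lam 0) * d"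
    by (metis real_sqrt_le_mono)
   have "nm (\<lambda>x. z k j x - lam k powr (- s) * phi k x)
    \<le> lam k powr (- s) * (sqrt (en (\<lambda>x. phi k x - w x) (\<lambda>x. phi k x - w x) / lam 0) + 2 * nm (\<lambda>x. phi k x - w x))"
    unfolding z_def using eigenfunction_approx[of s w k] s wV wd by simp
   also have "\<dots> \<le> lam k powr (- s) * (sqrt ((\<Lambda>2 + 4 * q) / lam 0) * d + 2 * (2 * d))"
    using n1 n3 by (intro mult_left_mono add_mono) auto
   also have "\<dots> = (lam k powr (- s) * (sqrt ((\<Lambda>2 + 4 * q) / lam 0) + 4)) * d" by (simp add: algebra_simps)
   also have "\<dots> < F * d" using d by (intro mult_strict_right_mono) (auto simp: F_def)
   also have "\<dots> = e" using F by (simp add: d_def)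
   finally show ?thesis .
  qed
  then show "\<exists>no. \<forall>n\<ge>no. norm (nm (\<lambda>x. z k n x - lam k powr (- s) * phi k x) - 0) < e"
   by (auto simp: L2_norm_ge_0)
 qed
 have zL: "z k j \<in> L2 U" for k j
 proof -
  interpret fe_neumann U A Q \<Lambda>1 \<Lambda>2 lam phi "T (hs j)" "P (hs j)" "hs j" \<kappa> "m (hs j)" "mu (hs j)" "psi (hs j)"
   by (rule disc[OF hs(1)])
  show ?thesis unfolding z_def by (rule H1_L2[OF comb_H1])
 qed
 have cz: "cf (c j) k = - inn (g j) (z k j)" for j k
 proof -
  interpret fe_neumann U A Q \<Lambda>1 \<Lambda>2 lam phi "T (hs j)" "P (hs j)" "hs j" \<kappa> "m (hs j)" "mu (hs j)" "psi (hs j)"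
   by (rule disc[OF hs(1)])
  have "(\<Sum>l<m (hs j). mu (hs j) l powr (- s) * inn (phi k) (psi (hs j) l) * psi (hs j) l x) = z k j x" for x
   unfolding z_def by (intro sum.cong refl) (simp add: L2.ip_sym[OF phi_L2 psi_L2])
  then show ?thesis using solution_inner[OF sol[of j] gL[of j] phi_L2[of k]] by simp
 qed
 have "cf c0 k = - (lam k powr (- s) * cf g0 k)" for k
 proof -
  have "(\<lambda>j. inn (g (r j)) (z k (r j))) \<longlonglongrightarrow> inn g0 (\<lambda>x. lam k powr (- s) * phi k x)"
  proof -
   let ?p = "\<lambda>x. lam k powr (- s) * phi k x"
   have pL: "?p \<in> L2 U" by (intro L2_scale) simp
   have "(\<lambda>j. inn (g j) (z k j)) \<longlonglongrightarrow> inn g0 ?p"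
   proof -
    have l1: "(\<lambda>j. inn (g j) ?p) \<longlonglongrightarrow> inn g0 ?p" by (rule L2_inner_tendsto[OF gL g0L pL g(3)])
    have l2: "null (\<lambda>j. inn (g j) (\<lambda>x. z k j x - ?p x))"
    proof (rule Lim_null_comparison)
     show "\<forall>\<^sub>F j in sequentially. norm (inn (g j) (\<lambda>x. z k j x - ?p x)) \<le> (B + nm g0) * nm (\<lambda>x. z k j x - ?p x)"
     proof (intro always_eventually allI)
      fix j
      have "\<bar>inn (g j) (\<lambda>x. z k j x - ?p x)\<bar> \<le> nm (g j) * nm (\<lambda>x. z k j x - ?p x)"
       by (rule L2_cauchy_schwarz[OF gL L2.S_diff[OF zL pL]])
      also have "\<dots> \<le> (B + nm g0) * nm (\<lambda>x. z k j x - ?p x)"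
       by (intro mult_right_mono gn L2_norm_ge_0)
      finally show "norm (inn (g j) (\<lambda>x. z k j x - ?p x)) \<le> (B + nm g0) * nm (\<lambda>x. z k j x - ?p x)" by simp
     qed
     show "null (\<lambda>j. (B + nm g0) * nm (\<lambda>x. z k j x - ?p x))" using tendsto_mult_right_zero[OF zl] .
    qed
    have "inn (g j) (z k j) = inn (g j) (\<lambda>x. z k j x - ?p x) + inn (g j) ?p" for j
     using L2.ip_diff_right[OF zL[of k j] pL gL[of j]] by simp
    then show ?thesis using tendsto_add[OF l2 l1] by simp
   qed
   from LIMSEQ_subseq_LIMSEQ[OF this r] show ?thesis by (simp add: o_def)
  qed
  then have "(\<lambda>j. cf (c (r j)) k) \<longlonglongrightarrow> - inn g0 (\<lambda>x. lam k powr (- s) * phi k x)"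
   unfolding cz by (rule tendsto_minus)
  moreover have "(\<lambda>j. cf (c (r j)) k) \<longlonglongrightarrow> cf c0 k" by (rule cf_tendsto[OF H1_L2[OF cH] H1_L2[OF c0] lim])
  ultimately have "cf c0 k = - inn g0 (\<lambda>x. lam k powr (- s) * phi k x)" by (rule LIMSEQ_unique[rotated])
  then show ?thesis using g0L by (simp add: L2_inner_scale_right)
 qed
 then have "fractional_power U Q lam phi s c0 (\<lambda>x. - g0 x)"
  using s by (intro fractional_power_coefficients g c0d) auto
 with r c0 c0d lim that show thesis by blast
qed

end

section \<open>Passing to the limit\<close>

lemma LIMSEQ_subseqI:
 fixes X :: "nat \<Rightarrow> real"
 assumes "\<And>r. strict_mono r \<Longrightarrow> \<exists>q. strict_mono (q :: nat \<Rightarrow> nat) \<and> (\<lambda>j. X (r (q j))) \<longlonglongrightarrow> l"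
 shows "X \<longlonglongrightarrow> l"
proof (rule ccontr)
 assume "\<not> X \<longlonglongrightarrow> l"
 then obtain e where e: "e > 0" "\<forall>N. \<exists>n\<ge>N. e \<le> dist (X n) l"
  unfolding lim_sequentially by (auto simp: not_less)
 then have "infinite {n. e \<le> dist (X n) l}" by (auto simp: infinite_nat_iff_unbounded_le)
 then obtain r :: "nat \<Rightarrow> nat" where r: "strict_mono r" "\<And>n. r n \<in> {n. e \<le> dist (X n) l}"
  using infinite_enumerate by blast
 obtain q where "strict_mono (q :: nat \<Rightarrow> nat)" and q: "(\<lambda>j. X (r (q j))) \<longlonglongrightarrow> l" using assms[OF r(1)] by blast
 obtain n where "dist (X (r (q n))) l < e" using q e(1) unfolding lim_sequentially by blast
 with r(2)[of "q n"] show False by auto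
qed

lemma LIMSEQ_null_scaled:
 fixes X :: "nat \<Rightarrow> real"
 assumes K: "0 \<le> K" and X: "\<And>e. e > 0 \<Longrightarrow> \<forall>\<^sub>F j in sequentially. \<bar>X j\<bar> \<le> e * K"
 shows "X \<longlonglongrightarrow> 0"
proof (rule tendstoI)
 fix e :: real assume e: "e > 0"
 have "e / (K + 1) * K < e" using e K by (simp add: field_simps)
 moreover have "\<forall>\<^sub>F j in sequentially. \<bar>X j\<bar> \<le> e / (K + 1) * K" using e K by (intro X) simp
 ultimately show "\<forall>\<^sub>F j in sequentially. dist (X j) 0 < e" by (auto elim: eventually_mono)
qed

lemma L2_inner_weak_strong:
 fixes u :: "nat \<Rightarrow> real^'n \<Rightarrow> 'b::euclidean_space"
 assumes u: "\<And>j. u j \<in> L2 U" "\<And>j. L2_norm U (u j) \<le> C"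
  and w: "\<And>j. w j \<in> L2 U" "w0 \<in> L2 U" "null (\<lambda>j. L2_norm U (\<lambda>x. w j x - w0 x))"
  and lim: "(\<lambda>j. L2_inner U (u j) w0) \<longlonglongrightarrow> l"
 shows "(\<lambda>j. L2_inner U (u j) (w j)) \<longlonglongrightarrow> l"
proof -
 have "null (\<lambda>j. L2_inner U (u j) (\<lambda>x. w j x - w0 x))"
 proof (rule Lim_null_comparison)
  show "\<forall>\<^sub>F j in sequentially. norm (L2_inner U (u j) (\<lambda>x. w j x - w0 x)) \<le> C * L2_norm U (\<lambda>x. w j x - w0 x)"
  proof (intro always_eventually allI)
   fix j
   have "\<bar>L2_inner U (u j) (\<lambda>x. w j x - w0 x)\<bar> \<le> L2_norm U (u j) * L2_norm U (\<lambda>x. w j x - w0 x)"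
    by (rule L2_cauchy_schwarz[OF u(1) L2.S_diff[OF w(1,2)]])
   also have "\<dots> \<le> C * L2_norm U (\<lambda>x. w j x - w0 x)" by (intro mult_right_mono u(2) L2_norm_ge_0)
   finally show "norm (L2_inner U (u j) (\<lambda>x. w j x - w0 x)) \<le> C * L2_norm U (\<lambda>x. w j x - w0 x)" by simp
  qed
  show "null (\<lambda>j. C * L2_norm U (\<lambda>x. w j x - w0 x))" using tendsto_mult_right_zero[OF w(3)] .
 qed
 from tendsto_add[OF this lim] show ?thesis by (simp add: L2.ip_diff_right[OF w(1,2) u(1)])
qed

lemma L2_convergent_bounded:
 fixes u :: "nat \<Rightarrow> real^'n \<Rightarrow> 'b::euclidean_space"
 assumes u: "\<And>j. u j \<in> L2 U" and v: "v \<in> L2 U" and lim: "null (\<lambda>j. L2_norm U (\<lambda>x. u j x - v x))"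
 obtains B where "0 \<le> B" "\<And>j. L2_norm U (u j) \<le> B"
proof -
 have "Bseq (\<lambda>j. L2_norm U (\<lambda>x. u j x - v x))" using lim by (intro convergent_imp_Bseq) (auto simp: convergent_def)
 then obtain B where B: "\<And>j. L2_norm U (\<lambda>x. u j x - v x) \<le> B" by (auto simp: Bseq_def L2_norm_ge_0)
 have "L2_norm U (u j) \<le> B + L2_norm U v" for j
  using L2_triangle[OF L2.S_diff[OF u[of j] v] v] B[of j] by simp
 moreover from this[of 0] have "0 \<le> B + L2_norm U v" using L2_norm_ge_0[of U "u 0"] by linarith
 ultimately show thesis using that by blast
qed

lemma (in lipschitz_dom) weak_form_extend:
 assumes a: "a \<in> L2 U" and b: "b \<in> L2 U"
  and eq: "\<And>f G. C1_closure f G \<Longrightarrow> inn a f + inn b G = 0" and u: "u \<in> H1 U"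
 shows "inn a u + inn b (grad U u) = 0"
proof -
 obtain v G where vG: "\<And>k::nat. C1_closure (v k) (G k)"
  "tends v u" "tends G (grad U u)"
  by (rule C1_approx_seq[OF u]) (rule that)
 have vL: "v k \<in> L2 U" and GL: "G k \<in> L2 U" for k
  using continuous_L2 C1_closure_continuous[OF vG(1)] vG(1) by (auto simp: C1_closure_def)
 have "(\<lambda>k. inn a (v k)) \<longlonglongrightarrow> inn a u"
  by (rule L2_inner_weak_strong[OF a order_refl vL H1_L2[OF u] vG(2)]) simp
 moreover have "(\<lambda>k. inn b (G k)) \<longlonglongrightarrow> inn b (grad U u)"
  by (rule L2_inner_weak_strong[OF b order_refl GL grad_L2[OF u] vG(3)]) simp
 ultimately have "(\<lambda>k. inn a (v k) + inn b (G k)) \<longlonglongrightarrow> inn a u + inn b (grad U u)"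
  by (rule tendsto_add)
 then show ?thesis using eq[OF vG(1)] by (simp add: LIMSEQ_const_iff)
qed

text \<open>A smoothed modulus of the negative part: zero on nonnegative arguments, positive on
  negative ones, and with a continuous derivative of modulus at most 1, as \<open>H1_chain\<close>
  requires.\<close>

definition neg_test :: "real \<Rightarrow> real" where "neg_test t = sqrt (1 + (max 0 (- t))^2) - 1"
definition neg_test' :: "real \<Rightarrow> real" where "neg_test' t = - max 0 (- t) / sqrt (1 + (max 0 (- t))^2)"

lemma neg_test_derivative: "(neg_test has_real_derivative neg_test' t) (at t)"
proof -
 have 1: "((\<lambda>t. (max 0 (- t))^2) has_real_derivative 2 * max 0 (- t) * (- 1)) (at t)"
  by (rule DERIV_chain2[where g="\<lambda>t. - t", OF max0_square_derivative]) (auto intro!: derivative_eq_intros)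
 have 2: "0 < 1 + (max 0 (- t))^2" by (simp add: add_pos_nonneg)
 have 3: "((\<lambda>t. 1 + (max 0 (- t))^2) has_real_derivative 2 * max 0 (- t) * (- 1)) (at t)"
  using DERIV_add[OF DERIV_const[of 1] 1] by simp
 have "((\<lambda>t. sqrt (1 + (max 0 (- t))^2) - 1) has_real_derivative
   inverse (sqrt (1 + (max 0 (- t))^2)) / 2 * (2 * max 0 (- t) * (- 1)) - 0) (at t)"
  by (rule DERIV_diff[OF DERIV_chain2[OF DERIV_real_sqrt[OF 2] 3] DERIV_const])
 then show ?thesis unfolding neg_test_def neg_test'_def by (simp add: field_simps)
qed

lemma neg_test'_props: "continuous_on UNIV neg_test'" "\<bar>neg_test' t\<bar> \<le> 1" "neg_test' t \<le> 0" "0 \<le> t \<Longrightarrow> neg_test' t = 0"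
proof -
 have p: "0 < 1 + (max 0 (- t))^2" for t :: real by (simp add: add_pos_nonneg)
 show "continuous_on UNIV neg_test'" unfolding neg_test'_def
  using p by (intro continuous_intros) (auto simp: less_imp_neq[symmetric])
 have "max 0 (- t) \<le> sqrt (1 + (max 0 (- t))^2)" by (rule real_le_rsqrt) simp
 then show "\<bar>neg_test' t\<bar> \<le> 1" using p[of t] by (simp add: neg_test'_def abs_div_pos)
 show "neg_test' t \<le> 0" unfolding neg_test'_def using p[of t] by (intro divide_nonpos_pos) auto
qed (simp add: neg_test'_def)

lemma neg_test_props: "0 \<le> neg_test t" "0 \<le> t \<Longrightarrow> neg_test t = 0" "t < 0 \<Longrightarrow> 0 < neg_test t"
 by (simp_all add: neg_test_def)

lemma (in lipschitz_dom) neg_test_H1: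
 assumes "u \<in> H1 U"
 shows "(\<lambda>x. neg_test (u x)) \<in> H1 U" "AE x in MU. grad U (\<lambda>x. neg_test (u x)) x = neg_test' (u x) *\<^sub>R grad U u x"
 by (rule H1_chain[OF assms neg_test_derivative neg_test'_props(1,2)])+

text \<open>The gradient term has a sign because \<open>neg_test'\<close> is nonpositive, so the
  first inner product is nonnegative. Its integrand is nonpositive because \<open>old\<close> is
  nonnegative; hence it vanishes almost everywhere, which is impossible where \<open>r\<close> is
  negative.\<close>

lemma (in lipschitz_dom) nonneg_of_test:
 assumes r: "r \<in> H1 U" and old: "old \<in> L2 U" "AE x in MU. 0 \<le> old x" and k: "0 \<le> k"
  and eq: "inn (\<lambda>x. r x - old x) (\<lambda>x. neg_test (r x)) + k * inn (grad U r) (grad U (\<lambda>x. neg_test (r x))) = 0"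
 shows "AE x in MU. 0 \<le> r x"
proof -
 note F = neg_test_H1[OF r]
 have "0 \<le> (LINT x|MU. - (grad U r x \<bullet> grad U (\<lambda>x. neg_test (r x)) x))"
 proof (rule integral_nonneg_AE)
  show "AE x in MU. 0 \<le> - (grad U r x \<bullet> grad U (\<lambda>x. neg_test (r x)) x)"
   using F(2) by eventually_elim (simp add: neg_test'_props(3) mult_nonpos_nonneg)
 qed
 then have "inn (grad U r) (grad U (\<lambda>x. neg_test (r x))) \<le> 0" by (simp add: L2_inner_def)
 then have ge: "0 \<le> inn (\<lambda>x. r x - old x) (\<lambda>x. neg_test (r x))"
  using eq mult_nonneg_nonpos[OF k, of "inn (grad U r) (grad U (\<lambda>x. neg_test (r x)))"] by linarith
 let ?Y = "\<lambda>x. - ((r x - old x) * neg_test (r x))"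
 have Yint: "integrable MU ?Y"
  using L2_prod_integrable[OF L2.S_diff[OF H1_L2[OF r] old(1)] H1_L2[OF F(1)]] by simp
 have Ypos: "AE x in MU. 0 \<le> ?Y x"
  using old(2)
 proof eventually_elim
  case (elim x)
  show ?case
  proof (cases "r x < 0")
   case True
   then show ?thesis using neg_test_props(1)[of "r x"] elim by (simp add: mult_nonpos_nonneg)
  qed (simp add: neg_test_props(2))
 qed
 have "(LINT x|MU. ?Y x) = 0"
 proof (rule antisym)
  show "(LINT x|MU. ?Y x) \<le> 0" using ge by (simp add: L2_inner_def)
  show "0 \<le> (LINT x|MU. ?Y x)" by (rule integral_nonneg_AE[OF Ypos])
 qed
 then have "AE x in MU. ?Y x = 0" using integral_nonneg_eq_0_iff_AE[OF Yint Ypos] by blast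
 then show ?thesis using old(2)
 proof eventually_elim
  case (elim x)
  show ?case
  proof (rule ccontr)
   assume "\<not> 0 \<le> r x"
   then show False using elim neg_test_props(3)[of "r x"] by auto
  qed
 qed
qed

section \<open>Limits of interpolants, lumped products and the initial datum\<close>

context fe_family
begin

lemma interpolant_eventually:
 assumes C1: "C1_closure f G" and hs: "\<And>j::nat. hs j \<in> H" "hs \<longlonglongrightarrow> 0" and e: "e > 0"
 shows "\<forall>\<^sub>F j in sequentially. (\<forall>K\<in>T (hs j). \<forall>x\<in>K. \<forall>z\<in>K. \<bar>Ih (hs j) f x - f z\<bar> \<le> e)
  \<and> (AE x in MU. norm (grad U (Ih (hs j) f) x - G x) \<le> e)"
proof -
 obtain \<eta> where \<eta>: "\<eta> > 0"
  "\<And>h K x z. h \<in> H \<Longrightarrow> h < \<eta> \<Longrightarrow> K \<in> T h \<Longrightarrow> x \<in> K \<Longrightarrow> z \<in> K \<Longrightarrow> \<bar>Ih h f x - f z\<bar> \<le> e"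
  "\<And>h. h \<in> H \<Longrightarrow> h < \<eta> \<Longrightarrow> AE x in MU. norm (grad U (Ih h f) x - G x) \<le> e"
  by (rule interpolation_uniform[OF C1 e]) (rule that)
 from order_tendstoD(2)[OF hs(2) \<eta>(1)] show ?thesis
  by eventually_elim (use hs(1) \<eta>(2,3) in blast)
qed

lemma interpolant_limits:
 assumes C1: "C1_closure f G" and hs: "\<And>j::nat. hs j \<in> H" "hs \<longlonglongrightarrow> 0"
 shows "tends (\<lambda>j. Ih (hs j) f) f" (is ?A)
  and "tends (\<lambda>j. grad U (Ih (hs j) f)) G" (is ?B)
proof -
 have fL: "f \<in> L2 U" and GL: "G \<in> L2 U" using continuous_L2 C1_closure_continuous[OF C1] C1 by (auto simp: C1_closure_def)
 have IL: "Ih (hs j) f \<in> L2 U" and gL: "grad U (Ih (hs j) f) \<in> L2 U" for j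
  using V_L2[OF hs(1) Ih_V[OF hs(1)]] grad_L2[OF V_H1[OF hs(1) Ih_V[OF hs(1)]]] by auto
 have ev: "\<forall>\<^sub>F j in sequentially. nm (\<lambda>x. Ih (hs j) f x - f x) \<le> e * sqrt (measure lebesgue U)
   \<and> nm (\<lambda>x. grad U (Ih (hs j) f) x - G x) \<le> e * sqrt (measure lebesgue U)" if e: "e > 0" for e
  using interpolant_eventually[OF C1 hs e]
 proof eventually_elim
  case (elim j)
  interpret fe_mesh U "T (hs j)" "P (hs j)" "hs j" \<kappa> by (rule meshes[OF hs(1)])
  have "AE x in MU. norm (Ih (hs j) f x - f x) \<le> e"
   using elim dom_K by (intro AE_I2) fastforce
  then have "nm (\<lambda>x. Ih (hs j) f x - f x) \<le> e * sqrt (measure lebesgue U)"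
   using e by (intro L2_bounded(2)[OF dom_lmeasurable] L2_measurable[OF L2.S_diff] IL fL) auto
  moreover have "nm (\<lambda>x. grad U (Ih (hs j) f) x - G x) \<le> e * sqrt (measure lebesgue U)"
   using e elim by (intro L2_bounded(2)[OF dom_lmeasurable] L2_measurable[OF L2.S_diff] gL GL) auto
  ultimately show ?case ..
 qed
 show ?A by (rule LIMSEQ_null_scaled[of "sqrt (measure lebesgue U)"]) (auto simp: L2_norm_ge_0 elim: eventually_mono[OF ev])
 show ?B by (rule LIMSEQ_null_scaled[of "sqrt (measure lebesgue U)"]) (auto simp: L2_norm_ge_0 elim: eventually_mono[OF ev])
qed

lemma lumped_limit:
 assumes C1: "C1_closure f G" and hs: "\<And>j::nat. hs j \<in> H" "hs \<longlonglongrightarrow> 0"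
  and r: "\<And>j. r j \<in> V (hs j)" and r0: "r0 \<in> L2 U" and lim: "tends r r0"
 shows "(\<lambda>j. LINT x|MU. Ih (hs j) (\<lambda>y. r j y * Ih (hs j) f y) x) \<longlonglongrightarrow> inn r0 f"
proof -
 have fL: "f \<in> L2 U" using continuous_L2 C1_closure_continuous[OF C1] by auto
 have rL: "r j \<in> L2 U" and IL: "Ih (hs j) f \<in> L2 U" for j using V_L2[OF hs(1) r] V_L2[OF hs(1) Ih_V[OF hs(1)]] by auto
 obtain B where B: "0 \<le> B" "\<And>j. nm (r j) \<le> B" by (rule L2_convergent_bounded[OF rL r0 lim]) (rule that)
 \<comment> \<open>\<open>4 * 4 ^ CARD('n)\<close> is \<open>Clump\<close>, written out because no
   mesh is fixed yet. The leading 2 is the oscillation \<open>2 * e\<close> of an interpolant that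
   is within \<open>e\<close> of \<open>f\<close>.\<close>
 let ?K = "2 * (sqrt (measure lebesgue U) * (sqrt (4 * 4 ^ CARD('n)) * B))"
 have "null (\<lambda>j. (LINT x|MU. Ih (hs j) (\<lambda>y. r j y * Ih (hs j) f y) x) - (LINT x|MU. r j x * Ih (hs j) f x))"
 proof (rule LIMSEQ_null_scaled[of ?K])
  show "0 \<le> ?K" using B by simp
  fix e :: real assume e: "e > 0"
  show "\<forall>\<^sub>F j in sequentially. \<bar>(LINT x|MU. Ih (hs j) (\<lambda>y. r j y * Ih (hs j) f y) x) - (LINT x|MU. r j x * Ih (hs j) f x)\<bar> \<le> e * ?K"
   using interpolant_eventually[OF C1 hs e]
  proof eventually_elim
   case (elim j)
   interpret fe_mesh U "T (hs j)" "P (hs j)" "hs j" \<kappa> by (rule meshes[OF hs(1)])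
   have osc: "\<bar>Ih (hs j) f x - Ih (hs j) f y\<bar> \<le> 2 * e" if K: "K \<in> T (hs j)" "x \<in> K" "y \<in> K" for K x y
   proof -
    have "\<bar>Ih (hs j) f x - f x\<bar> \<le> e" "\<bar>Ih (hs j) f y - f x\<bar> \<le> e" using elim K by auto
    then show ?thesis by linarith
   qed
   have "\<bar>(LINT x|MU. Ih (hs j) (\<lambda>y. r j y * Ih (hs j) f y) x) - (LINT x|MU. r j x * Ih (hs j) f x)\<bar>
     \<le> 2 * e * (sqrt (measure lebesgue U) * (sqrt Clump * nm (r j)))"
    using e by (intro lumping_error[OF r pih_fe]) (auto intro: osc)
   also have "\<dots> \<le> 2 * e * (sqrt (measure lebesgue U) * (sqrt Clump * B))"
    using e B by (intro mult_left_mono) (auto simp: Clump_def)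
   finally show ?case by (simp add: Clump_def mult_ac)
  qed
 qed
 moreover have "(\<lambda>j. inn (r j) (Ih (hs j) f)) \<longlonglongrightarrow> inn r0 f"
  by (rule L2_inner_weak_strong[OF rL B(2) IL fL interpolant_limits(1)[OF C1 hs] L2_inner_tendsto[OF rL r0 fL lim]])
 ultimately show ?thesis using tendsto_add by (fastforce simp: L2_inner_def)
qed

lemma stiffness_limit:
 assumes C1: "C1_closure f G" and hs: "\<And>j::nat. hs j \<in> H" "hs \<longlonglongrightarrow> 0"
  and r: "\<And>j. r j \<in> H1 U" "\<And>j. nm (grad U (r j)) \<le> D"
  and r0: "r0 \<in> L2 U" and lim: "tends r r0"
 shows "(\<lambda>j. inn (grad U (r j)) (grad U (Ih (hs j) f))) \<longlonglongrightarrow> inn (grad U r0) G"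
proof -
 have GL: "G \<in> L2 U" using continuous_L2 C1 by (auto simp: C1_closure_def)
 show ?thesis
  by (rule L2_inner_weak_strong[OF grad_L2[OF r(1)] r(2) grad_L2[OF V_H1[OF hs(1) Ih_V[OF hs(1)]]] GL
    interpolant_limits(2)[OF C1 hs] grad_weak_lim[OF r r0 lim GL]])
qed

text \<open>Testing with the solution itself, together with \<open>pih_square_lower\<close>, bounds
  it in \<open>H1\<close>. A limit solves the smoothed problem, and testing the difference of two
  solutions with itself gives uniqueness.\<close>

lemma initial_subsequence:
 assumes dt: "dt > 0" and rho0: "rho0 \<in> L2 U" and hs: "\<And>j::nat. hs j \<in> H" "hs \<longlonglongrightarrow> 0"
  and rj: "\<And>j. discrete_initial_datum U (T (hs j)) dt rho0 (r j)" and rho00: "smoothed_initial_datum U dt rho0 rho00"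
 shows "\<exists>q. strict_mono (q :: nat \<Rightarrow> nat) \<and> tends (\<lambda>j. r (q j)) rho00"
proof -
 have rV: "r j \<in> V (hs j)" and req: "\<And>f. f \<in> V (hs j) \<Longrightarrow>
   (LINT x|MU. Ih (hs j) (\<lambda>y. r j y * f y) x) + dt * inn (grad U (r j)) (grad U f) = inn rho0 f" for j
  using rj[of j] by (auto simp: discrete_initial_datum_def L2_inner_def)
 have rH: "r j \<in> H1 U" and rL: "r j \<in> L2 U" for j using V_H1[OF hs(1) rV] V_L2[OF hs(1) rV] .
 define R where "R = nm rho0"
 have R: "0 \<le> R" by (simp add: R_def L2_norm_ge_0)
 have e: "(nm (r j))^2 + dt * (nm (grad U (r j)))^2 \<le> R * nm (r j)" for j
 proof -
  interpret fe_mesh U "T (hs j)" "P (hs j)" "hs j" \<kappa> by (rule meshes[OF hs(1)])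
  have "(nm (r j))^2 + dt * (nm (grad U (r j)))^2 \<le> inn rho0 (r j)"
   using req[OF rV[of j]] pih_square_lower[OF rV] by (simp add: L2_norm_sq[OF grad_L2[OF rH]])
  also have "\<dots> \<le> R * nm (r j)" using L2_cauchy_schwarz[OF rho0 rL[of j]] by (simp add: R_def)
  finally show ?thesis .
 qed
 have n1: "nm (r j) \<le> R" for j
 proof (rule ccontr)
  assume "\<not> nm (r j) \<le> R"
  then have "R * nm (r j) < nm (r j) * nm (r j)" using R by (intro mult_strict_right_mono) auto
  moreover have "0 \<le> dt * (nm (grad U (r j)))^2" using dt by simp
  ultimately show False using e[of j] by (simp add: power2_eq_square)
 qed
 have n2: "nm (grad U (r j)) \<le> sqrt (R * R / dt)" for j
 proof (rule real_le_rsqrt)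
  have "dt * (nm (grad U (r j)))^2 \<le> R * R"
   using e[of j] mult_left_mono[OF n1[of j] R] zero_le_power2[of "nm (r j)"] by linarith
  then show "(nm (grad U (r j)))^2 \<le> R * R / dt" using dt by (simp add: field_simps)
 qed
 have s0: "0 \<le> sqrt (R * R / dt)" using R dt by simp
 have n1': "nm (r j) \<le> R + sqrt (R * R / dt)" and n2': "nm (grad U (r j)) \<le> R + sqrt (R * R / dt)" for j
  using n1[of j] n2[of j] s0 R by linarith+
 obtain q v where q: "strict_mono (q :: nat \<Rightarrow> nat)" and v: "v \<in> H1 U"
  and lim: "tends (\<lambda>j. r (q j)) v"
  by (rule H1_compactness[OF rH n1' n2']) (rule that)
 have vL: "v \<in> L2 U" by (rule H1_L2[OF v])
 have hq: "null (\<lambda>j. hs (q j))" using LIMSEQ_subseq_LIMSEQ[OF hs(2) q] by (simp add: o_def)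
 have ext: "inn (\<lambda>x. v x - rho0 x) u + inn (\<lambda>x. dt *\<^sub>R grad U v x) (grad U u) = 0" if u: "u \<in> H1 U" for u
 proof (rule weak_form_extend[OF L2.S_diff[OF vL rho0] L2_scaleR[OF grad_L2[OF v]] _ u])
  fix f G assume C1: "C1_closure f G"
  have fL: "f \<in> L2 U" and GL: "G \<in> L2 U" using continuous_L2 C1_closure_continuous[OF C1] C1 by (auto simp: C1_closure_def)
  let ?f = "\<lambda>j. Ih (hs (q j)) f"
  have fV: "?f j \<in> V (hs (q j))" for j by (rule Ih_V[OF hs(1)])
  have "(\<lambda>j. (LINT x|MU. Ih (hs (q j)) (\<lambda>y. r (q j) y * ?f j y) x) + dt * inn (grad U (r (q j))) (grad U (?f j)))
    \<longlonglongrightarrow> inn v f + dt * inn (grad U v) G"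
   by (intro tendsto_add tendsto_mult_left lumped_limit[OF C1 hs(1) hq rV vL lim] stiffness_limit[OF C1 hs(1) hq rH n2 vL lim])
  moreover have "(\<lambda>j. inn rho0 (?f j)) \<longlonglongrightarrow> inn rho0 f"
   by (rule L2_inner_weak_strong[OF rho0 order_refl V_L2[OF hs(1) fV] fL interpolant_limits(1)[OF C1 hs(1) hq]]) simp
  ultimately have "inn v f + dt * inn (grad U v) G = inn rho0 f"
   unfolding req[OF fV] by (rule LIMSEQ_unique)
  then show "inn (\<lambda>x. v x - rho0 x) f + inn (\<lambda>x. dt *\<^sub>R grad U v x) G = 0"
   using L2.ip_diff_left[OF vL rho0 fL] L2.ip_scale_left[OF grad_L2[OF v] GL, of dt] by simp
 qed
 have r0H: "rho00 \<in> H1 U" and r0: "\<And>f. f \<in> H1 U \<Longrightarrow> inn rho00 f + dt * inn (grad U rho00) (grad U f) = inn rho0 f"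
  using rho00 by (auto simp: smoothed_initial_datum_def L2_inner_def)
 let ?d = "\<lambda>x. v x - rho00 x"
 have dH: "?d \<in> H1 U" by (rule H1_diff[OF v r0H])
 have dL: "?d \<in> L2 U" by (rule H1_L2[OF dH])
 have g: "inn (grad U v) (grad U ?d) - inn (grad U rho00) (grad U ?d) = (nm (grad U ?d))^2"
 proof -
  have "inn (grad U ?d) (grad U ?d) = inn (\<lambda>x. grad U v x - grad U rho00 x) (grad U ?d)"
   using grad_L2[OF dH] grad_L2[OF v] grad_L2[OF r0H] L2_measurable grad_diff[OF v r0H]
   by (intro L2_inner_cong_AE) (auto intro: L2_measurable[OF L2.S_diff])
  then show ?thesis using L2.ip_diff_left[OF grad_L2[OF v] grad_L2[OF r0H] grad_L2[OF dH]] L2_norm_sq[OF grad_L2[OF dH]] by simp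
 qed
 have "(nm ?d)^2 + dt * (nm (grad U ?d))^2 = 0"
  using ext[OF dH] r0[OF dH] L2.ip_diff_left[OF vL rho0 dL] L2.ip_scale_left[OF grad_L2[OF v] grad_L2[OF dH], of dt]
   L2.ip_diff_left[OF vL H1_L2[OF r0H] dL] L2_norm_sq[OF dL] unfolding g[symmetric] by (simp add: algebra_simps)
 moreover have "0 \<le> dt * (nm (grad U ?d))^2" using dt by simp
 ultimately have "(nm ?d)^2 \<le> 0" by linarith
 then have d0: "nm ?d = 0" by simp
 have "tends (\<lambda>j. r (q j)) rho00"
 proof (rule Lim_null_comparison[OF _ lim])
  show "\<forall>\<^sub>F j in sequentially. norm (nm (\<lambda>x. r (q j) x - rho00 x)) \<le> nm (\<lambda>x. r (q j) x - v x)"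
   using L2_triangle3[OF rL vL H1_L2[OF r0H]] d0 by (intro always_eventually) (simp add: L2_norm_ge_0)
 qed
 with q show ?thesis by blast
qed

text \<open>Every subsequence has a further one with the same limit, so for the initial datum no
  extraction remains.\<close>

lemma initial_convergence:
 assumes dt: "dt > 0" and rho0: "rho0 \<in> L2 U" and hs: "\<And>j::nat. hs j \<in> H" "hs \<longlonglongrightarrow> 0"
  and rj: "\<And>j. discrete_initial_datum U (T (hs j)) dt rho0 (r j)" and rho00: "smoothed_initial_datum U dt rho0 rho00"
 shows "tends r rho00"
proof (rule LIMSEQ_subseqI)
 fix p :: "nat \<Rightarrow> nat" assume p: "strict_mono p"
 have "null (\<lambda>j. hs (p j))" using LIMSEQ_subseq_LIMSEQ[OF hs(2) p] by (simp add: o_def)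
 from initial_subsequence[OF dt rho0 hs(1) this rj rho00]
 show "\<exists>q. strict_mono (q :: nat \<Rightarrow> nat) \<and> tends (\<lambda>j. r (p (q j))) rho00" .
qed

text \<open>Starting values for the induction over the time steps: the sign by testing with
  \<open>neg_test\<close>, the mass by the constant test function.\<close>

lemma smoothed_datum_props:
 assumes dt: "dt > 0" and rho0: "rho0 \<in> L2 U" "AE x in MU. 0 \<le> rho0 x" and rho00: "smoothed_initial_datum U dt rho0 rho00"
 shows "rho00 \<in> H1 U" "AE x in MU. 0 \<le> rho00 x" "(LINT x|MU. rho00 x) = (LINT x|MU. rho0 x)"
proof -
 show rH: "rho00 \<in> H1 U" using rho00 by (simp add: smoothed_initial_datum_def)
 have eq: "inn rho00 f + dt * inn (grad U rho00) (grad U f) = inn rho0 f" if "f \<in> H1 U" for f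
  using rho00 that by (auto simp: smoothed_initial_datum_def L2_inner_def)
 note F = neg_test_H1(1)[OF rH]
 show "AE x in MU. 0 \<le> rho00 x"
  using dt eq[OF F] L2.ip_diff_left[OF H1_L2[OF rH] rho0(1) H1_L2[OF F]]
  by (intro nonneg_of_test[OF rH rho0, of dt]) auto
 have "inn (grad U rho00) (grad U (\<lambda>x. 1)) = 0"
  unfolding L2_inner_def by (rule integral_eq_zero_AE) (use const_H1(2)[of 1] in \<open>eventually_elim, simp\<close>)
 then show "(LINT x|MU. rho00 x) = (LINT x|MU. rho0 x)" using eq[OF const_H1(1)[of 1]] by (simp add: L2_inner_def)
qed

end

section \<open>A time step\<close>

text \<open>Interchanges a limit with an approximation that is uniform in \<open>j\<close>; it is
  used to replace a test function in \<open>H1\<close> by C1 functions.\<close>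

lemma LIMSEQ_approx:
 fixes X :: "nat \<Rightarrow> real"
 assumes "\<And>e. e > 0 \<Longrightarrow> \<exists>Y l'. (\<forall>j. \<bar>X j - Y j\<bar> \<le> e) \<and> Y \<longlonglongrightarrow> l' \<and> \<bar>l' - l\<bar> \<le> e"
 shows "X \<longlonglongrightarrow> l"
proof (rule tendstoI)
 fix e :: real assume e: "e > 0"
 obtain Y l' where Y: "\<And>j. \<bar>X j - Y j\<bar> \<le> e / 4" "Y \<longlonglongrightarrow> l'" "\<bar>l' - l\<bar> \<le> e / 4"
  using assms[of "e / 4"] e by auto
 have "\<forall>\<^sub>F j in sequentially. dist (Y j) l' < e / 4" using Y(2) e by (intro tendstoD) auto
 then show "\<forall>\<^sub>F j in sequentially. dist (X j) l < e"
 proof eventually_elim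
  case (elim j)
  then show ?case using Y(1)[of j] Y(3) e unfolding dist_real_def by linarith
 qed
qed

lemma quadratic_bound:
 fixes x p q :: real
 assumes "x^2 \<le> p + q * x" "0 \<le> p" "0 \<le> q" "0 \<le> x"
 shows "x \<le> p + q + 1"
proof (rule ccontr)
 assume "\<not> x \<le> p + q + 1"
 then have x: "p + q + 1 < x" by simp
 have "p + q * x \<le> (p + q) * x" using x assms by (simp add: algebra_simps mult_le_cancel_left1)
 also have "\<dots> < x * x" using x assms by (intro mult_strict_right_mono) auto
 finally show False using assms(1) by (simp add: power2_eq_square)
qed

lemma unbounded_subseq:
 fixes X :: "nat \<Rightarrow> real"
 assumes "\<not> (\<exists>B. \<forall>j. X j \<le> B)"
 obtains q :: "nat \<Rightarrow> nat" where "strict_mono q" "\<And>j. real j < X (q j)"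
proof -
 have ex: "\<exists>y. real n < X y \<and> k < y" for n k
 proof (rule ccontr)
  assume "\<nexists>y. real n < X y \<and> k < y"
  then have le: "X y \<le> real n" if "k < y" for y using that by (meson not_less)
  have "X y \<le> max (real n) (Max (X ` {..k}))" for y
   using le[of y] Max_ge[of "X ` {..k}" "X y"] by (cases "k < y") (auto intro: max.coboundedI1 max.coboundedI2)
  with assms show False by blast
 qed
 obtain q where q: "\<And>n::nat. real n < X (q n)" "\<And>n. q n < q (Suc n)"
  using dependent_nat_choice[of "\<lambda>n y. real n < X y" "\<lambda>n x y. x < y"] ex by (metis (no_types, lifting))
 show thesis by (rule that[of q]) (auto intro: strict_monoI_Suc q)
qed

text \<open>The third bound serves normalized densities: \<open>\<beta>_upper\<close> is not cut
  from below, but a negative \<open>a\<close> is no larger in modulus than its distance to a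
  nonnegative \<open>b\<close>. The fourth compares the two cut-offs, and for this the argument of
  \<open>\<beta>_upper\<close> has to be nonnegative.\<close>

lemma \<beta>_upper_bounds:
 assumes "0 < L"
 shows "\<bar>\<beta>_upper L t\<bar> \<le> \<bar>t\<bar>" "\<bar>\<beta>_upper L a - \<beta>_upper L b\<bar> \<le> \<bar>a - b\<bar>"
  "0 \<le> b \<Longrightarrow> 0 \<le> M \<Longrightarrow> \<bar>\<beta>_upper L (M * a)\<bar> \<le> M * \<bar>a - b\<bar> + L"
  "0 < \<delta> \<Longrightarrow> \<delta> < L \<Longrightarrow> 0 \<le> b \<Longrightarrow> \<bar>\<beta>_cut \<delta> L a - \<beta>_upper L b\<bar> \<le> \<bar>a - b\<bar> + \<delta>"
  "0 \<le> b \<Longrightarrow> 0 \<le> \<beta>_upper L b \<and> \<beta>_upper L b \<le> L"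
proof -
 show "\<bar>\<beta>_upper L (M * a)\<bar> \<le> M * \<bar>a - b\<bar> + L" if b: "0 \<le> b" and M: "0 \<le> M"
 proof (cases "0 \<le> a")
  case True
  then have "0 \<le> M * a" "0 \<le> M * \<bar>a - b\<bar>" using M by auto
  then show ?thesis using assms by (auto simp: \<beta>_upper_def)
 next
  case False
  then have "M * \<bar>a\<bar> \<le> M * \<bar>a - b\<bar>" using b M by (intro mult_left_mono) auto
  moreover have "\<bar>M * a\<bar> = M * \<bar>a\<bar>" using M by (simp add: abs_mult)
  moreover have "\<bar>\<beta>_upper L (M * a)\<bar> \<le> \<bar>M * a\<bar>" using assms by (auto simp: \<beta>_upper_def)
  ultimately show ?thesis using assms by linarith
 qed
qed (use assms in \<open>auto simp: \<beta>_upper_def \<beta>_cut_def\<close>)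

lemma \<beta>_upper_measurable: "u \<in> borel_measurable M \<Longrightarrow> (\<lambda>x. \<beta>_upper L (u x)) \<in> borel_measurable M"
 and \<beta>_cut_measurable: "u \<in> borel_measurable M \<Longrightarrow> (\<lambda>x. \<beta>_cut d L (u x)) \<in> borel_measurable M"
 unfolding \<beta>_upper_def \<beta>_cut_def by (intro borel_measurable_max borel_measurable_min borel_measurable_const; assumption)+

lemma \<beta>_upper_L2: "u \<in> L2 U \<Longrightarrow> 0 < L \<Longrightarrow> (\<lambda>x. \<beta>_upper L (u x)) \<in> L2 U"
 by (rule L2_dominated[of u _ _ 1]) (auto simp: \<beta>_upper_bounds intro: \<beta>_upper_measurable L2_measurable)

locale fe_scheme = fe_family U A Q \<Lambda>1 \<Lambda>2 lam phi H T P \<kappa> m mu psi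
 for U :: "(real^'n) set" and A Q \<Lambda>1 \<Lambda>2 lam phi H T P \<kappa> m mu psi +
 fixes s L dt :: real
 assumes s: "1 / 2 < s" "s < 1" and L: "1 < L" and dt: "0 < dt"
begin

abbreviation "Th h \<delta> u \<equiv> \<Theta> (T h) (P h) \<delta> L u"
abbreviation "flux h \<delta> u g \<equiv> (\<lambda>x. Th h \<delta> u x *v (A x *v g x))"

text \<open>\<open>TB\<close>, \<open>CL\<close> and \<open>AC\<close> bound the mobility matrix,
  the lumped mass and multiplication by \<open>A\<close>; they depend neither on the mesh size nor
  on \<open>\<delta>\<close>.\<close>

definition TB where "TB = (real CARD('n))^2 * (L / \<kappa>)"
definition CL :: real where "CL = 4 * 4 ^ CARD('n)"
definition AC where "AC = (SOME c. 0 \<le> c \<and> (\<forall>g\<in>L2 U. nm (\<lambda>x. A x *v g x) \<le> c * nm g))"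

lemma AC: "0 \<le> AC" "g \<in> L2 U \<Longrightarrow> nm (\<lambda>x. A x *v g x) \<le> AC * nm g"
proof -
 have "\<exists>c. 0 \<le> c \<and> (\<forall>g\<in>L2 U. nm (\<lambda>x. A x *v g x) \<le> c * nm g)"
 proof -
  obtain c where "0 \<le> c" "\<And>g. g \<in> L2 U \<Longrightarrow> nm (\<lambda>x. A x *v g x) \<le> c * nm g"
   by (rule A_L2_norm) (rule that)
  then show ?thesis by blast
 qed
 from someI_ex[OF this] show "0 \<le> AC" "g \<in> L2 U \<Longrightarrow> nm (\<lambda>x. A x *v g x) \<le> AC * nm g"
  by (auto simp: AC_def)
qed

lemma Th_bound: "h \<in> H \<Longrightarrow> 0 < \<delta> \<Longrightarrow> \<delta> < 1 \<Longrightarrow> norm (Th h \<delta> u x) \<le> TB"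
 and Th_measurable: "h \<in> H \<Longrightarrow> Th h \<delta> u \<in> bm"
 and TB_nonneg: "h \<in> H \<Longrightarrow> 0 \<le> TB"
proof -
 assume h: "h \<in> H"
 interpret fe_mesh U "T h" "P h" h \<kappa> by (rule meshes[OF h])
 show "0 < \<delta> \<Longrightarrow> \<delta> < 1 \<Longrightarrow> norm (Th h \<delta> u x) \<le> TB" using \<Theta>_bound[of \<delta> L] L by (simp add: TB_def Nn_def)
 show "Th h \<delta> u \<in> bm" by (rule \<Theta>_measurable)
 show "0 \<le> TB" using \<kappa>(1) L by (simp add: TB_def)
qed

lemma flux_measurable:
 assumes "B \<in> bm" "g \<in> L2 U"
 shows "(\<lambda>x. B x *v (A x *v g x)) \<in> bm"
 by (rule borel_measurable_matrix_vector[OF assms(1) L2_measurable[OF A_L2[OF assms(2)]]])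

lemma flux_L2:
 assumes B: "B \<in> bm" "\<And>x. norm (B x) \<le> K" "0 \<le> K" and g: "g \<in> L2 U"
 shows "(\<lambda>x. B x *v (A x *v g x)) \<in> L2 U" "nm (\<lambda>x. B x *v (A x *v g x)) \<le> K * (AC * nm g)"
proof -
 have le: "norm (B x *v (A x *v g x)) \<le> K * norm (A x *v g x)" for x
  by (rule order_trans[OF norm_matrix_vector_le mult_right_mono[OF B(2) norm_ge_zero]])
 show "(\<lambda>x. B x *v (A x *v g x)) \<in> L2 U"
  using le by (intro L2_dominated[OF A_L2[OF g] flux_measurable[OF B(1) g]]) auto
 have "nm (\<lambda>x. B x *v (A x *v g x)) \<le> K * nm (\<lambda>x. A x *v g x)"
  using le by (intro L2_norm_mono[OF A_L2[OF g] flux_measurable[OF B(1) g] B(3)]) auto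
 also have "\<dots> \<le> K * (AC * nm g)" by (intro mult_left_mono AC(2) g B(3))
 finally show "nm (\<lambda>x. B x *v (A x *v g x)) \<le> K * (AC * nm g)" .
qed

text \<open>The fields \<open>g j\<close> are only bounded. The size of the matrix is moved to the
  fixed function \<open>z\<close>: the products \<open>norm (B j x) * norm (z x)\<close> tend to 0
  in L2 by dominated convergence and are paired with bounded functions.\<close>

lemma vanishing_flux:
 assumes B: "\<And>j::nat. B j \<in> bm" "\<And>j x. norm (B j x) \<le> K" "0 \<le> K"
  and g: "\<And>j. g j \<in> L2 U" "\<And>j. nm (g j) \<le> C" and z: "z \<in> L2 U"
  and lim: "AE x in MU. null (\<lambda>j. norm (B j x) * norm (z x))"
 shows "null (\<lambda>j. inn (\<lambda>x. B j x *v (A x *v g j x)) z)"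
proof (rule Lim_null_comparison)
 let ?q = "\<lambda>j x. norm (B j x) * norm (z x)"
 have qm: "?q j \<in> bm" for j using B(1)[of j] L2_measurable[OF z] by measurable
 have qle: "norm (?q j x) \<le> K * norm (z x)" for j x using mult_right_mono[OF B(2) norm_ge_zero] by (simp add: abs_mult)
 have qL: "?q j \<in> L2 U" for j using qle by (intro L2_dominated[OF z qm]) auto
 have q0: "null (\<lambda>j. nm (?q j))" using qle by (intro L2_dominated_convergence[OF qm z lim]) auto
 show "null (\<lambda>j. AC * C * nm (?q j))" using tendsto_mult_right_zero[OF q0] .
 show "\<forall>\<^sub>F j in sequentially. norm (inn (\<lambda>x. B j x *v (A x *v g j x)) z) \<le> AC * C * nm (?q j)"
 proof (intro always_eventually allI)
  fix j
  let ?w = "\<lambda>x. A x *v g j x" and ?y = "\<lambda>x. norm (A x *v g j x)"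
  have wL: "?w \<in> L2 U" by (rule A_L2[OF g(1)])
  have yL: "?y \<in> L2 U" using L2_measurable[OF wL] by (intro L2_dominated[OF wL, of _ 1]) auto
  have yn: "nm ?y \<le> AC * C"
   using AC(2)[OF g(1)[of j]] mult_left_mono[OF g(2)[of j] AC(1)] by (simp add: L2_norm_eq)
  note FL = flux_L2(1)[OF B(1)[of j] B(2)[of j] B(3) g(1)[of j]]
  have "norm (LINT x|MU. (B j x *v ?w x) \<bullet> z x) \<le> (LINT x|MU. norm ((B j x *v ?w x) \<bullet> z x))"
   by (rule integral_norm_bound)
  also have "\<dots> \<le> (LINT x|MU. ?y x \<bullet> ?q j x)"
  proof (rule integral_mono)
   show "integrable MU (\<lambda>x. norm ((B j x *v ?w x) \<bullet> z x))" using L2_inner_integrable[OF FL z] by (rule integrable_norm)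
   show "integrable MU (\<lambda>x. ?y x \<bullet> ?q j x)" by (rule L2_inner_integrable[OF yL qL])
   fix x
   have "norm ((B j x *v ?w x) \<bullet> z x) \<le> norm (B j x *v ?w x) * norm (z x)" using Cauchy_Schwarz_ineq2 by simp
   also have "\<dots> \<le> norm (B j x) * norm (?w x) * norm (z x)" by (intro mult_right_mono norm_matrix_vector_le) simp
   finally show "norm ((B j x *v ?w x) \<bullet> z x) \<le> ?y x \<bullet> ?q j x" by (simp add: mult_ac)
  qed
  also have "\<dots> \<le> nm ?y * nm (?q j)"
   using L2_cauchy_schwarz[OF yL qL[of j]] unfolding L2_inner_def by linarith
  also have "\<dots> \<le> AC * C * nm (?q j)" by (intro mult_right_mono yn L2_norm_ge_0)
  finally show "norm (inn (\<lambda>x. B j x *v (A x *v g j x)) z) \<le> AC * C * nm (?q j)" by (simp add: L2_inner_def)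
 qed
qed

text \<open>The argument \<open>u\<close> of the mobility is separate from the unknown
  \<open>r\<close>. A normalized density then solves the same equation, which is linear in
  \<open>r\<close>, \<open>old\<close> and \<open>g\<close>, while the mobility still sees the
  original density.\<close>

definition step_eq where
 "step_eq h \<delta> u r old g \<longleftrightarrow> (\<forall>f\<in>V h. (LINT x|MU. Ih h (\<lambda>y. (r y - old y) / dt * f y) x)
   = - inn (grad U r) (grad U f) + inn (flux h \<delta> u g) (grad U f))"

text \<open>Testing with the solution; replacing lumped by exact norms costs nothing at the new time
  level and the factor \<open>CL\<close> at the old one.\<close>

lemma energy_step:
 assumes h: "h \<in> H" and d: "0 < \<delta>" "\<delta> < 1" and V: "r \<in> V h" "old \<in> V h" and g: "g \<in> L2 U" and eq: "step_eq h \<delta> u r old g"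
 shows "(nm r)^2 + 2 * dt * (nm (grad U r))^2
  \<le> CL * (nm old)^2 + 2 * dt * (TB * (AC * nm g) * nm (grad U r))"
proof -
 interpret fe_mesh U "T h" "P h" h \<kappa> by (rule meshes[OF h])
 let ?X = "LINT x|MU. Ih h (\<lambda>y. r y * r y) x" and ?Y = "LINT x|MU. Ih h (\<lambda>y. old y * old y) x"
 have gL: "grad U r \<in> L2 U" by (rule grad_L2[OF V_H1[OF h V(1)]])
 note F = flux_L2[OF Th_measurable[OF h] Th_bound[OF h d] TB_nonneg[OF h] g]
 have "(?X - ?Y) / (2 * dt) \<le> - (nm (grad U r))\<^sup>2 + inn (flux h \<delta> u g) (grad U r)"
  using pih_step_lower[OF dt, of r old] eq V(1) by (simp add: step_eq_def L2_norm_sq[OF gL])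
 also have "inn (flux h \<delta> u g) (grad U r) \<le> nm (flux h \<delta> u g) * nm (grad U r)"
  using L2_cauchy_schwarz[OF F(1)[of u] gL] by linarith
 also have "\<dots> \<le> TB * (AC * nm g) * nm (grad U r)" by (intro mult_right_mono F(2) L2_norm_ge_0)
 finally have "?X - ?Y \<le> (- (nm (grad U r))\<^sup>2 + TB * (AC * nm g) * nm (grad U r)) * (2 * dt)"
  using dt by (simp add: pos_divide_le_eq)
 moreover have "(nm r)^2 \<le> ?X" by (rule pih_square_lower[OF V(1)])
 moreover have "?Y \<le> CL * (nm old)^2" using pih_square_upper[OF V(2)] by (simp add: CL_def Clump_def)
 ultimately show ?thesis by (simp add: algebra_simps)
qed

text \<open>\<open>M j\<close> takes \<open>r j\<close> back to the original density: it is 1 for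
  the scheme itself and the L2 norm of the density in the argument by normalization.\<close>

definition step_seq :: "(nat \<Rightarrow> real) \<Rightarrow> (nat \<Rightarrow> real) \<Rightarrow> (nat \<Rightarrow> real) \<Rightarrow> (nat \<Rightarrow> real^'n \<Rightarrow> real) \<Rightarrow>
  (nat \<Rightarrow> real^'n \<Rightarrow> real) \<Rightarrow> (nat \<Rightarrow> real^'n \<Rightarrow> real^'n) \<Rightarrow> bool" where
 "step_seq hs ds M r old g \<longleftrightarrow> (\<forall>j. hs j \<in> H \<and> 0 < ds j \<and> ds j < 1 \<and> 0 < M j \<and> r j \<in> V (hs j) \<and> old j \<in> V (hs j) \<and> g j \<in> L2 U
   \<and> step_eq (hs j) (ds j) (\<lambda>x. M j * r j x) (r j) (old j) (g j)) \<and> hs \<longlonglongrightarrow> 0 \<and> ds \<longlonglongrightarrow> 0"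

lemma step_seq_subseq:
 assumes "step_seq hs ds M r old g" "strict_mono q"
 shows "step_seq (\<lambda>j. hs (q j)) (\<lambda>j. ds (q j)) (\<lambda>j. M (q j)) (\<lambda>j. r (q j)) (\<lambda>j. old (q j)) (\<lambda>j. g (q j))"
 using assms LIMSEQ_subseq_LIMSEQ[of hs 0 q] LIMSEQ_subseq_LIMSEQ[of ds 0 q] by (simp add: step_seq_def o_def)

lemma step_seqD:
 assumes "step_seq hs ds M r old g"
 shows "hs j \<in> H" "0 < ds j" "ds j < 1" "0 < M j" "r j \<in> V (hs j)" "old j \<in> V (hs j)" "g j \<in> L2 U"
  "step_eq (hs j) (ds j) (\<lambda>x. M j * r j x) (r j) (old j) (g j)" "hs \<longlonglongrightarrow> 0" "ds \<longlonglongrightarrow> 0"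
  "r j \<in> H1 U" "old j \<in> H1 U"
 using assms V_H1 by (auto simp: step_seq_def)

lemma step_bounds:
 assumes st: "step_seq hs ds M r old g" and B: "\<And>j. nm (old j) \<le> B" and C: "\<And>j. nm (g j) \<le> C"
 obtains D where "\<And>j. nm (r j) \<le> D" "\<And>j. nm (grad U (r j)) \<le> D"
proof -
 note S = step_seqD[OF st]
 define p where "p = CL * B^2"
 define q where "q = TB * (AC * C)"
 have B0: "0 \<le> B" and C0: "0 \<le> C" using B[of 0] C[of 0] L2_norm_ge_0 by (blast intro: order_trans)+
 have pq: "0 \<le> p" "0 \<le> q" using TB_nonneg[OF S(1)] AC(1) C0 by (auto simp: p_def q_def CL_def)
 have e: "(nm (r j))^2 + 2 * dt * (nm (grad U (r j)))^2 \<le> p + 2 * dt * (q * nm (grad U (r j)))" for j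
 proof -
  have "CL * (nm (old j))^2 \<le> p"
   unfolding p_def by (intro mult_left_mono power_mono B) (auto simp: CL_def L2_norm_ge_0)
  moreover have "2 * dt * (TB * (AC * nm (g j)) * nm (grad U (r j))) \<le> 2 * dt * (q * nm (grad U (r j)))"
   unfolding q_def using dt TB_nonneg[OF S(1)] AC(1) by (intro mult_left_mono mult_right_mono C) (auto simp: L2_norm_ge_0)
  ultimately show ?thesis using energy_step[OF S(1-3,5-8), of j] by linarith
 qed
 \<comment> \<open>The gradient is bounded first, by a quadratic inequality from which the norm of
   \<open>r j\<close> has been dropped; that norm follows afterwards.\<close>
 define G where "G = p / (2 * dt) + q + 1"
 have G: "nm (grad U (r j)) \<le> G" for j
  unfolding G_def
 proof (rule quadratic_bound)
  have "2 * dt * (nm (grad U (r j)))^2 \<le> p + 2 * dt * (q * nm (grad U (r j)))"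
   using e[of j] zero_le_power2[of "nm (r j)"] by linarith
  then show "(nm (grad U (r j)))^2 \<le> p / (2 * dt) + q * nm (grad U (r j))"
   using dt by (simp add: field_simps)
 qed (use pq dt in \<open>auto simp: L2_norm_ge_0\<close>)
 have G0: "0 \<le> G" using pq dt by (simp add: G_def)
 define R where "R = sqrt (p + 2 * dt * (q * G))"
 have R: "nm (r j) \<le> R" for j
  unfolding R_def
 proof (rule real_le_rsqrt)
  have "2 * dt * (q * nm (grad U (r j))) \<le> 2 * dt * (q * G)" using dt pq by (intro mult_left_mono G) auto
  moreover have "0 \<le> 2 * dt * (nm (grad U (r j)))^2" using dt by simp
  ultimately show "(nm (r j))^2 \<le> p + 2 * dt * (q * G)" using e[of j] by linarith
 qed
 show thesis by (rule that[of "max R G"]) (auto intro: max.coboundedI1 max.coboundedI2 R G)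
qed

text \<open>Mobility and potential need not converge here: the other terms of the equation do, and
  they determine the weak limit of the flux. The result is used both for nonnegativity and, in the
  end, for the limit equation. Boundedness of the flux in L2 extends it from C1 functions to all of
  \<open>H1\<close>.\<close>

lemma flux_limit:
 assumes st: "step_seq hs ds M r old g" and ol: "ol \<in> L2 U" "tends old ol"
  and D: "\<And>j. nm (grad U (r j)) \<le> D" and C: "\<And>j. nm (g j) \<le> C"
  and v: "v \<in> H1 U" "tends r v" and u: "u \<in> H1 U"
 shows "(\<lambda>j. inn (flux (hs j) (ds j) (\<lambda>x. M j * r j x) (g j)) (grad U u))
  \<longlonglongrightarrow> inn (\<lambda>x. (1 / dt) * (v x - ol x)) u + inn (grad U v) (grad U u)"
proof -
 note S = step_seqD[OF st]
 let ?F = "\<lambda>j. flux (hs j) (ds j) (\<lambda>x. M j * r j x) (g j)" and ?a = "\<lambda>x. (1 / dt) * (v x - ol x)"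
 define W where "W = TB * (AC * C)"
 have FL: "?F j \<in> L2 U" for j
  by (rule flux_L2(1)[OF Th_measurable[OF S(1)] Th_bound[OF S(1-3)] TB_nonneg[OF S(1)] S(7)])
 have FW: "nm (?F j) \<le> W" for j
 proof -
  have "nm (?F j) \<le> TB * (AC * nm (g j))"
   by (rule flux_L2(2)[OF Th_measurable[OF S(1)] Th_bound[OF S(1-3)] TB_nonneg[OF S(1)] S(7)])
  also have "\<dots> \<le> W" unfolding W_def using TB_nonneg[OF S(1)] AC(1) by (intro mult_left_mono C) auto
  finally show ?thesis .
 qed
 have W0: "0 \<le> W" using FW[of 0] L2_norm_ge_0 by (blast intro: order_trans)
 have vL: "v \<in> L2 U" by (rule H1_L2[OF v(1)])
 have aL: "?a \<in> L2 U" by (intro L2_scale L2.S_diff vL ol(1))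
 have C1_case: "(\<lambda>j. inn (?F j) G) \<longlonglongrightarrow> inn ?a f + inn (grad U v) G" if C1: "C1_closure f G" for f G
 proof -
  have GL: "G \<in> L2 U" using continuous_L2 C1 by (auto simp: C1_closure_def)
  let ?f = "\<lambda>j. Ih (hs j) f"
  have fV: "?f j \<in> V (hs j)" for j by (rule Ih_V[OF S(1)])
  have gfL: "grad U (?f j) \<in> L2 U" for j by (rule grad_L2[OF V_H1[OF S(1) fV]])
  let ?d = "\<lambda>j x. (1 / dt) * (r j x - old j x)"
  have dV: "?d j \<in> V (hs j)" for j
  proof -
   interpret fe_mesh U "T (hs j)" "P (hs j)" "hs j" \<kappa> by (rule meshes[OF S(1)])
   show ?thesis by (intro fe_scale fe_diff S)
  qed
  have dlim: "tends ?d ?a"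
  proof (rule Lim_null_comparison)
   show "null (\<lambda>j. (1 / dt) * (nm (\<lambda>x. r j x - v x) + nm (\<lambda>x. old j x - ol x)))"
    using tendsto_mult_right_zero[OF tendsto_add_zero[OF v(2) ol(2)]] .
   have "nm (\<lambda>x. ?d j x - ?a x) \<le> (1 / dt) * (nm (\<lambda>x. r j x - v x) + nm (\<lambda>x. old j x - ol x))" for j
   proof -
    have rv: "(\<lambda>x. r j x - v x) \<in> L2 U" and oo: "(\<lambda>x. old j x - ol x) \<in> L2 U"
     by (intro L2.S_diff H1_L2[OF S(11)] H1_L2[OF S(12)] vL ol(1))+
    have eq: "(\<lambda>x. ?d j x - ?a x) = (\<lambda>x. (1 / dt) * ((r j x - v x) - (old j x - ol x)))" by (auto simp: fun_eq_iff algebra_simps)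
    have "nm (\<lambda>x. ?d j x - ?a x) = (1 / dt) * nm (\<lambda>x. (r j x - v x) - (old j x - ol x))"
     unfolding eq using dt L2_norm_scale[OF L2.S_diff[OF rv oo], of "1 / dt"] by simp
    also have "\<dots> \<le> (1 / dt) * (nm (\<lambda>x. r j x - v x) + nm (\<lambda>x. old j x - ol x))"
     using dt L2.nrm_triangle_diff[OF rv oo] by (intro mult_left_mono) (simp_all add: L2_nrm)
    finally show ?thesis .
   qed
   then show "\<forall>\<^sub>F j in sequentially. norm (nm (\<lambda>x. ?d j x - ?a x)) \<le> (1 / dt) * (nm (\<lambda>x. r j x - v x) + nm (\<lambda>x. old j x - ol x))"
    by (intro always_eventually) (simp add: L2_norm_ge_0)
  qed
  have eq: "inn (?F j) (grad U (?f j))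
    = (LINT x|MU. Ih (hs j) (\<lambda>y. ?d j y * ?f j y) x) + inn (grad U (r j)) (grad U (?f j))" for j
   using S(8)[of j] fV[of j] by (simp add: step_eq_def)
  have 1: "(\<lambda>j. inn (?F j) (grad U (?f j))) \<longlonglongrightarrow> inn ?a f + inn (grad U v) G"
   unfolding eq by (intro tendsto_add lumped_limit[OF C1 S(1,9) dV aL dlim] stiffness_limit[OF C1 S(1,9) S(11) D vL v(2)])
  \<comment> \<open>Replaces the gradient of the interpolant by the fixed \<open>G\<close>, at a
    vanishing cost because the flux is bounded in L2.\<close>
  have 2: "null (\<lambda>j. inn (?F j) (\<lambda>x. grad U (?f j) x - G x))"
  proof (rule L2_inner_weak_strong[OF FL FW])
   show "(\<lambda>x. grad U (?f j) x - G x) \<in> L2 U" for j by (rule L2.S_diff[OF gfL GL])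
   show "(\<lambda>x. 0 :: real^'n) \<in> L2 U" by simp
   show "null (\<lambda>j. nm (\<lambda>x. grad U (?f j) x - G x - 0))" using interpolant_limits(2)[OF C1 S(1,9)] by simp
   show "null (\<lambda>j. inn (?F j) (\<lambda>x. 0))" by (simp add: L2_inner_def)
  qed
  have "inn (?F j) (grad U (?f j)) - inn (?F j) (\<lambda>x. grad U (?f j) x - G x) = inn (?F j) G" for j
   using L2.ip_diff_right[OF gfL GL FL, of j j] by simp
  then show ?thesis using tendsto_diff[OF 1 2] by simp
 qed
 let ?l = "inn ?a u + inn (grad U v) (grad U u)"
 obtain w G where wG: "\<And>k::nat. C1_closure (w k) (G k)"
  "tends w u" "tends G (grad U u)"
  by (rule C1_approx_seq[OF u]) (rule that)
 have wL: "w k \<in> L2 U" and GL: "G k \<in> L2 U" for k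
  using continuous_L2 C1_closure_continuous[OF wG(1)] wG(1) by (auto simp: C1_closure_def)
 have "(\<lambda>k. inn ?a (w k)) \<longlonglongrightarrow> inn ?a u"
  by (rule L2_inner_weak_strong[OF aL order_refl wL H1_L2[OF u] wG(2)]) simp
 moreover have "(\<lambda>k. inn (grad U v) (G k)) \<longlonglongrightarrow> inn (grad U v) (grad U u)"
  by (rule L2_inner_weak_strong[OF grad_L2[OF v(1)] order_refl GL grad_L2[OF u] wG(3)]) simp
 ultimately have ll: "(\<lambda>k. inn ?a (w k) + inn (grad U v) (G k)) \<longlonglongrightarrow> ?l" by (rule tendsto_add)
 show ?thesis
 proof (rule LIMSEQ_approx)
  fix e :: real assume e: "e > 0"
  have "\<forall>\<^sub>F k in sequentially. dist (inn ?a (w k) + inn (grad U v) (G k)) ?l < e" using ll e by (rule tendstoD)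
  moreover have "\<forall>\<^sub>F k in sequentially. W * nm (\<lambda>x. G k x - grad U u x) < e"
   using order_tendstoD(2)[OF tendsto_mult_right_zero[OF wG(3)] e] .
  ultimately have "\<forall>\<^sub>F k in sequentially. dist (inn ?a (w k) + inn (grad U v) (G k)) ?l < e \<and> W * nm (\<lambda>x. G k x - grad U u x) < e"
   by eventually_elim simp
  then obtain k where k: "dist (inn ?a (w k) + inn (grad U v) (G k)) ?l < e" "W * nm (\<lambda>x. G k x - grad U u x) < e"
   by (auto simp: eventually_sequentially)
  have "\<bar>inn (?F j) (grad U u) - inn (?F j) (G k)\<bar> \<le> e" for j
  proof -
   have "\<bar>inn (?F j) (\<lambda>x. grad U u x - G k x)\<bar> \<le> nm (?F j) * nm (\<lambda>x. grad U u x - G k x)"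
    by (rule L2_cauchy_schwarz[OF FL L2.S_diff[OF grad_L2[OF u] GL]])
   also have "\<dots> \<le> W * nm (\<lambda>x. grad U u x - G k x)" by (intro mult_right_mono FW L2_norm_ge_0)
   finally show ?thesis using k(2) L2_norm_commute[OF grad_L2[OF u] GL] L2.ip_diff_right[OF grad_L2[OF u] GL FL] by simp
  qed
  then show "\<exists>Y l'. (\<forall>j. \<bar>inn (?F j) (grad U u) - Y j\<bar> \<le> e) \<and> Y \<longlonglongrightarrow> l' \<and> \<bar>l' - ?l\<bar> \<le> e"
   using C1_case[OF wG(1)[of k]] k(1) by (intro exI[of _ "\<lambda>j. inn (?F j) (G k)"]
    exI[of _ "inn ?a (w k) + inn (grad U v) (G k)"]) (simp add: dist_real_def)
 qed
qed

end

section \<open>Nonnegativity of limits and the uniform bound on the densities\<close>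

context fe_scheme
begin

text \<open>The hypothesis on \<open>hs j *\<^sub>R grad U (r j) x\<close> controls the oscillation
  of \<open>r j\<close> over the element containing \<open>x\<close>. Where \<open>v x\<close> is
  negative, the whole element is therefore eventually negative, not just the point, and the mobility
  there is of size \<open>ds j\<close>.\<close>

lemma limit_nonneg:
 assumes st: "step_seq hs ds M r old g" and ol: "ol \<in> L2 U" "tends old ol" "AE x in MU. 0 \<le> ol x"
  and D: "\<And>j. nm (grad U (r j)) \<le> D" and C: "\<And>j. nm (g j) \<le> C"
  and v: "v \<in> H1 U" "tends r v"
  and ae: "AE x in MU. (\<lambda>j. r j x) \<longlonglongrightarrow> v x" "AE x in MU. null (\<lambda>j. hs j *\<^sub>R grad U (r j) x)"
 shows "AE x in MU. 0 \<le> v x"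
proof -
 note S = step_seqD[OF st]
 let ?B = "\<lambda>j. Th (hs j) (ds j) (\<lambda>x. M j * r j x)" and ?u = "\<lambda>x. neg_test (v x)"
 note u = neg_test_H1[OF v(1)]
 have neg: "AE x in MU. \<forall>j. r j x + hs j * norm (grad U (r j) x) < 0 \<longrightarrow> norm (?B j x) \<le> (real CARD('n))^2 * ds j"
  unfolding AE_all_countable
 proof
  fix j
  interpret fe_mesh U "T (hs j)" "P (hs j)" "hs j" \<kappa> by (rule meshes[OF S(1)])
  have "ds j < L" using S(3)[of j] L by simp
  from \<Theta>_negative[OF S(2) this S(5) S(4)]
  show "AE x in MU. r j x + hs j * norm (grad U (r j) x) < 0 \<longrightarrow> norm (?B j x) \<le> (real CARD('n))^2 * ds j"
   by (simp add: Nn_def)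
 qed
 have van: "AE x in MU. null (\<lambda>j. norm (?B j x) * norm (grad U ?u x))"
  using neg ae u(2)
 proof eventually_elim
  case (elim x)
  show ?case
  proof (cases "0 \<le> v x")
   case True
   then show ?thesis using elim(4) by (simp add: neg_test'_props(4))
  next
   case False
   have "null (\<lambda>j. norm (hs j *\<^sub>R grad U (r j) x))" using tendsto_norm_zero[OF elim(3)] .
   then have "(\<lambda>j. r j x + norm (hs j *\<^sub>R grad U (r j) x)) \<longlonglongrightarrow> v x + 0" by (intro tendsto_add elim(2))
   then have "\<forall>\<^sub>F j in sequentially. r j x + norm (hs j *\<^sub>R grad U (r j) x) < 0" using False by (intro order_tendstoD(2)) auto
   then have "\<forall>\<^sub>F j in sequentially. norm (?B j x) \<le> (real CARD('n))^2 * ds j"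
   proof eventually_elim
    case (elim j)
    have "hs j * norm (grad U (r j) x) \<le> norm (hs j *\<^sub>R grad U (r j) x)" by (simp add: mult_right_mono)
    then show ?case using elim \<open>\<forall>j. r j x + hs j * norm (grad U (r j) x) < 0 \<longrightarrow> norm (?B j x) \<le> (real CARD('n))^2 * ds j\<close> by force
   qed
   then have "\<forall>\<^sub>F j in sequentially. norm (?B j x) * norm (grad U ?u x) \<le> (real CARD('n))^2 * ds j * norm (grad U ?u x)"
    by eventually_elim (simp add: mult_right_mono)
   moreover have "null (\<lambda>j. (real CARD('n))^2 * ds j * norm (grad U ?u x))"
    by (rule tendsto_mult_left_zero[OF tendsto_mult_right_zero[OF S(10)]])
   ultimately show ?thesis by (intro Lim_null_comparison[of "\<lambda>j. norm (?B j x) * norm (grad U ?u x)"]) auto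
  qed
 qed
 have "null (\<lambda>j. inn (flux (hs j) (ds j) (\<lambda>x. M j * r j x) (g j)) (grad U ?u))"
  by (rule vanishing_flux[OF Th_measurable[OF S(1)] Th_bound[OF S(1-3)] TB_nonneg[OF S(1)] S(7) C grad_L2[OF u(1)] van])
 moreover note flux_limit[OF st ol(1,2) D C v u(1)]
 ultimately have 0: "inn (\<lambda>x. (1 / dt) * (v x - ol x)) ?u + inn (grad U v) (grad U ?u) = 0" by (rule LIMSEQ_unique[rotated])
 show ?thesis
 proof (rule nonneg_of_test[OF v(1) ol(1,3), of dt])
  have "inn (\<lambda>x. (1 / dt) * (v x - ol x)) ?u = (1 / dt) * inn (\<lambda>x. v x - ol x) ?u"
   by (rule L2_inner_scale_left[OF L2.S_diff[OF H1_L2[OF v(1)] ol(1)] H1_L2[OF u(1)]])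
  with 0 have "dt * ((1 / dt) * inn (\<lambda>x. v x - ol x) ?u + inn (grad U v) (grad U ?u)) = dt * 0" by (simp only:)
  then show "inn (\<lambda>x. v x - ol x) ?u + dt * inn (grad U v) (grad U ?u) = 0"
   using dt by (simp add: distrib_left)
 qed (use dt in simp)
qed

lemma compactness:
 assumes st: "step_seq hs ds M r old g" and ol: "ol \<in> L2 U" "tends old ol" "AE x in MU. 0 \<le> ol x"
  and C: "\<And>j. nm (g j) \<le> C"
 obtains q :: "nat \<Rightarrow> nat" and v D where "strict_mono q" "v \<in> H1 U" "AE x in MU. 0 \<le> v x"
  "tends (\<lambda>j. r (q j)) v" "\<And>j. nm (grad U (r j)) \<le> D"
proof -
 note S = step_seqD[OF st]
 obtain B where B: "0 \<le> B" "\<And>j. nm (old j) \<le> B"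
  by (rule L2_convergent_bounded[OF H1_L2[OF S(12)] ol(1,2)]) (rule that)
 obtain D where D: "\<And>j. nm (r j) \<le> D" "\<And>j. nm (grad U (r j)) \<le> D"
  by (rule step_bounds[OF st B(2) C]) (rule that)
 obtain q1 v where q1: "strict_mono (q1 :: nat \<Rightarrow> nat)" and v: "v \<in> H1 U"
  and l1: "tends (\<lambda>j. r (q1 j)) v"
  by (rule H1_compactness[OF S(11) D]) (rule that)
 obtain q2 where q2: "strict_mono (q2 :: nat \<Rightarrow> nat)" and a2: "AE x in MU. (\<lambda>j. r (q1 (q2 j)) x) \<longlonglongrightarrow> v x"
  by (rule L2_AE_subseq[OF H1_L2[OF S(11)] H1_L2[OF v] l1]) (rule that)
 \<comment> \<open>Bounded gradients times mesh sizes tend to 0 in L2; a further subsequence gives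
   the almost everywhere convergence that \<open>limit_nonneg\<close> asks for.\<close>
 let ?z = "\<lambda>j x. hs (q1 (q2 j)) *\<^sub>R grad U (r (q1 (q2 j))) x"
 have hq: "null (\<lambda>j. hs (q1 (q2 j)))"
  using LIMSEQ_subseq_LIMSEQ[OF LIMSEQ_subseq_LIMSEQ[OF S(9) q1] q2] by (simp add: o_def)
 have zn: "nm (\<lambda>x. ?z j x - 0) \<le> \<bar>hs (q1 (q2 j))\<bar> * D" for j
  using mult_left_mono[OF D(2) abs_ge_zero] L2_norm_scaleR[OF grad_L2[OF S(11)]] by simp
 have z0: "null (\<lambda>j. nm (\<lambda>x. ?z j x - 0))"
 proof (rule Lim_null_comparison)
  show "null (\<lambda>j. \<bar>hs (q1 (q2 j))\<bar> * D)" by (rule tendsto_mult_left_zero[OF tendsto_rabs_zero[OF hq]])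
  show "\<forall>\<^sub>F j in sequentially. norm (nm (\<lambda>x. ?z j x - 0)) \<le> \<bar>hs (q1 (q2 j))\<bar> * D"
   using zn by (intro always_eventually allI) (simp add: L2_norm_ge_0 del: diff_zero)
 qed
 have zL: "?z j \<in> L2 U" for j by (rule L2_scaleR[OF grad_L2[OF S(11)]])
 obtain q3 where q3: "strict_mono (q3 :: nat \<Rightarrow> nat)" and a3: "AE x in MU. null (\<lambda>j. ?z (q3 j) x)"
  by (rule L2_AE_subseq[OF zL L2_zero z0]) (rule that)
 define q where "q j = q1 (q2 (q3 j))" for j
 have q: "strict_mono q" using q1 q2 q3 by (simp add: q_def strict_mono_def)
 have lim: "tends (\<lambda>j. r (q j)) v"
  using LIMSEQ_subseq_LIMSEQ[OF LIMSEQ_subseq_LIMSEQ[OF l1 q2] q3] by (simp add: o_def q_def)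
 have "AE x in MU. 0 \<le> v x"
 proof (rule limit_nonneg[OF step_seq_subseq[OF st q] ol(1) _ ol(3) D(2) C v lim])
  show "tends (\<lambda>j. old (q j)) ol" using LIMSEQ_subseq_LIMSEQ[OF ol(2) q] by (simp add: o_def)
  show "AE x in MU. (\<lambda>j. r (q j) x) \<longlonglongrightarrow> v x"
   using a2 by eventually_elim (use LIMSEQ_subseq_LIMSEQ[OF _ q3] in \<open>simp add: o_def q_def\<close>)
  show "AE x in MU. null (\<lambda>j. hs (q j) *\<^sub>R grad U (r (q j)) x)" using a3 by (simp add: q_def)
 qed
 then show thesis using that[OF q v _ lim D(2)] by blast
qed

definition coupled where
 "coupled hs rho c \<longleftrightarrow> (\<forall>j. discrete_fractional_solution U Q (T (hs j)) (m (hs j)) (mu (hs j)) (psi (hs j)) s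
   (dia U Q (\<lambda>x. \<beta>_upper L (rho j x))) (c j))" for hs :: "nat \<Rightarrow> real"

lemma coupled_bound:
 obtains C where "C > 0" "\<And>hs rho c j. coupled hs rho c \<Longrightarrow> hs j \<in> H \<Longrightarrow> rho j \<in> L2 U \<Longrightarrow>
  c j \<in> H1 U \<and> nm (grad U (c j)) \<le> C * nm (\<lambda>x. \<beta>_upper L (rho j x))"
proof -
 obtain C where C: "C > 0" "\<And>h f c. h \<in> H \<Longrightarrow> f \<in> L2 U \<Longrightarrow>
  discrete_fractional_solution U Q (T h) (m h) (mu h) (psi h) s f c \<Longrightarrow>
  c \<in> V h \<and> c \<in> H1 U \<and> c \<in> L2_dia U Q \<and> nm c \<le> C * nm f \<and> nm (grad U c) \<le> C * nm f"
  by (rule solution_bound[OF s(1)]) (rule that)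
 have "c j \<in> H1 U \<and> nm (grad U (c j)) \<le> 2 * C * nm (\<lambda>x. \<beta>_upper L (rho j x))"
  if co: "coupled hs rho c" "hs j \<in> H" "rho j \<in> L2 U" for hs :: "nat \<Rightarrow> real" and rho c j
 proof -
  have bL: "(\<lambda>x. \<beta>_upper L (rho j x)) \<in> L2 U" using co(3) L by (intro \<beta>_upper_L2) auto
  note c = C(2)[OF co(2) dia_L2[OF bL] co(1)[unfolded coupled_def, rule_format]]
  then show ?thesis using mult_left_mono[OF L2_norm_dia[OF bL] less_imp_le[OF C(1)]] by simp
 qed
 with C(1) that[of "2 * C"] show thesis by auto
qed

lemma \<beta>_upper_norm: "u \<in> L2 U \<Longrightarrow> nm (\<lambda>x. \<beta>_upper L (u x)) \<le> nm u"
proof -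
 assume u: "u \<in> L2 U"
 have "nm (\<lambda>x. \<beta>_upper L (u x)) \<le> 1 * nm u"
  using L by (intro L2_norm_mono[OF u \<beta>_upper_measurable[OF L2_measurable[OF u]]]) (auto simp: \<beta>_upper_bounds)
 then show ?thesis by simp
qed

lemma density_bounded:
 assumes st: "step_seq hs ds (\<lambda>_. 1) rho old (\<lambda>j. grad U (c j))" and co: "coupled hs rho c"
  and ol: "ol \<in> L2 U" "tends old ol"
 shows "\<exists>B. \<forall>j. nm (rho j) \<le> B"
proof (rule ccontr)
 assume nb: "\<nexists>B. \<forall>j. nm (rho j) \<le> B"
 obtain p where p: "strict_mono (p :: nat \<Rightarrow> nat)" "\<And>j. real j < nm (rho (p j))" by (rule unbounded_subseq[OF nb]) (rule that)
 note S = step_seqD[OF step_seq_subseq[OF st p(1)]]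
 obtain C where C: "C > 0" "\<And>hs rho c j. coupled hs rho c \<Longrightarrow> hs j \<in> H \<Longrightarrow> rho j \<in> L2 U \<Longrightarrow>
  c j \<in> H1 U \<and> nm (grad U (c j)) \<le> C * nm (\<lambda>x. \<beta>_upper L (rho j x))"
  by (rule coupled_bound) (rule that)
 have cop: "coupled (\<lambda>j. hs (p j)) (\<lambda>j. rho (p j)) (\<lambda>j. c (p j))" using co by (simp add: coupled_def)
 have rL: "rho (p j) \<in> L2 U" for j by (rule H1_L2[OF S(11)])
 note cb = C(2)[OF cop S(1) rL]
 define M where "M j = nm (rho (p j))" for j
 have M: "0 < M j" "real j < M j" for j using p(2)[of j] by (auto simp: M_def intro: le_less_trans[of 0 "real j"])
 have Mi: "null (\<lambda>j. 1 / M j)"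
 proof (rule tendsto_divide_0[OF tendsto_const])
  have "filterlim M at_top sequentially"
   by (rule filterlim_at_top_mono[OF filterlim_real_sequentially]) (use M(2) in \<open>auto intro: always_eventually less_imp_le\<close>)
  then show "filterlim M at_infinity sequentially" by (rule filterlim_at_top_imp_at_infinity)
 qed
 define r where "r j x = (1 / M j) * rho (p j) x" for j x
 define o' where "o' j x = (1 / M j) * old (p j) x" for j x
 define g where "g j x = (1 / M j) *\<^sub>R grad U (c (p j)) x" for j x
 have gL: "g j \<in> L2 U" for j unfolding g_def by (rule L2_scaleR[OF S(7)])
 have Mr: "(\<lambda>x. M j * r j x) = rho (p j)" for j using M(1)[of j] by (simp add: r_def)
 have st': "step_seq (\<lambda>j. hs (p j)) (\<lambda>j. ds (p j)) M r o' g"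
  unfolding step_seq_def
 proof (intro conjI allI S M(1) gL)
  fix j
  interpret fe_mesh U "T (hs (p j))" "P (hs (p j))" "hs (p j)" \<kappa> by (rule meshes[OF S(1)])
  show "r j \<in> V (hs (p j))" "o' j \<in> V (hs (p j))" unfolding r_def o'_def by (intro fe_scale S)+
  show "step_eq (hs (p j)) (ds (p j)) (\<lambda>x. M j * r j x) (r j) (o' j) (g j)"
   unfolding step_eq_def Mr
  proof
   fix f assume f: "f \<in> V (hs (p j))"
   let ?m = "1 / M j"
   have "(\<lambda>y. (r j y - o' j y) / dt * f y) = (\<lambda>y. ?m * ((rho (p j) y - old (p j) y) / dt * f y))"
    by (auto simp: fun_eq_iff r_def o'_def diff_divide_distrib algebra_simps)
   then have 1: "(LINT x|MU. Ih (hs (p j)) (\<lambda>y. (r j y - o' j y) / dt * f y) x)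
     = ?m * (LINT x|MU. Ih (hs (p j)) (\<lambda>y. (rho (p j) y - old (p j) y) / dt * f y) x)" by (simp only: pih_scale)
   have fH: "f \<in> H1 U" by (rule V_H1[OF S(1) f])
   have "inn (grad U (r j)) (grad U f) = inn (\<lambda>x. ?m *\<^sub>R grad U (rho (p j)) x) (grad U f)"
    unfolding r_def using grad_scale[OF S(11), of ?m j]
    by (intro L2_inner_cong_AE L2_measurable grad_L2 H1_scale S L2_scaleR fH)
   then have 2: "inn (grad U (r j)) (grad U f) = ?m * inn (grad U (rho (p j))) (grad U f)"
    by (simp only: L2.ip_scale_left[OF grad_L2[OF S(11)] grad_L2[OF fH]])
   have "flux (hs (p j)) (ds (p j)) (rho (p j)) (g j) = (\<lambda>x. ?m *\<^sub>R flux (hs (p j)) (ds (p j)) (rho (p j)) (grad U (c (p j))) x)"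
    by (simp add: g_def fun_eq_iff matrix_vector_mult_scaleR)
   then have 3: "inn (flux (hs (p j)) (ds (p j)) (rho (p j)) (g j)) (grad U f)
     = ?m * inn (flux (hs (p j)) (ds (p j)) (rho (p j)) (grad U (c (p j)))) (grad U f)"
    by (simp only: L2.ip_scale_left[OF flux_L2(1)[OF Th_measurable[OF S(1)] Th_bound[OF S(1-3)] TB_nonneg[OF S(1)] S(7)] grad_L2[OF fH]])
   have "(LINT x|MU. Ih (hs (p j)) (\<lambda>y. (rho (p j) y - old (p j) y) / dt * f y) x)
     = - inn (grad U (rho (p j))) (grad U f) + inn (flux (hs (p j)) (ds (p j)) (rho (p j)) (grad U (c (p j)))) (grad U f)"
    using S(8)[of j] f by (simp add: step_eq_def)
   then show "(LINT x|MU. Ih (hs (p j)) (\<lambda>y. (r j y - o' j y) / dt * f y) x)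
     = - inn (grad U (r j)) (grad U f) + inn (flux (hs (p j)) (ds (p j)) (rho (p j)) (g j)) (grad U f)"
    unfolding 1 2 3 by (simp only: distrib_left mult_minus_right)
  qed
 qed
 note S' = step_seqD[OF st']
 obtain B where B: "0 \<le> B" "\<And>j. nm (old (p j)) \<le> B"
  by (rule L2_convergent_bounded[OF H1_L2[OF S(12)] ol(1)])
   (use LIMSEQ_subseq_LIMSEQ[OF ol(2) p(1)] that in \<open>auto simp: o_def\<close>)
 have o'n: "nm (o' j) \<le> 1 / M j * B" for j
 proof -
  have "nm (o' j) = 1 / M j * nm (old (p j))"
   unfolding o'_def using M(1)[of j] L2_norm_scale[OF H1_L2[OF S(12)], of "1 / M j"] by simp
  also have "\<dots> \<le> 1 / M j * B" using M(1)[of j] by (intro mult_left_mono B) auto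
  finally show ?thesis .
 qed
 have o'0: "null (\<lambda>j. nm (o' j))"
 proof (rule Lim_null_comparison[OF _ tendsto_mult_left_zero[OF Mi]])
  show "\<forall>\<^sub>F j in sequentially. norm (nm (o' j)) \<le> 1 / M j * B" using o'n by (intro always_eventually) (simp add: L2_norm_ge_0)
 qed
 have gn: "nm (g j) \<le> 1 / M j * (C * nm (\<lambda>x. \<beta>_upper L (rho (p j) x)))" for j
 proof -
  have "nm (g j) = 1 / M j * nm (grad U (c (p j)))"
   unfolding g_def using M(1)[of j] L2_norm_scaleR[OF S(7), of "1 / M j"] by simp
  also have "\<dots> \<le> 1 / M j * (C * nm (\<lambda>x. \<beta>_upper L (rho (p j) x)))" using M(1)[of j] cb[of j] by (intro mult_left_mono) auto
  finally show ?thesis .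
 qed
 \<comment> \<open>At first only boundedness is known, since \<open>\<beta>_upper\<close> does not
   increase the modulus; this suffices to extract a nonnegative limit.\<close>
 have gC: "nm (g j) \<le> C" for j
 proof -
  have "1 / M j * (C * nm (\<lambda>x. \<beta>_upper L (rho (p j) x))) \<le> 1 / M j * (C * M j)"
   using M(1)[of j] C(1) \<beta>_upper_norm[OF rL[of j]] by (intro mult_left_mono) (auto simp: M_def)
  then show ?thesis using gn[of j] M(1)[of j] by simp
 qed
 obtain q v D where q: "strict_mono (q :: nat \<Rightarrow> nat)" and v: "v \<in> H1 U" "AE x in MU. 0 \<le> v x"
  and lim: "tends (\<lambda>j. r (q j)) v" and D: "\<And>j. nm (grad U (r j)) \<le> D"
  by (rule compactness[OF st' L2_zero _ _ gC]) (use o'0 that in auto)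
 have Mq: "null (\<lambda>j. 1 / M (q j))" and oq: "null (\<lambda>j. nm (o' (q j)))"
  using LIMSEQ_subseq_LIMSEQ[OF Mi q] LIMSEQ_subseq_LIMSEQ[OF o'0 q] by (simp_all add: o_def)
 \<comment> \<open>With \<open>v\<close> nonnegative, the drift is bounded by the distance to
   \<open>v\<close> plus a multiple of \<open>1 / M j\<close>, so it tends to 0 along
   \<open>q\<close>.\<close>
 let ?k = "\<lambda>j. C * (nm (\<lambda>x. r j x - v x) + 1 / M j * (L * sqrt (measure lebesgue U)))"
 have gk: "nm (g j) \<le> ?k j" for j
 proof -
  have rv: "(\<lambda>x. r j x - v x) \<in> L2 U" by (rule L2.S_diff[OF H1_L2[OF S'(11)] H1_L2[OF v(1)]])
  \<comment> \<open>Two summands indexed by \<open>bool\<close> fit the general triangle inequality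
    \<open>L2_norm_le_sum\<close>.\<close>
  have "nm (\<lambda>x. \<beta>_upper L (rho (p j) x)) \<le> (\<Sum>b\<in>UNIV. nm (\<lambda>x. if b then M j * (r j x - v x) else L))"
  proof (rule L2_norm_le_sum)
   show "(\<lambda>x. \<beta>_upper L (rho (p j) x)) \<in> bm" by (rule \<beta>_upper_measurable[OF L2_measurable[OF rL]])
   show "(\<lambda>x. if b then M j * (r j x - v x) else L) \<in> L2 U" for b
    using L2_scale[OF rv] L2_const[OF dom_lmeasurable, of L] by (cases b) auto
   show "AE x in MU. norm (\<beta>_upper L (rho (p j) x)) \<le> (\<Sum>b\<in>UNIV. norm (if b then M j * (r j x - v x) else L))"
    using v(2)
   proof eventually_elim
    case (elim x)
    have "\<bar>\<beta>_upper L (M j * r j x)\<bar> \<le> M j * \<bar>r j x - v x\<bar> + L" using \<beta>_upper_bounds(3)[of L "v x" "M j" "r j x"] elim M(1)[of j] L by simp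
    then show ?case using fun_cong[OF Mr[of j], of x] L M(1)[of j] by (simp add: UNIV_bool abs_mult)
   qed
  qed simp
  also have "\<dots> = M j * nm (\<lambda>x. r j x - v x) + L * sqrt (measure lebesgue U)"
   using L2_norm_scale[OF rv, of "M j"] M(1)[of j] L by (simp add: UNIV_bool L2_norm_const)
  finally have "1 / M j * (C * nm (\<lambda>x. \<beta>_upper L (rho (p j) x)))
    \<le> 1 / M j * (C * (M j * nm (\<lambda>x. r j x - v x) + L * sqrt (measure lebesgue U)))"
   using M(1)[of j] C(1) by (intro mult_left_mono) auto
  also have "\<dots> = ?k j" using M(1)[of j] by (simp add: field_simps)
  finally show ?thesis using gn[of j] by linarith
 qed
 have k0: "null (\<lambda>j. ?k (q j))"
  by (rule tendsto_mult_right_zero[OF tendsto_add_zero[OF lim tendsto_mult_left_zero[OF Mq]]])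
 have r1: "nm (r j) = 1" for j
  unfolding r_def using L2_norm_scale[OF rL[of j], of "1 / M j"] M(1)[of j] by (simp add: M_def)
 have D0: "0 \<le> D" using D[of 0] L2_norm_ge_0 by (blast intro: order_trans)
 \<comment> \<open>The normalized density has norm 1, while the old values and the drift on the
   right tend to 0 along \<open>q\<close>.\<close>
 have up: "1 \<le> CL * (nm (o' j))^2 + 2 * dt * (TB * (AC * ?k j) * D)" for j
 proof -
  have "(nm (r j))^2 + 2 * dt * (nm (grad U (r j)))^2
    \<le> CL * (nm (o' j))^2 + 2 * dt * (TB * (AC * nm (g j)) * nm (grad U (r j)))"
   by (rule energy_step[OF S'(1-3,5-8)])
  moreover have "TB * (AC * nm (g j)) * nm (grad U (r j)) \<le> TB * (AC * ?k j) * D"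
  proof (rule mult_mono[OF mult_left_mono[OF mult_left_mono[OF gk AC(1)] TB_nonneg[OF S'(1)]] D _ L2_norm_ge_0])
   have "0 \<le> ?k j" using gk[of j] L2_norm_ge_0[of U "g j"] by linarith
   then show "0 \<le> TB * (AC * ?k j)" by (rule mult_nonneg_nonneg[OF TB_nonneg[OF S'(1)] mult_nonneg_nonneg[OF AC(1)]])
  qed
  then have "2 * dt * (TB * (AC * nm (g j)) * nm (grad U (r j))) \<le> 2 * dt * (TB * (AC * ?k j) * D)"
   using dt by (intro mult_left_mono) auto
  moreover have "0 \<le> 2 * dt * (nm (grad U (r j)))^2" using dt by simp
  ultimately show ?thesis unfolding r1 by simp
 qed
 have "(\<lambda>j. CL * (nm (o' (q j)))^2 + 2 * dt * (TB * (AC * ?k (q j)) * D)) \<longlonglongrightarrow> CL * 0^2 + 2 * dt * (TB * (AC * 0) * D)"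
  by (intro tendsto_add tendsto_mult tendsto_const tendsto_power oq k0)
 from LIMSEQ_le_const[OF this] up have "1 \<le> CL * 0^2 + 2 * dt * (TB * (AC * 0) * D)" by blast
 then show False by simp
qed

end

lemma mat_scaleR: "mat c = c *\<^sub>R (mat 1 :: real^'n^'n)"
 by (simp add: mat_def vec_eq_iff)

lemma L2_strong_lim_subseq: "L2_strong_lim U u v sequentially \<Longrightarrow> strict_mono r \<Longrightarrow> L2_strong_lim U (\<lambda>j. u (r j)) v sequentially"
 and L2_weak_lim_subseq: "L2_weak_lim U u' v' sequentially \<Longrightarrow> strict_mono r \<Longrightarrow> L2_weak_lim U (\<lambda>j. u' (r j)) v' sequentially"
 for r :: "nat \<Rightarrow> nat"
 unfolding L2_strong_lim_def L2_weak_lim_def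
 using filterlim_subseq by (auto intro: eventually_compose_filterlim filterlim_compose)

section \<open>Identification of the limit problem and induction over the time steps\<close>

context fe_scheme
begin

text \<open>There are two errors: from \<open>\<Theta>\<close> to \<open>\<beta>_cut\<close> of the
  discrete density, of order \<open>hs j\<close> times a bounded gradient, and from there to
  \<open>\<beta>_upper\<close> of the limit, where nonnegativity of \<open>v\<close> enters.\<close>

lemma mobility_limit:
 assumes st: "step_seq hs ds (\<lambda>_. 1) rho old g" and v: "v \<in> H1 U" "AE x in MU. 0 \<le> v x"
  and lim: "tends rho v" and D: "\<And>j. nm (grad U (rho j)) \<le> D"
 shows "L2_strong_lim U (\<lambda>j. Th (hs j) (ds j) (rho j)) (\<lambda>x. mat (\<beta>_upper L (v x))) sequentially"
proof -
 note S = step_seqD[OF st]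
 let ?N = "(real CARD('n))^2"
 have L0: "0 < L" using L by simp
 have vL: "v \<in> L2 U" by (rule H1_L2[OF v(1)])
 have matm: "f \<in> bm \<Longrightarrow> (\<lambda>x. mat (f x) :: real^'n^'n) \<in> bm" for f
  unfolding mat_scaleR[of "f _"] by (intro borel_measurable_scaleR) auto
 have matL: "f \<in> L2 U \<Longrightarrow> (\<lambda>x. mat (f x) :: real^'n^'n) \<in> L2 U" for f
  by (rule L2_dominated[OF _ matm[OF L2_measurable], of _ _ ?N]) (auto intro!: AE_I2 norm_mat_le)
 have uL: "(\<lambda>x. \<beta>_upper L (v x)) \<in> L2 U" by (rule \<beta>_upper_L2[OF vL L0])
 have rL: "rho j \<in> L2 U" for j by (rule H1_L2[OF S(11)])
 have cL: "(\<lambda>x. \<beta>_cut (ds j) L (rho j x)) \<in> L2 U" for j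
 proof (rule L2_bounded(1)[OF dom_lmeasurable \<beta>_cut_measurable[OF L2_measurable[OF rL]], where C=L])
  have "\<bar>\<beta>_cut (ds j) L t\<bar> \<le> L" for t using \<beta>_cut_bounds[of "ds j" L t] S(2)[of j] S(3)[of j] L by linarith
  then show "AE x in MU. norm (\<beta>_cut (ds j) L (rho j x)) \<le> L" by simp
 qed (use L0 in simp)
 have ThL: "Th (hs j) (ds j) (rho j) \<in> L2 U" for j
  using Th_bound[OF S(1-3)] TB_nonneg[OF S(1)] by (intro L2_bounded(1)[OF dom_lmeasurable Th_measurable[OF S(1)], where C=TB]) auto
 have k0: "\<kappa> > 0" using meshes[OF S(1)] fe_mesh.\<kappa>(1) by blast
 let ?E = "\<lambda>j. ?N / \<kappa> * hs j * D + ?N * (nm (\<lambda>x. rho j x - v x) + ds j * sqrt (measure lebesgue U))"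
 have bound: "nm (\<lambda>x. Th (hs j) (ds j) (rho j) x - mat (\<beta>_upper L (v x))) \<le> ?E j" for j
 proof -
  interpret fe_mesh U "T (hs j)" "P (hs j)" "hs j" \<kappa> by (rule meshes[OF S(1)])
  have dL: "ds j < L" using S(3)[of j] L by simp
  let ?c = "\<lambda>x. \<beta>_cut (ds j) L (rho j x)" and ?u = "\<lambda>x. \<beta>_upper L (v x)"
  have rv: "(\<lambda>x. rho j x - v x) \<in> L2 U" by (rule L2.S_diff[OF rL vL])
  obtain K where K: "K \<in> T (hs j)" using nonempty dom_K by blast
  have h0: "0 \<le> hs j" using diam[OF K] diam_pos[OF K] by simp
  have "nm (\<lambda>x. Th (hs j) (ds j) (rho j) x - mat (?c x)) \<le> ?N / \<kappa> * hs j * nm (grad U (rho j))"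
   using h0 k0 \<Theta>_deviation[OF S(2) dL S(5)]
   by (intro L2_norm_mono[OF grad_L2[OF S(11)] L2_measurable[OF L2.S_diff[OF ThL matL[OF cL]]]]) (auto simp: Nn_def)
  also have "\<dots> \<le> ?N / \<kappa> * hs j * D" using h0 k0 by (intro mult_left_mono D) auto
  finally have 1: "nm (\<lambda>x. Th (hs j) (ds j) (rho j) x - mat (?c x)) \<le> ?N / \<kappa> * hs j * D" .
  have cu: "nm (\<lambda>x. ?c x - ?u x) \<le> (\<Sum>b\<in>UNIV. nm (\<lambda>x. if b then rho j x - v x else ds j))"
  proof (rule L2_norm_le_sum)
   show "(\<lambda>x. ?c x - ?u x) \<in> bm" by (rule L2_measurable[OF L2.S_diff[OF cL uL]])
   show "(\<lambda>x. if b then rho j x - v x else ds j) \<in> L2 U" for b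
    using rv L2_const[OF dom_lmeasurable, of "ds j"] by (cases b) auto
   show "AE x in MU. norm (?c x - ?u x) \<le> (\<Sum>b\<in>UNIV. norm (if b then rho j x - v x else ds j))"
    using v(2)
   proof eventually_elim
    case (elim x)
    show ?case using \<beta>_upper_bounds(4)[OF L0 S(2) dL elim, of "rho j x"] S(2)[of j] by (simp add: UNIV_bool)
   qed
  qed simp
  have "nm (\<lambda>x. mat (?c x) - mat (?u x) :: real^'n^'n) \<le> ?N * nm (\<lambda>x. ?c x - ?u x)"
   unfolding mat_diff
   by (intro L2_norm_mono[OF L2.S_diff[OF cL uL] matm[OF L2_measurable[OF L2.S_diff[OF cL uL]]]]) (auto intro!: AE_I2 norm_mat_le)
  also have "\<dots> \<le> ?N * (nm (\<lambda>x. rho j x - v x) + ds j * sqrt (measure lebesgue U))"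
   using cu S(2)[of j] by (intro mult_left_mono) (auto simp: UNIV_bool L2_norm_const)
  finally have 2: "nm (\<lambda>x. mat (?c x) - mat (?u x) :: real^'n^'n) \<le> ?N * (nm (\<lambda>x. rho j x - v x) + ds j * sqrt (measure lebesgue U))" .
  show ?thesis using L2_triangle3[OF ThL matL[OF cL] matL[OF uL], of j j] 1 2 by linarith
 qed
 have "?E \<longlonglongrightarrow> ?N / \<kappa> * 0 * D + ?N * (0 + 0 * sqrt (measure lebesgue U))"
  by (intro tendsto_add tendsto_mult tendsto_const S(9,10) lim)
 then have E0: "?E \<longlonglongrightarrow> 0" by simp
 have "null (\<lambda>j. nm (\<lambda>x. Th (hs j) (ds j) (rho j) x - mat (\<beta>_upper L (v x))))"
  by (rule Lim_null_comparison[OF _ E0]) (use bound in \<open>auto intro!: always_eventually simp: L2_norm_ge_0\<close>)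
 then show ?thesis using ThL matL[OF uL] by (simp add: L2_strong_lim_def)
qed

text \<open>The product of a bounded, almost everywhere convergent matrix and a weakly convergent
  gradient: the difference of the matrices is handled by \<open>vanishing_flux\<close>, and what
  remains is linear in the gradient.\<close>

lemma flux_identification:
 assumes st: "step_seq hs ds (\<lambda>_. 1) rho old (\<lambda>j. grad U (c j))" and v: "v \<in> H1 U" "AE x in MU. 0 \<le> v x"
  and th: "AE x in MU. (\<lambda>j. Th (hs j) (ds j) (rho j) x) \<longlonglongrightarrow> mat (\<beta>_upper L (v x))"
  and c: "\<And>j. c j \<in> H1 U" "\<And>j. nm (grad U (c j)) \<le> C" "c0 \<in> H1 U" "tends c c0"
  and z: "z \<in> L2 U"
 shows "(\<lambda>j. inn (flux (hs j) (ds j) (rho j) (grad U (c j))) z)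
  \<longlonglongrightarrow> (LINT x|MU. \<beta>_upper L (v x) * ((A x *v grad U c0 x) \<bullet> z x))"
proof -
 note S = step_seqD[OF st]
 let ?N = "(real CARD('n))^2"
 \<comment> \<open>\<open>max 0\<close> makes the bounds on \<open>b\<close> hold everywhere instead
   of almost everywhere, as the pointwise hypotheses of \<open>vanishing_flux\<close> and
   \<open>flux_L2\<close> ask.\<close>
 define b where "b x = \<beta>_upper L (max 0 (v x))" for x
 have L0: "0 < L" using L by simp
 have b: "0 \<le> b x" "b x \<le> L" for x using \<beta>_upper_bounds(5)[OF L0, of "max 0 (v x)"] by (auto simp: b_def)
 have bm: "b \<in> bm"
  unfolding b_def using L2_measurable[OF H1_L2[OF v(1)]] by (intro \<beta>_upper_measurable borel_measurable_max) auto
 have bv: "AE x in MU. b x = \<beta>_upper L (v x)" using v(2) by eventually_elim (simp add: b_def)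
 have mbm: "(\<lambda>x. mat (b x) :: real^'n^'n) \<in> bm"
  unfolding mat_scaleR[of "b _"] using bm by (intro borel_measurable_scaleR) auto
 let ?B = "\<lambda>j x. Th (hs j) (ds j) (rho j) x - mat (b x)"
 have Bm: "?B j \<in> bm" for j by (intro borel_measurable_diff Th_measurable[OF S(1)] mbm)
 have Bb: "norm (?B j x) \<le> TB + ?N * L" for j x
 proof -
  have "norm (mat (b x) :: real^'n^'n) \<le> ?N * L"
   using norm_mat_le[where 'n='n, of "b x"] b[of x] by (auto intro: order_trans mult_left_mono)
  then show ?thesis using Th_bound[OF S(1)[of j] S(2)[of j] S(3)[of j], of "rho j" x] norm_triangle_ineq4[of "Th (hs j) (ds j) (rho j) x" "mat (b x)"] by linarith
 qed
 have K0: "0 \<le> TB + ?N * L" using TB_nonneg[OF S(1)] L0 by simp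
 have van: "AE x in MU. null (\<lambda>j. norm (?B j x) * norm (z x))"
  using th bv by eventually_elim (auto intro!: tendsto_mult_left_zero tendsto_norm_zero LIM_zero)
 have 1: "null (\<lambda>j. inn (\<lambda>x. ?B j x *v (A x *v grad U (c j) x)) z)"
  by (rule vanishing_flux[OF Bm Bb K0 S(7) c(2) z van])
 have sc: "(\<lambda>x. b x *\<^sub>R (A x *v w x)) \<in> L2 U" if w: "w \<in> L2 U" for w
 proof (rule L2_dominated[OF A_L2[OF w]])
  show "(\<lambda>x. b x *\<^sub>R (A x *v w x)) \<in> bm" by (rule borel_measurable_scaleR[OF bm L2_measurable[OF A_L2[OF w]]])
  show "AE x in MU. norm (b x *\<^sub>R (A x *v w x)) \<le> L * norm (A x *v w x)"
   using b by (intro AE_I2) (simp add: mult_right_mono)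
 qed
 \<comment> \<open>Symmetry of \<open>A\<close> moves the coefficients onto \<open>z\<close>,
   leaving the plain gradient for weak convergence.\<close>
 have sym: "inn (\<lambda>x. b x *\<^sub>R (A x *v w x)) z = inn w (\<lambda>x. b x *\<^sub>R (A x *v z x))" if w: "w \<in> L2 U" for w
  unfolding L2_inner_def
 proof (rule integral_cong_AE)
  show "(\<lambda>x. (b x *\<^sub>R (A x *v w x)) \<bullet> z x) \<in> bm" "(\<lambda>x. w x \<bullet> (b x *\<^sub>R (A x *v z x))) \<in> bm"
   using L2_inner_integrable[OF sc[OF w] z] L2_inner_integrable[OF w sc[OF z]] by auto
  show "AE x in MU. (b x *\<^sub>R (A x *v w x)) \<bullet> z x = w x \<bullet> (b x *\<^sub>R (A x *v z x))"
   using A_sym by eventually_elim (simp add: inner_commute)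
 qed
 have gw: "grad U (c j) \<in> L2 U" for j by (rule S(7))
 have 2: "(\<lambda>j. inn (\<lambda>x. b x *\<^sub>R (A x *v grad U (c j) x)) z) \<longlonglongrightarrow> inn (\<lambda>x. b x *\<^sub>R (A x *v grad U c0 x)) z"
  unfolding sym[OF gw] sym[OF grad_L2[OF c(3)]] by (rule grad_weak_lim[OF c(1,2) H1_L2[OF c(3)] c(4) sc[OF z]])
 have sum: "inn (\<lambda>x. ?B j x *v (A x *v grad U (c j) x)) z + inn (\<lambda>x. b x *\<^sub>R (A x *v grad U (c j) x)) z
   = inn (flux (hs j) (ds j) (rho j) (grad U (c j))) z" for j
  using L2.ip_add_left[OF flux_L2(1)[OF Bm[of j] Bb K0 gw] sc[OF gw] z, of j j]
  by (simp add: matrix_vector_mult_diff_rdistrib mat_vector)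
 have "inn (\<lambda>x. b x *\<^sub>R (A x *v grad U c0 x)) z = (LINT x|MU. \<beta>_upper L (v x) * ((A x *v grad U c0 x) \<bullet> z x))"
  unfolding L2_inner_def
 proof (rule integral_cong_AE)
  show "(\<lambda>x. (b x *\<^sub>R (A x *v grad U c0 x)) \<bullet> z x) \<in> bm"
   using L2_inner_integrable[OF sc[OF grad_L2[OF c(3)]] z] by auto
  show "(\<lambda>x. \<beta>_upper L (v x) * ((A x *v grad U c0 x) \<bullet> z x)) \<in> bm"
   using L2_inner_integrable[OF A_L2[OF grad_L2[OF c(3)]] z]
   by (intro borel_measurable_times \<beta>_upper_measurable L2_measurable[OF H1_L2[OF v(1)]]) auto
  show "AE x in MU. (b x *\<^sub>R (A x *v grad U c0 x)) \<bullet> z x = \<beta>_upper L (v x) * ((A x *v grad U c0 x) \<bullet> z x)"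
   using bv by eventually_elim simp
 qed
 then show ?thesis using tendsto_add[OF 1 2] unfolding sum by simp
qed

text \<open>All conclusions for one time step, in a form stable under passing to subsequences. Mass
  is recorded as equality with the previous step, so that the steps can be chained.\<close>

definition limit_step where
 "limit_step hs ds rho c old v c0 \<longleftrightarrow> v \<in> H1 U \<and> (AE x in MU. 0 \<le> v x) \<and> c0 \<in> H1 U \<inter> L2_dia U Q
  \<and> L2_weak_lim U (\<lambda>j. grad U (rho j)) (grad U v) sequentially
  \<and> L2_strong_lim U rho v sequentially
  \<and> L2_strong_lim U (\<lambda>j. Th (hs j) (ds j) (rho j)) (\<lambda>x. mat (\<beta>_upper L (v x))) sequentially
  \<and> L2_strong_lim U c c0 sequentially
  \<and> L2_weak_lim U (\<lambda>j. grad U (c j)) (grad U c0) sequentially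
  \<and> (\<forall>f\<in>H1 U. (LINT x|MU. (v x - old x) / dt * f x) = - (LINT x|MU. grad U v x \<bullet> grad U f x)
    + (LINT x|MU. \<beta>_upper L (v x) * ((A x *v grad U c0 x) \<bullet> grad U f x)))
  \<and> fractional_power U Q lam phi s c0 (\<lambda>x. - dia U Q (\<lambda>y. \<beta>_upper L (v y)) x)
  \<and> (LINT x|MU. v x) = (LINT x|MU. old x)" for hs :: "nat \<Rightarrow> real"

lemma limit_step_subseq:
 assumes "limit_step hs ds rho c old v c0" "strict_mono q"
 shows "limit_step (\<lambda>j. hs (q j)) (\<lambda>j. ds (q j)) (\<lambda>j. rho (q j)) (\<lambda>j. c (q j)) old v c0"
 using assms(1) L2_strong_lim_subseq[OF _ assms(2)] L2_weak_lim_subseq[OF _ assms(2)]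
 unfolding limit_step_def by (elim conjE) (intro conjI; (assumption | rule L2_strong_lim_subseq[OF _ assms(2)] | rule L2_weak_lim_subseq[OF _ assms(2)]))

lemma step_limit:
 assumes st: "step_seq hs ds (\<lambda>_. 1) rho old (\<lambda>j. grad U (c j))" and co: "coupled hs rho c"
  and ol: "ol \<in> L2 U" "tends old ol" "AE x in MU. 0 \<le> ol x"
 obtains q v c0 where "strict_mono q" "limit_step (\<lambda>j. hs (q j)) (\<lambda>j. ds (q j)) (\<lambda>j. rho (q j)) (\<lambda>j. c (q j)) ol v c0"
proof -
 note S = step_seqD[OF st]
 have L0: "0 < L" using L by simp
 have rL: "rho j \<in> L2 U" for j by (rule H1_L2[OF S(11)])
 obtain B where B: "\<And>j. nm (rho j) \<le> B" using density_bounded[OF st co ol(1,2)] by blast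
 obtain C where C: "C > 0" "\<And>hs rho c j. coupled hs rho c \<Longrightarrow> hs j \<in> H \<Longrightarrow> rho j \<in> L2 U \<Longrightarrow>
  c j \<in> H1 U \<and> nm (grad U (c j)) \<le> C * nm (\<lambda>x. \<beta>_upper L (rho j x))"
  by (rule coupled_bound) (rule that)
 have cH: "c j \<in> H1 U" for j using C(2)[OF co S(1) rL] by blast
 have cC: "nm (grad U (c j)) \<le> C * B" for j
 proof -
  have "nm (\<lambda>x. \<beta>_upper L (rho j x)) \<le> B" using \<beta>_upper_norm[OF rL[of j]] B[of j] by linarith
  from mult_left_mono[OF this less_imp_le[OF C(1)]] show ?thesis using C(2)[OF co S(1) rL, of j] by linarith
 qed
 obtain q1 v D where q1: "strict_mono (q1 :: nat \<Rightarrow> nat)" and v: "v \<in> H1 U" "AE x in MU. 0 \<le> v x"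
  and l1: "tends (\<lambda>j. rho (q1 j)) v" and D: "\<And>j. nm (grad U (rho j)) \<le> D"
  by (rule compactness[OF st ol cC]) (rule that)
 have vL: "v \<in> L2 U" by (rule H1_L2[OF v(1)])
 have bL: "(\<lambda>x. \<beta>_upper L (rho j x)) \<in> L2 U" and bvL: "(\<lambda>x. \<beta>_upper L (v x)) \<in> L2 U" for j
  using \<beta>_upper_L2[OF rL L0] \<beta>_upper_L2[OF vL L0] by auto
 have "null (\<lambda>j. nm (\<lambda>x. \<beta>_upper L (rho (q1 j) x) - \<beta>_upper L (v x)))"
 proof (rule Lim_null_comparison[OF _ l1])
  have "nm (\<lambda>x. \<beta>_upper L (rho (q1 j) x) - \<beta>_upper L (v x)) \<le> 1 * nm (\<lambda>x. rho (q1 j) x - v x)" for j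
   using \<beta>_upper_bounds(2)[OF L0]
   by (intro L2_norm_mono[OF L2.S_diff[OF rL vL] L2_measurable[OF L2.S_diff[OF bL bvL]]]) auto
  then show "\<forall>\<^sub>F j in sequentially. norm (nm (\<lambda>x. \<beta>_upper L (rho (q1 j) x) - \<beta>_upper L (v x))) \<le> nm (\<lambda>x. rho (q1 j) x - v x)"
   by (intro always_eventually) (simp add: L2_norm_ge_0)
 qed
 note dl = dia_tendsto[OF bL bvL this]
 have h1: "null (\<lambda>j. hs (q1 j))" using LIMSEQ_subseq_LIMSEQ[OF S(9) q1] by (simp add: o_def)
 obtain q2 c0 where q2: "strict_mono (q2 :: nat \<Rightarrow> nat)" and c0: "c0 \<in> H1 U" "c0 \<in> L2_dia U Q"
  and l2: "tends (\<lambda>j. c (q1 (q2 j))) c0"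
  and fp: "fractional_power U Q lam phi s c0 (\<lambda>x. - dia U Q (\<lambda>y. \<beta>_upper L (v y)) x)"
  by (rule fractional_convergence[OF s S(1) h1 dia_L2_dia[OF bL] dia_L2_dia[OF bvL] dl])
   (use co that in \<open>auto simp: coupled_def\<close>)
 define q where "q j = q1 (q2 j)" for j
 have q: "strict_mono q" using q1 q2 by (simp add: q_def strict_mono_def)
 have l1': "tends (\<lambda>j. rho (q j)) v" using LIMSEQ_subseq_LIMSEQ[OF l1 q2] by (simp add: o_def q_def)
 have l2': "tends (\<lambda>j. c (q j)) c0" using l2 by (simp add: q_def)
 note stq = step_seq_subseq[OF st q]
 note mob = mobility_limit[OF stq v l1' D]
 have ThL: "Th (hs (q j)) (ds (q j)) (rho (q j)) \<in> L2 U" for j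
  using Th_bound[OF S(1-3)] TB_nonneg[OF S(1)] by (intro L2_bounded(1)[OF dom_lmeasurable Th_measurable[OF S(1)], where C=TB]) auto
 \<comment> \<open>Almost everywhere convergence of the mobility is used only to derive the limit
   equation, which does not mention the sequence; \<open>q3\<close> is not part of the subsequence
   returned.\<close>
 obtain q3 where q3: "strict_mono (q3 :: nat \<Rightarrow> nat)"
  and a3: "AE x in MU. (\<lambda>j. Th (hs (q (q3 j))) (ds (q (q3 j))) (rho (q (q3 j))) x) \<longlonglongrightarrow> mat (\<beta>_upper L (v x))"
  by (rule L2_AE_subseq[OF ThL]) (use mob that in \<open>auto simp: L2_strong_lim_def\<close>)
 note sub = LIMSEQ_subseq_LIMSEQ[OF _ q3, unfolded o_def]
 note stq3 = step_seq_subseq[OF stq q3]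
 have qq: "strict_mono (\<lambda>j. q (q3 j))" using q q3 by (simp add: strict_mono_def)
 have eq: "(LINT x|MU. (v x - ol x) / dt * f x) = - (LINT x|MU. grad U v x \<bullet> grad U f x)
    + (LINT x|MU. \<beta>_upper L (v x) * ((A x *v grad U c0 x) \<bullet> grad U f x))" if f: "f \<in> H1 U" for f
 proof -
  have "(\<lambda>j. inn (flux (hs (q (q3 j))) (ds (q (q3 j))) (\<lambda>x. 1 * rho (q (q3 j)) x) (grad U (c (q (q3 j))))) (grad U f))
   \<longlonglongrightarrow> inn (\<lambda>x. (1 / dt) * (v x - ol x)) f + inn (grad U v) (grad U f)"
   by (rule flux_limit[OF stq3 ol(1) LIMSEQ_subseq_LIMSEQ[OF ol(2) qq, unfolded o_def] D cC v(1) sub[OF l1'] f])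
  moreover have "(\<lambda>j. inn (flux (hs (q (q3 j))) (ds (q (q3 j))) (rho (q (q3 j))) (grad U (c (q (q3 j))))) (grad U f))
   \<longlonglongrightarrow> (LINT x|MU. \<beta>_upper L (v x) * ((A x *v grad U c0 x) \<bullet> grad U f x))"
   by (rule flux_identification[OF stq3 v a3 cH cC c0(1) sub[OF l2'] grad_L2[OF f]])
  ultimately have "inn (\<lambda>x. (1 / dt) * (v x - ol x)) f + inn (grad U v) (grad U f)
    = (LINT x|MU. \<beta>_upper L (v x) * ((A x *v grad U c0 x) \<bullet> grad U f x))"
   by (simp only: mult_1) (rule LIMSEQ_unique)
  then show ?thesis by (simp add: L2_inner_def)
 qed
 \<comment> \<open>The constant test function annihilates both gradient terms.\<close>
 have mean: "(LINT x|MU. v x) = (LINT x|MU. ol x)"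
 proof -
  have z: "AE x in MU. grad U (\<lambda>x. 1) x = 0" by (rule const_H1(2))
  have "(LINT x|MU. grad U v x \<bullet> grad U (\<lambda>x. 1) x) = 0" by (rule integral_eq_zero_AE) (use z in \<open>eventually_elim, simp\<close>)
  moreover have "(LINT x|MU. \<beta>_upper L (v x) * ((A x *v grad U c0 x) \<bullet> grad U (\<lambda>x. 1) x)) = 0"
   by (rule integral_eq_zero_AE) (use z in \<open>eventually_elim, simp\<close>)
  ultimately have "(LINT x|MU. (v x - ol x) / dt) = 0" using eq[OF const_H1(1)[of 1]] by simp
  then show ?thesis using dt L2_int[OF vL] L2_int[OF ol(1)] by simp
 qed
 have "limit_step (\<lambda>j. hs (q j)) (\<lambda>j. ds (q j)) (\<lambda>j. rho (q j)) (\<lambda>j. c (q j)) ol v c0"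
  unfolding limit_step_def
 proof (intro conjI ballI IntI v c0 mob fp mean eq)
  show "L2_weak_lim U (\<lambda>j. grad U (rho (q j))) (grad U v) sequentially"
   unfolding L2_weak_lim_def using grad_L2[OF v(1)] grad_L2[OF S(11)] grad_weak_lim[OF S(11) D vL l1'] by auto
  show "L2_weak_lim U (\<lambda>j. grad U (c (q j))) (grad U c0) sequentially"
   unfolding L2_weak_lim_def using grad_L2[OF c0(1)] grad_L2[OF cH] grad_weak_lim[OF cH cC H1_L2[OF c0(1)] l2'] by auto
  show "L2_strong_lim U (\<lambda>j. rho (q j)) v sequentially" using vL rL l1' by (simp add: L2_strong_lim_def)
  show "L2_strong_lim U (\<lambda>j. c (q j)) c0 sequentially" using H1_L2[OF c0(1)] H1_L2[OF cH] l2' by (simp add: L2_strong_lim_def)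
 qed
 then show thesis by (rule that[OF q])
qed

text \<open>The limit of one step is the old value of the next, so the subsequence is refined at
  every step; the conclusions for earlier steps pass to the finer subsequence.\<close>

lemma scheme_limit:
 fixes N k :: nat
 assumes hs: "\<And>j. hs j \<in> H" "hs \<longlonglongrightarrow> 0" and ds: "\<And>j. 0 < ds j" "\<And>j. ds j < 1" "ds \<longlonglongrightarrow> 0"
  and R: "\<And>n j. n \<le> N \<Longrightarrow> R n j \<in> V (hs j)"
  and eq: "\<And>n j. n \<in> {1..N} \<Longrightarrow> step_eq (hs j) (ds j) (R n j) (R n j) (R (n - 1) j) (grad U (Z n j))"
  and co: "\<And>n. n \<in> {1..N} \<Longrightarrow> coupled hs (R n) (Z n)"
  and ini: "rho00 \<in> L2 U" "AE x in MU. 0 \<le> rho00 x" "tends (R 0) rho00"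
  and k: "k \<le> N"
 shows "\<exists>r rhoL cL. strict_mono r \<and> rhoL 0 = rho00 \<and> (\<forall>n\<in>{1..k}. limit_step (\<lambda>j. hs (r j)) (\<lambda>j. ds (r j))
  (\<lambda>j. R n (r j)) (\<lambda>j. Z n (r j)) (rhoL (n - 1)) (rhoL n) (cL n))"
 using k
proof (induction k)
 case 0
 show ?case by (intro exI[of _ "\<lambda>j. j"] exI[of _ "\<lambda>_. rho00"]) (auto simp: strict_mono_def)
next
 case (Suc k)
 from Suc.IH[OF Suc_leD[OF Suc.prems]] obtain r rhoL cL where r: "strict_mono r" "rhoL 0 = rho00"
  and IH': "\<forall>n\<in>{1..k}. limit_step (\<lambda>j. hs (r j)) (\<lambda>j. ds (r j)) (\<lambda>j. R n (r j)) (\<lambda>j. Z n (r j)) (rhoL (n - 1)) (rhoL n) (cL n)"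
  by (elim exE conjE) (rule that)
 note IH = bspec[OF IH']
 have n: "Suc k \<in> {1..N}" using Suc.prems by simp
 have old: "rhoL k \<in> L2 U \<and> tends (\<lambda>j. R k (r j)) (rhoL k) \<and> (AE x in MU. 0 \<le> rhoL k x)"
 proof (cases "k = 0")
  case True
  then show ?thesis using r ini LIMSEQ_subseq_LIMSEQ[OF ini(3) r(1)] by (simp add: o_def)
 next
  case False
  then have "k \<in> {1..k}" by simp
  from IH[OF this] show ?thesis unfolding limit_step_def L2_strong_lim_def by blast
 qed
 have ZH: "Z (Suc k) j \<in> H1 U" for j
  using co[OF n] V_H1[OF hs(1)] by (auto simp: coupled_def discrete_fractional_solution_def)
 have st: "step_seq hs ds (\<lambda>_. 1) (R (Suc k)) (R k) (\<lambda>j. grad U (Z (Suc k) j))"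
  using hs ds R[of "Suc k"] R[of k] Suc.prems eq[OF n] grad_L2[OF ZH] by (simp add: step_seq_def)
 have co': "coupled (\<lambda>j. hs (r j)) (\<lambda>j. R (Suc k) (r j)) (\<lambda>j. Z (Suc k) (r j))" using co[OF n] by (simp add: coupled_def)
 obtain q v c0 where q: "strict_mono (q :: nat \<Rightarrow> nat)"
  and ls: "limit_step (\<lambda>j. hs (r (q j))) (\<lambda>j. ds (r (q j))) (\<lambda>j. R (Suc k) (r (q j))) (\<lambda>j. Z (Suc k) (r (q j))) (rhoL k) v c0"
  by (rule step_limit[OF step_seq_subseq[OF st r(1)] co']) (use old that in auto)
 have rq: "strict_mono (\<lambda>j. r (q j))" using r(1) q by (simp add: strict_mono_def)
 show ?case
 proof (intro exI conjI ballI)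
  show "strict_mono (\<lambda>j. r (q j))" by (rule rq)
  \<comment> \<open>Updating at \<open>Suc k\<close> leaves the limits with smaller index unchanged,
    and with them the old values of all earlier steps.\<close>
  show "(rhoL(Suc k := v)) 0 = rho00" using r by simp
  fix n assume nk: "n \<in> {1..Suc k}"
  show "limit_step (\<lambda>j. hs (r (q j))) (\<lambda>j. ds (r (q j))) (\<lambda>j. R n (r (q j))) (\<lambda>j. Z n (r (q j)))
    ((rhoL(Suc k := v)) (n - 1)) ((rhoL(Suc k := v)) n) ((cL(Suc k := c0)) n)"
  proof (cases "n = Suc k")
   case True
   then show ?thesis using ls by simp
  next
   case False
   then have "n \<in> {1..k}" "n - 1 \<noteq> Suc k" using nk by auto
   then show ?thesis using limit_step_subseq[OF IH q] False by simp
  qed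
 qed
qed

end

theorem theorem3p8:
  fixes \<Omega> :: "(real ^ 'n) set"
    and A :: "real ^ 'n \<Rightarrow> real ^ 'n ^ 'n"
    and Q rho0 rho00 :: "real ^ 'n \<Rightarrow> real"
    and \<Lambda>1 \<Lambda>2 s T dt L :: real
    and N :: nat
    and lam :: "nat \<Rightarrow> real" and phi :: "nat \<Rightarrow> real ^ 'n \<Rightarrow> real"
    and H :: "real set"
    and \<T> :: "real \<Rightarrow> (real ^ 'n) set set"
    and P :: "real \<Rightarrow> (real ^ 'n) set \<Rightarrow> 'n option \<Rightarrow> real ^ 'n"
    and m :: "real \<Rightarrow> nat" and mu :: "real \<Rightarrow> nat \<Rightarrow> real"
    and psi :: "real \<Rightarrow> nat \<Rightarrow> real ^ 'n \<Rightarrow> real"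
    and rho0h :: "real \<Rightarrow> real ^ 'n \<Rightarrow> real"
    and params :: "(real \<times> real) set"
    and rho c :: "real \<Rightarrow> real \<Rightarrow> nat \<Rightarrow> real ^ 'n \<Rightarrow> real"
  assumes dim: "CARD('n) = 2 \<or> CARD('n) = 3"
    and dom: "lipschitz_polyhedral_domain \<Omega>"
    and coeffs: "elliptic_coefficients \<Omega> \<Lambda>1 \<Lambda>2 A Q"
    and basis: "neumann_eigenbasis \<Omega> A Q lam phi"
    and regularity: "elliptic_regularity \<Omega> A Q lam phi"
    and mesh: "mesh_family \<Omega> H \<T> P"
    and discrete_basis: "\<forall>h\<in>H. discrete_eigenbasis \<Omega> A Q (\<T> h) (m h) (mu h) (psi h)"
    and s: "1 / 2 < s" "s < 1"
    and time: "0 < T" "2 \<le> N" "dt = T / real N"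
    and L: "1 < L"
    and rho0: "rho0 \<in> Linfty \<Omega>" "AE x in lebesgue_on \<Omega>. 0 \<le> rho0 x" "mean_value \<Omega> rho0 = 1"
    and rho00: "smoothed_initial_datum \<Omega> dt rho0 rho00"
    and rho0h: "\<forall>h\<in>H. discrete_initial_datum \<Omega> (\<T> h) dt rho0 (rho0h h)"
    and params: "params \<subseteq> H \<times> {0<..<1}"
    and scheme: "\<forall>(h, \<delta>)\<in>params. fully_discrete_solution \<Omega> A Q (\<T> h) (P h) (m h) (mu h) (psi h)
                   s \<delta> L dt N (rho0h h) (rho h \<delta>) (c h \<delta>)"
  shows "L2_strong_lim \<Omega> rho0h rho00 (at 0 within H)
    \<and> (\<forall>hs ds :: nat \<Rightarrow> real.
         (\<forall>j. (hs j, ds j) \<in> params) \<and> hs \<longlonglongrightarrow> 0 \<and> ds \<longlonglongrightarrow> 0 \<longrightarrow>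
         (\<exists>r rhoL cL. strict_mono (r :: nat \<Rightarrow> nat) \<and> rhoL 0 = rho00 \<and>
            (\<forall>n\<in>{1..N}.
               rhoL n \<in> H1 \<Omega> \<and> (AE x in lebesgue_on \<Omega>. 0 \<le> rhoL n x) \<and>
               cL n \<in> H1 \<Omega> \<inter> L2_dia \<Omega> Q \<and>
               L2_weak_lim \<Omega> (\<lambda>j. grad \<Omega> (rho (hs (r j)) (ds (r j)) n))
                 (grad \<Omega> (rhoL n)) sequentially \<and>
               L2_strong_lim \<Omega> (\<lambda>j. rho (hs (r j)) (ds (r j)) n) (rhoL n) sequentially \<and>
               L2_strong_lim \<Omega>
                 (\<lambda>j. \<Theta> (\<T> (hs (r j))) (P (hs (r j))) (ds (r j)) L (rho (hs (r j)) (ds (r j)) n))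
                 (\<lambda>x. mat (\<beta>_upper L (rhoL n x))) sequentially \<and>
               L2_strong_lim \<Omega> (\<lambda>j. c (hs (r j)) (ds (r j)) n) (cL n) sequentially \<and>
               L2_weak_lim \<Omega> (\<lambda>j. grad \<Omega> (c (hs (r j)) (ds (r j)) n))
                 (grad \<Omega> (cL n)) sequentially \<and>
               (\<forall>f\<in>H1 \<Omega>.
                  (LINT x|lebesgue_on \<Omega>. (rhoL n x - rhoL (n - 1) x) / dt * f x)
                  = - (LINT x|lebesgue_on \<Omega>. grad \<Omega> (rhoL n) x \<bullet> grad \<Omega> f x)
                    + (LINT x|lebesgue_on \<Omega>.
                         \<beta>_upper L (rhoL n x) * ((A x *v grad \<Omega> (cL n) x) \<bullet> grad \<Omega> f x))) \<and>
               fractional_power \<Omega> Q lam phi s (cL n)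
                 (\<lambda>x. - dia \<Omega> Q (\<lambda>y. \<beta>_upper L (rhoL n y)) x) \<and>
               mean_value \<Omega> (rhoL n) = 1)))"
proof -
 have D: "open \<Omega>" "bounded \<Omega>" "\<Omega> \<noteq> {}" "lipschitz_boundary \<Omega>" using dom by (auto simp: lipschitz_polyhedral_domain_def)
 interpret lipschitz_dom \<Omega> using D by unfold_locales
 obtain \<kappa> where \<kappa>: "\<kappa> > 0" "\<And>h K. h \<in> H \<Longrightarrow> K \<in> \<T> h \<Longrightarrow> \<exists>x. cball x (\<kappa> * diameter K) \<subseteq> K"
  using mesh unfolding mesh_family_def by blast
 have me: "labelled_triangulation \<Omega> (\<T> h) (P h)" "h = Max (diameter ` \<T> h)" if "h \<in> H" for h
  using mesh that unfolding mesh_family_def by auto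
 have diam: "diameter K \<le> h" if h: "h \<in> H" and K: "K \<in> \<T> h" for h K
 proof -
  have "finite (\<T> h)" using me(1)[OF h] by (auto simp: labelled_triangulation_def triangulation_def)
  then show ?thesis using K Max_ge[of "diameter ` \<T> h" "diameter K"] me(2)[OF h] by simp
 qed
 have dt: "0 < dt" using time by simp
 have "fe_mesh \<Omega> (\<T> h) (P h) h \<kappa>" if h: "h \<in> H" for h
  by (intro fe_mesh.intro fe_mesh_axioms.intro lipschitz_dom_axioms D(3) me(1)[OF h] diam[OF h] \<kappa>(1) \<kappa>(2)[OF h])
 then interpret fe_scheme \<Omega> A Q \<Lambda>1 \<Lambda>2 lam phi H \<T> P \<kappa> m mu psi s L dt
  using D(3) coeffs basis discrete_basis s L dt
  by (intro fe_scheme.intro fe_scheme_axioms.intro fe_family.intro fe_family_axioms.intro neumann.intro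
    neumann_axioms.intro lipschitz_dom_axioms) auto
 obtain C where C: "AE x in MU. norm (rho0 x) \<le> C" and r0m: "rho0 \<in> borel_measurable MU" using rho0(1) by (auto simp: Linfty_def)
 have rho0L: "rho0 \<in> L2 \<Omega>"
 proof (rule L2_bounded(1)[OF dom_lmeasurable r0m, where C="\<bar>C\<bar>"])
  show "AE x in MU. norm (rho0 x) \<le> \<bar>C\<bar>" using C by eventually_elim simp
 qed simp
 note r00 = smoothed_datum_props[OF dt rho0L rho0(2) rho00]
 have r00L: "rho00 \<in> L2 \<Omega>" by (rule H1_L2[OF r00(1)])
 have ini: "(\<lambda>j. L2_norm \<Omega> (\<lambda>x. rho0h (hs j) x - rho00 x)) \<longlonglongrightarrow> 0" if "\<And>j::nat. hs j \<in> H" "hs \<longlonglongrightarrow> 0" for hs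
  using rho0h that by (intro initial_convergence[OF dt rho0L that _ rho00]) auto
 have r0hV: "rho0h h \<in> V h" if "h \<in> H" for h using rho0h that by (auto simp: discrete_initial_datum_def)
 \<comment> \<open>Convergence within \<open>H\<close> is tested along sequences, for which
   \<open>initial_convergence\<close> needs no subsequence.\<close>
 have "((\<lambda>h. L2_norm \<Omega> (\<lambda>x. rho0h h x - rho00 x)) \<longlongrightarrow> 0) (at 0 within H)"
  unfolding tendsto_at_iff_sequentially o_def using ini by auto
 moreover have "\<forall>\<^sub>F h in at 0 within H. rho0h h \<in> L2 \<Omega>"
  using V_L2 r0hV by (auto simp: eventually_at_topological)
 ultimately have "L2_strong_lim \<Omega> rho0h rho00 (at 0 within H)" using r00L by (simp add: L2_strong_lim_def)
 then show ?thesis (is "_ \<and> (\<forall>hs ds. ?X hs ds \<longrightarrow> ?P hs ds)")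
 proof (intro conjI allI impI, assumption, elim conjE)
  fix hs ds :: "nat \<Rightarrow> real"
  assume par': "\<forall>j. (hs j, ds j) \<in> params" and h0: "hs \<longlonglongrightarrow> 0" and d0: "ds \<longlonglongrightarrow> 0"
  note par = par'[rule_format]
  have hH: "hs j \<in> H" and d: "0 < ds j" "ds j < 1" for j using par[of j] params by auto
  have sol: "fully_discrete_solution \<Omega> A Q (\<T> (hs j)) (P (hs j)) (m (hs j)) (mu (hs j)) (psi (hs j))
    s (ds j) L dt N (rho0h (hs j)) (rho (hs j) (ds j)) (c (hs j) (ds j))" for j
   using scheme par[of j] by auto
  have R0: "rho (hs j) (ds j) 0 = rho0h (hs j)" for j using sol[of j] by (simp add: fully_discrete_solution_def)
  have RV: "rho (hs j) (ds j) n \<in> V (hs j)" if "n \<le> N" for n j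
   using sol[of j] that r0hV[OF hH, of j] by (cases "n = 0") (auto simp: fully_discrete_solution_def)
  have eq: "step_eq (hs j) (ds j) (rho (hs j) (ds j) n) (rho (hs j) (ds j) n) (rho (hs j) (ds j) (n - 1)) (grad \<Omega> (c (hs j) (ds j) n))"
   if "n \<in> {1..N}" for n j
   using sol[of j] that by (simp add: fully_discrete_solution_def step_eq_def L2_inner_def)
  have co: "coupled hs (\<lambda>j. rho (hs j) (ds j) n) (\<lambda>j. c (hs j) (ds j) n)" if "n \<in> {1..N}" for n
   using sol that by (simp add: fully_discrete_solution_def coupled_def)
  have i0: "(\<lambda>j. L2_norm \<Omega> (\<lambda>x. rho (hs j) (ds j) 0 x - rho00 x)) \<longlonglongrightarrow> 0" unfolding R0 by (rule ini[OF hH h0])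
  have "\<exists>r rhoL cL. strict_mono r \<and> rhoL 0 = rho00 \<and> (\<forall>n\<in>{1..N}. limit_step (\<lambda>j. hs (r j)) (\<lambda>j. ds (r j))
    (\<lambda>j. rho (hs (r j)) (ds (r j)) n) (\<lambda>j. c (hs (r j)) (ds (r j)) n) (rhoL (n - 1)) (rhoL n) (cL n))"
   by (rule scheme_limit[where R="\<lambda>n j. rho (hs j) (ds j) n" and Z="\<lambda>n j. c (hs j) (ds j) n",
     OF hH h0 d d0 RV eq co r00L r00(2) i0 order_refl])
  then obtain r rhoL cL where r: "strict_mono r" "rhoL 0 = rho00"
   and st: "\<forall>n\<in>{1..N}. limit_step (\<lambda>j. hs (r j)) (\<lambda>j. ds (r j)) (\<lambda>j. rho (hs (r j)) (ds (r j)) n)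
    (\<lambda>j. c (hs (r j)) (ds (r j)) n) (rhoL (n - 1)) (rhoL n) (cL n)"
   by (elim exE conjE) (rule that)
  \<comment> \<open>Each step conserves the integral, and the smoothed datum has the integral of
    \<open>rho0\<close>, whose mean is 1.\<close>
  have int: "(LINT x|MU. rhoL n x) = (LINT x|MU. rho0 x)" if "n \<le> N" for n
   using that
  proof (induction n)
   case 0
   then show ?case using r(2) r00(3) by simp
  next
   case (Suc n)
   then have "Suc n \<in> {1..N}" by simp
   from bspec[OF st this] show ?case using Suc by (simp add: limit_step_def)
  qed
  have mean: "mean_value \<Omega> (rhoL n) = 1" if "n \<in> {1..N}" for n
   using int[of n] that rho0(3) by (simp add: mean_value_def)
  show "?P hs ds"
   by (rule exI[of _ r], rule exI[of _ rhoL], rule exI[of _ cL])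
    (use r st mean in \<open>unfold limit_step_def, blast\<close>)
 qed
qed

end
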